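(* Let $\tau:I\to I$ be piecewise monotonic and transitive, and not essentially injective, and let $\sigma:X\to X$ be the associated local homeomorphism. There is a unique partition of $X$ into clopen sets $X_1,\ldots,X_N$ such that $\sigma(X_i)=X_{i+1 \bmod N}$ for each $i$, and such that $\sigma^N|_{X_i}$ is topologically exact for each $i$. Let $\mu$ be a probability measure on $X$ scaled by $\sigma$, with scaling factor $s$. For each $i$ there exists $\phi_i\in C(X)$ of bounded variation, with $\operatorname{supp}\phi_i=X_i$ and $\phi_i>0$ on $X_i$, such that for each $f\in C(X)$ of bounded variation with $\operatorname{supp} f\subset X_i$, $$\lim_{k\to\infty}\,(s^{-N}\mathcal L_\sigma^N)^k f=\mu(f)\,\phi_i \quad\text{(uniform convergence)},$$ and such that the functions $\phi_i$ are cyclically permuted by $(1/s)\mathcal L_\sigma$, i.e. $$(1/s)\,\mathcal L_\sigma\phi_i=\phi_{i+1\bmod N}.$$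
   Context: Let $I=[0,1]$. A (not necessarily continuous) map $\tau:I\to I$ is piecewise monotonic if there are points $0=a_0<a_1<\dots<a_n=1$ such that each $\tau|_{(a_{i-1},a_i)}$ is continuous and strictly monotonic; the points are chosen so that no $(a_{i-1},a_i)$ is contained in a larger open interval on which $\tau$ is continuous and strictly monotonic. Then $\{a_0,\dots,a_n\}$ is the partition associated with $\tau$, the $(a_{i-1},a_i)$ are the intervals of monotonicity, and $\tau_i:[a_{i-1},a_i]\to I$ denotes the continuous extension of $\tau|_{(a_{i-1},a_i)}$. Actual values of $\tau$ at partition points of discontinuity are ignored: $\widehat\tau(x)$ is the set of left and right limits of $\tau$ at $x$, $\widehat\tau(A)=\bigcup_i\tau_i(A\cap[a_{i-1},a_i])$, and $\widehat\tau^{-1}(A)=\bigcup_i\{x\in[a_{i-1},a_i]:\tau_i(x)\in A\}$. $\tau$ (viewed as undefined at the partition points) is transitive if for all non-empty open $U,V\subset I$ there is $n\ge 0$ with $\tau^n(U)\cap V\ne\emptyset$. $\tau$ is essentially injective if there are no disjoint (nondegenerate) intervals $J,J'$ with $\tau(J)=\tau(J')$; equivalently, $\tau$ is injective on the complement of the set of partition points. The generalized orbit of $x\in I$ is the smallest subset of $I$ containing $x$ that is forward and backward invariant under $\widehat\tau$. $I_1$ is the union of the generalized orbits of $a_0,\dots,a_n$, and $I_0=I\setminus I_1$. $X$ is the totally ordered set obtained from $I$ by replacing each $x\in I_1\setminus\{0,1\}$ by two points $x^-<x^+$, with the order topology (it is homeomorphic to a compact subset of $\mathbb R$); $\pi:X\to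 I$ is the collapse map ($\pi(x^\pm)=x$ for $x\in I_1$, $\pi(x)=x$ for $x\in I_0$), and $X_0=\pi^{-1}(I_0)$. The local homeomorphism associated with $\tau$ is the unique continuous map $\sigma:X\to X$ with $\pi\circ\sigma=\tau\circ\pi$ on $X_0$. The transfer operator is $(\mathcal L_\sigma f)(x)=\sum_{\sigma y=x}f(y)$; it maps $C(X)$ (real continuous functions) into itself. A probability measure $\mu$ (regular Borel) on $X$ is scaled by $\sigma$ by a factor $s>0$ if $\mu(\sigma(E))=s\,\mu(E)$ for all Borel sets $E$ on which $\sigma$ is one-to-one; $\mu(f)$ means $\int f\,d\mu$. A continuous map $g:Y\to Y$ is topologically exact if for each non-empty open $V\subset Y$ there is $n\ge0$ with $g^n(V)=Y$. A function $f$ on $X$ has bounded variation if $\sup\sum_{i=1}^n|f(x_i)-f(x_{i-1})|<\infty$, the supremum over all finite sequences $x_0<x_1<\dots<x_n$ in $X$. The support of $f$ is the closure of $\{x: f(x)\ne0\}$. Indices mod $N$ are taken in $\{1,\dots,N\}$, partitions have non-empty members, and uniqueness refers to the partition as a collection of sets. *)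

theory Defs
  imports "HOL-Probability.Probability"
begin

section \<open>Piecewise monotonic maps of the unit interval\<close>

definition cont_strictly_monotonic_on :: "(real \<Rightarrow> real) \<Rightarrow> real set \<Rightarrow> bool" where
  "cont_strictly_monotonic_on \<tau> J \<longleftrightarrow>
     continuous_on J \<tau> \<and> (strict_mono_on J \<tau> \<or> strict_antimono_on J \<tau>)"

text \<open>The map is piecewise monotonic and \<open>{a 0, \<dots>, a n}\<close> is the partition associated with it.
  The last conjunct is the maximality of the intervals of monotonicity; it determines
  \<open>n\<close> and \<open>a 0, \<dots>, a n\<close> uniquely.\<close>

definition piecewise_monotonic :: "(real \<Rightarrow> real) \<Rightarrow> nat \<Rightarrow> (nat \<Rightarrow> real) \<Rightarrow> bool" where
  "piecewise_monotonic \<tau> n a \<longleftrightarrow>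
     \<tau> \<in> {0..1} \<rightarrow> {0..1} \<and>
     a 0 = 0 \<and> a n = 1 \<and> (\<forall>i<n. a i < a (Suc i)) \<and>
     (\<forall>i<n. cont_strictly_monotonic_on \<tau> {a i<..<a (Suc i)}) \<and>
     (\<forall>i<n. \<not> (\<exists>c d. {a i<..<a (Suc i)} \<subset> {c<..<d} \<and> {c<..<d} \<subseteq> {0..1} \<and>
        cont_strictly_monotonic_on \<tau> {c<..<d}))"

definition partition_points :: "nat \<Rightarrow> (nat \<Rightarrow> real) \<Rightarrow> real set" where
  "partition_points n a = a ` {..n}"

text \<open>The continuous extension of \<open>\<tau>\<close> from \<open>{a i<..<a (Suc i)}\<close> to \<open>{a i..a (Suc i)}\<close>
  (so \<open>i\<close> runs over \<open>0, \<dots>, n - 1\<close>); in the interior this limit is \<open>\<tau> x\<close>.\<close>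

definition branch :: "(real \<Rightarrow> real) \<Rightarrow> (nat \<Rightarrow> real) \<Rightarrow> nat \<Rightarrow> real \<Rightarrow> real" where
  "branch \<tau> a i x = Lim (at x within {a i<..<a (Suc i)}) \<tau>"

definition hat_image :: "(real \<Rightarrow> real) \<Rightarrow> nat \<Rightarrow> (nat \<Rightarrow> real) \<Rightarrow> real set \<Rightarrow> real set" where
  "hat_image \<tau> n a A = (\<Union>i<n. branch \<tau> a i ` (A \<inter> {a i..a (Suc i)}))"

definition hat_vimage :: "(real \<Rightarrow> real) \<Rightarrow> nat \<Rightarrow> (nat \<Rightarrow> real) \<Rightarrow> real set \<Rightarrow> real set" where
  "hat_vimage \<tau> n a A = (\<Union>i<n. {x \<in> {a i..a (Suc i)}. branch \<tau> a i x \<in> A})"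

text \<open>The image of a set under \<open>\<tau>\<close>, where \<open>\<tau>\<close> is viewed as undefined at the partition points.\<close>

definition partial_image :: "(real \<Rightarrow> real) \<Rightarrow> nat \<Rightarrow> (nat \<Rightarrow> real) \<Rightarrow> real set \<Rightarrow> real set" where
  "partial_image \<tau> n a A = \<tau> ` (A - partition_points n a)"

definition transitive_map :: "(real \<Rightarrow> real) \<Rightarrow> nat \<Rightarrow> (nat \<Rightarrow> real) \<Rightarrow> bool" where
  "transitive_map \<tau> n a \<longleftrightarrow>
     (\<forall>U V. openin (top_of_set {0..1}) U \<and> U \<noteq> {} \<and> openin (top_of_set {0..1}) V \<and> V \<noteq> {}
        \<longrightarrow> (\<exists>k. (partial_image \<tau> n a ^^ k) U \<inter> V \<noteq> {}))"

definition nondegenerate_interval :: "real set \<Rightarrow> bool" where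
  "nondegenerate_interval J \<longleftrightarrow> is_interval J \<and> J \<subseteq> {0..1} \<and> (\<exists>x\<in>J. \<exists>y\<in>J. x < y)"

definition essentially_injective :: "(real \<Rightarrow> real) \<Rightarrow> nat \<Rightarrow> (nat \<Rightarrow> real) \<Rightarrow> bool" where
  "essentially_injective \<tau> n a \<longleftrightarrow>
     \<not> (\<exists>J J'. nondegenerate_interval J \<and> nondegenerate_interval J' \<and> J \<inter> J' = {} \<and>
          partial_image \<tau> n a J = partial_image \<tau> n a J')"

section \<open>The disconnected interval and the associated local homeomorphism\<close>

definition generalized_orbit :: "(real \<Rightarrow> real) \<Rightarrow> nat \<Rightarrow> (nat \<Rightarrow> real) \<Rightarrow> real \<Rightarrow> real set" where
  "generalized_orbit \<tau> n a x =
     \<Inter> {B. B \<subseteq> {0..1} \<and> x \<in> B \<and> hat_image \<tau> n a B \<subseteq> B \<and> hat_vimage \<tau> n a B \<subseteq> B}"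

definition I1 :: "(real \<Rightarrow> real) \<Rightarrow> nat \<Rightarrow> (nat \<Rightarrow> real) \<Rightarrow> real set" where
  "I1 \<tau> n a = (\<Union>c \<in> partition_points n a. generalized_orbit \<tau> n a c)"

definition I0 :: "(real \<Rightarrow> real) \<Rightarrow> nat \<Rightarrow> (nat \<Rightarrow> real) \<Rightarrow> real set" where
  "I0 \<tau> n a = {0..1} - I1 \<tau> n a"

text \<open>\<open>Pt x\<close> is a point that is not split; \<open>Minus x\<close> and \<open>Plus x\<close> are
  \<open>x\<^sup>-\<close> and \<open>x\<^sup>+\<close>. The endpoints 0 and 1, although in \<open>I1\<close>, are not split.\<close>

datatype point = Pt real | Minus real | Plus real

primrec collapse :: "point \<Rightarrow> real" where
  "collapse (Pt x) = x"
| "collapse (Minus x) = x"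
| "collapse (Plus x) = x"

definition X_set :: "(real \<Rightarrow> real) \<Rightarrow> nat \<Rightarrow> (nat \<Rightarrow> real) \<Rightarrow> point set" where
  "X_set \<tau> n a = Pt ` (I0 \<tau> n a \<union> {0, 1}) \<union>
     Minus ` (I1 \<tau> n a - {0, 1}) \<union> Plus ` (I1 \<tau> n a - {0, 1})"

definition X0_set :: "(real \<Rightarrow> real) \<Rightarrow> nat \<Rightarrow> (nat \<Rightarrow> real) \<Rightarrow> point set" where
  "X0_set \<tau> n a = {p \<in> X_set \<tau> n a. collapse p \<in> I0 \<tau> n a}"

text \<open>A strict total order on \<open>X_set \<tau> n a\<close> (though not on the whole type).\<close>

definition point_less :: "point \<Rightarrow> point \<Rightarrow> bool" where
  "point_less p q \<longleftrightarrow> collapse p < collapse q \<or> (\<exists>x. p = Minus x \<and> q = Plus x)"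

definition X_top :: "(real \<Rightarrow> real) \<Rightarrow> nat \<Rightarrow> (nat \<Rightarrow> real) \<Rightarrow> point topology" where
  "X_top \<tau> n a = topology_generated_by
     (insert (X_set \<tau> n a)
       ((\<lambda>p. {q \<in> X_set \<tau> n a. point_less p q}) ` X_set \<tau> n a \<union>
        (\<lambda>p. {q \<in> X_set \<tau> n a. point_less q p}) ` X_set \<tau> n a))"

text \<open>These conditions determine \<open>\<sigma>\<close> on \<open>X_set \<tau> n a\<close>; its values elsewhere are irrelevant.\<close>

definition associated_local_homeo ::
    "(real \<Rightarrow> real) \<Rightarrow> nat \<Rightarrow> (nat \<Rightarrow> real) \<Rightarrow> (point \<Rightarrow> point) \<Rightarrow> bool" where
  "associated_local_homeo \<tau> n a \<sigma> \<longleftrightarrow>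
     continuous_map (X_top \<tau> n a) (X_top \<tau> n a) \<sigma> \<and>
     (\<forall>p \<in> X0_set \<tau> n a. collapse (\<sigma> p) = \<tau> (collapse p))"

section \<open>Dynamics, functions and measures on a space \<open>T\<close>\<close>

definition topologically_exact :: "'a topology \<Rightarrow> ('a \<Rightarrow> 'a) \<Rightarrow> bool" where
  "topologically_exact T g \<longleftrightarrow>
     continuous_map T T g \<and>
     (\<forall>V. openin T V \<and> V \<noteq> {} \<longrightarrow> (\<exists>k. (g ^^ k) ` V = topspace T))"

text \<open>The members are indexed by \<open>1, \<dots>, N\<close>, so the cyclic successor of \<open>i\<close> is \<open>i mod N + 1\<close>.\<close>

definition exact_cyclic_partition ::
    "'a topology \<Rightarrow> ('a \<Rightarrow> 'a) \<Rightarrow> nat \<Rightarrow> (nat \<Rightarrow> 'a set) \<Rightarrow> bool" where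
  "exact_cyclic_partition T \<sigma> N Y \<longleftrightarrow>
     N \<ge> 1 \<and>
     (\<forall>i\<in>{1..N}. Y i \<noteq> {} \<and> openin T (Y i) \<and> closedin T (Y i)) \<and>
     disjoint_family_on Y {1..N} \<and> (\<Union>i\<in>{1..N}. Y i) = topspace T \<and>
     (\<forall>i\<in>{1..N}. \<sigma> ` Y i = Y (i mod N + 1)) \<and>
     (\<forall>i\<in>{1..N}. topologically_exact (subtopology T (Y i)) (\<sigma> ^^ N))"

definition transfer :: "'a topology \<Rightarrow> ('a \<Rightarrow> 'a) \<Rightarrow> ('a \<Rightarrow> real) \<Rightarrow> 'a \<Rightarrow> real" where
  "transfer T \<sigma> f x = (\<Sum>y | y \<in> topspace T \<and> \<sigma> y = x. f y)"

definition supp :: "'a topology \<Rightarrow> ('a \<Rightarrow> real) \<Rightarrow> 'a set" where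
  "supp T f = T closure_of {x \<in> topspace T. f x \<noteq> 0}"

definition bounded_variation :: "point set \<Rightarrow> (point \<Rightarrow> real) \<Rightarrow> bool" where
  "bounded_variation S f \<longleftrightarrow>
     bdd_above {\<Sum>i=1..m. \<bar>f (x i) - f (x (i - 1))\<bar> | (m::nat) x.
       (\<forall>i\<le>m. x i \<in> S) \<and> (\<forall>i\<in>{1..m}. point_less (x (i - 1)) (x i))}"

definition regular_borel_prob :: "'a topology \<Rightarrow> 'a measure \<Rightarrow> bool" where
  "regular_borel_prob T \<mu> \<longleftrightarrow>
     prob_space \<mu> \<and> space \<mu> = topspace T \<and>
     sets \<mu> = sigma_sets (topspace T) {U. openin T U} \<and>
     (\<forall>A\<in>sets \<mu>.
        emeasure \<mu> A = (INF U\<in>{U. openin T U \<and> A \<subseteq> U}. emeasure \<mu> U) \<and>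
        emeasure \<mu> A = (SUP K\<in>{K. compactin T K \<and> K \<subseteq> A}. emeasure \<mu> K))"

definition scaled_by :: "'a measure \<Rightarrow> ('a \<Rightarrow> 'a) \<Rightarrow> real \<Rightarrow> bool" where
  "scaled_by \<mu> \<sigma> s \<longleftrightarrow>
     s > 0 \<and> (\<forall>E\<in>sets \<mu>. inj_on \<sigma> E \<longrightarrow> measure \<mu> (\<sigma> ` E) = s * measure \<mu> E)"

end

theory Submission
  imports Defs
begin

text \<open>Everything happens on the compact ordered space \<open>X\<close>, on which \<open>\<sigma>\<close> is piecewise a strictly
  monotone homeomorphism between clopen order-intervals.

  Partition. The orbit of a non-empty open set is open and dense and, since \<open>\<sigma>\<close> has finitely many
  pieces, it has finitely many order-components; so its complement \<open>Z\<close> is finite. The map permutes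
  \<open>Z\<close> and each cycle has no further preimages, so one-sided neighbourhoods of a cycle would be
  forward or backward invariant. Hence \<open>Z\<close> is empty. The exponential growth rate \<open>r\<close> of the
  number of preimages is greater than 1 because \<open>\<sigma>\<close> is not injective, and the Abel means of the fibre
  counts, taken at \<open>t\<close> slightly above \<open>r\<close>, give a subadditive size of sets that \<open>\<sigma>\<close> expands by
  almost \<open>t\<close>; an interval therefore grows until it covers one of finitely many
  fixed intervals. It follows that some open \<open>D\<close> is covered by an iterate of every open set. The
  return times of \<open>D\<close> form a semigroup whose period is \<open>N\<close>, and the sets
  \<open>\<Union>{\<sigma>\<^sup>k D | k \<equiv> i mod N}\<close> are the members of the partition.

  Densities. The normalized transfer operator satisfies a Lasota--Yorke inequality, and on mean-zero
  functions whose variation is controlled by the \<open>L\<^sup>1\<close> norm exactness gives a strict \<open>L\<^sup>1\<close>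
  contraction. Together they make it a contraction on mean-zero functions of bounded variation, for
  a norm that dominates the supremum norm.\<close>

section \<open>Piecewise monotone maps of a compact ordered space\<close>

text \<open>All dynamics is done on an abstract compact ordered space with a continuous map that is
  strictly monotone on finitely many clopen order-intervals; there is no metric and there are no
  slopes. Clopen pieces have continuous indicators, so images of open sets are open and the transfer
  operator preserves continuity. The obstacle is that the partition must be found before any scaled
  measure is at hand: the Abel means replace such a measure, and since they are used at one fixed
  \<open>t > r\<close>, no limit measure has to be built. Finiteness of \<open>Z\<close> is a
  separation argument: an order-component of the orbit lies on one side of each point of
  \<open>Z\<close>, so finitely many components tell points of \<open>Z\<close> apart in finitely
  many ways only, while density puts a component between the outer two of any three points of
  \<open>Z\<close>. Once a scaled measure is given, strong transitivity and non-injectivity force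
  \<open>s > 1\<close>; so the pieces of high iterates have small measure, and the factor 3 in the
  Lasota--Yorke inequality is beaten. Each density is a normalized limit of iterates of the
  indicator of its member, and this convergence identifies the image of one density with the
  next.\<close>

definition order_convex :: "'a::linorder set \<Rightarrow> 'a set \<Rightarrow> bool" where
  "order_convex S C \<longleftrightarrow> C \<subseteq> S \<and> (\<forall>x\<in>C. \<forall>z\<in>C. \<forall>y\<in>S. x \<le> y \<and> y \<le> z \<longrightarrow> y \<in> C)"

lemma order_convexD:
  "order_convex S C \<Longrightarrow> x \<in> C \<Longrightarrow> z \<in> C \<Longrightarrow> y \<in> S \<Longrightarrow> x \<le> y \<Longrightarrow> y \<le> z \<Longrightarrow> y \<in> C"
  unfolding order_convex_def by blast

lemma order_convex_subset: "order_convex S C \<Longrightarrow> C \<subseteq> S"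
  unfolding order_convex_def by blast

lemma order_convex_Int: "order_convex S C \<Longrightarrow> order_convex S D \<Longrightarrow> order_convex S (C \<inter> D)"
  unfolding order_convex_def by blast

text \<open>If \<open>y' \<le> x'\<close>, then either \<open>x \<le> y'\<close> and
  \<open>y'\<close> is caught in \<open>C\<close> between \<open>x\<close> and \<open>x'\<close>, or
  \<open>y' < x\<close> and \<open>x\<close> is caught in \<open>D\<close> between \<open>y'\<close>
  and \<open>y\<close>.\<close>

lemma order_convex_disjoint_less:
  fixes C D :: "'a::linorder set"
  assumes "order_convex S C" "order_convex S D" "C \<inter> D = {}"
    and "x \<in> C" "y \<in> D" "x < y" "x' \<in> C" "y' \<in> D"
  shows "x' < y'"
proof (rule ccontr)
  assume "\<not> x' < y'"
  then have le: "y' \<le> x'" by simp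
  have S: "x \<in> S" "y \<in> S" "x' \<in> S" "y' \<in> S" using assms order_convex_subset by blast+
  show False
  proof (cases "x \<le> y'")
    case True
    then have "y' \<in> C" using assms S le by (meson order_convexD)
    then show False using assms by auto
  next
    case False
    then have "x \<in> D" using assms S by (meson order_convexD less_imp_le not_le)
    then show False using assms by auto
  qed
qed

text \<open>The topology enters through three properties instead of as an order topology: open rays
  separate points and make closed rays closed, and convex neighbourhoods shrink an open set to an
  open order-interval. Order and convexity are always relative to the carrier, not to the whole
  type.\<close>

locale ordered_compact =
  fixes T :: "'a::linorder topology"
  assumes compact: "compact_space T"
    and open_upper: "p \<in> topspace T \<Longrightarrow> openin T {q \<in> topspace T. p < q}"
    and open_lower: "p \<in> topspace T \<Longrightarrow> openin T {q \<in> topspace T. q < p}"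
    and convex_nbhd: "openin T U \<Longrightarrow> p \<in> U \<Longrightarrow>
      \<exists>N. openin T N \<and> order_convex (topspace T) N \<and> p \<in> N \<and> N \<subseteq> U"
begin

abbreviation "X \<equiv> topspace T"

text \<open>Two points are separated by the rays at a point between them; if there is none, the rays
  \<open>q < y\<close> and \<open>x < q\<close> are themselves disjoint.\<close>

lemma Hausdorff: "Hausdorff_space T"
  unfolding Hausdorff_space_def
proof (intro allI impI)
  have *: "\<exists>U V. openin T U \<and> openin T V \<and> x \<in> U \<and> y \<in> V \<and> disjnt U V"
    if x: "x \<in> X" and y: "y \<in> X" and "x < y" for x y
  proof (cases "\<exists>z\<in>X. x < z \<and> z < y")
    case True
    then obtain z where z: "z \<in> X" "x < z" "z < y" by auto
    show ?thesis
      by (rule exI[of _ "{q \<in> X. q < z}"], rule exI[of _ "{q \<in> X. z < q}"])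
         (use z that open_upper open_lower in \<open>auto simp: disjnt_def\<close>)
  next
    case False
    show ?thesis
      by (rule exI[of _ "{q \<in> X. q < y}"], rule exI[of _ "{q \<in> X. x < q}"])
         (use False that open_upper open_lower in \<open>auto simp: disjnt_def\<close>)
  qed
  fix x y assume "x \<in> X \<and> y \<in> X \<and> x \<noteq> y"
  then consider "x \<in> X" "y \<in> X" "x < y" | "x \<in> X" "y \<in> X" "y < x" by (meson linorder_neqE)
  then show "\<exists>U V. openin T U \<and> openin T V \<and> x \<in> U \<and> y \<in> V \<and> disjnt U V"
    by cases (use * in \<open>metis disjnt_sym\<close>)+
qed

lemma closed_iff_compact: "closedin T C \<longleftrightarrow> compactin T C"
  using compact Hausdorff closedin_compact_space compactin_imp_closedin by blast

lemma closedin_atLeast: assumes "p \<in> X" shows "closedin T {q \<in> X. p \<le> q}"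
proof -
  have "X - {q \<in> X. p \<le> q} = {q \<in> X. q < p}" by auto
  then show ?thesis using open_lower[OF assms] by (simp add: closedin_def)
qed

lemma closedin_atMost: assumes "p \<in> X" shows "closedin T {q \<in> X. q \<le> p}"
proof -
  have "X - {q \<in> X. q \<le> p} = {q \<in> X. p < q}" by auto
  then show ?thesis using open_upper[OF assms] by (simp add: closedin_def)
qed

text \<open>Without a maximum, the lower rays at the points of \<open>C\<close> cover
  \<open>C\<close>; the largest endpoint in a finite subcover is then uncovered.\<close>

lemma closed_attains_max:
  assumes C: "closedin T C" "C \<noteq> {}"
  shows "\<exists>m\<in>C. \<forall>x\<in>C. x \<le> m"
proof (rule ccontr)
  assume "\<not> ?thesis"
  then have nm: "\<forall>m\<in>C. \<exists>x\<in>C. m < x" by (meson not_le)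
  have CX: "C \<subseteq> X" using C closedin_subset by blast
  have "compactin T C" using C closed_iff_compact by blast
  moreover have "\<forall>U\<in>(\<lambda>p. {q \<in> X. q < p}) ` C. openin T U" using open_lower CX by auto
  moreover have "C \<subseteq> \<Union>((\<lambda>p. {q \<in> X. q < p}) ` C)" using nm CX by auto
  ultimately obtain F where F: "finite F" "F \<subseteq> (\<lambda>p. {q \<in> X. q < p}) ` C" "C \<subseteq> \<Union>F"
    unfolding compactin_def by meson
  then obtain D where D: "D \<subseteq> C" "finite D" "F = (\<lambda>p. {q \<in> X. q < p}) ` D"
    by (meson finite_subset_image)
  then have "D \<noteq> {}" using F C by auto
  then have "Max D \<in> C" using D Max_in by blast
  then obtain p where "p \<in> D" "Max D < p" using F D by blast
  then show False using D by (meson Max_ge not_le)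
qed

lemma closed_attains_min:
  assumes C: "closedin T C" "C \<noteq> {}"
  shows "\<exists>m\<in>C. \<forall>x\<in>C. m \<le> x"
proof (rule ccontr)
  assume "\<not> ?thesis"
  then have nm: "\<forall>m\<in>C. \<exists>x\<in>C. x < m" by (meson not_le)
  have CX: "C \<subseteq> X" using C closedin_subset by blast
  have "compactin T C" using C closed_iff_compact by blast
  moreover have "\<forall>U\<in>(\<lambda>p. {q \<in> X. p < q}) ` C. openin T U" using open_upper CX by auto
  moreover have "C \<subseteq> \<Union>((\<lambda>p. {q \<in> X. p < q}) ` C)" using nm CX by auto
  ultimately obtain F where F: "finite F" "F \<subseteq> (\<lambda>p. {q \<in> X. p < q}) ` C" "C \<subseteq> \<Union>F"
    unfolding compactin_def by meson
  then obtain D where D: "D \<subseteq> C" "finite D" "F = (\<lambda>p. {q \<in> X. p < q}) ` D"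
    by (meson finite_subset_image)
  then have "D \<noteq> {}" using F C by auto
  then have "Min D \<in> C" using D Min_in by blast
  then obtain p where "p \<in> D" "p < Min D" using F D by blast
  then show False using D by (meson Min_le not_le)
qed

text \<open>Openness and convexity of the image do not follow from monotonicity, since the image
  could skip points of \<open>X\<close>. The flag records the orientation: that of a composite is
  \<open>up = up'\<close>, so a square preserves the order.\<close>

definition mono_piece :: "('a \<Rightarrow> 'a) \<Rightarrow> bool \<Rightarrow> 'a set \<Rightarrow> bool" where
  "mono_piece g up C \<longleftrightarrow> openin T C \<and> closedin T C \<and> order_convex X C \<and>
     (\<forall>x\<in>C. \<forall>y\<in>C. x < y \<longrightarrow> (if up then g x < g y else g y < g x)) \<and>
     openin T (g ` C) \<and> order_convex X (g ` C)"

definition pmono :: "('a \<Rightarrow> 'a) \<Rightarrow> 'a set set \<Rightarrow> bool" where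
  "pmono g \<C> \<longleftrightarrow> continuous_map T T g \<and> finite \<C> \<and> disjoint \<C> \<and> \<Union>\<C> = X \<and>
     (\<forall>C\<in>\<C>. C \<noteq> {} \<and> (\<exists>up. mono_piece g up C))"

lemma mono_piece_inj: "mono_piece g up C \<Longrightarrow> inj_on g C"
  unfolding mono_piece_def inj_on_def by (metis less_irrefl linorder_neqE)

lemma mono_piece_less_iff:
  assumes "mono_piece g up C" "x \<in> C" "y \<in> C"
  shows "g x < g y \<longleftrightarrow> (if up then x < y else y < x)"
  using assms unfolding mono_piece_def by (metis less_asym' linorder_neqE)

lemma mono_piece_le_iff:
  assumes "mono_piece g up C" "x \<in> C" "y \<in> C"
  shows "g x \<le> g y \<longleftrightarrow> (if up then x \<le> y else y \<le> x)"
  using mono_piece_less_iff[OF assms(1,3,2)] by (auto simp: not_less[symmetric])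

lemma pmonoD:
  assumes "pmono g \<C>"
  shows "continuous_map T T g" "finite \<C>" "disjoint \<C>" "\<Union>\<C> = X"
    "C \<in> \<C> \<Longrightarrow> C \<noteq> {}" "C \<in> \<C> \<Longrightarrow> \<exists>up. mono_piece g up C" "C \<in> \<C> \<Longrightarrow> inj_on g C"
    "C \<in> \<C> \<Longrightarrow> openin T C" "C \<in> \<C> \<Longrightarrow> closedin T C" "C \<in> \<C> \<Longrightarrow> order_convex X C"
    "C \<in> \<C> \<Longrightarrow> openin T (g ` C)" "C \<in> \<C> \<Longrightarrow> order_convex X (g ` C)" "C \<in> \<C> \<Longrightarrow> C \<subseteq> X"
    "x \<in> X \<Longrightarrow> g x \<in> X"
proof -
  have p: "continuous_map T T g" "finite \<C>" "disjoint \<C>" "\<Union>\<C> = X"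
    "\<And>C. C \<in> \<C> \<Longrightarrow> C \<noteq> {}" "\<And>C. C \<in> \<C> \<Longrightarrow> \<exists>up. mono_piece g up C"
    using assms unfolding pmono_def by blast+
  show "continuous_map T T g" "finite \<C>" "disjoint \<C>" "\<Union>\<C> = X" by fact+
  show "x \<in> X \<Longrightarrow> g x \<in> X" using p(1) unfolding continuous_map_def by auto
  show "C \<noteq> {}" "\<exists>up. mono_piece g up C" if "C \<in> \<C>" using that p(5,6) by blast+
  show "inj_on g C" "openin T C" "closedin T C" "order_convex X C"
    "openin T (g ` C)" "order_convex X (g ` C)" if "C \<in> \<C>"
    using p(6)[OF that] mono_piece_inj unfolding mono_piece_def by blast+
  show "C \<subseteq> X" if "C \<in> \<C>" using p(4) that by blast
qed

lemma pmono_fibre_finite: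
  assumes g: "pmono g \<J>" shows "finite {y \<in> X. g y = x}"
proof -
  have "{y \<in> X. g y = x} = (\<Union>J\<in>\<J>. {y \<in> J. g y = x})"
    unfolding pmonoD(4)[OF g, symmetric] by auto
  moreover have "finite {y \<in> J. g y = x}" if "J \<in> \<J>" for J
  proof -
    have "inj_on g {y \<in> J. g y = x}"
      using pmonoD(7)[OF g that] by (auto simp: inj_on_def)
    then show ?thesis by (rule finite_imageD[rotated]) (auto intro: finite_subset[of _ "{x}"])
  qed
  ultimately show ?thesis using pmonoD(2)[OF g] by auto
qed

lemma closed_image:
  assumes "continuous_map T T g" "closedin T C"
  shows "closedin T (g ` C)"
  using assms closed_iff_compact image_compactin by metis

text \<open>On one piece, injectivity makes the image of \<open>U\<close> equal to the open image of
  the piece minus the compact, hence closed, image of the rest of the piece.\<close>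

lemma open_image:
  assumes g: "pmono g \<C>" and U: "openin T U"
  shows "openin T (g ` U)"
proof -
  have "openin T (g ` (U \<inter> C))" if C: "C \<in> \<C>" for C
  proof -
    have "closedin T (C - U)" using pmonoD(9)[OF g C] U by auto
    then have "closedin T (g ` (C - U))" using closed_image pmonoD(1)[OF g] by blast
    moreover have "g ` (U \<inter> C) = g ` C - g ` (C - U)"
      using pmonoD(7)[OF g C] by (auto simp: inj_on_def)
    ultimately show ?thesis using pmonoD(11)[OF g C] by auto
  qed
  then have "openin T (\<Union>C\<in>\<C>. g ` (U \<inter> C))" by auto
  moreover have "(\<Union>C\<in>\<C>. g ` (U \<inter> C)) = g ` U"
    using openin_subset[OF U] unfolding pmonoD(4)[OF g, symmetric] by blast
  ultimately show ?thesis by simp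
qed

lemma mono_piece_convex_image:
  assumes g: "mono_piece g up C" and "order_convex X D" "D \<subseteq> C"
  shows "order_convex X (g ` D)"
proof -
  have gC: "order_convex X (g ` C)" "D \<subseteq> X"
    using assms order_convex_subset unfolding mono_piece_def by blast+
  show ?thesis unfolding order_convex_def
  proof (intro conjI ballI impI)
    show "g ` D \<subseteq> X" using order_convex_subset[OF gC(1)] assms by blast
    fix u w v assume u: "u \<in> g ` D" and w: "w \<in> g ` D" and v: "v \<in> X" "u \<le> v \<and> v \<le> w"
    obtain x z where xz: "x \<in> D" "z \<in> D" "u = g x" "w = g z" using u w by auto
    have "v \<in> g ` C" using gC xz assms v by (meson image_eqI order_convexD subsetD)
    then obtain y where y: "y \<in> C" "v = g y" by auto
    have yX: "y \<in> X" using y g order_convex_subset unfolding mono_piece_def by blast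
    have "if up then x \<le> y \<and> y \<le> z else z \<le> y \<and> y \<le> x"
      using v xz y mono_piece_le_iff[OF g] assms by (auto split: if_splits)
    then have "y \<in> D" using order_convexD[OF assms(2) _ _ yX] xz by (cases up) auto
    then show "v \<in> g ` D" using y by auto
  qed
qed

lemma mono_piece_convex_vimage:
  assumes g: "mono_piece g up C" and D: "order_convex X D"
  shows "order_convex X (C \<inter> g -` D)"
proof -
  have C: "order_convex X C" using g by (auto simp: mono_piece_def)
  show ?thesis unfolding order_convex_def
  proof (intro conjI ballI impI)
    show "C \<inter> g -` D \<subseteq> X" using order_convex_subset[OF C] by blast
    fix x z y assume x: "x \<in> C \<inter> g -` D" and z: "z \<in> C \<inter> g -` D" and y: "y \<in> X" "x \<le> y \<and> y \<le> z"
    have yC: "y \<in> C" using C x z y by (meson Int_iff order_convexD)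
    have gy: "g y \<in> X" using g yC order_convex_subset unfolding mono_piece_def by blast
    have "if up then g x \<le> g y \<and> g y \<le> g z else g z \<le> g y \<and> g y \<le> g x"
      using mono_piece_le_iff[OF g] x y z yC by auto
    then show "y \<in> C \<inter> g -` D"
      using order_convexD[OF D _ _ gy] x z yC by (cases up) auto
  qed
qed

lemma mono_piece_comp:
  assumes g: "pmono g \<C>" "mono_piece g up C" and h: "pmono h \<D>" "mono_piece h up' D"
    and C: "C \<in> \<C>"
  shows "mono_piece (h \<circ> g) (up = up') (C \<inter> g -` D)"
proof -
  let ?E = "C \<inter> g -` D"
  have CX: "C \<subseteq> X" using pmonoD(13)[OF g(1) C] .
  have E: "?E = C \<inter> {x \<in> X. g x \<in> D}" using CX by auto
  have oD: "openin T D" "closedin T D" "order_convex X D" using h(2) by (auto simp: mono_piece_def)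
  have 1: "openin T ?E" unfolding E
    using pmonoD(1,8)[OF g(1)] C oD openin_continuous_map_preimage by blast
  have 2: "closedin T ?E" unfolding E
    using pmonoD(1,9)[OF g(1)] C oD closedin_continuous_map_preimage by blast
  have 3: "order_convex X ?E" using mono_piece_convex_vimage[OF g(2) oD(3)] .
  have gE: "g ` ?E = g ` C \<inter> D" by auto
  have 4: "openin T ((h \<circ> g) ` ?E)"
    using open_image[OF h(1) open_image[OF g(1) 1]] by (simp add: image_comp)
  have "order_convex X (g ` C \<inter> D)"
    using g(2) oD order_convex_Int by (auto simp: mono_piece_def)
  then have 5: "order_convex X ((h \<circ> g) ` ?E)"
    using mono_piece_convex_image[OF h(2), of "g ` ?E"] gE by (metis Int_lower2 image_comp)
  have 6: "if up = up' then (h \<circ> g) x < (h \<circ> g) y else (h \<circ> g) y < (h \<circ> g) x"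
    if "x \<in> ?E" "y \<in> ?E" "x < y" for x y
    using that mono_piece_less_iff[OF g(2), of x y] mono_piece_less_iff[OF g(2), of y x]
      mono_piece_less_iff[OF h(2), of "g x" "g y"] mono_piece_less_iff[OF h(2), of "g y" "g x"]
    by (auto split: if_splits)
  show ?thesis unfolding mono_piece_def using 1 2 3 4 5 6 by blast
qed

text \<open>The pieces are the common refinement. Empty intersections are discarded because every
  piece must have endpoints and, later, positive measure.\<close>

lemma pmono_comp:
  assumes g: "pmono g \<C>" and h: "pmono h \<D>"
  shows "pmono (h \<circ> g) ({C \<inter> g -` D | C D. C \<in> \<C> \<and> D \<in> \<D>} - {{}})"
  unfolding pmono_def
proof (intro conjI ballI)
  let ?\<E> = "{C \<inter> g -` D | C D. C \<in> \<C> \<and> D \<in> \<D>} - {{}}"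
  show "continuous_map T T (h \<circ> g)" using pmonoD(1) g h continuous_map_compose by blast
  have "?\<E> \<subseteq> (\<lambda>(C, D). C \<inter> g -` D) ` (\<C> \<times> \<D>)" by auto
  then show "finite ?\<E>" using pmonoD(2) g h by (meson finite_SigmaI finite_imageI finite_subset)
  show "disjoint ?\<E>"
    using pmonoD(3)[OF g] pmonoD(3)[OF h] unfolding disjoint_def pairwise_def disjnt_def by blast
  show "\<Union>?\<E> = X"
  proof
    show "\<Union>?\<E> \<subseteq> X" using pmonoD(13)[OF g] by auto
    show "X \<subseteq> \<Union>?\<E>"
    proof
      fix x assume x: "x \<in> X"
      obtain C where C: "C \<in> \<C>" "x \<in> C" using x pmonoD(4)[OF g] by auto
      obtain D where D: "D \<in> \<D>" "g x \<in> D" using pmonoD(14)[OF g x] pmonoD(4)[OF h] by auto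
      have "x \<in> C \<inter> g -` D" using C D by auto
      then show "x \<in> \<Union>?\<E>" using C D by blast
    qed
  qed
  fix E assume E: "E \<in> ?\<E>"
  then show "E \<noteq> {}" by auto
  show "\<exists>up. mono_piece (h \<circ> g) up E"
    using E pmonoD(6)[OF g] pmonoD(6)[OF h] mono_piece_comp[OF g _ h] by blast
qed

lemma pmono_id: "X \<noteq> {} \<Longrightarrow> pmono (\<lambda>x. x) {X}"
  unfolding pmono_def mono_piece_def
  by (auto simp: order_convex_def intro!: exI[of _ True])

end

locale pmono_system = ordered_compact +
  fixes \<sigma> :: "'a \<Rightarrow> 'a" and \<C> :: "'a set set"
  assumes pmono: "pmono \<sigma> \<C>" and nonempty: "X \<noteq> {}"
begin

lemma pmono_funpow_ex: "\<exists>\<J>. pmono (\<sigma> ^^ k) \<J>"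
proof (induction k)
  case 0
  then show ?case using pmono_id[OF nonempty] by (auto simp: id_def)
next
  case (Suc k)
  then obtain \<J> where "pmono (\<sigma> ^^ k) \<J>" by blast
  from pmono_comp[OF this pmono] show ?case by (auto simp: o_def)
qed

text \<open>An arbitrary decomposition for the \<open>k\<close>-th iterate; those for different
  \<open>k\<close> are chosen independently of each other and of \<open>\<C>\<close>.\<close>

definition pieces :: "nat \<Rightarrow> 'a set set" where
  "pieces k = (SOME \<J>. pmono (\<sigma> ^^ k) \<J>)"

lemma pmono_funpow: "pmono (\<sigma> ^^ k) (pieces k)"
  unfolding pieces_def using pmono_funpow_ex by (rule someI_ex)

lemma funpow_X: "x \<in> X \<Longrightarrow> (\<sigma> ^^ k) x \<in> X"
  using pmonoD(14)[OF pmono_funpow] .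

lemma openin_funpow: "openin T U \<Longrightarrow> openin T ((\<sigma> ^^ k) ` U)"
  using open_image[OF pmono_funpow] .

lemma continuous_funpow: "continuous_map T T (\<sigma> ^^ k)"
  using pmonoD(1)[OF pmono_funpow] .

lemma funpow_image_add: "(\<sigma> ^^ (j + k)) ` A = (\<sigma> ^^ j) ` (\<sigma> ^^ k) ` A"
  by (simp add: funpow_add image_comp)

end

section \<open>Transitivity implies strong transitivity\<close>

lemma infinite_three_chain:
  fixes S :: "'a::linorder set"
  assumes "infinite S"
  shows "\<exists>x\<in>S. \<exists>y\<in>S. \<exists>z\<in>S. x < y \<and> y < z"
proof -
  obtain B where B: "B \<subseteq> S" "card B = 3" "finite B" using infinite_arbitrarily_large[OF assms] by blast
  then obtain x y z where "B = {x, y, z}" "x \<noteq> y" "y \<noteq> z" "x \<noteq> z" by (auto simp: card_3_iff)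
  then show ?thesis using B by (metis insertI1 insert_commute linorder_neqE subset_iff)
qed

locale transitive_system = pmono_system +
  assumes transitive: "openin T U \<Longrightarrow> U \<noteq> {} \<Longrightarrow> openin T V \<Longrightarrow> V \<noteq> {} \<Longrightarrow> \<exists>k. (\<sigma> ^^ k) ` U \<inter> V \<noteq> {}"
    and no_isolated: "\<not> openin T {x}"
begin

lemma transitive_point:
  assumes "openin T U" "u \<in> U" "openin T V" "v \<in> V"
  shows "\<exists>x k. x \<in> U \<and> (\<sigma> ^^ k) x \<in> V"
proof -
  have "U \<noteq> {}" "V \<noteq> {}" using assms by auto
  then obtain k where "(\<sigma> ^^ k) ` U \<inter> V \<noteq> {}" using transitive assms(1,3) by meson
  then show ?thesis by auto
qed

section \<open>Segments and order-components\<close>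

definition seg :: "'a \<Rightarrow> 'a \<Rightarrow> 'a set" where
  "seg x y = {z \<in> X. min x y \<le> z \<and> z \<le> max x y}"

text \<open>The points of \<open>W\<close> that can be joined to \<open>x\<close> within
  \<open>W\<close>. These are components in the sense of the order, as the space may be totally
  disconnected. Since \<open>seg\<close> is symmetric in its ends, belonging to the same component
  is an equivalence relation on \<open>W\<close>.\<close>

definition ccomp :: "'a set \<Rightarrow> 'a \<Rightarrow> 'a set" where
  "ccomp W x = {y \<in> W. seg x y \<subseteq> W}"

lemma seg_subset_convex:
  assumes "order_convex X A" "x \<in> A" "y \<in> A" shows "seg x y \<subseteq> A"
proof
  fix z assume "z \<in> seg x y"
  then have z: "z \<in> X" "min x y \<le> z" "z \<le> max x y" by (auto simp: seg_def)
  have "min x y \<in> A" "max x y \<in> A" using assms(2,3) by (auto simp: min_def max_def)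
  then show "z \<in> A" using order_convexD[OF assms(1)] z by blast
qed

lemma seg_commute: "seg x y = seg y x" by (simp add: seg_def min.commute max.commute)

lemma seg_triangle: "seg x z \<subseteq> seg x y \<union> seg y z"
proof
  fix w assume "w \<in> seg x z"
  then show "w \<in> seg x y \<union> seg y z"
    by (cases "w \<le> y") (auto simp: seg_def min_le_iff_disj le_max_iff_disj)
qed

lemma seg_mono: "x \<le> y \<Longrightarrow> y \<le> z \<Longrightarrow> seg x y \<subseteq> seg x z"
  by (auto simp: seg_def min_le_iff_disj le_max_iff_disj)

lemma closedin_seg: assumes "x \<in> X" "y \<in> X" shows "closedin T (seg x y)"
proof -
  have "seg x y = {z \<in> X. min x y \<le> z} \<inter> {z \<in> X. z \<le> max x y}" by (auto simp: seg_def)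
  moreover have "min x y \<in> X" "max x y \<in> X" using assms by (auto simp: min_def max_def)
  ultimately show ?thesis using closedin_atLeast closedin_atMost by auto
qed

lemma ccomp_refl: "W \<subseteq> X \<Longrightarrow> x \<in> W \<Longrightarrow> x \<in> ccomp W x"
  by (auto simp: ccomp_def seg_def)

lemma ccomp_eq: assumes "y \<in> ccomp W x" shows "ccomp W y = ccomp W x"
proof -
  have "seg x y \<subseteq> W" using assms by (auto simp: ccomp_def)
  then have "seg y z \<subseteq> W \<longleftrightarrow> seg x z \<subseteq> W" for z
    using seg_triangle[of x z y] seg_triangle[of y z x] seg_commute[of x y] by blast
  then show ?thesis by (auto simp: ccomp_def)
qed

lemma ccomp_subset: "ccomp W x \<subseteq> W" by (auto simp: ccomp_def)

lemma ccomp_convex: assumes W: "W \<subseteq> X" shows "order_convex X (ccomp W x)"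
  unfolding order_convex_def
proof (intro conjI ballI impI)
  show "ccomp W x \<subseteq> X" using ccomp_subset W by blast
  fix u w v assume u: "u \<in> ccomp W x" and w: "w \<in> ccomp W x" and v: "v \<in> X" "u \<le> v \<and> v \<le> w"
  have "w \<in> ccomp W u" using ccomp_eq[OF u] w by simp
  then have s: "seg u w \<subseteq> W" by (auto simp: ccomp_def)
  have "v \<in> seg u w" using v by (auto simp: seg_def min_def max_def)
  moreover have "seg u v \<subseteq> seg u w" using seg_mono v by blast
  ultimately have "v \<in> ccomp W u" using s by (auto simp: ccomp_def)
  then show "v \<in> ccomp W x" using ccomp_eq[OF u] by simp
qed

lemma convex_subset_ccomp:
  assumes "order_convex X A" "A \<subseteq> W" "a \<in> A" "a \<in> ccomp W x"
  shows "A \<subseteq> ccomp W x"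
proof
  fix b assume "b \<in> A"
  then have "b \<in> ccomp W a" using seg_subset_convex[OF assms(1,3)] assms(2) by (auto simp: ccomp_def)
  then show "b \<in> ccomp W x" using ccomp_eq[OF assms(4)] by simp
qed

lemma ccomp_open: assumes "openin T W" shows "openin T (ccomp W x)"
proof (subst openin_subopen, intro ballI)
  fix y assume y: "y \<in> ccomp W x"
  then have "y \<in> W" using ccomp_subset by blast
  then obtain N where N: "openin T N" "order_convex X N" "y \<in> N" "N \<subseteq> W"
    using convex_nbhd[OF assms] by blast
  have "N \<subseteq> ccomp W x" by (rule convex_subset_ccomp[OF N(2,4,3) y])
  then show "\<exists>U. openin T U \<and> y \<in> U \<and> U \<subseteq> ccomp W x" using N(1,3) by auto
qed

section \<open>The complement of a forward orbit is finite\<close>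

definition forward_orbit :: "'a set \<Rightarrow> 'a set" where
  "forward_orbit V = (\<Union>i. (\<sigma> ^^ i) ` V)"

lemma forward_orbit_open: "openin T V \<Longrightarrow> openin T (forward_orbit V)"
  unfolding forward_orbit_def using openin_funpow by auto

lemma forward_orbit_step: "x \<in> forward_orbit V \<Longrightarrow> \<sigma> x \<in> forward_orbit V"
  unfolding forward_orbit_def by (auto intro: exI[of _ "Suc _"] simp: image_iff) 
    (metis comp_apply funpow.simps(2))

lemma forward_orbit_funpow: "x \<in> forward_orbit V \<Longrightarrow> (\<sigma> ^^ k) x \<in> forward_orbit V"
  by (induction k) (auto intro: forward_orbit_step)

definition piece_max :: "'a set \<Rightarrow> 'a" where
  "piece_max C = (SOME m. m \<in> C \<and> (\<forall>x\<in>C. x \<le> m))"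

lemma piece_max: assumes "C \<in> \<C>" shows "piece_max C \<in> C" "x \<in> C \<Longrightarrow> x \<le> piece_max C"
proof -
  have "\<exists>m. m \<in> C \<and> (\<forall>x\<in>C. x \<le> m)"
    using closed_attains_max pmonoD(5,9)[OF pmono assms] by blast
  from someI_ex[OF this] show "piece_max C \<in> C" "x \<in> C \<Longrightarrow> x \<le> piece_max C"
    unfolding piece_max_def by auto
qed

text \<open>A convex set that continues to the right of a piece it meets must pass through the
  maximum of that piece.\<close>

lemma convex_within_piece:
  assumes A: "order_convex X A" "A \<inter> piece_max ` \<C> = {}" "A \<noteq> {}"
  shows "\<exists>C\<in>\<C>. A \<subseteq> C"
proof -
  have *: False if "x \<in> A" "y \<in> A" "x < y" "x \<in> C" "y \<in> D" "C \<in> \<C>" "D \<in> \<C>" "C \<noteq> D" for x y C D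
  proof -
    have disj: "C \<inter> D = {}" using pmonoD(3)[OF pmono] that by (auto simp: disjoint_def)
    have "piece_max C < y"
      using order_convex_disjoint_less[OF _ _ disj that(4,5,3)] pmonoD(10)[OF pmono] that piece_max by blast
    moreover have "x \<le> piece_max C" using that piece_max by blast
    moreover have "piece_max C \<in> X" using pmonoD(13)[OF pmono] that piece_max by blast
    ultimately have "piece_max C \<in> A" using order_convexD[OF A(1) that(1,2)] by simp
    then show False using A that by auto
  qed
  obtain x where x: "x \<in> A" using A by auto
  have AX: "A \<subseteq> X" using order_convex_subset A by blast
  then obtain C where C: "C \<in> \<C>" "x \<in> C" using x pmonoD(4)[OF pmono] by auto
  have "y \<in> C" if y: "y \<in> A" for y
  proof (rule ccontr)
    assume "y \<notin> C"
    moreover obtain D where D: "D \<in> \<C>" "y \<in> D" using y AX pmonoD(4)[OF pmono] by auto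
    ultimately show False using * x y C by (metis linorder_neqE)
  qed
  then show ?thesis using C by auto
qed

text \<open>A component that contains no endpoint of a piece lies in one piece and so has a single
  successor. Only finitely many components branch, and by transitivity every chain of successors
  returns to the component of \<open>V\<close>; thus finitely many finite chains exhaust all components.\<close>

lemma finite_ccomp:
  assumes V: "openin T V" "order_convex X V" "V \<noteq> {}"
  defines "W \<equiv> forward_orbit V"
  shows "finite (ccomp W ` W)"
proof -
  let ?K = "ccomp W ` W"
  have W: "openin T W" "W \<subseteq> X" using forward_orbit_open V openin_subset W_def by blast+
  have VW: "V \<subseteq> W" unfolding W_def forward_orbit_def by (auto intro: exI[of _ 0] UN_I[of 0])
  obtain v0 where v0: "v0 \<in> V" using V by auto
  define K0 where "K0 = ccomp W v0"
  have VK0: "V \<subseteq> K0" unfolding K0_def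
    using convex_subset_ccomp V VW v0 ccomp_refl W by blast
  have cls: "ccomp W x = K" if "K \<in> ?K" "x \<in> K" for K x using that ccomp_eq by blast
  have sW: "\<sigma> x \<in> W" if "x \<in> W" for x using that forward_orbit_step W_def by blast
  have KW: "K \<subseteq> W" if "K \<in> ?K" for K using that ccomp_subset by blast
  have Kne: "K \<noteq> {}" if "K \<in> ?K" for K using that ccomp_refl W by blast
  have Kconv: "order_convex X K" if "K \<in> ?K" for K using that ccomp_convex[OF W(2)] by auto
  have K0K: "K0 \<in> ?K" using K0_def v0 VW by blast
  \<comment> \<open>\<open>K0\<close>, which contains \<open>V\<close>, is included even if it does
    not branch, because a chain is stopped when it returns there.\<close>
  define \<S> where "\<S> = insert K0 {K \<in> ?K. K \<inter> piece_max ` \<C> \<noteq> {}}"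
  have "{K \<in> ?K. K \<inter> piece_max ` \<C> \<noteq> {}} \<subseteq> ccomp W ` (piece_max ` \<C>)" using cls by blast
  moreover have "finite (ccomp W ` (piece_max ` \<C>))" using pmonoD(2)[OF pmono] by simp
  ultimately have finS: "finite \<S>" unfolding \<S>_def using finite_subset by auto
  have SK: "\<S> \<subseteq> ?K" unfolding \<S>_def using K0K by blast
  define start where "start K C = ccomp W (\<sigma> (SOME x. x \<in> K \<inter> C))" for K C
  have image_in: "ccomp W (\<sigma> x) = ccomp W (\<sigma> y)"
    if "order_convex X A" "A \<subseteq> C" "C \<in> \<C>" "A \<subseteq> W" "x \<in> A" "y \<in> A" for A C x y
  proof -
    have "\<exists>up. mono_piece \<sigma> up C" using pmonoD(6)[OF pmono that(3)] by auto
    then obtain up where "mono_piece \<sigma> up C" ..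
    then have conv: "order_convex X (\<sigma> ` A)" using mono_piece_convex_image that(1,2) by auto
    have sub: "\<sigma> ` A \<subseteq> W" using sW that(4) by auto
    have "\<sigma> x \<in> \<sigma> ` A" "\<sigma> x \<in> ccomp W (\<sigma> x)" using that(5) sub ccomp_refl[OF W(2)] by auto
    then have "\<sigma> ` A \<subseteq> ccomp W (\<sigma> x)" using convex_subset_ccomp[OF conv sub] by auto
    then show ?thesis using ccomp_eq[of "\<sigma> y" W "\<sigma> x"] that(6) by auto
  qed
  have start: "ccomp W (\<sigma> x) = start K C" if "K \<in> ?K" "C \<in> \<C>" "x \<in> K" "x \<in> C" for K C x
  proof -
    have "order_convex X (K \<inter> C)"
      using order_convex_Int[OF Kconv[OF that(1)] pmonoD(10)[OF pmono that(2)]] .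
    moreover have "(SOME x. x \<in> K \<inter> C) \<in> K \<inter> C"
      using someI[of "\<lambda>x. x \<in> K \<inter> C" x] that(3,4) by simp
    moreover have "K \<inter> C \<subseteq> W" using KW[OF that(1)] by auto
    moreover have "x \<in> K \<inter> C" using that(3,4) by simp
    ultimately show ?thesis unfolding start_def
      using image_in[OF _ Int_lower2 that(2), of K x "SOME x. x \<in> K \<inter> C"] by metis
  qed
  \<comment> \<open>Members of \<open>\<S>\<close> are made fixed points, so a chain stays where it
    first hits \<open>\<S>\<close> and its iterates remain defined. Elsewhere the chosen point does
    not matter, since the whole component is mapped into one component.\<close>
  define next' where "next' K = (if K \<in> \<S> then K else ccomp W (\<sigma> (SOME x. x \<in> K)))" for K
  have next': "ccomp W (\<sigma> x) = next' K" if "K \<in> ?K" "K \<notin> \<S>" "x \<in> K" for K x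
  proof -
    have "K \<inter> piece_max ` \<C> = {}" using that(1,2) unfolding \<S>_def by auto
    moreover have "K \<noteq> {}" using that(3) by auto
    ultimately have "\<exists>C\<in>\<C>. K \<subseteq> C"
      by (rule convex_within_piece[OF Kconv[OF that(1)]])
    then obtain C where C: "C \<in> \<C>" "K \<subseteq> C" by auto
    have "(SOME x. x \<in> K) \<in> K" using someI[of "\<lambda>x. x \<in> K" x] that(3) by simp
    then show ?thesis unfolding next'_def
      using image_in[OF Kconv[OF that(1)] C(2,1) KW[OF that(1)] that(3)] that(2) by auto
  qed
  have next'_S: "next' K = K" if "K \<in> \<S>" for K using that by (simp add: next'_def)
  have absorb: "(next' ^^ (k + i)) K = (next' ^^ k) K" if "(next' ^^ k) K \<in> \<S>" for k i K
  proof (induction i)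
    case (Suc i)
    then show ?case using that next'_S by simp
  qed simp
  \<comment> \<open>By \<open>absorb\<close>, the second premise says that no member of the chain
    before the \<open>j\<close>-th lies in \<open>\<S>\<close>; \<open>j = 0\<close> is separate
    because \<open>j - 1\<close> is truncated.\<close>
  have chain: "(next' ^^ j) K \<in> ?K \<and> (\<sigma> ^^ j) ` K \<subseteq> (next' ^^ j) K"
    if "K \<in> ?K" "j = 0 \<or> (next' ^^ (j - 1)) K \<notin> \<S>" for j K
    using that(2)
  proof (induction j)
    case 0
    then show ?case using that by auto
  next
    case (Suc j)
    let ?L = "(next' ^^ j) K"
    have nS: "?L \<notin> \<S>" using Suc by auto
    have "j = 0 \<or> (next' ^^ (j - 1)) K \<notin> \<S>"
    proof (rule ccontr)
      assume "\<not> ?thesis"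
      then show False using absorb[of "j - 1" K 1] nS by auto
    qed
    then have IH: "?L \<in> ?K" "(\<sigma> ^^ j) ` K \<subseteq> ?L" using Suc by auto
    have *: "next' ?L = ccomp W (\<sigma> y)" "\<sigma> y \<in> W" if "y \<in> ?L" for y
      using next'[OF IH(1) nS that] KW[OF IH(1)] sW that by auto
    obtain x where "x \<in> ?L" using Kne IH by blast
    then have "next' ?L \<in> ?K" using * by blast
    moreover have "\<sigma> y \<in> next' ?L" if "y \<in> ?L" for y
      using *[OF that] ccomp_refl W by auto
    ultimately show ?case using IH by auto
  qed
  \<comment> \<open>After \<open>d K\<close> steps the image of \<open>K\<close> meets
    \<open>V\<close>, hence \<open>K0\<close>. A chain that avoided \<open>\<S>\<close> until then
    would have arrived at \<open>K0\<close>, which belongs to \<open>\<S>\<close>; so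
    \<open>d K\<close> bounds the length of the chain.\<close>
  define d where "d K = (LEAST k. (\<sigma> ^^ k) ` K \<inter> V \<noteq> {})" for K
  have d: "(\<sigma> ^^ d K) ` K \<inter> V \<noteq> {}" if "K \<in> ?K" for K
    unfolding d_def by (rule LeastI_ex, rule transitive) (use that ccomp_open W V Kne in auto)
  have less_d: "j < d K" if K: "K \<in> ?K" and n: "(next' ^^ j) K \<notin> \<S>" for j K
  proof (rule ccontr)
    assume "\<not> j < d K"
    then obtain i where i: "j = d K + i" by (metis le_iff_add not_less)
    have nS: "(next' ^^ d K) K \<notin> \<S>" using absorb[of "d K" K i] n i by auto
    have "d K = 0 \<or> (next' ^^ (d K - 1)) K \<notin> \<S>"
    proof (rule ccontr)
      assume "\<not> ?thesis"
      then show False using absorb[of "d K - 1" K 1] nS by auto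
    qed
    then have c: "(next' ^^ d K) K \<in> ?K" "(\<sigma> ^^ d K) ` K \<subseteq> (next' ^^ d K) K"
      using chain[OF K] by auto
    obtain x where "x \<in> (\<sigma> ^^ d K) ` K" "x \<in> V" using d[OF K] by auto
    then have x: "x \<in> (next' ^^ d K) K" "x \<in> K0" using c(2) VK0 by auto
    have "(next' ^^ d K) K = K0" using cls[OF c(1) x(1)] cls[OF K0K x(2)] by simp
    then show False using nS unfolding \<S>_def by simp
  qed
  \<comment> \<open>The possible beginnings of chains: a member of \<open>\<S>\<close>, or a
    component entered directly from one.\<close>
  define \<B> where "\<B> = \<S> \<union> (\<lambda>(K, C). start K C) ` {(K, C). K \<in> \<S> \<and> C \<in> \<C> \<and> K \<inter> C \<noteq> {}}"
  have "{(K, C). K \<in> \<S> \<and> C \<in> \<C> \<and> K \<inter> C \<noteq> {}} \<subseteq> \<S> \<times> \<C>" by auto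
  then have "finite {(K, C). K \<in> \<S> \<and> C \<in> \<C> \<and> K \<inter> C \<noteq> {}}"
    using finite_subset finS pmonoD(2)[OF pmono] by blast
  then have finB: "finite \<B>" unfolding \<B>_def using finS by simp
  have BK: "\<B> \<subseteq> ?K"
  proof
    fix L assume "L \<in> \<B>"
    then consider "L \<in> \<S>" | K C x where "K \<in> \<S>" "C \<in> \<C>" "x \<in> K" "x \<in> C" "L = start K C"
      unfolding \<B>_def by auto
    then show "L \<in> ?K"
    proof cases
      case 2
      then have K: "K \<in> ?K" using SK by blast
      have "L = ccomp W (\<sigma> x)" using start[OF K 2(2,3,4)] 2(5) by simp
      moreover have "\<sigma> x \<in> W" using sW KW[OF K] 2 by blast
      ultimately show ?thesis by blast
    qed (use SK in blast)
  qed
  define \<F> where "\<F> = (\<Union>K\<in>\<B>. (\<lambda>j. (next' ^^ j) K) ` {..d K})"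
  have finF: "finite \<F>" unfolding \<F>_def using finB by auto
  have BF: "\<B> \<subseteq> \<F>"
  proof
    fix K assume "K \<in> \<B>"
    moreover have "K = (next' ^^ 0) K" by simp
    ultimately show "K \<in> \<F>" unfolding \<F>_def by (intro UN_I image_eqI) auto
  qed
  have closed: "ccomp W (\<sigma> x) \<in> \<F>" if K: "K \<in> \<F>" "K \<in> ?K" and x: "x \<in> K" for K x
  proof (cases "K \<in> \<S>")
    case True
    obtain C where C: "C \<in> \<C>" "x \<in> C" using x KW[OF K(2)] W pmonoD(4)[OF pmono] by blast
    then have "(K, C) \<in> {(K, C). K \<in> \<S> \<and> C \<in> \<C> \<and> K \<inter> C \<noteq> {}}" using True x by auto
    then have "(\<lambda>(K, C). start K C) (K, C) \<in> \<B>" unfolding \<B>_def by (intro UnI2 imageI)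
    then have "start K C \<in> \<B>" by simp
    then show ?thesis using start[OF K(2) C(1) x C(2)] BF by auto
  next
    case False
    obtain L j where L: "L \<in> \<B>" "K = (next' ^^ j) L" using K(1) unfolding \<F>_def by auto
    have "L \<in> ?K" using L(1) BK by auto
    then have "Suc j \<le> d L" using less_d[of L j] L(2) False by simp
    then have "(next' ^^ Suc j) L \<in> (\<lambda>j. (next' ^^ j) L) ` {..d L}" by (intro imageI) simp
    then have "(next' ^^ Suc j) L \<in> \<F>" unfolding \<F>_def using L(1) by (intro UN_I)
    then show ?thesis using next'[OF K(2) False x] L(2) by simp
  qed
  have "ccomp W ((\<sigma> ^^ i) v) \<in> \<F>" if v: "v \<in> V" for i v
  proof (induction i)
    case 0
    have "v \<in> K0" using VK0 v by blast
    then have "ccomp W v = K0" using cls[OF K0K] by simp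
    moreover have "K0 \<in> \<B>" unfolding \<B>_def \<S>_def by simp
    ultimately show ?case using BF by auto
  next
    case (Suc i)
    have "v \<in> W" using v VW by blast
    then have m: "(\<sigma> ^^ i) v \<in> W" unfolding W_def by (rule forward_orbit_funpow)
    then have "ccomp W ((\<sigma> ^^ i) v) \<in> ?K" by (rule imageI)
    then show ?case using closed[OF Suc _ ccomp_refl[OF W(2) m]] by simp
  qed
  then have "?K \<subseteq> \<F>" unfolding W_def forward_orbit_def by auto
  then show ?thesis using finF finite_subset by blast
qed

lemma forward_orbit_dense:
  assumes "openin T V" "V \<noteq> {}" "openin T U" "U \<noteq> {}"
  shows "\<exists>x\<in>U. x \<in> forward_orbit V"
  using transitive[OF assms] unfolding forward_orbit_def by blast

lemma cofinite_forward_orbit_convex: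
  assumes V: "openin T V" "order_convex X V" "V \<noteq> {}"
  shows "finite (X - forward_orbit V)"
proof (rule ccontr)
  define W where "W = forward_orbit V"
  assume inf: "infinite (X - forward_orbit V)"
  have W: "openin T W" "W \<subseteq> X" using forward_orbit_open V openin_subset W_def by blast+
  \<comment> \<open>A component with a point left of some \<open>z\<close> outside \<open>W\<close>
    lies entirely left of \<open>z\<close>, by convexity. Thus \<open>L z\<close> is the cut that
    \<open>z\<close> makes among the components, and there are only finitely many cuts.\<close>
  define L where "L z = {K \<in> ccomp W ` W. \<exists>x\<in>K. x < z}" for z
  have "L ` (X - W) \<subseteq> Pow (ccomp W ` W)" unfolding L_def by auto
  then have "finite (L ` (X - W))" using finite_ccomp[OF V] W_def finite_subset by blast
  then obtain z0 where "infinite {z \<in> X - W. L z = L z0}"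
    using pigeonhole_infinite[of "X - W" L] inf W_def by auto
  then obtain x y z where c: "x \<in> X - W" "y \<in> X - W" "z \<in> X - W" "L x = L z" "x < y" "y < z"
    using infinite_three_chain by (smt (verit, best) mem_Collect_eq)
  let ?U = "{q \<in> X. x < q} \<inter> {q \<in> X. q < z}"
  have "openin T ?U" using open_upper open_lower c by blast
  moreover have "y \<in> ?U" using c by auto
  ultimately obtain w where w: "w \<in> ?U" "w \<in> W" using forward_orbit_dense[OF V(1,3)] W_def by blast
  \<comment> \<open>Equal cuts put a point of this component left of \<open>x\<close> as well; as
    \<open>w\<close> is to the right of \<open>x\<close>, convexity forces \<open>x\<close> into
    \<open>W\<close>.\<close>
  have "ccomp W w \<in> L z" using w ccomp_refl[OF W(2) w(2)] unfolding L_def by auto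
  then have "ccomp W w \<in> L x" using c(4) by simp
  then obtain u where u: "u \<in> ccomp W w" "u < x" unfolding L_def by blast
  then have "x \<in> ccomp W w"
    using order_convexD[OF ccomp_convex[OF W(2)] u(1) ccomp_refl[OF W(2) w(2)], of x] w c by auto
  then show False using c ccomp_subset by blast
qed

lemma cofinite_forward_orbit:
  assumes V: "openin T V" "V \<noteq> {}"
  shows "finite (X - forward_orbit V)"
proof -
  obtain p where "p \<in> V" using V by auto
  then obtain N where N: "openin T N" "order_convex X N" "p \<in> N" "N \<subseteq> V" using convex_nbhd V by blast
  then have "finite (X - forward_orbit N)" using cofinite_forward_orbit_convex by blast
  moreover have "forward_orbit N \<subseteq> forward_orbit V" using N unfolding forward_orbit_def by blast
  ultimately show ?thesis by (meson Diff_mono finite_subset subset_refl)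
qed

lemma infinite_open:
  assumes U: "openin T U" "U \<noteq> {}"
  shows "infinite U"
proof
  assume fin: "finite U"
  obtain x where x: "x \<in> U" using U by auto
  have "closedin T (U - {x})"
    using fin openin_subset[OF U(1)] finite_imp_compactin[of "U - {x}" T] closed_iff_compact by auto
  then have "openin T (U - (U - {x}))" using U by auto
  moreover have "U - (U - {x}) = {x}" using x by auto
  ultimately show False using no_isolated by simp
qed

text \<open>The complement of the image is open and no positive iterate enters it. If it were
  non-empty it would be infinite, hence contain two disjoint non-empty open sets, and transitivity
  could not lead from one to the other.\<close>

lemma surj: "\<sigma> ` X = X"
proof (rule ccontr)
  assume ne: "\<sigma> ` X \<noteq> X"
  have sub: "\<sigma> ` X \<subseteq> X" using pmonoD(14)[OF pmono] by blast
  have cl: "closedin T (\<sigma> ` X)" using closed_image[OF pmonoD(1)[OF pmono]] by simp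
  let ?O = "X - \<sigma> ` X"
  have O: "openin T ?O" "?O \<noteq> {}" using cl ne sub by auto
  then obtain x y z where xyz: "x \<in> ?O" "y \<in> ?O" "z \<in> ?O" "x < y" "y < z"
    using infinite_three_chain[OF infinite_open] by meson
  let ?U = "?O \<inter> {q \<in> X. q < y}" and ?V = "?O \<inter> {q \<in> X. y < q}"
  have y: "y \<in> X" using xyz by auto
  have "openin T ?U" "openin T ?V"
    using openin_Int[OF O(1) open_lower[OF y]] openin_Int[OF O(1) open_upper[OF y]] by simp_all
  moreover have "x \<in> ?U" "z \<in> ?V" using xyz by auto
  ultimately obtain u k where u: "u \<in> ?U" "(\<sigma> ^^ k) u \<in> ?V"
    using transitive_point by meson
  show False
  proof (cases k)
    case 0
    then show False using u by auto
  next
    case (Suc j)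
    have "(\<sigma> ^^ j) u \<in> X" using u funpow_X by auto
    then show False using u Suc by auto
  qed
qed

lemma surj_funpow: "(\<sigma> ^^ k) ` X = X"
proof (induction k)
  case (Suc k)
  have "(\<sigma> ^^ Suc k) ` X = \<sigma> ` ((\<sigma> ^^ k) ` X)" by (simp add: image_comp)
  then show ?case using Suc surj by simp
qed simp

section \<open>There are no exceptional points\<close>

lemma finite_fibre: "finite {y \<in> X. (\<sigma> ^^ k) y = x}"
  by (rule pmono_fibre_finite[OF pmono_funpow])

text \<open>By surjectivity each point of \<open>Z\<close> has a preimage, which lies in
  \<open>Z\<close> again, so \<open>\<sigma>\<close> permutes the finite set \<open>Z\<close>. A
  preimage of \<open>z\<close> under the period lies in \<open>Z\<close> too, where injectivity
  identifies it with \<open>z\<close>.\<close>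

lemma finite_backward_invariant_periodic:
  assumes Z: "finite Z" "Z \<subseteq> X" "\<And>y. y \<in> X \<Longrightarrow> \<sigma> y \<in> Z \<Longrightarrow> y \<in> Z" and z: "z \<in> Z"
  shows "\<exists>q\<ge>1. (\<sigma> ^^ q) z = z \<and> (\<forall>j. (\<sigma> ^^ j) z \<in> Z) \<and> (\<forall>y\<in>X. (\<sigma> ^^ q) y = z \<longrightarrow> y = z)"
proof -
  have sub: "Z \<subseteq> \<sigma> ` Z"
  proof
    fix w assume w: "w \<in> Z"
    then have "w \<in> \<sigma> ` X" using Z(2) surj by auto
    then obtain y where y: "y \<in> X" "w = \<sigma> y" by auto
    then show "w \<in> \<sigma> ` Z" using Z(3) w by auto
  qed
  have im: "Z = \<sigma> ` Z"
    by (rule card_seteq[OF _ sub]) (use Z(1) card_image_le in auto)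
  then have inj: "inj_on \<sigma> Z" using Z(1) by (metis eq_card_imp_inj_on)
  have fZ: "(\<sigma> ^^ j) y \<in> Z" if "y \<in> Z" for j y
    using that im by (induction j) auto
  have injk: "inj_on (\<sigma> ^^ k) Z" for k
    unfolding inj_on_def
  proof (induction k)
    case (Suc k)
    then show ?case using inj fZ by (auto simp: inj_on_def)
  qed simp
  have bwd: "y \<in> Z" if "y \<in> X" "(\<sigma> ^^ k) y \<in> Z" for k y
    using that by (induction k) (auto intro: Z(3) funpow_X)
  have "\<not> inj (\<lambda>i. (\<sigma> ^^ i) z)"
  proof
    assume "inj (\<lambda>i. (\<sigma> ^^ i) z)"
    moreover have "finite (range (\<lambda>i. (\<sigma> ^^ i) z))"
      by (rule finite_subset[OF _ Z(1)]) (use fZ z in auto)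
    ultimately show False using finite_imageD by fastforce
  qed
  then have "\<exists>i j. i < j \<and> (\<sigma> ^^ i) z = (\<sigma> ^^ j) z"
    unfolding inj_def by (metis linorder_neqE_nat)
  then obtain i j where ij: "i < j" "(\<sigma> ^^ i) z = (\<sigma> ^^ j) z" by blast
  have "(\<sigma> ^^ i) ((\<sigma> ^^ (j - i)) z) = (\<sigma> ^^ j) z"
    using ij(1) funpow_add[of i "j - i" \<sigma>] by simp
  then have per: "(\<sigma> ^^ (j - i)) z = z" using injk[of i] fZ[OF z] z ij(2) by (auto simp: inj_on_def)
  have "y = z" if "y \<in> X" "(\<sigma> ^^ (j - i)) y = z" for y
  proof -
    have "y \<in> Z" using bwd[OF that(1), of "j - i"] that(2) z by simp
    then show ?thesis using injk[of "j - i"] per that(2) z by (auto simp: inj_on_def)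
  qed
  then show ?thesis using per ij(1) fZ[OF z] by (intro exI[of _ "j - i"]) auto
qed

lemma piece_containing: "z \<in> X \<Longrightarrow> \<exists>C\<in>\<C>. z \<in> C"
  using pmonoD(4)[OF pmono] by auto

text \<open>The return map at \<open>z\<close> may reverse the order; its square, on the part of the
  piece that stays in the piece, cannot.\<close>

lemma orientation_preserving_neighbourhood:
  assumes z: "z \<in> X" "(\<sigma> ^^ q) z = z"
  shows "\<exists>C. mono_piece (\<sigma> ^^ (q + q)) True C \<and> z \<in> C"
proof -
  obtain J where J: "J \<in> pieces q" "z \<in> J" using z pmonoD(4)[OF pmono_funpow, of q] by auto
  then obtain up where up: "mono_piece (\<sigma> ^^ q) up J" using pmonoD(6)[OF pmono_funpow] by blast
  have "mono_piece ((\<sigma> ^^ q) \<circ> (\<sigma> ^^ q)) (up = up) (J \<inter> (\<sigma> ^^ q) -` J)"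
    by (rule mono_piece_comp[OF pmono_funpow up pmono_funpow up J(1)])
  moreover have "(\<sigma> ^^ q) \<circ> (\<sigma> ^^ q) = \<sigma> ^^ (q + q)" by (simp add: funpow_add)
  ultimately have "mono_piece (\<sigma> ^^ (q + q)) True (J \<inter> (\<sigma> ^^ q) -` J)" by simp
  moreover have "z \<in> J \<inter> (\<sigma> ^^ q) -` J" using J z by auto
  ultimately show ?thesis by blast
qed

text \<open>\<open>z\<close> may be an accumulation point from one side only, so \<open>b\<close> is
  taken on a side on which \<open>N\<close> is infinite; a third point between \<open>b\<close> and
  \<open>z\<close> makes the open set non-empty.\<close>

lemma point_with_fat_seg:
  assumes N: "openin T N" "order_convex X N" "z \<in> N"
  shows "\<exists>b\<in>N. b \<noteq> z \<and> (\<exists>U. openin T U \<and> U \<noteq> {} \<and> U \<subseteq> seg z b)"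
proof -
  have zX: "z \<in> X" using openin_subset N by blast
  have "infinite N" using infinite_open N by blast
  then have "infinite ({q \<in> N. q < z} \<union> {q \<in> N. z < q})"
  proof -
    have "N \<subseteq> insert z ({q \<in> N. q < z} \<union> {q \<in> N. z < q})" by auto
    then show ?thesis using \<open>infinite N\<close> by (meson finite_insert finite_subset)
  qed
  then consider "infinite {q \<in> N. q < z}" | "infinite {q \<in> N. z < q}" by auto
  then show ?thesis
  proof cases
    case 1
    obtain b c where bc: "b \<in> N" "c \<in> N" "b < c" "c < z" "b < z"
      using infinite_three_chain[OF 1] by auto
    have X: "b \<in> X" "c \<in> X" using bc N openin_subset by auto
    let ?U = "{q \<in> X. b < q} \<inter> {q \<in> X. q < z}"
    have "openin T ?U" using open_upper open_lower zX X by blast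
    moreover have "c \<in> ?U" using bc X by auto
    moreover have "?U \<subseteq> seg z b" using bc by (auto simp: seg_def)
    ultimately have "\<exists>U. openin T U \<and> U \<noteq> {} \<and> U \<subseteq> seg z b" by (intro exI[of _ ?U]) auto
    moreover have "b \<noteq> z" using bc by auto
    ultimately show ?thesis using bc(1) by auto
  next
    case 2
    obtain b c where bc: "b \<in> N" "c \<in> N" "c < b" "z < c" "z < b"
      using infinite_three_chain[OF 2] by auto
    have X: "b \<in> X" "c \<in> X" using bc N openin_subset by auto
    let ?U = "{q \<in> X. z < q} \<inter> {q \<in> X. q < b}"
    have "openin T ?U" using open_upper open_lower zX X by blast
    moreover have "c \<in> ?U" using bc X by auto
    moreover have "?U \<subseteq> seg z b" using bc by (auto simp: seg_def)
    ultimately have "\<exists>U. openin T U \<and> U \<noteq> {} \<and> U \<subseteq> seg z b" by (intro exI[of _ ?U]) auto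
    moreover have "b \<noteq> z" using bc by auto
    ultimately show ?thesis using bc(1) by auto
  qed
qed

text \<open>An order-preserving piece keeps the two sides of its fixed point \<open>z\<close>, so it
  acts on segments at \<open>z\<close> through their far ends.\<close>

lemma seg_image_iff:
  assumes g: "mono_piece g True C" and "x \<in> C" "y \<in> C" "z \<in> C" "g z = z"
  shows "g x \<in> seg z (g y) \<longleftrightarrow> x \<in> seg z y"
proof -
  have X: "x \<in> X" "g x \<in> X"
    using g assms(2) order_convex_subset unfolding mono_piece_def by blast+
  have "g x \<le> g y \<longleftrightarrow> x \<le> y" "g y \<le> g x \<longleftrightarrow> y \<le> x" "g x \<le> z \<longleftrightarrow> x \<le> z" "z \<le> g x \<longleftrightarrow> z \<le> x"
    using mono_piece_le_iff[OF g] assms by metis+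
  then show ?thesis using X unfolding seg_def by (simp add: min_le_iff_disj le_max_iff_disj)
qed

lemma seg_linear:
  assumes g: "mono_piece g True C" and "y \<in> C" "z \<in> C" "g z = z"
  shows "seg z (g y) \<subseteq> seg z y \<or> seg z y \<subseteq> seg z (g y)"
proof -
  have *: "g y \<le> z \<longleftrightarrow> y \<le> z" "z \<le> g y \<longleftrightarrow> z \<le> y"
    using mono_piece_le_iff[OF g] assms by metis+
  show ?thesis
  proof (cases "z \<le> y")
    case True
    then show ?thesis using seg_mono[of z "g y" y] seg_mono[of z y "g y"] * by (meson linear)
  next
    case False
    then have "y \<le> z" "g y \<le> z" using * by auto
    then show ?thesis unfolding seg_def
      by (cases "g y \<le> y") (auto simp: min_def max_def)
  qed
qed

text \<open>Near a point \<open>z\<close> whose only \<open>g\<close>-preimage is \<open>z\<close>, the segments \<open>seg z (g y)\<close> and \<open>seg z y\<close>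
  are nested; depending on which is larger, one of the next two lemmas applies.\<close>

lemma no_small_backward_invariant:
  assumes q: "q \<ge> 1" and K: "closedin T K" "\<And>x. x \<in> X \<Longrightarrow> (\<sigma> ^^ q) x \<in> K \<Longrightarrow> x \<in> K"
    and U: "openin T U" "U \<noteq> {}" "U \<subseteq> K"
    and x0: "x0 \<in> X" "\<And>j. j < q \<Longrightarrow> (\<sigma> ^^ j) x0 \<notin> K"
  shows False
proof -
  \<comment> \<open>Pulling \<open>K\<close> back along \<open>q\<close> consecutive times turns
    backward invariance under the \<open>q\<close>-th iterate into backward invariance under
    \<open>\<sigma>\<close>. A point outside \<open>B\<close>, such as \<open>x0\<close>, then never
    enters \<open>B\<close>, although \<open>B\<close> contains the open set
    \<open>U\<close>.\<close>
  define B where "B = (\<Union>j<q. {x \<in> X. (\<sigma> ^^ j) x \<in> K})"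
  have "closedin T B" unfolding B_def
    using closedin_continuous_map_preimage[OF continuous_funpow K(1)] by (intro closedin_Union) auto
  then have "openin T (X - B)" by auto
  moreover have "x0 \<in> X - B" using x0 unfolding B_def by auto
  moreover obtain u where "u \<in> U" using U by auto
  ultimately obtain x k where x: "x \<in> X - B" "(\<sigma> ^^ k) x \<in> U"
    using transitive_point[OF _ _ U(1)] by meson
  have step: "y \<in> B" if y: "y \<in> X" "\<sigma> y \<in> B" for y
  proof -
    obtain j where j: "j < q" "(\<sigma> ^^ j) (\<sigma> y) \<in> K" using y unfolding B_def by auto
    then have j': "(\<sigma> ^^ Suc j) y \<in> K" by (simp add: funpow_swap1)
    show ?thesis
    proof (cases "Suc j < q")
      case True
      then show ?thesis using j' y unfolding B_def by blast
    next
      case False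
      then have "Suc j = q" using j by simp
      then have "y \<in> K" using j' K(2) y by simp
      then show ?thesis unfolding B_def using q y by (intro UN_I[of 0]) auto
    qed
  qed
  have "y \<in> B" if "y \<in> X" "(\<sigma> ^^ k) y \<in> B" for y k
    using that
  proof (induction k arbitrary: y)
    case (Suc k)
    then show ?case using step pmonoD(14)[OF pmono] by (metis funpow.simps(2) funpow_swap1 comp_apply)
  qed simp
  moreover have "(\<sigma> ^^ k) x \<in> B" unfolding B_def using x U q openin_subset
    by (intro UN_I[of 0]) auto
  ultimately show False using x by auto
qed

lemma no_small_forward_invariant:
  assumes q: "q \<ge> 1" and K: "closedin T K" "\<And>x. x \<in> K \<Longrightarrow> (\<sigma> ^^ q) x \<in> K"
    and U: "openin T U" "U \<noteq> {}" "U \<subseteq> K"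
    and x0: "x0 \<in> X" "\<And>j y. j < q \<Longrightarrow> y \<in> K \<Longrightarrow> (\<sigma> ^^ j) y \<noteq> x0"
  shows False
proof -
  \<comment> \<open>Dually, pushing \<open>K\<close> forward along \<open>q\<close> times gives a
    forward invariant set. It is closed by compactness, contains \<open>U\<close> and misses
    \<open>x0\<close>.\<close>
  define B where "B = (\<Union>j<q. (\<sigma> ^^ j) ` K)"
  have "closedin T B" unfolding B_def
    using closed_image[OF continuous_funpow K(1)] by (intro closedin_Union) auto
  then have "openin T (X - B)" by auto
  moreover have "x0 \<in> X - B" using x0 unfolding B_def by auto
  moreover obtain u where "u \<in> U" using U by auto
  ultimately obtain x k where x: "x \<in> U" "(\<sigma> ^^ k) x \<in> X - B"
    using transitive_point[OF U(1)] by meson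
  have step: "\<sigma> y \<in> B" if y: "y \<in> B" for y
  proof -
    obtain j w where j: "j < q" "w \<in> K" "y = (\<sigma> ^^ j) w" using y unfolding B_def by auto
    show ?thesis
    proof (cases "Suc j < q")
      case True
      have "\<sigma> y = (\<sigma> ^^ Suc j) w" using j by simp
      then show ?thesis using True j unfolding B_def by blast
    next
      case False
      then have "Suc j = q" using j by simp
      then have "\<sigma> y \<in> K" using j K(2)[of w] by auto
      then show ?thesis unfolding B_def using q by (intro UN_I[of 0]) auto
    qed
  qed
  have "x \<in> B" unfolding B_def using x U q by (intro UN_I[of 0]) auto
  then have "(\<sigma> ^^ k) x \<in> B" by (induction k) (auto intro: step)
  then show False using x by auto
qed

lemma forward_orbit_eq_X:
  assumes V: "openin T V" "V \<noteq> {}"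
  shows "forward_orbit V = X"
proof (rule ccontr)
  define W where "W = forward_orbit V"
  define Z where "Z = X - W"
  assume "forward_orbit V \<noteq> X"
  moreover have WX: "W \<subseteq> X" using forward_orbit_open V openin_subset W_def by blast
  ultimately have "Z \<noteq> {}" unfolding Z_def W_def by auto
  then obtain z where z: "z \<in> Z" by auto
  then have zX: "z \<in> X" using Z_def by auto
  have finZ: "finite Z" using cofinite_forward_orbit[OF V] Z_def W_def by simp
  have "y \<in> Z" if "y \<in> X" "\<sigma> y \<in> Z" for y
    using that forward_orbit_step unfolding Z_def W_def by auto
  then obtain q0 where q0: "q0 \<ge> 1" "(\<sigma> ^^ q0) z = z" "\<And>j. (\<sigma> ^^ j) z \<in> Z"
      "\<And>y. y \<in> X \<Longrightarrow> (\<sigma> ^^ q0) y = z \<Longrightarrow> y = z"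
    using finite_backward_invariant_periodic[OF finZ _ _ z] Z_def by auto
  \<comment> \<open>Twice the period, so that the return map \<open>G\<close> preserves the order
    near \<open>z\<close>.\<close>
  define q where "q = q0 + q0"
  define G where "G = \<sigma> ^^ q"
  have q: "q \<ge> 1" using q0 q_def by simp
  have G_G0: "G y = (\<sigma> ^^ q0) ((\<sigma> ^^ q0) y)" for y by (simp add: G_def q_def funpow_add)
  have Gz: "G z = z" using q0 G_G0 by simp
  have Guniq: "y = z" if "y \<in> X" "G y = z" for y
    using q0(4)[OF that(1)] q0(4)[OF funpow_X[OF that(1)]] that(2) G_G0 by metis
  obtain C where C: "mono_piece G True C" "z \<in> C"
    using orientation_preserving_neighbourhood[OF zX q0(2)] G_def q_def by auto
  obtain x0 where x0: "x0 \<in> V" using V by auto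
  have x0W: "(\<sigma> ^^ j) x0 \<in> W" for j unfolding W_def forward_orbit_def using x0 by blast
  have x0X: "x0 \<in> X" using x0 V openin_subset by blast
  \<comment> \<open>The images and the preimages of \<open>x0\<close> at times below
    \<open>q\<close>. A segment that avoids this finite set keeps \<open>x0\<close> out of both
    unions formed in the two preceding lemmas. \<open>z\<close> is not in \<open>E\<close>: the
    orbit of \<open>x0\<close> stays in \<open>W\<close>, that of \<open>z\<close> stays in
    \<open>Z\<close>.\<close>
  define E where "E = (\<lambda>j. (\<sigma> ^^ j) x0) ` {..<q} \<union> (\<Union>j<q. {y \<in> X. (\<sigma> ^^ j) y = x0})"
  have finE: "finite E" unfolding E_def using finite_fibre by auto
  have zE: "z \<notin> E"
  proof
    assume "z \<in> E"
    then consider j where "z = (\<sigma> ^^ j) x0" | j where "(\<sigma> ^^ j) z = x0" unfolding E_def by auto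
    then show False
    proof cases
      case 1
      then show False using x0W z Z_def by blast
    next
      case 2
      then have "x0 \<in> Z" using q0(3) by blast
      then show False using x0W[of 0] Z_def by simp
    qed
  qed
  have "openin T (C - E)"
  proof -
    have "closedin T (E \<inter> X)" using finE finite_imp_compactin[of "E \<inter> X" T] closed_iff_compact by auto
    then have "openin T (C - (E \<inter> X))" using C by (auto simp: mono_piece_def)
    moreover have "C - (E \<inter> X) = C - E" using C openin_subset by (auto simp: mono_piece_def)
    ultimately show ?thesis by simp
  qed
  then obtain M where M: "openin T M" "order_convex X M" "z \<in> M" "M \<subseteq> C - E"
    using convex_nbhd[of "C - E" z] C(2) zE by blast
  \<comment> \<open>Since \<open>z\<close> is the only \<open>G\<close>-preimage of
    \<open>z\<close>, compactness gives a neighbourhood \<open>N\<close> of \<open>z\<close> all of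
    whose \<open>G\<close>-preimages lie in \<open>M\<close>.\<close>
  have "closedin T (X - M)" using M(1) by auto
  then have "closedin T (G ` (X - M))" unfolding G_def by (rule closed_image[OF continuous_funpow])
  then have "openin T (M - G ` (X - M))" using M by auto
  moreover have "z \<in> M - G ` (X - M)"
  proof -
    have "False" if "x \<in> X" "x \<notin> M" "z = G x" for x using Guniq[of x] that M(3) by simp
    then show ?thesis using M(3) by blast
  qed
  ultimately obtain N where N: "openin T N" "order_convex X N" "z \<in> N" "N \<subseteq> M - G ` (X - M)"
    using convex_nbhd by meson
  obtain b U where b: "b \<in> N" "b \<noteq> z" and U: "openin T U" "U \<noteq> {}" "U \<subseteq> seg z b"
    using point_with_fat_seg[OF N(1-3)] by blast
  have bX: "b \<in> X" using b N openin_subset by blast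
  have segb: "seg z b \<subseteq> N" using seg_subset_convex N b by blast
  have bwd: "x \<in> M" if "x \<in> X" "G x \<in> N" for x using that N(4) by blast
  have "b \<in> G ` X" using surj_funpow bX G_def by auto
  then obtain c where c: "c \<in> X" "G c = b" by auto
  have cM: "c \<in> M" using bwd c b by blast
  have segc: "seg z c \<subseteq> M" using seg_subset_convex M cM by blast
  have iff: "G x \<in> seg z b \<longleftrightarrow> x \<in> seg z c" if "x \<in> M" for x
    using seg_image_iff[OF C(1), of x c z] that cM M(4) C(2) Gz c(2) by auto
  have avoid: "(\<sigma> ^^ j) x0 \<notin> M" "y \<in> M \<Longrightarrow> (\<sigma> ^^ j) y \<noteq> x0" if "j < q" for j y
    using that M(4) M(1) openin_subset unfolding E_def by blast+
  have "seg z b \<subseteq> seg z c \<or> seg z c \<subseteq> seg z b"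
    using seg_linear[OF C(1), of c z] cM M(4) C(2) Gz c(2) by auto
  then show False
  proof
    assume sub: "seg z b \<subseteq> seg z c"
    have inv: "(\<sigma> ^^ q) x \<in> seg z c" if "x \<in> seg z c" for x
      using iff[of x] segc sub that G_def by auto
    have "(\<sigma> ^^ j) y \<noteq> x0" if "j < q" "y \<in> seg z c" for j y
      using avoid(2)[OF that(1)] that(2) segc by auto
    then show False
      using no_small_forward_invariant[OF q closedin_seg[OF zX c(1)] inv U(1,2) _ x0X] U(3) sub by auto
  next
    assume sub: "seg z c \<subseteq> seg z b"
    have inv: "x \<in> seg z b" if "x \<in> X" "(\<sigma> ^^ q) x \<in> seg z b" for x
    proof -
      have "x \<in> M" using bwd[OF that(1)] that(2) segb G_def by auto
      then show ?thesis using iff[of x] sub that(2) G_def by auto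
    qed
    show False
      by (rule no_small_backward_invariant[OF q closedin_seg[OF zX bX] inv U x0X])
        (use avoid segb N(4) in auto)
  qed
qed

lemma strongly_transitive:
  assumes V: "openin T V" "V \<noteq> {}"
  shows "\<exists>m. (\<Union>k\<le>m. (\<sigma> ^^ k) ` V) = X"
proof -
  have "\<forall>U\<in>range (\<lambda>k. (\<sigma> ^^ k) ` V). openin T U" using openin_funpow V by auto
  moreover have "X \<subseteq> \<Union>(range (\<lambda>k. (\<sigma> ^^ k) ` V))"
    using forward_orbit_eq_X[OF V] unfolding forward_orbit_def by simp
  ultimately obtain F where F: "finite F" "F \<subseteq> range (\<lambda>k. (\<sigma> ^^ k) ` V)" "X \<subseteq> \<Union>F"
    using compact unfolding compact_space_def compactin_def by (meson order_refl)
  then obtain D where D: "finite D" "F = (\<lambda>k. (\<sigma> ^^ k) ` V) ` D"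
    by (meson finite_subset_image)
  have "X \<subseteq> (\<Union>k\<le>Max D. (\<sigma> ^^ k) ` V)" using F D by (fastforce intro: Max_ge)
  moreover have "(\<sigma> ^^ k) ` V \<subseteq> X" for k using openin_funpow[OF V(1)] openin_subset by blast
  ultimately show ?thesis by blast
qed

end

text \<open>Let \<open>N\<close> be the least positive difference of two members \<open>t\<close>
  and \<open>t + N\<close>. A member not divisible by \<open>N\<close> would yield its remainder as
  a smaller difference. Write \<open>t = N * e\<close> and \<open>l = e * u + i\<close> with
  \<open>i < e\<close>; then \<open>l * N\<close> is the sum of \<open>u - i\<close> copies of
  \<open>t\<close> and \<open>i\<close> copies of \<open>t + N\<close>.\<close>

lemma semigroup_period:
  fixes S :: "nat set"
  assumes add: "\<And>t u. t \<in> S \<Longrightarrow> u \<in> S \<Longrightarrow> t + u \<in> S" and t0: "t0 \<in> S" "t0 > 0"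
  shows "\<exists>N\<ge>1. (\<forall>t\<in>S. N dvd t) \<and> (\<exists>L. \<forall>l\<ge>L. l * N \<in> S)"
proof -
  define D where "D d \<longleftrightarrow> d > 0 \<and> (\<exists>t\<in>S. t + d \<in> S)" for d
  have "D t0" using add[OF t0(1) t0(1)] t0 by (auto simp: D_def)
  define N where "N = (LEAST d. D d)"
  have N: "D N" unfolding N_def using \<open>D t0\<close> by (rule LeastI)
  have least: "\<not> D d" if "d < N" for d using that not_less_Least unfolding N_def by blast
  obtain t where t: "t \<in> S" "t + N \<in> S" "N > 0" using N by (auto simp: D_def)
  have mult: "Suc k * u \<in> S" if "u \<in> S" for k u
    by (induction k) (use that add in auto)
  have dvd: "N dvd u" if u: "u \<in> S" for u
  proof (rule ccontr)
    assume "\<not> N dvd u"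
    then have r: "u mod N > 0" "u mod N < N" using t by (auto simp: dvd_eq_mod_eq_0)
    let ?q = "u div N"
    have "u + Suc ?q * t \<in> S" using add[OF u mult[OF t(1)]] .
    moreover have "?q * (t + N) + t \<in> S"
    proof (cases ?q)
      case 0
      then show ?thesis using t by simp
    next
      case (Suc k)
      then show ?thesis using add[OF mult[OF t(2), of k] t(1)] by simp
    qed
    moreover have "u + Suc ?q * t = (?q * (t + N) + t) + u mod N"
    proof -
      have "u = ?q * N + u mod N" by simp
      then show ?thesis by (simp add: algebra_simps)
    qed
    ultimately have "D (u mod N)" unfolding D_def using r(1) by metis
    then show False using least r by blast
  qed
  obtain e where e: "t = N * e" using dvd[OF t(1)] by auto
  \<comment> \<open>The square ensures \<open>u \<ge> e > i\<close>; the summand 2 makes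
    \<open>l\<close> positive if \<open>e = 0\<close>, in which case \<open>N\<close> itself is a
    member.\<close>
  have big: "l * N \<in> S" if l: "l \<ge> e * e + 2" for l
  proof (cases "e = 0")
    case True
    then have "N \<in> S" using t e by simp
    moreover obtain k where "l = Suc k" using l by (cases l) auto
    ultimately show ?thesis using mult[of N k] by simp
  next
    case False
    define u where "u = l div e"
    define i where "i = l mod e"
    have ui: "l = e * u + i" "i < e" using False by (auto simp: u_def i_def)
    have "u \<ge> e"
    proof (rule ccontr)
      assume "\<not> u \<ge> e"
      then have "e * Suc u \<le> e * e" by (intro mult_le_mono2) simp
      then show False using ui l by simp
    qed
    then obtain k where k: "u - i = Suc k" using ui by (cases "u - i") auto
    have "Suc k * t \<in> S" using mult t by blast
    moreover have eq: "l * N = Suc k * t + i * (t + N)"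
    proof -
      have u: "u = Suc k + i" using k by simp
      show ?thesis using ui(1) unfolding u e by (simp add: algebra_simps)
    qed
    ultimately show ?thesis
    proof (cases i)
      case (Suc j)
      then show ?thesis using add[OF \<open>Suc k * t \<in> S\<close> mult[OF t(2), of j]] eq by simp
    qed simp
  qed
  show ?thesis using t dvd big by (intro exI[of _ N]) auto
qed

text \<open>Along each residue class modulo \<open>p\<close> the terms decay geometrically, with
  ratio \<open>a p / t ^ p < 1\<close>.\<close>

lemma submultiplicative_summable:
  fixes a :: "nat \<Rightarrow> real"
  assumes nonneg: "\<And>k. a k \<ge> 0" and sub: "\<And>j k. a (j + k) \<le> a j * a k"
    and p: "p > 0" "t > 0" "a p < t ^ p"
  shows "summable (\<lambda>k. a k / t ^ k)"
proof -
  define \<rho> where "\<rho> = a p / t ^ p"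
  have \<rho>: "0 \<le> \<rho>" "\<rho> < 1" using p nonneg by (auto simp: \<rho>_def)
  define D where "D = (\<Sum>i<p. a i / t ^ i)"
  have le: "a (q * p + i) / t ^ (q * p + i) \<le> \<rho> ^ q * (a i / t ^ i)" for q i
  proof (induction q)
    case (Suc q)
    have "a (Suc q * p + i) / t ^ (Suc q * p + i) \<le> a p * a (q * p + i) / t ^ (p + (q * p + i))"
      using sub[of p "q * p + i"] p by (simp add: divide_right_mono algebra_simps)
    also have "\<dots> = \<rho> * (a (q * p + i) / t ^ (q * p + i))" by (simp add: \<rho>_def power_add)
    also have "\<dots> \<le> \<rho> * (\<rho> ^ q * (a i / t ^ i))" using Suc \<rho> mult_left_mono by blast
    finally show ?case by simp
  qed simp
  have nn: "a k / t ^ k \<ge> 0" for k using nonneg p by simp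
  have D: "D \<ge> 0" unfolding D_def by (intro sum_nonneg nn)
  show ?thesis
  proof (rule summableI_nonneg_bounded[OF nn])
    fix n
    have "(\<Sum>k<n. a k / t ^ k) \<le> (\<Sum>k<n * p. a k / t ^ k)"
      using nn p by (intro sum_mono2) auto
    also have "\<dots> = (\<Sum>q<n. \<Sum>k=q * p..<q * p + p. a k / t ^ k)"
      by (rule sum.nat_group[symmetric])
    also have "\<dots> \<le> (\<Sum>q<n. \<rho> ^ q * D)"
    proof (rule sum_mono)
      fix q
      have "(\<Sum>k=q * p..<q * p + p. a k / t ^ k) = (\<Sum>i<p. a (q * p + i) / t ^ (q * p + i))"
        by (rule sum.reindex_bij_witness[of _ "\<lambda>i. q * p + i" "\<lambda>k. k - q * p"]) auto
      also have "\<dots> \<le> (\<Sum>i<p. \<rho> ^ q * (a i / t ^ i))" by (intro sum_mono le)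
      also have "\<dots> = \<rho> ^ q * D" by (simp add: D_def sum_distrib_left)
      finally show "(\<Sum>k=q * p..<q * p + p. a k / t ^ k) \<le> \<rho> ^ q * D" .
    qed
    also have "\<dots> = (\<Sum>q<n. \<rho> ^ q) * D" by (simp add: sum_distrib_right)
    also have "\<dots> \<le> (1 / (1 - \<rho>)) * D"
    proof (rule mult_right_mono[OF _ D])
      have "(\<Sum>q<n. \<rho> ^ q) \<le> (\<Sum>q. \<rho> ^ q)" using \<rho> by (intro sum_le_suminf summable_geometric) auto
      then show "(\<Sum>q<n. \<rho> ^ q) \<le> 1 / (1 - \<rho>)" using suminf_geometric[of \<rho>] \<rho> by simp
    qed
    finally show "(\<Sum>k<n. a k / t ^ k) \<le> 1 / (1 - \<rho>) * D" .
  qed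
qed

text \<open>\<open>r\<close> is the infimum of the \<open>t\<close> at which the series converges,
  and the growth along multiples of \<open>M\<close> keeps it above 1. The series diverges at
  \<open>r\<close> itself: convergence would give \<open>a p < r ^ p\<close> for some
  \<open>p > 0\<close>, an inequality that persists slightly below \<open>r\<close> and implies
  convergence there. As the terms are non-negative, partial sums at \<open>r\<close> become
  arbitrarily large, and by continuity so do the sums at \<open>t\<close> slightly above
  \<open>r\<close>.\<close>

lemma submultiplicative_radius:
  fixes a :: "nat \<Rightarrow> real"
  assumes pos: "\<And>k. a k \<ge> 1" and sub: "\<And>j k. a (j + k) \<le> a j * a k"
    and M: "M > 0" "\<And>j. a (M * j) \<ge> 2 ^ j"
  shows "\<exists>r>1. (\<forall>t>r. summable (\<lambda>k. a k / t ^ k)) \<and>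
    (\<forall>B. \<exists>u>r. \<forall>t. r < t \<and> t < u \<longrightarrow> B \<le> (\<Sum>k. a k / t ^ k))"
proof -
  define R where "R = {t. t > 0 \<and> summable (\<lambda>k. a k / t ^ k)}"
  have nn: "a k \<ge> 0" for k using pos[of k] by simp
  have up: "t' \<in> R" if "t \<in> R" "t \<le> t'" for t t'
  proof -
    have t: "t > 0" "t' > 0" "summable (\<lambda>k. a k / t ^ k)" using that by (auto simp: R_def)
    have "summable (\<lambda>k. a k / t' ^ k)"
    proof (rule summable_comparison_test'[OF t(3)])
      show "norm (a k / t' ^ k) \<le> a k / t ^ k" if "k \<ge> 0" for k
        using t nn[of k] \<open>t \<le> t'\<close> by (auto intro!: divide_left_mono power_mono)
    qed
    then show ?thesis using t by (simp add: R_def)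
  qed
  have gt: "t > root M 2" if "t \<in> R" for t
  proof -
    have t: "t > 0" "summable (\<lambda>k. a k / t ^ k)" using that by (auto simp: R_def)
    have "eventually (\<lambda>k. a k / t ^ k < 1) sequentially"
      using summable_LIMSEQ_zero[OF t(2)] by (rule order_tendstoD) simp
    then obtain K where K: "\<And>k. k \<ge> K \<Longrightarrow> a k / t ^ k < 1" by (auto simp: eventually_sequentially)
    have "a (M * Suc K) / t ^ (M * Suc K) < 1"
    proof (rule K)
      have "K \<le> 1 * Suc K" by simp
      also have "\<dots> \<le> M * Suc K" using M(1) by (intro mult_le_mono) auto
      finally show "K \<le> M * Suc K" .
    qed
    then have "a (M * Suc K) < t ^ (M * Suc K)" using t by (simp add: field_simps)
    moreover have "(t ^ M) ^ Suc K = t ^ (M * Suc K)" by (simp only: power_mult)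
    ultimately have "2 ^ Suc K < (t ^ M) ^ Suc K" using M(2)[of "Suc K"] by linarith
    then have "2 < t ^ M" using t by (meson power_less_imp_less_base zero_le_power less_imp_le)
    then have "root M 2 < root M (t ^ M)" using M(1) by simp
    then show ?thesis using t M(1) by (simp add: real_root_power_cancel)
  qed
  have "a 1 > 0" using pos[of 1] by simp
  then have ne: "2 * a 1 \<in> R"
    using submultiplicative_summable[OF nn sub, of 1 "2 * a 1"] by (simp add: R_def)
  have bdd: "bdd_below R" using gt by (meson bdd_belowI less_imp_le)
  define r where "r = Inf R"
  have r: "r \<ge> root M 2" unfolding r_def using gt ne by (intro cInf_greatest) (auto intro: less_imp_le)
  moreover have "root M 2 > 1" using M(1) by simp
  ultimately have r1: "r > 1" by simp
  have above: "t \<in> R" if "t > r" for t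
  proof -
    have "\<exists>t'\<in>R. t' < t" using that ne bdd unfolding r_def by (subst cInf_less_iff[symmetric]) auto
    then show ?thesis using up less_imp_le by blast
  qed
  have "r \<notin> R"
  proof
    assume "r \<in> R"
    then have "summable (\<lambda>k. a k / r ^ k)" by (simp add: R_def)
    then have "eventually (\<lambda>k. a k / r ^ k < 1) sequentially"
      using summable_LIMSEQ_zero order_tendstoD(2) zero_less_one by blast
    then obtain K where K: "\<And>k. k \<ge> K \<Longrightarrow> a k / r ^ k < 1" by (auto simp: eventually_sequentially)
    have "a (Suc K) / r ^ Suc K < 1" by (rule K) simp
    then have *: "a (Suc K) < r ^ Suc K" using r1 by (simp add: field_simps)
    have "((\<lambda>t. t ^ Suc K) \<longlongrightarrow> r ^ Suc K) (at_left r)" by (intro tendsto_intros)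
    then have "eventually (\<lambda>t. a (Suc K) < t ^ Suc K) (at_left r)" using * by (rule order_tendstoD)
    moreover have "eventually (\<lambda>t. 0 < t \<and> t < r) (at_left r)"
      using r1 by (auto simp: eventually_at_left intro!: exI[of _ 0])
    ultimately have "eventually (\<lambda>t. a (Suc K) < t ^ Suc K \<and> 0 < t \<and> t < r) (at_left r)"
      by eventually_elim auto
    then obtain t where t: "a (Suc K) < t ^ Suc K" "0 < t" "t < r"
      using eventually_happens trivial_limit_at_left_real by blast
    then have "t \<in> R" using submultiplicative_summable[OF nn sub, of "Suc K" t] by (simp add: R_def)
    then show False using t(3) cInf_lower[OF _ bdd] unfolding r_def by fastforce
  qed
  then have ns: "\<not> summable (\<lambda>k. a k / r ^ k)" using r1 by (simp add: R_def)
  have "\<exists>u>r. \<forall>t. r < t \<and> t < u \<longrightarrow> B \<le> (\<Sum>k. a k / t ^ k)" for B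
  proof -
    obtain n where n: "B < (\<Sum>k<n. a k / r ^ k)"
      using ns summableI_nonneg_bounded[of "\<lambda>k. a k / r ^ k" B] nn r1 by (metis divide_nonneg_nonneg
        less_eq_real_def linorder_not_le order_less_trans zero_le_power zero_less_one)
    have "((\<lambda>t. \<Sum>k<n. a k / t ^ k) \<longlongrightarrow> (\<Sum>k<n. a k / r ^ k)) (at_right r)"
      using r1 by (intro tendsto_intros) auto
    then have "eventually (\<lambda>t. B < (\<Sum>k<n. a k / t ^ k)) (at_right r)" using n by (rule order_tendstoD)
    then obtain u where u: "u > r" "\<And>t. r < t \<Longrightarrow> t < u \<Longrightarrow> B < (\<Sum>k<n. a k / t ^ k)"
      by (auto simp: eventually_at_right[OF gt_ex[THEN someI_ex]] eventually_at_right_field)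
    have "B \<le> (\<Sum>k. a k / t ^ k)" if "r < t" "t < u" for t
    proof -
      have "(\<Sum>k<n. a k / t ^ k) \<le> (\<Sum>k. a k / t ^ k)"
        using above[OF that(1)] nn by (intro sum_le_suminf) (auto simp: R_def)
      then show ?thesis using u(2)[OF that] by linarith
    qed
    then show ?thesis using u by blast
  qed
  then show ?thesis using r1 above by (auto simp: R_def)
qed

section \<open>The exact cyclic partition\<close>

locale expanding_system = transitive_system +
  assumes noninjective: "\<exists>x\<in>X. \<exists>y\<in>X. x \<noteq> y \<and> \<sigma> x = \<sigma> y"
begin

section \<open>Counting preimages\<close>

definition fibre :: "nat \<Rightarrow> 'a set \<Rightarrow> 'a \<Rightarrow> 'a set" where
  "fibre k V x = {y \<in> V. (\<sigma> ^^ k) y = x}"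

text \<open>The maximum exists for \<open>V \<subseteq> X\<close>: a fibre has at most one point in
  each member of \<open>pieces k\<close>, so only finitely many cardinalities occur.\<close>

definition fcount :: "nat \<Rightarrow> 'a set \<Rightarrow> nat" where
  "fcount k V = Max (range (\<lambda>x. card (fibre k V x)))"

lemma card_fibre_le: assumes "V \<subseteq> X" shows "card (fibre k V x) \<le> card (pieces k)"
proof -
  let ?P = "\<lambda>y. SOME J. J \<in> pieces k \<and> y \<in> J"
  have P: "?P y \<in> pieces k \<and> y \<in> ?P y" if "y \<in> X" for y
  proof (rule someI_ex)
    show "\<exists>J. J \<in> pieces k \<and> y \<in> J" using that pmonoD(4)[OF pmono_funpow, of k] by auto
  qed
  have "inj_on ?P (fibre k V x)"
  proof (rule inj_onI)
    fix y z assume y: "y \<in> fibre k V x" and z: "z \<in> fibre k V x" and eq: "?P y = ?P z"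
    have X: "y \<in> X" "z \<in> X" using y z assms by (auto simp: fibre_def)
    have "inj_on (\<sigma> ^^ k) (?P y)" using pmonoD(7)[OF pmono_funpow] P[OF X(1)] by blast
    moreover have "y \<in> ?P y" "z \<in> ?P y" using P[OF X(1)] P[OF X(2)] eq by auto
    moreover have "(\<sigma> ^^ k) y = (\<sigma> ^^ k) z" using y z by (simp add: fibre_def)
    ultimately show "y = z" by (meson inj_onD)
  qed
  moreover have "?P ` fibre k V x \<subseteq> pieces k" using P assms by (auto simp: fibre_def)
  ultimately show ?thesis using card_inj_on_le pmonoD(2)[OF pmono_funpow] by blast
qed

lemma finite_range_card_fibre: "V \<subseteq> X \<Longrightarrow> finite (range (\<lambda>x. card (fibre k V x)))"
  by (rule finite_subset[of _ "{..card (pieces k)}"]) (auto intro: card_fibre_le)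

lemma finite_fibre_in: "V \<subseteq> X \<Longrightarrow> finite (fibre k V x)"
  by (rule finite_subset[OF _ finite_fibre[of k x]]) (auto simp: fibre_def)

lemma card_fibre_le_fcount: "V \<subseteq> X \<Longrightarrow> card (fibre k V x) \<le> fcount k V"
  unfolding fcount_def by (intro Max_ge finite_range_card_fibre) auto

lemma fcount_attained: assumes "V \<subseteq> X" shows "\<exists>x. card (fibre k V x) = fcount k V"
proof -
  have "fcount k V \<in> range (\<lambda>x. card (fibre k V x))" unfolding fcount_def
    using finite_range_card_fibre[OF assms] by (intro Max_in) auto
  then show ?thesis by auto
qed

lemma fcount_le: assumes "V \<subseteq> X" "\<And>x. card (fibre k V x) \<le> b" shows "fcount k V \<le> b"
  using fcount_attained[OF assms(1), of k] assms(2) by metis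

lemma fcount_mono: assumes "U \<subseteq> V" "V \<subseteq> X" shows "fcount k U \<le> fcount k V"
proof (rule fcount_le)
  fix x
  have "card (fibre k U x) \<le> card (fibre k V x)"
    using assms finite_fibre_in by (intro card_mono) (auto simp: fibre_def)
  then show "card (fibre k U x) \<le> fcount k V" using card_fibre_le_fcount[OF assms(2)] le_trans by blast
qed (use assms in auto)

lemma fcount_Un: assumes "U \<subseteq> X" "V \<subseteq> X" shows "fcount k (U \<union> V) \<le> fcount k U + fcount k V"
proof (rule fcount_le)
  fix x
  have "fibre k (U \<union> V) x = fibre k U x \<union> fibre k V x" by (auto simp: fibre_def)
  then have "card (fibre k (U \<union> V) x) \<le> card (fibre k U x) + card (fibre k V x)"
    by (simp add: card_Un_le)
  then show "card (fibre k (U \<union> V) x) \<le> fcount k U + fcount k V"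
    using card_fibre_le_fcount[OF assms(1), of k x] card_fibre_le_fcount[OF assms(2), of k x] by linarith
qed (use assms in auto)

text \<open>The injective iterate carries the \<open>(k + p)\<close>-fibres in \<open>V\<close>
  bijectively onto the \<open>k\<close>-fibres in the image. This shift of the index is what becomes
  the expansion factor \<open>t ^ p\<close>.\<close>

lemma fcount_image:
  assumes "V \<subseteq> X" "inj_on (\<sigma> ^^ p) V"
  shows "fcount k ((\<sigma> ^^ p) ` V) = fcount (k + p) V"
proof -
  have "card (fibre k ((\<sigma> ^^ p) ` V) x) = card (fibre (k + p) V x)" for x
  proof -
    have "fibre k ((\<sigma> ^^ p) ` V) x = (\<sigma> ^^ p) ` fibre (k + p) V x"
      by (auto simp: fibre_def funpow_add)
    moreover have "inj_on (\<sigma> ^^ p) (fibre (k + p) V x)"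
      using assms(2) by (rule inj_on_subset) (auto simp: fibre_def)
    ultimately show ?thesis by (simp add: card_image)
  qed
  then show ?thesis by (simp add: fcount_def)
qed

lemma fcount_add_le: "fcount (j + k) X \<le> fcount j X * fcount k X"
proof (rule fcount_le)
  fix x
  have "fibre (j + k) X x \<subseteq> (\<Union>z\<in>fibre j X x. fibre k X z)"
    using funpow_X by (auto simp: fibre_def funpow_add)
  moreover have "finite (\<Union>z\<in>fibre j X x. fibre k X z)" using finite_fibre_in by auto
  ultimately have "card (fibre (j + k) X x) \<le> card (\<Union>z\<in>fibre j X x. fibre k X z)"
    by (rule card_mono[rotated])
  also have "\<dots> \<le> (\<Sum>z\<in>fibre j X x. card (fibre k X z))"
    using finite_fibre_in by (intro card_UN_le) auto
  also have "\<dots> \<le> card (fibre j X x) * fcount k X"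
    using card_fibre_le_fcount[of X k] by (intro sum_bounded_above[of _ _ "fcount k X", simplified]) auto
  also have "\<dots> \<le> fcount j X * fcount k X"
    using card_fibre_le_fcount[of X j x] by (intro mult_right_mono) auto
  finally show "card (fibre (j + k) X x) \<le> fcount j X * fcount k X" .
qed simp

lemma fcount_pos: assumes "V \<subseteq> X" "V \<noteq> {}" shows "fcount k V \<ge> 1"
proof -
  obtain v where v: "v \<in> V" using assms by auto
  have "fibre k V ((\<sigma> ^^ k) v) \<noteq> {}" using v by (auto simp: fibre_def)
  then have "card (fibre k V ((\<sigma> ^^ k) v)) \<noteq> 0" using finite_fibre_in[OF assms(1)] by simp
  then show ?thesis using card_fibre_le_fcount[OF assms(1), of k "(\<sigma> ^^ k) v"] by linarith
qed

text \<open>Every point of an \<open>i\<close>-fibre is the \<open>k\<close>-th image of a point of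
  \<open>V\<close> for some \<open>k \<le> m\<close>, and that point lies in the
  \<open>(i + k)\<close>-fibre over the same \<open>x\<close>.\<close>

lemma fcount_cover:
  assumes V: "V \<subseteq> X" "(\<Union>k\<le>m. (\<sigma> ^^ k) ` V) = X"
  shows "fcount i X \<le> (\<Sum>k\<le>m. fcount (i + k) V)"
proof (rule fcount_le)
  fix x
  have "fibre i X x \<subseteq> (\<Union>k\<le>m. (\<sigma> ^^ k) ` fibre (i + k) V x)"
  proof
    fix y assume y: "y \<in> fibre i X x"
    then have "y \<in> (\<Union>k\<le>m. (\<sigma> ^^ k) ` V)" using V(2) by (simp add: fibre_def)
    then obtain k v where kv: "k \<le> m" "v \<in> V" "y = (\<sigma> ^^ k) v" by auto
    then have "v \<in> fibre (i + k) V x" using y by (simp add: fibre_def funpow_add)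
    then show "y \<in> (\<Union>k\<le>m. (\<sigma> ^^ k) ` fibre (i + k) V x)" using kv by blast
  qed
  then have "card (fibre i X x) \<le> card (\<Union>k\<le>m. (\<sigma> ^^ k) ` fibre (i + k) V x)"
    using finite_fibre_in[OF V(1)] by (intro card_mono) auto
  also have "\<dots> \<le> (\<Sum>k\<le>m. card ((\<sigma> ^^ k) ` fibre (i + k) V x))" by (intro card_UN_le) auto
  also have "\<dots> \<le> (\<Sum>k\<le>m. fcount (i + k) V)"
    using le_trans[OF card_image_le[OF finite_fibre_in[OF V(1)]] card_fibre_le_fcount[OF V(1)]]
    by (intro sum_mono) auto
  finally show "card (fibre i X x) \<le> (\<Sum>k\<le>m. fcount (i + k) V)" .
qed simp

lemma open_set_with_two_preimages:
  "\<exists>U V. openin T U \<and> openin T V \<and> U \<inter> V = {} \<and> \<sigma> ` U \<inter> \<sigma> ` V \<noteq> {}"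
proof -
  obtain x y where xy: "x \<in> X" "y \<in> X" "x \<noteq> y" "\<sigma> x = \<sigma> y" using noninjective by auto
  then have "\<exists>U V. openin T U \<and> openin T V \<and> x \<in> U \<and> y \<in> V \<and> disjnt U V"
    using Hausdorff unfolding Hausdorff_space_def by simp
  then obtain U V where "openin T U" "openin T V" "x \<in> U" "y \<in> V" "disjnt U V" by auto
  moreover have "\<sigma> x \<in> \<sigma> ` U \<inter> \<sigma> ` V" using calculation(3,4) xy(4) by (metis IntI imageI)
  ultimately show ?thesis unfolding disjnt_def by blast
qed

text \<open>The open set of points with preimages in both \<open>U\<close> and \<open>V\<close>
  covers \<open>X\<close> within \<open>m\<close> steps. If \<open>k\<close> steps suffice for a
  given point, surjectivity fills in \<open>m - k\<close> further steps before the branching, so one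
  time \<open>m + 1\<close> serves all points.\<close>

lemma two_preimages:
  "\<exists>M\<ge>1. \<forall>x\<in>X. \<exists>u\<in>X. \<exists>v\<in>X. u \<noteq> v \<and> (\<sigma> ^^ M) u = x \<and> (\<sigma> ^^ M) v = x"
proof -
  obtain U V where UV: "openin T U" "openin T V" "U \<inter> V = {}" "\<sigma> ` U \<inter> \<sigma> ` V \<noteq> {}"
    using open_set_with_two_preimages by blast
  let ?O = "\<sigma> ` U \<inter> \<sigma> ` V"
  have "openin T ?O" using open_image[OF pmono] UV by auto
  then obtain m where m: "(\<Union>k\<le>m. (\<sigma> ^^ k) ` ?O) = X" using strongly_transitive UV by blast
  have "\<exists>u\<in>X. \<exists>v\<in>X. u \<noteq> v \<and> (\<sigma> ^^ Suc m) u = x \<and> (\<sigma> ^^ Suc m) v = x" if x: "x \<in> X" for x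
  proof -
    have "x \<in> (\<Union>k\<le>m. (\<sigma> ^^ k) ` ?O)" using x m by simp
    then obtain k w where k: "k \<le> m" "w \<in> ?O" "x = (\<sigma> ^^ k) w" by blast
    obtain u v where uv: "u \<in> U" "v \<in> V" "w = \<sigma> u" "w = \<sigma> v" using k(2) by auto
    have "u \<in> X" "v \<in> X" using uv UV openin_subset by blast+
    then have "u \<in> (\<sigma> ^^ (m - k)) ` X" "v \<in> (\<sigma> ^^ (m - k)) ` X" using surj_funpow by auto
    then obtain u' v' where uv': "u' \<in> X" "v' \<in> X" "u = (\<sigma> ^^ (m - k)) u'" "v = (\<sigma> ^^ (m - k)) v'"
      by auto
    have "(\<sigma> ^^ Suc m) z = (\<sigma> ^^ k) (\<sigma> ((\<sigma> ^^ (m - k)) z))" for z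
    proof -
      have "Suc m = k + (1 + (m - k))" using k by simp
      then show ?thesis by (simp only: funpow_add o_apply) simp
    qed
    moreover have "u' \<noteq> v'" using uv uv' UV(3) by auto
    ultimately show ?thesis using uv uv' k by metis
  qed
  then show ?thesis by (intro exI[of _ "Suc m"]) auto
qed

lemma fcount_exponential: "\<exists>M>0. \<forall>j. fcount (M * j) X \<ge> 2 ^ j"
proof -
  obtain M where M: "M \<ge> 1"
    "\<forall>x\<in>X. \<exists>u\<in>X. \<exists>v\<in>X. u \<noteq> v \<and> (\<sigma> ^^ M) u = x \<and> (\<sigma> ^^ M) v = x"
    using two_preimages by auto
  have "card (fibre (M * j) X x) \<ge> 2 ^ j" if "x \<in> X" for j x
    using that
  proof (induction j arbitrary: x)
    case 0
    then have "fibre (M * 0) X x = {x}" by (auto simp: fibre_def)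
    then show ?case by simp
  next
    case (Suc j)
    obtain u v where uv: "u \<in> X" "v \<in> X" "u \<noteq> v" "(\<sigma> ^^ M) u = x" "(\<sigma> ^^ M) v = x"
      using bspec[OF M(2) Suc.prems] by auto
    have "fibre (M * j) X u \<union> fibre (M * j) X v \<subseteq> fibre (M * Suc j) X x"
      using uv by (auto simp: fibre_def funpow_add)
    then have "card (fibre (M * j) X u \<union> fibre (M * j) X v) \<le> card (fibre (M * Suc j) X x)"
      using finite_fibre_in by (intro card_mono) auto
    moreover have "fibre (M * j) X u \<inter> fibre (M * j) X v = {}" using uv by (auto simp: fibre_def)
    ultimately have "card (fibre (M * j) X u) + card (fibre (M * j) X v) \<le> card (fibre (M * Suc j) X x)"
      using finite_fibre_in by (simp add: card_Un_disjoint)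
    then show ?case using Suc.IH[OF uv(1)] Suc.IH[OF uv(2)] by simp
  qed
  moreover obtain x where "x \<in> X" using nonempty by blast
  ultimately have "2 ^ j \<le> fcount (M * j) X" for j
    using card_fibre_le_fcount[of X "M * j" x] le_trans by blast
  then show ?thesis using M(1) by (intro exI[of _ M]) auto
qed

section \<open>Abel means of the fibre counts\<close>

definition fibre_series :: "real \<Rightarrow> 'a set \<Rightarrow> real" where
  "fibre_series t V = (\<Sum>k. real (fcount k V) / t ^ k)"

text \<open>If \<open>J\<close> met three pieces, the middle one would be contained in
  \<open>J\<close>.\<close>

lemma convex_in_two_pieces:
  assumes J: "order_convex X J" and no: "\<And>D. D \<in> pieces p \<Longrightarrow> \<not> D \<subseteq> J" and ne: "J \<noteq> {}"
  shows "\<exists>D\<in>pieces p. \<exists>E\<in>pieces p. J \<subseteq> D \<union> E"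
proof (rule ccontr)
  assume neg: "\<not> ?thesis"
  note pm = pmono_funpow[of p]
  have cover: "\<exists>D\<in>pieces p. x \<in> D" if "x \<in> J" for x
    using that order_convex_subset[OF J] pmonoD(4)[OF pm] by auto
  obtain x where x: "x \<in> J" using ne by auto
  then obtain D where D: "D \<in> pieces p" "x \<in> D" using cover by blast
  then obtain y where y: "y \<in> J" "y \<notin> D" using neg by blast
  then obtain E where E: "E \<in> pieces p" "y \<in> E" using cover by blast
  then obtain z where z: "z \<in> J" "z \<notin> D" "z \<notin> E" using neg D by blast
  then obtain F where F: "F \<in> pieces p" "z \<in> F" using cover by blast
  have mid: False if "A \<in> pieces p" "B \<in> pieces p" "C \<in> pieces p" "A \<noteq> B" "B \<noteq> C"
      "u \<in> A" "v \<in> B" "w \<in> C" "u \<in> J" "w \<in> J" "u < v" "v < w" for A B C u v w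
  proof -
    have disj: "A \<inter> B = {}" "B \<inter> C = {}" using pmonoD(3)[OF pm] that by (auto simp: disjoint_def)
    have "B \<subseteq> J"
    proof
      fix b assume b: "b \<in> B"
      have "u < b" using order_convex_disjoint_less[OF pmonoD(10)[OF pm that(1)]
        pmonoD(10)[OF pm that(2)] disj(1) that(6,7,11) that(6) b] .
      moreover have "b < w" using order_convex_disjoint_less[OF pmonoD(10)[OF pm that(2)]
        pmonoD(10)[OF pm that(3)] disj(2) that(7,8,12) b that(8)] .
      moreover have "b \<in> X" using pmonoD(13)[OF pm that(2)] b by blast
      ultimately show "b \<in> J" using order_convexD[OF J that(9,10)] by simp
    qed
    then show False using no that by blast
  qed
  have d: "D \<noteq> E" "D \<noteq> F" "E \<noteq> F" using D E F y z by auto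
  note m = mid[OF D(1) E(1) F(1) d(1,3)] mid[OF D(1) F(1) E(1) d(2) d(3)[symmetric]]
    mid[OF E(1) D(1) F(1) d(1)[symmetric] d(2)] mid[OF E(1) F(1) D(1) d(3) d(2)[symmetric]]
    mid[OF F(1) D(1) E(1) d(2)[symmetric] d(1)] mid[OF F(1) E(1) D(1) d(3)[symmetric] d(1)[symmetric]]
  have "x \<noteq> y" "y \<noteq> z" "x \<noteq> z" using D E y z x by auto
  then consider "x < y" "y < z" | "x < z" "z < y" | "y < x" "x < z" | "y < z" "z < x"
    | "z < x" "x < y" | "z < y" "y < x" by (metis linorder_neqE)
  then show False using m D(2) E(2) F(2) x y(1) z(1) by cases blast+
qed

lemma exponent:
  "\<exists>r>1. (\<forall>t>r. summable (\<lambda>k. real (fcount k X) / t ^ k)) \<and>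
    (\<forall>B. \<exists>u>r. \<forall>t. r < t \<and> t < u \<longrightarrow> B \<le> fibre_series t X)"
proof -
  obtain M where M: "M > 0" "\<forall>j. fcount (M * j) X \<ge> 2 ^ j" using fcount_exponential by auto
  show ?thesis unfolding fibre_series_def
  proof (rule submultiplicative_radius[OF _ _ M(1)])
    show "1 \<le> real (fcount k X)" for k using fcount_pos[OF _ nonempty, of k] by simp
    show "real (fcount (j + k) X) \<le> real (fcount j X) * real (fcount k X)" for j k
      using fcount_add_le[of j k] by (metis of_nat_le_iff of_nat_mult)
    show "2 ^ j \<le> real (fcount (M * j) X)" for j
      using M(2) by (metis of_nat_le_iff of_nat_numeral of_nat_power)
  qed
qed

context
  fixes r :: real
  assumes r1: "r > 1" and sumX: "\<And>t. t > r \<Longrightarrow> summable (\<lambda>k. real (fcount k X) / t ^ k)"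
    and diverges: "\<And>B. \<exists>u>r. \<forall>t. r < t \<and> t < u \<longrightarrow> B \<le> fibre_series t X"
begin

lemma summable_fcount:
  assumes "t > r" "V \<subseteq> X" shows "summable (\<lambda>k. real (fcount k V) / t ^ k)"
proof (rule summable_comparison_test'[OF sumX[OF assms(1)]])
  show "norm (real (fcount k V) / t ^ k) \<le> real (fcount k X) / t ^ k" if "k \<ge> 0" for k
    using assms r1 fcount_mono[OF assms(2) subset_refl, of k] by (auto intro!: divide_right_mono)
qed

lemma fibre_series_mono: assumes "t > r" "U \<subseteq> V" "V \<subseteq> X" shows "fibre_series t U \<le> fibre_series t V"
proof -
  have "U \<subseteq> X" using assms by auto
  then show ?thesis unfolding fibre_series_def using assms r1 fcount_mono[OF assms(2,3)] summable_fcount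
    by (intro suminf_le) (auto intro!: divide_right_mono)
qed

lemma fibre_series_Un: assumes t: "t > r" and UV: "U \<subseteq> X" "V \<subseteq> X" shows "fibre_series t (U \<union> V) \<le> fibre_series t U + fibre_series t V"
proof -
  have UVX: "U \<union> V \<subseteq> X" using UV by auto
  have "fibre_series t U + fibre_series t V = (\<Sum>k. real (fcount k U) / t ^ k + real (fcount k V) / t ^ k)"
    unfolding fibre_series_def by (rule suminf_add) (use summable_fcount t UV in auto)
  moreover have "fibre_series t (U \<union> V) \<le> (\<Sum>k. real (fcount k U) / t ^ k + real (fcount k V) / t ^ k)"
    unfolding fibre_series_def
  proof (rule suminf_le)
    show "real (fcount k (U \<union> V)) / t ^ k \<le> real (fcount k U) / t ^ k + real (fcount k V) / t ^ k" for k
    proof -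
      have "real (fcount k (U \<union> V)) \<le> real (fcount k U) + real (fcount k V)"
        using fcount_Un[OF UV, of k] by linarith
      then show ?thesis using t r1 by (simp add: add_divide_distrib[symmetric] divide_right_mono)
    qed
    show "summable (\<lambda>k. real (fcount k (U \<union> V)) / t ^ k)" using summable_fcount t UVX by blast
    show "summable (\<lambda>k. real (fcount k U) / t ^ k + real (fcount k V) / t ^ k)"
      using summable_fcount t UV by (intro summable_add) auto
  qed
  ultimately show ?thesis by simp
qed

lemma fibre_series_nonneg: "t > r \<Longrightarrow> V \<subseteq> X \<Longrightarrow> fibre_series t V \<ge> 0"
  unfolding fibre_series_def using summable_fcount r1 by (intro suminf_nonneg) auto

lemma fibre_series_empty: "t > r \<Longrightarrow> fibre_series t {} = 0"
proof -
  have "fcount k {} = 0" for k by (simp add: fcount_def fibre_def)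
  then show ?thesis by (simp add: fibre_series_def)
qed

lemma fibre_series_shift:
  assumes t: "t > r" and V: "V \<subseteq> X"
  shows "(\<Sum>k. real (fcount (k + p) V) / t ^ k) = t ^ p * (fibre_series t V - (\<Sum>k<p. real (fcount k V) / t ^ k))"
proof -
  have t0: "t > 0" using t r1 by simp
  have "fibre_series t V - (\<Sum>k<p. real (fcount k V) / t ^ k) = (\<Sum>k. real (fcount (k + p) V) / t ^ (k + p))"
    using suminf_minus_initial_segment[OF summable_fcount[OF t V], of p] by (simp add: fibre_series_def)
  moreover have "summable (\<lambda>k. real (fcount (k + p) V) / t ^ (k + p))"
    using summable_fcount[OF t V] summable_iff_shift[of "\<lambda>k. real (fcount k V) / t ^ k" p] by simp
  ultimately have "t ^ p * (fibre_series t V - (\<Sum>k<p. real (fcount k V) / t ^ k))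
      = (\<Sum>k. t ^ p * (real (fcount (k + p) V) / t ^ (k + p)))"
    using suminf_mult[of "\<lambda>k. real (fcount (k + p) V) / t ^ (k + p)" "t ^ p"] by (simp only:)
  also have "\<dots> = (\<Sum>k. real (fcount (k + p) V) / t ^ k)"
    using t0 by (simp add: power_add field_simps)
  finally show ?thesis by simp
qed

text \<open>Shifting the index by \<open>p\<close> multiplies the series by \<open>t ^ p\<close> and
  loses its first \<open>p\<close> terms. These are bounded by the counts for \<open>X\<close>,
  which makes the error independent of \<open>V\<close>.\<close>

lemma fibre_series_image:
  assumes t: "t > r" and V: "V \<subseteq> X" "inj_on (\<sigma> ^^ p) V"
  shows "fibre_series t ((\<sigma> ^^ p) ` V) \<ge> t ^ p * fibre_series t V - t ^ p * (\<Sum>k<p. real (fcount k X))"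
proof -
  have t1: "t > 1" using t r1 by simp
  have "fibre_series t ((\<sigma> ^^ p) ` V) = t ^ p * (fibre_series t V - (\<Sum>k<p. real (fcount k V) / t ^ k))"
    using fibre_series_shift[OF t V(1), of p] fcount_image[OF V] by (simp add: fibre_series_def)
  moreover have "(\<Sum>k<p. real (fcount k V) / t ^ k) \<le> (\<Sum>k<p. real (fcount k X))"
  proof (rule sum_mono)
    fix k
    have "real (fcount k V) / t ^ k \<le> real (fcount k V) / 1" using t1 by (intro divide_left_mono) auto
    also have "\<dots> \<le> real (fcount k X)" using fcount_mono[OF V(1) subset_refl, of k] by simp
    finally show "real (fcount k V) / t ^ k \<le> real (fcount k X)" .
  qed
  ultimately show ?thesis using t1 by (simp add: right_diff_distrib mult_left_mono)
qed

lemma fibre_series_cover: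
  assumes t: "t > r" and V: "V \<subseteq> X" "(\<Union>k\<le>m. (\<sigma> ^^ k) ` V) = X"
  shows "fibre_series t X \<le> (real m + 1) * t ^ m * fibre_series t V"
proof -
  have t1: "t > 1" using t r1 by simp
  have "fibre_series t X \<le> (\<Sum>i. \<Sum>k\<le>m. real (fcount (i + k) V) / t ^ i)"
    unfolding fibre_series_def
  proof (rule suminf_le)
    show "real (fcount i X) / t ^ i \<le> (\<Sum>k\<le>m. real (fcount (i + k) V) / t ^ i)" for i
    proof -
      have "real (fcount i X) \<le> (\<Sum>k\<le>m. real (fcount (i + k) V))"
        using fcount_cover[OF V, of i] by (metis of_nat_le_iff of_nat_sum)
      then show ?thesis using t1 by (simp add: sum_divide_distrib[symmetric] divide_right_mono)
    qed
    show "summable (\<lambda>i. real (fcount i X) / t ^ i)" using sumX t by blast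
    have *: "summable (\<lambda>i. real (fcount (i + k) V) / t ^ i)" for k
    proof -
      have "summable (\<lambda>i. t ^ k * (real (fcount (i + k) V) / t ^ (i + k)))"
        using summable_fcount[OF t V(1)] by (intro Series.summable_mult) (simp add: summable_iff_shift[of "\<lambda>i. real (fcount i V) / t ^ i"])
      then show ?thesis using t1 by (simp add: power_add field_simps)
    qed
    show "summable (\<lambda>i. \<Sum>k\<le>m. real (fcount (i + k) V) / t ^ i)" by (intro summable_sum *)
  qed
  also have "\<dots> = (\<Sum>k\<le>m. \<Sum>i. real (fcount (i + k) V) / t ^ i)"
  proof (rule suminf_sum)
    fix k
    have "summable (\<lambda>i. t ^ k * (real (fcount (i + k) V) / t ^ (i + k)))"
      using summable_fcount[OF t V(1)] by (intro Series.summable_mult) (simp add: summable_iff_shift[of "\<lambda>i. real (fcount i V) / t ^ i"])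
    then show "summable (\<lambda>i. real (fcount (i + k) V) / t ^ i)" using t1 by (simp add: power_add field_simps)
  qed
  also have "\<dots> \<le> (\<Sum>k\<le>m. t ^ m * fibre_series t V)"
  proof (rule sum_mono)
    fix k assume k: "k \<in> {..m}"
    have "(\<Sum>j<k. real (fcount j V) / t ^ j) \<ge> 0" using t1 by (intro sum_nonneg) auto
    then have "(\<Sum>i. real (fcount (i + k) V) / t ^ i) \<le> t ^ k * fibre_series t V"
      unfolding fibre_series_shift[OF t V(1)] using t1 by (intro mult_left_mono) auto
    also have "\<dots> \<le> t ^ m * fibre_series t V"
      using k t1 fibre_series_nonneg[OF t V(1)] by (intro mult_right_mono power_increasing) auto
    finally show "(\<Sum>i. real (fcount (i + k) V) / t ^ i) \<le> t ^ m * fibre_series t V" .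
  qed
  also have "\<dots> = (real m + 1) * t ^ m * fibre_series t V" by (simp add: algebra_simps)
  finally show ?thesis .
qed

text \<open>An interval that contains no piece of \<open>\<sigma>\<^sup>p\<close> meets at most two of them, so half of its size
  survives in one piece and \<open>\<sigma>\<^sup>p\<close> multiplies it by at least 3, up to the error \<open>e\<close>. The latter does
  not depend on the interval and is negligible for \<open>t\<close> close to \<open>r\<close>, where the series diverges.\<close>

lemma covers_piece:
  assumes p: "r ^ p \<ge> 3" and V: "openin T V" "V \<noteq> {}"
  shows "\<exists>D\<in>pieces p. \<exists>i. D \<subseteq> (\<sigma> ^^ i) ` V"
proof (rule ccontr)
  assume neg: "\<not> ?thesis"
  have no: "\<not> D \<subseteq> (\<sigma> ^^ i) ` V" if "D \<in> pieces p" for D i using neg that by blast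
  obtain v where "v \<in> V" using V by auto
  then obtain V0 where V0: "openin T V0" "order_convex X V0" "v \<in> V0" "V0 \<subseteq> V"
    using convex_nbhd[OF V(1)] by blast
  have "V0 \<noteq> {}" using V0(3) by auto
  then obtain m where m: "(\<Union>k\<le>m. (\<sigma> ^^ k) ` V0) = X" using strongly_transitive[OF V0(1)] by auto
  define a where "a = (\<Sum>k<p. real (fcount k X))"
  \<comment> \<open>The threshold is the factor lost when \<open>X\<close> is compared with
    \<open>V0\<close>, times a bound exceeding \<open>2 * e\<close>; it is written with
    \<open>r + 1\<close> in place of \<open>t\<close> because \<open>t\<close> is chosen only
    afterwards.\<close>
  obtain u where u: "u > r" "\<forall>t. r < t \<and> t < u \<longrightarrow> (real m + 1) * (r + 1) ^ m * (2 * (r + 1) ^ p * a + 1) \<le> fibre_series t X"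
    using diverges by blast
  define t where "t = (r + min u (r + 1)) / 2"
  have t: "r < t" "t < u" "t < r + 1" using u by (auto simp: t_def min_def field_simps)
  have t1: "t > 1" using t r1 by simp
  have V0X: "V0 \<subseteq> X" using V0 openin_subset by blast
  have a0: "a \<ge> 0" unfolding a_def by (intro sum_nonneg) auto
  define e where "e = t ^ p * a"
  have e0: "e \<ge> 0" using a0 t1 by (simp add: e_def)
  have "2 * e < fibre_series t V0"
  proof -
    have "(real m + 1) * (r + 1) ^ m * (2 * (r + 1) ^ p * a + 1) \<le> fibre_series t X" using u(2) t by blast
    also have "\<dots> \<le> (real m + 1) * t ^ m * fibre_series t V0" using fibre_series_cover[OF t(1) V0X m] .
    also have "\<dots> \<le> (real m + 1) * (r + 1) ^ m * fibre_series t V0"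
      using t t1 fibre_series_nonneg[OF t(1) V0X] by (intro mult_right_mono mult_left_mono power_mono) auto
    finally have "2 * (r + 1) ^ p * a + 1 \<le> fibre_series t V0" using r1 by (simp add: mult_le_cancel_left)
    moreover have "e \<le> (r + 1) ^ p * a" unfolding e_def
      using t t1 a0 by (intro mult_right_mono power_mono) auto
    ultimately show ?thesis by linarith
  qed
  \<comment> \<open>\<open>2 * e\<close> is the fixed point of the map sending a size
    \<open>S\<close> to \<open>3 / 2 * S - e\<close>, so the excess over it grows by the factor
    \<open>3 / 2\<close> at each step.\<close>
  then have d: "fibre_series t V0 - 2 * e > 0" by simp
  have tp: "t ^ p \<ge> 3" using p t r1 power_mono[of r t p] by linarith
  have "\<exists>J. openin T J \<and> order_convex X J \<and> J \<subseteq> (\<sigma> ^^ (p * i)) ` V0 \<and>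
      fibre_series t J - 2 * e \<ge> (3 / 2) ^ i * (fibre_series t V0 - 2 * e)" for i
  proof (induction i)
    case 0
    then show ?case using V0 by (intro exI[of _ V0]) auto
  next
    case (Suc i)
    then obtain J where J: "openin T J" "order_convex X J" "J \<subseteq> (\<sigma> ^^ (p * i)) ` V0"
      "fibre_series t J - 2 * e \<ge> (3 / 2) ^ i * (fibre_series t V0 - 2 * e)" by auto
    have JX: "J \<subseteq> X" using J openin_subset by blast
    have "(3 / 2) ^ i * (fibre_series t V0 - 2 * e) > 0" using d by simp
    then have "fibre_series t J > 0" using J(4) e0 by linarith
    then have ne: "J \<noteq> {}" using fibre_series_empty[OF t(1)] by auto
    have noJ: "\<not> D \<subseteq> J" if "D \<in> pieces p" for D
      using no[OF that, of "p * i"] J(3) V0(4) by blast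
    have "\<exists>D\<in>pieces p. \<exists>E\<in>pieces p. J \<subseteq> D \<union> E" using convex_in_two_pieces[OF J(2) _ ne] noJ by blast
    then obtain D E where DE: "D \<in> pieces p" "E \<in> pieces p" "J \<subseteq> D \<union> E" by auto
    have "fibre_series t J \<le> fibre_series t (J \<inter> D) + fibre_series t (J \<inter> E)"
    proof -
      have "J = (J \<inter> D) \<union> (J \<inter> E)" using DE by auto
      then show ?thesis using fibre_series_Un[OF t(1), of "J \<inter> D" "J \<inter> E"] JX by auto
    qed
    then have "fibre_series t (J \<inter> D) \<ge> fibre_series t J / 2 \<or> fibre_series t (J \<inter> E) \<ge> fibre_series t J / 2" by linarith
    then obtain F where F: "F \<in> pieces p" "fibre_series t (J \<inter> F) \<ge> fibre_series t J / 2" using DE(1,2) by auto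
    note pm = pmono_funpow[of p]
    obtain up where mp: "mono_piece (\<sigma> ^^ p) up F" using pmonoD(6)[OF pm F(1)] by auto
    let ?J = "(\<sigma> ^^ p) ` (J \<inter> F)"
    have "openin T (J \<inter> F)" using J(1) pmonoD(8)[OF pm F(1)] by auto
    then have 1: "openin T ?J" by (rule openin_funpow)
    have "order_convex X (J \<inter> F)" using J(2) pmonoD(10)[OF pm F(1)] by (rule order_convex_Int)
    then have 2: "order_convex X ?J" using mono_piece_convex_image[OF mp] by simp
    have 3: "?J \<subseteq> (\<sigma> ^^ (p * Suc i)) ` V0"
    proof -
      have "?J \<subseteq> (\<sigma> ^^ p) ` ((\<sigma> ^^ (p * i)) ` V0)" using J(3) by auto
      then show ?thesis by (simp add: funpow_image_add)
    qed
    have "inj_on (\<sigma> ^^ p) (J \<inter> F)" using mono_piece_inj[OF mp] by (rule inj_on_subset) auto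
    then have "fibre_series t ?J \<ge> t ^ p * fibre_series t (J \<inter> F) - e" unfolding e_def a_def
      using fibre_series_image[OF t(1)] JX by blast
    moreover have "t ^ p * fibre_series t (J \<inter> F) \<ge> 3 * (fibre_series t J / 2)"
      using tp F(2) \<open>fibre_series t J > 0\<close> by (intro mult_mono) auto
    ultimately have "fibre_series t ?J - 2 * e \<ge> 3 / 2 * (fibre_series t J - 2 * e)" by (simp add: algebra_simps)
    also have "3 / 2 * (fibre_series t J - 2 * e) \<ge> 3 / 2 * ((3 / 2) ^ i * (fibre_series t V0 - 2 * e))"
      using J(4) by (intro mult_left_mono) auto
    finally have "fibre_series t ?J - 2 * e \<ge> (3 / 2) ^ Suc i * (fibre_series t V0 - 2 * e)" by simp
    then show ?case using 1 2 3 by blast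
  qed
  moreover have "fibre_series t J \<le> fibre_series t X" if "openin T J" for J
    using fibre_series_mono[OF t(1)] openin_subset[OF that] by auto
  ultimately have bound: "(3 / 2) ^ i * (fibre_series t V0 - 2 * e) \<le> fibre_series t X" for i
  proof -
    assume ex: "\<And>i. \<exists>J. openin T J \<and> order_convex X J \<and> J \<subseteq> (\<sigma> ^^ (p * i)) ` V0 \<and>
      fibre_series t J - 2 * e \<ge> (3 / 2) ^ i * (fibre_series t V0 - 2 * e)" and le: "\<And>J. openin T J \<Longrightarrow> fibre_series t J \<le> fibre_series t X"
    obtain J where "openin T J" "fibre_series t J - 2 * e \<ge> (3 / 2) ^ i * (fibre_series t V0 - 2 * e)" using ex[of i] by auto
    then show ?thesis using le[of J] e0 by linarith
  qed
  have "\<exists>i. fibre_series t X / (fibre_series t V0 - 2 * e) < (3 / 2 :: real) ^ i" by (rule real_arch_pow) simp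
  then obtain i where "fibre_series t X / (fibre_series t V0 - 2 * e) < (3 / 2 :: real) ^ i" by blast
  then show False using bound[of i] d by (simp add: field_simps)
qed

end

section \<open>A common core and its return times\<close>

definition reaches :: "'a set \<Rightarrow> 'a set \<Rightarrow> bool" where
  "reaches V D \<longleftrightarrow> (\<exists>i. D \<subseteq> (\<sigma> ^^ i) ` V)"

lemma reaches_trans: "reaches U V \<Longrightarrow> reaches V W \<Longrightarrow> reaches U W"
proof -
  assume "reaches U V" "reaches V W"
  then obtain i j where "V \<subseteq> (\<sigma> ^^ i) ` U" "W \<subseteq> (\<sigma> ^^ j) ` V" by (auto simp: reaches_def)
  then have "W \<subseteq> (\<sigma> ^^ (j + i)) ` U" unfolding funpow_image_add by blast
  then show "reaches U W" by (auto simp: reaches_def)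
qed

text \<open>By transitivity an image of one open set meets another one, and a piece reached from the
  overlap is reached from both. Merging the finitely many pieces one at a time gives a piece that is
  reached from all of them, and every open set reaches some piece.\<close>

lemma common_core: "\<exists>D. openin T D \<and> D \<noteq> {} \<and> (\<forall>V. openin T V \<and> V \<noteq> {} \<longrightarrow> reaches V D)"
proof -
  obtain r where r: "r > 1" "\<And>t. t > r \<Longrightarrow> summable (\<lambda>k. real (fcount k X) / t ^ k)"
    "\<And>B. \<exists>u>r. \<forall>t. r < t \<and> t < u \<longrightarrow> B \<le> fibre_series t X" using exponent by blast
  obtain p where "3 < r ^ p" using real_arch_pow[OF r(1)] by blast
  then have p: "r ^ p \<ge> 3" by simp
  note pm = pmono_funpow[of p]
  have cov: "\<exists>D\<in>pieces p. reaches V D" if "openin T V" "V \<noteq> {}" for V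
    using covers_piece[OF r p that] unfolding reaches_def .
  have two: "\<exists>D\<in>pieces p. reaches U D \<and> reaches V D"
    if "openin T U" "U \<noteq> {}" "openin T V" "V \<noteq> {}" for U V
  proof -
    have "\<exists>k. (\<sigma> ^^ k) ` U \<inter> V \<noteq> {}" by (rule transitive[OF that])
    then obtain k where k: "(\<sigma> ^^ k) ` U \<inter> V \<noteq> {}" ..
    have "openin T ((\<sigma> ^^ k) ` U \<inter> V)" using openin_funpow[OF that(1)] that(3) by (rule openin_Int)
    from cov[OF this k] obtain D where D: "D \<in> pieces p" "reaches ((\<sigma> ^^ k) ` U \<inter> V) D" by auto
    have "reaches U ((\<sigma> ^^ k) ` U \<inter> V)" unfolding reaches_def by blast
    moreover have "reaches V ((\<sigma> ^^ k) ` U \<inter> V)" unfolding reaches_def by (intro exI[of _ 0]) auto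
    ultimately show ?thesis using D reaches_trans by blast
  qed
  have pc: "openin T D" "D \<noteq> {}" if "D \<in> pieces p" for D using pmonoD(5,8)[OF pm that] by auto
  have "\<exists>D\<in>pieces p. \<forall>E\<in>F. reaches E D" if "finite F" "F \<subseteq> pieces p" for F
    using that
  proof (induction F rule: finite_induct)
    case empty
    have "openin T X" by simp
    then show ?case using cov nonempty by blast
  next
    case (insert E F)
    then obtain D where D: "D \<in> pieces p" "\<forall>E\<in>F. reaches E D" by auto
    obtain D' where D': "D' \<in> pieces p" "reaches E D'" "reaches D D'"
      using two[of E D] pc D insert.prems by auto
    then show ?case using D reaches_trans by blast
  qed
  then obtain D where D: "D \<in> pieces p" "\<forall>E\<in>pieces p. reaches E D" using pmonoD(2)[OF pm] by blast
  have "reaches V D" if "openin T V" "V \<noteq> {}" for V using cov[OF that] D(2) reaches_trans by blast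
  then show ?thesis using pc[OF D(1)] by blast
qed

lemma exact_cyclic_partition_exists: "\<exists>N Y. exact_cyclic_partition T \<sigma> N Y"
proof -
  obtain D where D: "openin T D" "D \<noteq> {}" "\<And>V. openin T V \<Longrightarrow> V \<noteq> {} \<Longrightarrow> reaches V D"
    using common_core by blast
  define P where "P = {t. D \<subseteq> (\<sigma> ^^ t) ` D}"
  have P_add: "t + u \<in> P" if "t \<in> P" "u \<in> P" for t u
    using that unfolding P_def by (simp add: funpow_image_add) blast
  \<comment> \<open>Starting from the image of \<open>D\<close> instead of \<open>D\<close>
    guarantees a positive return time.\<close>
  have "openin T (\<sigma> ` D)" using open_image[OF pmono D(1)] .
  then obtain t0 where "D \<subseteq> (\<sigma> ^^ t0) ` \<sigma> ` D" using D(3)[of "\<sigma> ` D"] D(2) by (auto simp: reaches_def)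
  then have "D \<subseteq> (\<sigma> ^^ (t0 + 1)) ` D" unfolding funpow_image_add by (simp add: image_comp o_def)
  then have t0: "t0 + 1 \<in> P" unfolding P_def by blast
  obtain N L where N: "N \<ge> 1" "\<And>t. t \<in> P \<Longrightarrow> N dvd t" "\<And>l. l \<ge> L \<Longrightarrow> l * N \<in> P"
    using semigroup_period[of P, OF P_add t0] by auto
  define Z where "Z j = (\<Union>k\<in>{k. k mod N = j mod N}. (\<sigma> ^^ k) ` D)" for j
  have Z_cong: "Z j = Z k" if "j mod N = k mod N" for j k using that by (simp add: Z_def)
  have in_Z: "(\<sigma> ^^ k) ` D \<subseteq> Z k" for k unfolding Z_def by blast
  have Z_open: "openin T (Z j)" for j unfolding Z_def using openin_funpow[OF D(1)] by auto
  have Z_ne: "Z j \<noteq> {}" for j using in_Z[of j] D(2) by auto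
  \<comment> \<open>An overlap of the images of \<open>D\<close> at times \<open>j'\<close> and
    \<open>k'\<close> covers \<open>D\<close> again after some \<open>t\<close> steps. Then
    \<open>t + j'\<close> and \<open>t + k'\<close> are both return times, and \<open>N\<close>
    divides their difference.\<close>
  have Z_disj: "j mod N = k mod N" if "Z j \<inter> Z k \<noteq> {}" for j k
  proof -
    have "\<exists>x. x \<in> Z j \<and> x \<in> Z k" using that by auto
    then obtain x where x: "x \<in> Z j" "x \<in> Z k" by auto
    obtain j' where j': "j' mod N = j mod N" "x \<in> (\<sigma> ^^ j') ` D" using x(1) unfolding Z_def by auto
    obtain k' where k': "k' mod N = k mod N" "x \<in> (\<sigma> ^^ k') ` D" using x(2) unfolding Z_def by auto
    note jk = j'(1) k'(1)
    let ?O = "(\<sigma> ^^ j') ` D \<inter> (\<sigma> ^^ k') ` D"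
    have "openin T ?O" using openin_funpow[OF D(1)] openin_funpow[OF D(1)] by (rule openin_Int)
    moreover have "?O \<noteq> {}" using j'(2) k'(2) by blast
    ultimately have "reaches ?O D" by (rule D(3))
    then obtain t where t: "D \<subseteq> (\<sigma> ^^ t) ` ?O" unfolding reaches_def by auto
    have "(\<sigma> ^^ t) ` ?O \<subseteq> (\<sigma> ^^ (t + j')) ` D" "(\<sigma> ^^ t) ` ?O \<subseteq> (\<sigma> ^^ (t + k')) ` D"
      unfolding funpow_image_add by (intro image_mono; blast)+
    then have "D \<subseteq> (\<sigma> ^^ (t + j')) ` D" "D \<subseteq> (\<sigma> ^^ (t + k')) ` D"
      using t subset_trans by metis+
    then have "t + j' \<in> P" "t + k' \<in> P" unfolding P_def by auto
    then have "N dvd t + j'" "N dvd t + k'" using N(2) by auto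
    then have "int N dvd int (t + j') - int (t + k')"
      unfolding int_dvd_int_iff[symmetric] by (rule dvd_diff)
    then have "int j' mod int N = int k' mod int N" by (simp add: mod_eq_dvd_iff)
    then have "j' mod N = k' mod N" by (metis nat_int zmod_int)
    then show ?thesis using jk by simp
  qed
  have Z_cover: "x \<in> X \<Longrightarrow> \<exists>k. x \<in> Z k" for x
    using forward_orbit_eq_X[OF D(1,2)] in_Z unfolding forward_orbit_def by blast
  have Z_X: "Z j \<subseteq> X" for j using openin_subset[OF Z_open] .

  have Z_step: "\<sigma> ` Z j = Z (j + 1)" for j
  proof
    show "\<sigma> ` Z j \<subseteq> Z (j + 1)"
    proof
      fix y assume "y \<in> \<sigma> ` Z j"
      then obtain k d where k: "k mod N = j mod N" "d \<in> D" "y = \<sigma> ((\<sigma> ^^ k) d)" unfolding Z_def by auto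
      then have "y \<in> (\<sigma> ^^ Suc k) ` D" by auto
      then have "y \<in> Z (Suc k)" using in_Z by blast
      moreover have "Suc k mod N = (j + 1) mod N" using k(1) by (metis Suc_eq_plus1 mod_add_left_eq)
      ultimately show "y \<in> Z (j + 1)" using Z_cong by blast
    qed
    show "Z (j + 1) \<subseteq> \<sigma> ` Z j"
    proof
      fix y assume "y \<in> Z (j + 1)"
      then obtain k d where k: "k mod N = (j + 1) mod N" "d \<in> D" "y = (\<sigma> ^^ k) d" unfolding Z_def by auto
      \<comment> \<open>The point of \<open>D\<close> is replaced by an earlier one, a return time
        before. This leaves the residue unchanged and makes the total time positive, so that a last
        application of \<open>\<sigma>\<close> can be split off.\<close>
      have "D \<subseteq> (\<sigma> ^^ Suc t0) ` D" using t0 by (simp add: P_def)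
      then obtain d' where d': "d' \<in> D" "d = (\<sigma> ^^ Suc t0) d'" using k(2) by blast
      have "y = (\<sigma> ^^ (k + Suc t0)) d'" using k(3) d'(2) by (simp only: funpow_add o_apply)
      then have y: "y = \<sigma> ((\<sigma> ^^ (k + t0)) d')" by simp
      have "N dvd Suc t0" using N(2)[OF t0] by simp
      then have "(k + Suc t0) mod N = (j + 1) mod N" using k(1) by (metis mod_add_right_eq dvd_eq_mod_eq_0 add.right_neutral)
      then have "int (k + t0 + 1) mod int N = int (j + 1) mod int N" by (metis Suc_eq_plus1 add_Suc_right zmod_int)
      then have "int N dvd int (k + t0) - int j" by (simp add: mod_eq_dvd_iff)
      then have "int (k + t0) mod int N = int j mod int N" by (simp add: mod_eq_dvd_iff)
      then have "(k + t0) mod N = j mod N" by (metis nat_int zmod_int)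
      then have "(\<sigma> ^^ (k + t0)) d' \<in> Z j" using in_Z[of "k + t0"] Z_cong d'(1) by blast
      then show "y \<in> \<sigma> ` Z j" using y by blast
    qed
  qed
  have Z_steps: "(\<sigma> ^^ k) ` Z j = Z (j + k)" for j k
  proof (induction k)
    case (Suc k)
    have "(\<sigma> ^^ Suc k) ` Z j = \<sigma> ` ((\<sigma> ^^ k) ` Z j)" by (simp add: image_comp)
    then show ?case using Suc Z_step by simp
  qed simp
  have Z_closed: "closedin T (Z j)" for j
  proof -
    have "X - Z j = (\<Union>k\<in>{k. k mod N \<noteq> j mod N}. Z k)"
    proof
      show "X - Z j \<subseteq> (\<Union>k\<in>{k. k mod N \<noteq> j mod N}. Z k)"
      proof
        fix x assume x: "x \<in> X - Z j"
        then obtain k where k: "x \<in> Z k" using Z_cover by blast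
        then have "k mod N \<noteq> j mod N" using x Z_cong by blast
        then show "x \<in> (\<Union>k\<in>{k. k mod N \<noteq> j mod N}. Z k)" using k by blast
      qed
      show "(\<Union>k\<in>{k. k mod N \<noteq> j mod N}. Z k) \<subseteq> X - Z j" using Z_disj Z_X by blast
    qed
    moreover have "openin T (\<Union>k\<in>{k. k mod N \<noteq> j mod N}. Z k)" using Z_open by auto
    ultimately show ?thesis using Z_X by (simp add: closedin_def)
  qed
  obtain m where m: "(\<Union>k\<le>m. (\<sigma> ^^ k) ` D) = X" using strongly_transitive[OF D(1,2)] by blast
  have exact: "\<exists>k. ((\<sigma> ^^ N) ^^ k) ` V = Z i" if V: "openin T V" "V \<noteq> {}" "V \<subseteq> Z i" for V i
  proof -
    obtain t where t: "D \<subseteq> (\<sigma> ^^ t) ` V" using D(3)[OF V(1,2)] by (auto simp: reaches_def)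
    \<comment> \<open>A point of \<open>Z 0\<close> lies in an image of \<open>D\<close> at a time
      \<open>N * k'\<close> with \<open>k' \<le> m\<close>. What remains of
      \<open>(L + m) * N\<close> is a multiple of \<open>N\<close> large enough to be a return
      time.\<close>
    define K where "K = (L + m) * N + t"
    have "Z 0 \<subseteq> (\<sigma> ^^ K) ` V"
    proof
      fix x assume x: "x \<in> Z 0"
      then have "x \<in> X" using Z_X[of 0] by auto
      then have "x \<in> (\<Union>k\<le>m. (\<sigma> ^^ k) ` D)" using m by simp
      then obtain k where k: "k \<le> m" "x \<in> (\<sigma> ^^ k) ` D" by auto
      then have "Z 0 \<inter> Z k \<noteq> {}" using in_Z[of k] x by blast
      then have "N dvd k" using Z_disj[of 0 k] by (simp add: dvd_eq_mod_eq_0)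
      then obtain k' where k': "k = N * k'" by auto
      have "k' \<le> m" using k(1) k' N(1) by (metis le_trans mult_le_mono1 nat_mult_1)
      then have "(L + m - k') * N \<in> P" using N(3) by simp
      then have "D \<subseteq> (\<sigma> ^^ ((L + m - k') * N)) ` D" by (simp add: P_def)
      then have "D \<subseteq> (\<sigma> ^^ ((L + m - k') * N)) ` (\<sigma> ^^ t) ` V"
        using image_mono[OF t] by (rule subset_trans)
      then have "x \<in> (\<sigma> ^^ k) ` (\<sigma> ^^ ((L + m - k') * N)) ` (\<sigma> ^^ t) ` V"
        using k(2) image_mono subsetD by metis
      then have "x \<in> (\<sigma> ^^ (k + ((L + m - k') * N + t))) ` V" by (simp add: funpow_image_add)
      moreover have "k + ((L + m - k') * N + t) = K"
      proof -
        define l where "l = L + m - k'"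
        have "L + m = l + k'" using \<open>k' \<le> m\<close> by (simp add: l_def)
        then show ?thesis unfolding K_def k' l_def[symmetric] by (simp add: algebra_simps)
      qed
      ultimately show "x \<in> (\<sigma> ^^ K) ` V" by simp
    qed
    moreover have sub: "(\<sigma> ^^ K) ` V \<subseteq> Z (i + K)" using V(3) Z_steps[of K i] by blast
    ultimately have "Z 0 \<inter> Z (i + K) \<noteq> {}" using Z_ne[of 0] by blast
    then have dvd: "N dvd i + K" using Z_disj[of 0 "i + K"] by (simp add: dvd_eq_mod_eq_0)
    then have "Z (i + K) = Z 0" by (intro Z_cong) (simp add: dvd_eq_mod_eq_0)
    then have eq: "(\<sigma> ^^ K) ` V = Z 0" using sub \<open>Z 0 \<subseteq> (\<sigma> ^^ K) ` V\<close> by blast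
    obtain k where k: "i + K = N * k" using dvd by auto
    have "((\<sigma> ^^ N) ^^ k) ` V = (\<sigma> ^^ (i + K)) ` V" using k by (simp add: funpow_mult mult.commute)
    also have "\<dots> = (\<sigma> ^^ i) ` Z 0" using eq by (simp add: funpow_image_add)
    also have "\<dots> = Z i" using Z_steps by simp
    finally show ?thesis by blast
  qed
  have "exact_cyclic_partition T \<sigma> N Z"
    unfolding exact_cyclic_partition_def
  proof (intro conjI ballI)
    show "1 \<le> N" by (rule N(1))
    fix i assume i: "i \<in> {1..N}"
    show "Z i \<noteq> {}" "openin T (Z i)" "closedin T (Z i)" by (rule Z_ne Z_open Z_closed)+
    have "Z (i + 1) = Z (i mod N + 1)" by (rule Z_cong) (simp add: mod_simps)
    then show "\<sigma> ` Z i = Z (i mod N + 1)" using Z_step by simp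
    have "Z (i + N) = Z i" by (rule Z_cong) simp
    then have inv: "(\<sigma> ^^ N) ` Z i \<subseteq> Z i" using Z_steps[of N i] by simp
    show "topologically_exact (subtopology T (Z i)) (\<sigma> ^^ N)"
      unfolding topologically_exact_def
    proof (intro conjI allI impI)
      show "continuous_map (subtopology T (Z i)) (subtopology T (Z i)) (\<sigma> ^^ N)"
        using continuous_funpow[of N] inv
        by (auto simp: continuous_map_in_subtopology continuous_map_from_subtopology)
      fix V assume V: "openin (subtopology T (Z i)) V \<and> V \<noteq> {}"
      then have "openin T V" "V \<subseteq> Z i" using Z_open[of i] openin_open_subtopology by blast+
      then show "\<exists>k. ((\<sigma> ^^ N) ^^ k) ` V = topspace (subtopology T (Z i))"
        using exact V Z_X[of i] by (simp add: Int_absorb1)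
    qed
  next
    show "disjoint_family_on Z {1..N}" unfolding disjoint_family_on_def
    proof (intro ballI impI)
      fix i j assume ij: "i \<in> {1..N}" "j \<in> {1..N}" "i \<noteq> j"
      have "i mod N \<noteq> j mod N"
      proof
        assume "i mod N = j mod N"
        moreover have "k mod N = (if k = N then 0 else k)" if "k \<in> {1..N}" for k using that by auto
        ultimately show False using ij by (auto split: if_splits)
      qed
      then show "Z i \<inter> Z j = {}" using Z_disj by blast
    qed
    show "(\<Union>i\<in>{1..N}. Z i) = X"
    proof
      show "(\<Union>i\<in>{1..N}. Z i) \<subseteq> X" using Z_X by blast
      show "X \<subseteq> (\<Union>i\<in>{1..N}. Z i)"
      proof
        fix x assume "x \<in> X"
        then obtain k where k: "x \<in> Z k" using Z_cover by blast
        show "x \<in> (\<Union>i\<in>{1..N}. Z i)"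
        \<comment> \<open>The residue 0 is represented by the index \<open>N\<close>.\<close>
        proof (cases "k mod N = 0")
          case True
          then have "Z k = Z N" by (intro Z_cong) simp
          then show ?thesis using k N(1) by (intro UN_I[of N]) auto
        next
          case False
          have "Z k = Z (k mod N)" by (intro Z_cong) simp
          moreover have "k mod N \<in> {1..N}" using False N(1) by (simp add: Suc_le_eq less_imp_le)
          ultimately show ?thesis using k by blast
        qed
      qed
    qed
  qed
  then show ?thesis by blast
qed

end

section \<open>Uniqueness of the exact cyclic partition\<close>

lemma cyclic_partition_funpow:
  assumes "exact_cyclic_partition T \<sigma> N Y" "i \<in> {1..N}"
  shows "(\<sigma> ^^ (N * k)) ` Y i = Y i"
proof -
  have N: "N \<ge> 1" and step: "\<And>j. j \<in> {1..N} \<Longrightarrow> \<sigma> ` Y j = Y (j mod N + 1)"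
    using assms(1) by (auto simp: exact_cyclic_partition_def)
  have "(\<sigma> ^^ l) ` Y i = Y ((i - 1 + l) mod N + 1)" for l
  proof (induction l)
    case 0
    have "i - 1 < N" using assms(2) N by auto
    then have "(i - 1 + 0) mod N + 1 = i" using assms(2) by simp
    then show ?case by simp
  next
    case (Suc l)
    have "(i - 1 + l) mod N + 1 \<in> {1..N}" using N by (simp add: Suc_le_eq)
    have "(\<sigma> ^^ Suc l) ` Y i = \<sigma> ` ((\<sigma> ^^ l) ` Y i)" by (simp add: image_comp)
    also have "\<dots> = Y (((i - 1 + l) mod N + 1) mod N + 1)"
      unfolding Suc by (rule step) fact
    also have "((i - 1 + l) mod N + 1) mod N = (i - 1 + Suc l) mod N" by (simp add: mod_simps)
    finally show ?case .
  qed
  from this[of "N * k"] have "(\<sigma> ^^ (N * k)) ` Y i = Y ((i - 1) mod N + 1)" by simp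
  moreover have "(i - 1) mod N + 1 = i"
  proof -
    have "i - 1 < N" using assms(2) N by auto
    then show ?thesis using assms(2) by simp
  qed
  ultimately show ?thesis by simp
qed

text \<open>As the \<open>N\<close>-th iterate maps \<open>Y i\<close> onto itself, a set that has
  once covered \<open>Y i\<close> covers it at all later multiples of \<open>N\<close>. This allows
  comparison with another partition at a common time.\<close>

lemma exact_cyclic_partition_exactD:
  assumes ecp: "exact_cyclic_partition T \<sigma> N Y" and i: "i \<in> {1..N}"
    and V: "openin T V" "V \<noteq> {}" "V \<subseteq> Y i"
  shows "\<exists>K. \<forall>k\<ge>K. (\<sigma> ^^ (N * k)) ` V = Y i"
proof -
  have Y: "openin T (Y i)" and ex: "topologically_exact (subtopology T (Y i)) (\<sigma> ^^ N)"
    using ecp i by (auto simp: exact_cyclic_partition_def)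
  have "openin (subtopology T (Y i)) V" using V Y openin_open_subtopology by blast
  then obtain K where "((\<sigma> ^^ N) ^^ K) ` V = topspace (subtopology T (Y i))"
    using ex V(2) unfolding topologically_exact_def by blast
  then have K: "(\<sigma> ^^ (N * K)) ` V = Y i"
    using openin_subset[OF Y] by (simp add: funpow_mult Int_absorb1 mult.commute)
  have "(\<sigma> ^^ (N * k)) ` V = Y i" if "k \<ge> K" for k
  proof -
    have "N * k = N * (k - K) + N * K" using that by (simp add: diff_mult_distrib2)
    then have "(\<sigma> ^^ (N * k)) ` V = (\<sigma> ^^ (N * (k - K))) ` (\<sigma> ^^ (N * K)) ` V"
      by (simp add: funpow_add image_comp)
    then show ?thesis using K cyclic_partition_funpow[OF ecp i] by simp
  qed
  then show ?thesis by blast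
qed

text \<open>Two members that meet share a non-empty open set; at the time
  \<open>N * M * (K + L)\<close> its image is equal to both of them.\<close>

lemma exact_cyclic_partition_member:
  assumes Y: "exact_cyclic_partition T \<sigma> N Y" and Z: "exact_cyclic_partition T \<sigma> M Z"
  shows "Y ` {1..N} \<subseteq> Z ` {1..M}"
proof
  fix A assume "A \<in> Y ` {1..N}"
  then obtain i where i: "i \<in> {1..N}" "A = Y i" by auto
  have Yi: "openin T (Y i)" "Y i \<noteq> {}" using Y i by (auto simp: exact_cyclic_partition_def)
  then have "Y i \<subseteq> (\<Union>j\<in>{1..M}. Z j)"
    using openin_subset[OF Yi(1)] Z by (auto simp: exact_cyclic_partition_def)
  then obtain j where j: "j \<in> {1..M}" "Y i \<inter> Z j \<noteq> {}" using Yi(2) by blast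
  have "openin T (Z j)" using Z j by (auto simp: exact_cyclic_partition_def)
  then have o: "openin T (Y i \<inter> Z j)" using Yi by auto
  obtain K where K: "\<And>k. k \<ge> K \<Longrightarrow> (\<sigma> ^^ (N * k)) ` (Y i \<inter> Z j) = Y i"
    using exact_cyclic_partition_exactD[OF Y i(1) o j(2)] by auto
  obtain L where L: "\<And>k. k \<ge> L \<Longrightarrow> (\<sigma> ^^ (M * k)) ` (Y i \<inter> Z j) = Z j"
    using exact_cyclic_partition_exactD[OF Z j(1) o j(2)] by auto
  have "N \<ge> 1" "M \<ge> 1" using Y Z by (auto simp: exact_cyclic_partition_def)
  then have "M * (K + L) \<ge> K" "N * (K + L) \<ge> L"
    by (metis add_leD1 le_trans mult_le_mono1 nat_mult_1, metis add_leD2 le_trans mult_le_mono1 nat_mult_1)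
  then have "Y i = Z j" using K[of "M * (K + L)"] L[of "N * (K + L)"]
    by (simp add: mult.assoc[symmetric] mult.commute[of N M])
  then show "A \<in> Z ` {1..M}" using i j by auto
qed

lemma (in expanding_system) ex1_exact_cyclic_partition:
  "\<exists>!P. \<exists>N Y. exact_cyclic_partition T \<sigma> N Y \<and> P = Y ` {1..N}"
proof -
  obtain N Y where Y: "exact_cyclic_partition T \<sigma> N Y" using exact_cyclic_partition_exists by blast
  show ?thesis
  proof (rule ex1I[of _ "Y ` {1..N}"])
    show "\<exists>M Z. exact_cyclic_partition T \<sigma> M Z \<and> Y ` {1..N} = Z ` {1..M}" using Y by blast
    fix P assume "\<exists>M Z. exact_cyclic_partition T \<sigma> M Z \<and> P = Z ` {1..M}"
    then show "P = Y ` {1..N}"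
      using exact_cyclic_partition_member[OF Y] exact_cyclic_partition_member[OF _ Y] by blast
  qed
qed

section \<open>Transfer operators and variation\<close>

text \<open>The contribution of one inverse branch to the transfer operator.\<close>

definition lift_piece :: "('a \<Rightarrow> 'a) \<Rightarrow> 'a set \<Rightarrow> ('a \<Rightarrow> real) \<Rightarrow> 'a \<Rightarrow> real" where
  "lift_piece g C f x = (if x \<in> g ` C then f (inv_into C g x) else 0)"

lemma lift_piece_image: "inj_on g C \<Longrightarrow> y \<in> C \<Longrightarrow> lift_piece g C f (g y) = f y"
  by (simp add: lift_piece_def)

context ordered_compact
begin

abbreviation cont :: "('a \<Rightarrow> real) \<Rightarrow> bool" where
  "cont f \<equiv> continuous_map T euclideanreal f"

lemma transfer_eq_sum_pieces:
  assumes g: "pmono g \<J>"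
  shows "transfer T g f x = (\<Sum>C\<in>\<J>. lift_piece g C f x)"
proof -
  have "{y \<in> X. g y = x} = (\<Union>C\<in>\<J>. {y \<in> C. g y = x})"
    unfolding pmonoD(4)[OF g, symmetric] by auto
  then have "transfer T g f x = (\<Sum>y\<in>(\<Union>C\<in>\<J>. {y \<in> C. g y = x}). f y)"
    by (simp add: transfer_def)
  also have "\<dots> = (\<Sum>C\<in>\<J>. \<Sum>y\<in>{y \<in> C. g y = x}. f y)"
  proof (rule sum.UNION_disjoint)
    show "finite \<J>" using pmonoD(2)[OF g] .
    show "\<forall>C\<in>\<J>. finite {y \<in> C. g y = x}"
    proof
      fix C assume "C \<in> \<J>"
      then have "{y \<in> C. g y = x} \<subseteq> {y \<in> X. g y = x}" using pmonoD(13)[OF g] by blast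
      then show "finite {y \<in> C. g y = x}" using pmono_fibre_finite[OF g] finite_subset by blast
    qed
    show "\<forall>C\<in>\<J>. \<forall>D\<in>\<J>. C \<noteq> D \<longrightarrow> {y \<in> C. g y = x} \<inter> {y \<in> D. g y = x} = {}"
      using pmonoD(3)[OF g] unfolding disjoint_def by blast
  qed
  also have "\<dots> = (\<Sum>C\<in>\<J>. lift_piece g C f x)"
  proof (rule sum.cong[OF refl])
    fix C assume C: "C \<in> \<J>"
    have inj: "inj_on g C" using pmonoD(7)[OF g C] .
    show "(\<Sum>y\<in>{y \<in> C. g y = x}. f y) = lift_piece g C f x"
    proof (cases "x \<in> g ` C")
      case True
      then obtain z where z: "z \<in> C" "x = g z" by auto
      then have "{y \<in> C. g y = x} = {z}" using inj by (auto simp: inj_on_def)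
      then show ?thesis using z lift_piece_image[OF inj] by simp
    next
      case False
      then have "{y \<in> C. g y = x} = {}" by auto
      then show ?thesis using False by (simp only: lift_piece_def sum.empty if_False)
    qed
  qed
  finally show ?thesis .
qed

lemma transfer_comp:
  assumes g: "pmono g \<J>" and h: "pmono h \<K>"
  shows "transfer T (h \<circ> g) f x = transfer T h (transfer T g f) x"
proof -
  let ?S = "{y \<in> X. (h \<circ> g) y = x}" and ?R = "{z \<in> X. h z = x}"
  have fS: "finite ?S" using pmono_fibre_finite[OF pmono_comp[OF g h]] .
  have fR: "finite ?R" using pmono_fibre_finite[OF h] .
  have "g ` ?S \<subseteq> ?R" using pmonoD(14)[OF g] by auto
  from sum.group[OF fS fR this, of f]
  have "sum f ?S = (\<Sum>z\<in>?R. \<Sum>y\<in>{y \<in> ?S. g y = z}. f y)" by simp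
  also have "\<dots> = (\<Sum>z\<in>?R. \<Sum>y\<in>{y \<in> X. g y = z}. f y)"
  proof (rule sum.cong[OF refl])
    fix z assume "z \<in> ?R"
    then have "{y \<in> ?S. g y = z} = {y \<in> X. g y = z}" by auto
    then show "(\<Sum>y\<in>{y \<in> ?S. g y = z}. f y) = (\<Sum>y\<in>{y \<in> X. g y = z}. f y)" by simp
  qed
  finally show ?thesis by (simp add: transfer_def)
qed

lemma transfer_cong: "(\<And>y. y \<in> X \<Longrightarrow> f y = f' y) \<Longrightarrow> transfer T g f x = transfer T g f' x"
  by (simp add: transfer_def)

text \<open>The image of a piece is clopen, so extending by 0 creates no discontinuity.\<close>

lemma cont_lift_piece:
  assumes g: "pmono g \<J>" and C: "C \<in> \<J>" and f: "cont f"
  shows "cont (lift_piece g C f)"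
  unfolding continuous_map_def
proof (intro conjI allI impI)
  show "lift_piece g C f \<in> X \<rightarrow> topspace euclideanreal" by simp
  fix U :: "real set" assume U: "openin euclideanreal U"
  have inj: "inj_on g C" using pmonoD(7)[OF g C] .
  have CX: "C \<subseteq> X" using pmonoD(13)[OF g C] .
  have "openin T {y \<in> X. f y \<in> U}" using f U by (simp add: continuous_map_def)
  then have "openin T (g ` (C \<inter> {y \<in> X. f y \<in> U}))" using pmonoD(8)[OF g C] open_image[OF g] by blast
  moreover have "openin T (if 0 \<in> U then X - g ` C else {})"
    using closed_image[OF pmonoD(1)[OF g] pmonoD(9)[OF g C]] by auto
  ultimately have "openin T (g ` (C \<inter> {y \<in> X. f y \<in> U}) \<union> (if 0 \<in> U then X - g ` C else {}))"
    by (rule openin_Un)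
  also have "g ` (C \<inter> {y \<in> X. f y \<in> U}) \<union> (if 0 \<in> U then X - g ` C else {}) = {x \<in> X. lift_piece g C f x \<in> U}"
  proof (rule set_eqI)
    fix x
    have gX: "g ` C \<subseteq> X" using CX pmonoD(14)[OF g] by blast
    show "x \<in> g ` (C \<inter> {y \<in> X. f y \<in> U}) \<union> (if 0 \<in> U then X - g ` C else {}) \<longleftrightarrow>
      x \<in> {x \<in> X. lift_piece g C f x \<in> U}"
    proof (cases "x \<in> g ` C")
      case True
      then obtain z where z: "z \<in> C" "x = g z" by auto
      have "x \<in> g ` (C \<inter> {y \<in> X. f y \<in> U}) \<longleftrightarrow> f z \<in> U" using z inj CX by (auto simp: inj_on_def)
      then show ?thesis using True z lift_piece_image[OF inj] gX by auto
    next
      case False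
      then show ?thesis by (auto simp: lift_piece_def)
    qed
  qed
  finally show "openin T {x \<in> X. lift_piece g C f x \<in> U}" .
qed

lemma cont_transfer:
  assumes g: "pmono g \<J>" and f: "cont f" shows "cont (transfer T g f)"
proof -
  have "cont (\<lambda>x. \<Sum>C\<in>\<J>. lift_piece g C f x)"
    using cont_lift_piece[OF g _ f] pmonoD(2)[OF g] by (intro continuous_map_sum) auto
  moreover have "transfer T g f = (\<lambda>x. \<Sum>C\<in>\<J>. lift_piece g C f x)"
    using transfer_eq_sum_pieces[OF g] by auto
  ultimately show ?thesis by simp
qed

lemma cont_indicator: assumes "openin T A" "closedin T A" shows "cont (indicat_real A)"
  unfolding continuous_map_def
proof (intro conjI allI impI)
  fix U :: "real set"
  have "{x \<in> X. indicat_real A x \<in> U} = (if 1 \<in> U then A else {}) \<union> (if 0 \<in> U then X - A else {})"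
    using openin_subset[OF assms(1)] by (auto simp: indicator_def)
  then show "openin T {x \<in> X. indicat_real A x \<in> U}" using assms by auto
qed simp

lemma cont_bounded: assumes f: "cont f" shows "\<exists>B. \<forall>x\<in>X. \<bar>f x\<bar> \<le> B"
proof -
  have "compactin euclideanreal (f ` X)"
    using image_compactin[OF _ f] compact compact_space_def by blast
  then have "bounded (f ` X)" using compact_imp_bounded by auto
  then show ?thesis by (auto simp: bounded_iff)
qed

text \<open>Bounding the variation of \<open>f\<close> by the increments of a monotone \<open>w\<close> makes it additive over
  disjoint order-intervals.\<close>

definition dominated :: "('a \<Rightarrow> real) \<Rightarrow> ('a \<Rightarrow> real) \<Rightarrow> real \<Rightarrow> bool" where
  "dominated f w v \<longleftrightarrow> (\<forall>x\<in>X. \<forall>y\<in>X. x \<le> y \<longrightarrow> \<bar>f y - f x\<bar> \<le> w y - w x) \<and>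
     (\<forall>x\<in>X. \<forall>y\<in>X. w y - w x \<le> v)"

definition vdom :: "('a \<Rightarrow> real) \<Rightarrow> real \<Rightarrow> bool" where
  "vdom f v \<longleftrightarrow> (\<exists>w. dominated f w v)"

lemma vdomI:
  assumes "\<And>x y. x \<in> X \<Longrightarrow> y \<in> X \<Longrightarrow> x \<le> y \<Longrightarrow> \<bar>f y - f x\<bar> \<le> w y - w x"
    and "\<And>x y. x \<in> X \<Longrightarrow> y \<in> X \<Longrightarrow> w y - w x \<le> v"
  shows "vdom f v"
  unfolding vdom_def dominated_def using assms by (intro exI[of _ w]) auto

lemma dominatedD:
  assumes "dominated f w v"
  shows "x \<in> X \<Longrightarrow> y \<in> X \<Longrightarrow> x \<le> y \<Longrightarrow> \<bar>f y - f x\<bar> \<le> w y - w x"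
    and "x \<in> X \<Longrightarrow> y \<in> X \<Longrightarrow> w y - w x \<le> v"
  using assms unfolding dominated_def by auto

lemma vdom_le: "vdom f v \<Longrightarrow> v \<le> v' \<Longrightarrow> vdom f v'"
  unfolding vdom_def dominated_def by (meson order_trans)

lemma vdom_cong: "vdom f v \<Longrightarrow> (\<And>x. x \<in> X \<Longrightarrow> f x = g x) \<Longrightarrow> vdom g v"
  unfolding vdom_def dominated_def by auto

lemma vdom_dist: assumes "vdom f v" "x \<in> X" "y \<in> X" shows "\<bar>f y - f x\<bar> \<le> v"
proof -
  obtain w where "dominated f w v" using assms(1) by (auto simp: vdom_def)
  note w = dominatedD[OF this]
  show ?thesis
  proof (cases "x \<le> y")
    case True
    show ?thesis using w(1)[OF assms(2,3) True] w(2)[OF assms(2,3)] by linarith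
  next
    case False
    then have "y \<le> x" by simp
    then show ?thesis using w(1)[OF assms(3,2)] w(2)[OF assms(3,2)] by linarith
  qed
qed

lemma vdom_add:
  assumes "vdom f v" "vdom g u" shows "vdom (\<lambda>x. f x + g x) (v + u)"
proof -
  obtain w where "dominated f w v" using assms(1) by (auto simp: vdom_def)
  note w = dominatedD[OF this]
  obtain z where "dominated g z u" using assms(2) by (auto simp: vdom_def)
  note z = dominatedD[OF this]
  show ?thesis
  proof (rule vdomI[of _ "\<lambda>x. w x + z x"])
    show "\<bar>f y + g y - (f x + g x)\<bar> \<le> w y + z y - (w x + z x)" if "x \<in> X" "y \<in> X" "x \<le> y" for x y
      using w(1)[OF that] z(1)[OF that] by linarith
    show "w y + z y - (w x + z x) \<le> v + u" if "x \<in> X" "y \<in> X" for x y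
      using w(2)[OF that] z(2)[OF that] by linarith
  qed
qed

lemma vdom_cmult:
  assumes "vdom f v" shows "vdom (\<lambda>x. c * f x) (\<bar>c\<bar> * v)"
proof -
  obtain w where "dominated f w v" using assms(1) by (auto simp: vdom_def)
  note w = dominatedD[OF this]
  show ?thesis
  proof (rule vdomI[of _ "\<lambda>x. \<bar>c\<bar> * w x"])
    show "\<bar>c * f y - c * f x\<bar> \<le> \<bar>c\<bar> * w y - \<bar>c\<bar> * w x" if "x \<in> X" "y \<in> X" "x \<le> y" for x y
      using mult_left_mono[OF w(1)[OF that], of "\<bar>c\<bar>"]
      by (simp add: abs_mult[symmetric] right_diff_distrib)
    show "\<bar>c\<bar> * w y - \<bar>c\<bar> * w x \<le> \<bar>c\<bar> * v" if "x \<in> X" "y \<in> X" for x y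
      using mult_left_mono[OF w(2)[OF that], of "\<bar>c\<bar>"] by (simp add: right_diff_distrib)
  qed
qed

lemma vdom_pos_part: "vdom f v \<Longrightarrow> vdom (\<lambda>x. max 0 (f x)) v"
  unfolding vdom_def dominated_def by (smt (verit))

text \<open>By compactness, a clopen set is a finite union of open order-intervals, and passing
  between the set and its complement means entering or leaving one of them.\<close>

lemma vdom_indicator:
  assumes A: "openin T A" "closedin T A" shows "\<exists>v. vdom (indicat_real A) v"
proof -
  have "\<forall>p\<in>A. \<exists>M. openin T M \<and> order_convex X M \<and> p \<in> M \<and> M \<subseteq> A"
    using convex_nbhd[OF A(1)] by blast
  then obtain M where M: "\<And>p. p \<in> A \<Longrightarrow> openin T (M p)" "\<And>p. p \<in> A \<Longrightarrow> order_convex X (M p)"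
    "\<And>p. p \<in> A \<Longrightarrow> p \<in> M p" "\<And>p. p \<in> A \<Longrightarrow> M p \<subseteq> A" by metis
  have "compactin T A" using A closed_iff_compact by blast
  moreover have "\<forall>U\<in>M ` A. openin T U" "A \<subseteq> \<Union>(M ` A)" using M by auto
  ultimately obtain F where F: "finite F" "F \<subseteq> M ` A" "A \<subseteq> \<Union>F"
    unfolding compactin_def by meson
  \<comment> \<open>An interval \<open>B\<close> of the cover contributes 0, 1 or 2 according as
    \<open>x\<close> lies before, in or beyond it.\<close>
  define w where "w x = (\<Sum>B\<in>F. (if \<exists>u\<in>B. u \<le> x then 1 else 0) + (if \<forall>u\<in>B. u < x then 1 else (0::real)))" for x
  have conv: "order_convex X B" "B \<subseteq> A" if "B \<in> F" for B using F(2) M(2,4) that by blast+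
  have mono: "(if \<exists>u\<in>B. u \<le> x then 1 else 0) + (if \<forall>u\<in>B. u < x then 1 else (0::real))
      \<le> (if \<exists>u\<in>B. u \<le> y then 1 else 0) + (if \<forall>u\<in>B. u < y then 1 else (0::real))"
    if "x \<le> y" for x y :: 'a and B
  proof -
    have 1: "(\<exists>u\<in>B. u \<le> x) \<longrightarrow> (\<exists>u\<in>B. u \<le> y)" using order.trans[OF _ that] by auto
    have 2: "(\<forall>u\<in>B. u < x) \<longrightarrow> (\<forall>u\<in>B. u < y)" using less_le_trans[OF _ that] by auto
    have gen: "(if a then 1 else 0) + (if b then 1 else 0) \<le> (if a' then 1 else 0) + (if b' then 1 else (0::real))"
      if "a \<longrightarrow> a'" "b \<longrightarrow> b'" for a a' b b' using that by auto
    show ?thesis by (rule gen[OF 1 2])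
  qed
  have wmono: "w x \<le> w y" if "x \<le> y" for x y
    unfolding w_def by (rule sum_mono) (rule mono[OF that])
  have jump: "1 \<le> w y - w x" if xy: "x \<le> y" "x \<in> X" "y \<in> X" and d: "(x \<in> A) \<noteq> (y \<in> A)" for x y
  proof -
    obtain B where B: "B \<in> F" "(x \<in> B) \<noteq> (y \<in> B)" using d F(3) conv(2) by blast
    let ?h = "\<lambda>B x. (if \<exists>u\<in>B. u \<le> x then 1 else 0) + (if \<forall>u\<in>B. u < x then 1 else (0::real))"
    have "?h B x + 1 \<le> ?h B y"
    proof (cases "x \<in> B")
      case True
      then have "y \<notin> B" using B by simp
      then have "\<forall>u\<in>B. u < y"
        using order_convexD[OF conv(1)[OF B(1)] True _ xy(3,1)] by (meson not_le)
      moreover have "\<not> (\<forall>u\<in>B. u < x)" "\<exists>u\<in>B. u \<le> x" "\<exists>u\<in>B. u \<le> y" using True xy by auto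
      ultimately show ?thesis by simp
    next
      case False
      then have y: "y \<in> B" using B by simp
      then have n1: "\<not> (\<exists>u\<in>B. u \<le> x)"
        using order_convexD[OF conv(1)[OF B(1)] _ y xy(2) _ xy(1)] False by blast
      have n2: "\<not> (\<forall>u\<in>B. u < x)" using y xy by (meson not_le)
      have e: "\<exists>u\<in>B. u \<le> y" using y by auto
      have "?h B x = 0" by (simp only: n1 n2 if_False add_0_left)
      moreover have "?h B y \<ge> 1" unfolding if_P[OF e] by simp
      ultimately show ?thesis by linarith
    qed
    moreover have "(\<Sum>B\<in>F - {B}. ?h B x) \<le> (\<Sum>B\<in>F - {B}. ?h B y)"
      by (rule sum_mono) (rule mono[OF xy(1)])
    ultimately show ?thesis unfolding w_def using sum.remove[OF F(1) B(1)] by (smt (verit, best))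
  qed
  have "0 \<le> w x" "w x \<le> 2 * card F" for x
  proof -
    show "0 \<le> w x" unfolding w_def by (intro sum_nonneg) auto
    have "w x \<le> (\<Sum>B\<in>F. 2)" unfolding w_def by (intro sum_mono) auto
    then show "w x \<le> 2 * card F" by simp
  qed
  then have "w y - w x \<le> 2 * card F" for x y by (smt (verit))
  then have "vdom (indicat_real A) (2 * card F)"
  proof (rule vdomI[rotated])
    fix x y assume xy: "x \<in> X" "y \<in> X" "x \<le> y"
    show "\<bar>indicat_real A y - indicat_real A x\<bar> \<le> w y - w x"
      using jump[OF xy(3,1,2)] wmono[OF xy(3)] by (cases "x \<in> A"; cases "y \<in> A") auto
  qed
  then show ?thesis by blast
qed

text \<open>The majorant rises by \<open>M\<close> on entering the image, follows \<open>w\<close>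
  along the inverse branch (reversed if the branch decreases), and rises by \<open>M\<close> on
  leaving. The term \<open>2 * M\<close> is thus the price of extending by 0.\<close>

lemma piece_variation:
  assumes g: "mono_piece g up J" and lohi: "lo \<in> J" "hi \<in> J" "\<And>x. x \<in> J \<Longrightarrow> lo \<le> x \<and> x \<le> hi"
    and w: "\<And>x y. x \<in> J \<Longrightarrow> y \<in> J \<Longrightarrow> x \<le> y \<Longrightarrow> \<bar>f y - f x\<bar> \<le> w y - w x"
    and M: "\<And>x. x \<in> J \<Longrightarrow> \<bar>f x\<bar> \<le> M"
  shows "vdom (lift_piece g J f) (2 * M + (w hi - w lo))"
proof -
  define h where "h = inv_into J g"
  define osc where "osc = w hi - w lo"
  define part where "part x = (if up then w (h x) - w lo else w hi - w (h x))" for x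
  define w' where "w' x = (if x \<in> g ` J then M + part x else if \<exists>y\<in>g ` J. x < y then 0 else 2 * M + osc)" for x
  have inj: "inj_on g J" using mono_piece_inj[OF g] .
  have gJ: "order_convex X (g ` J)" using g by (simp add: mono_piece_def)
  have h: "h x \<in> J" "g (h x) = x" "lift_piece g J f x = f (h x)" if "x \<in> g ` J" for x
    using that by (auto simp: h_def lift_piece_def inv_into_into f_inv_into_f)
  have M0: "M \<ge> 0" using M[OF lohi(1)] by linarith
  have part: "0 \<le> part x" "part x \<le> osc" if x: "x \<in> g ` J" for x
  proof -
    have "w lo \<le> w (h x)" "w (h x) \<le> w hi"
      using w[OF lohi(1) h(1)[OF x]] w[OF h(1)[OF x] lohi(2)] lohi(3)[OF h(1)[OF x]] by auto
    then show "0 \<le> part x" "part x \<le> osc" by (auto simp: part_def osc_def)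
  qed
  have osc: "osc \<ge> 0" using w[OF lohi(1,2)] lohi(3)[OF lohi(2)] by (auto simp: osc_def)
  have out: "lift_piece g J f x = 0" if "x \<notin> g ` J" for x using that by (simp add: lift_piece_def)
  have bound: "0 \<le> w' x" "w' x \<le> 2 * M + osc" for x
    using M0 osc part[of x] by (auto simp: w'_def)
  have "vdom (lift_piece g J f) (2 * M + osc)"
  proof (rule vdomI[of _ w'])
    fix x y assume xy: "x \<in> X" "y \<in> X" "x \<le> y"
    consider "x \<in> g ` J" "y \<in> g ` J" | "x \<in> g ` J" "y \<notin> g ` J" | "x \<notin> g ` J" "y \<in> g ` J"
      | "x \<notin> g ` J" "y \<notin> g ` J" by blast
    then show "\<bar>lift_piece g J f y - lift_piece g J f x\<bar> \<le> w' y - w' x"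
    proof cases
      case 1
      have "if up then h x \<le> h y else h y \<le> h x"
        using mono_piece_le_iff[OF g h(1)[OF 1(1)] h(1)[OF 1(2)]] h(2)[OF 1(1)] h(2)[OF 1(2)] xy(3) by simp
      then have "\<bar>f (h y) - f (h x)\<bar> \<le> part y - part x"
        using w[OF h(1)[OF 1(1)] h(1)[OF 1(2)]] w[OF h(1)[OF 1(2)] h(1)[OF 1(1)]]
        unfolding part_def by (cases up) auto
      then show ?thesis using 1 h by (simp add: w'_def)
    next
      case 2
      have "\<not> (\<exists>z\<in>g ` J. y < z)"
        using order_convexD[OF gJ 2(1) _ xy(2,3)] 2(2) by (meson less_imp_le)
      then have "w' y = 2 * M + osc" using 2 by (simp add: w'_def)
      then show ?thesis using 2 part[OF 2(1)] M[OF h(1)[OF 2(1)]] h(3)[OF 2(1)] out[OF 2(2)]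
        by (simp add: w'_def)
    next
      case 3
      then have "x < y" using xy(3) by (metis le_imp_less_or_eq)
      then have "w' x = 0" using 3 by (auto simp: w'_def)
      then show ?thesis using 3 part[OF 3(2)] M[OF h(1)[OF 3(2)]] h(3)[OF 3(2)] out[OF 3(1)]
        by (simp add: w'_def)
    next
      case 4
      have "w' x \<le> w' y"
      proof (cases "\<exists>z\<in>g ` J. y < z")
        case True
        then have "\<exists>z\<in>g ` J. x < z" using xy(3) by (meson le_less_trans)
        then have "w' x = 0" using 4 by (simp add: w'_def)
        then show ?thesis using bound by simp
      next
        case False
        then have "w' y = 2 * M + osc" using 4 by (simp add: w'_def)
        then show ?thesis using bound by simp
      qed
      then show ?thesis using out 4 by simp
    qed
  next
    fix x y show "w' y - w' x \<le> 2 * M + osc" using bound(1)[of x] bound(2)[of y] by linarith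
  qed
  then show ?thesis by (simp add: osc_def)
qed

lemma vdom_sum:
  assumes "finite F" "\<And>i. i \<in> F \<Longrightarrow> vdom (f i) (v i)"
  shows "vdom (\<lambda>x. \<Sum>i\<in>F. f i x) (\<Sum>i\<in>F. v i)"
  using assms
proof (induction F rule: finite_induct)
  case empty
  show ?case by (rule vdomI[of _ "\<lambda>_. 0"]) auto
next
  case (insert i F)
  then show ?case using vdom_add[of "f i" "v i"] by simp
qed

text \<open>The bound on \<open>f\<close> is taken piece by piece, so that it can later be replaced
  by the local oscillation plus a local mean.\<close>

lemma vdom_transfer:
  assumes g: "pmono g \<J>"
    and lohi: "\<And>J. J \<in> \<J> \<Longrightarrow> lo J \<in> J \<and> hi J \<in> J \<and> (\<forall>x\<in>J. lo J \<le> x \<and> x \<le> hi J)"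
    and w: "\<And>x y. x \<in> X \<Longrightarrow> y \<in> X \<Longrightarrow> x \<le> y \<Longrightarrow> \<bar>f y - f x\<bar> \<le> w y - w x"
    and M: "\<And>J x. J \<in> \<J> \<Longrightarrow> x \<in> J \<Longrightarrow> \<bar>f x\<bar> \<le> M J"
  shows "vdom (transfer T g f) (\<Sum>J\<in>\<J>. 2 * M J + (w (hi J) - w (lo J)))"
proof -
  have "vdom (\<lambda>x. \<Sum>J\<in>\<J>. lift_piece g J f x) (\<Sum>J\<in>\<J>. 2 * M J + (w (hi J) - w (lo J)))"
  proof (rule vdom_sum[OF pmonoD(2)[OF g]])
    fix J assume J: "J \<in> \<J>"
    obtain up where up: "mono_piece g up J" using pmonoD(6)[OF g J] by blast
    have JX: "J \<subseteq> X" using pmonoD(13)[OF g J] .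
    show "vdom (lift_piece g J f) (2 * M J + (w (hi J) - w (lo J)))"
      by (rule piece_variation[OF up]) (use lohi[OF J] w JX M[OF J] in auto)
  qed
  then show ?thesis using transfer_eq_sum_pieces[OF g] by (auto intro: vdom_cong)
qed

text \<open>The induction adds the pieces in the order of their right ends: the new piece lies to
  the right of all others, whose increments fit below its left end.\<close>

lemma sum_osc_le:
  fixes w :: "'a \<Rightarrow> real"
  assumes "finite \<J>" "disjoint \<J>" "\<And>J. J \<in> \<J> \<Longrightarrow> order_convex X J"
    and lohi: "\<And>J. J \<in> \<J> \<Longrightarrow> lo J \<in> J \<and> hi J \<in> J \<and> (\<forall>x\<in>J. lo J \<le> x \<and> x \<le> hi J)"
    and w: "\<And>x y. x \<in> X \<Longrightarrow> y \<in> X \<Longrightarrow> x \<le> y \<Longrightarrow> w x \<le> w y"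
    and b: "b \<in> X" "m \<in> X" "m \<le> b" "\<And>J. J \<in> \<J> \<Longrightarrow> m \<le> lo J \<and> hi J \<le> b"
  shows "(\<Sum>J\<in>\<J>. w (hi J) - w (lo J)) \<le> w b - w m"
  using assms
proof (induction \<J> arbitrary: b rule: finite_ranking_induct[where f = hi])
  case empty
  then show ?case by simp
next
  case (insert J \<J>)
  show ?case
  proof (cases "J \<in> \<J>")
    case True
    then show ?thesis using insert by (simp add: insert_absorb)
  next
    case False
    have J: "lo J \<in> J" "hi J \<in> J" "lo J \<le> hi J" "m \<le> lo J" "hi J \<le> b" using insert.prems by auto
    have conv: "order_convex X J" using insert.prems by auto
    have JX: "lo J \<in> X" "hi J \<in> X" using order_convex_subset[OF conv] J by auto
    have "hi K \<le> lo J" if K: "K \<in> \<J>" for K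
    proof (rule ccontr)
      assume "\<not> hi K \<le> lo J"
      then have "lo J \<le> hi K" by simp
      moreover have "hi K \<le> hi J" using insert.hyps K by auto
      moreover have K': "hi K \<in> K" "order_convex X K" using insert.prems K by auto
      moreover have "hi K \<in> X" using K' order_convex_subset by blast
      ultimately have "hi K \<in> J" using order_convexD[OF conv J(1,2)] by blast
      moreover have "J \<inter> K = {}"
      proof -
        have "J \<noteq> K" using False K by auto
        then show ?thesis using insert.prems(1) K by (auto simp: disjoint_def)
      qed
      ultimately show False using K' by blast
    qed
    then have "(\<Sum>K\<in>\<J>. w (hi K) - w (lo K)) \<le> w (lo J) - w m"
      using insert.prems JX J by (intro insert.IH) (auto simp: disjoint_def pairwise_insert)
    moreover have "w (hi J) \<le> w b" using insert.prems JX J by auto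
    ultimately show ?thesis using insert.hyps False by simp
  qed
qed

lemma pmono_endpoints:
  assumes g: "pmono g \<J>"
  shows "\<exists>lo hi. \<forall>J\<in>\<J>. lo J \<in> J \<and> hi J \<in> J \<and> (\<forall>x\<in>J. lo J \<le> x \<and> x \<le> hi J)"
proof -
  have "\<forall>J\<in>\<J>. \<exists>l u. l \<in> J \<and> u \<in> J \<and> (\<forall>x\<in>J. l \<le> x \<and> x \<le> u)"
  proof
    fix J assume J: "J \<in> \<J>"
    obtain l where "l \<in> J" "\<forall>x\<in>J. l \<le> x" using closed_attains_min[OF pmonoD(9)[OF g J] pmonoD(5)[OF g J]] by blast
    moreover obtain u where "u \<in> J" "\<forall>x\<in>J. x \<le> u" using closed_attains_max[OF pmonoD(9)[OF g J] pmonoD(5)[OF g J]] by blast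
    ultimately show "\<exists>l u. l \<in> J \<and> u \<in> J \<and> (\<forall>x\<in>J. l \<le> x \<and> x \<le> u)" by blast
  qed
  then show ?thesis by metis
qed

lemma pmono_sum_osc_le:
  fixes w :: "'a \<Rightarrow> real"
  assumes g: "pmono g \<J>" and ne: "X \<noteq> {}"
    and lohi: "\<And>J. J \<in> \<J> \<Longrightarrow> lo J \<in> J \<and> hi J \<in> J \<and> (\<forall>x\<in>J. lo J \<le> x \<and> x \<le> hi J)"
    and w: "\<And>x y. x \<in> X \<Longrightarrow> y \<in> X \<Longrightarrow> x \<le> y \<Longrightarrow> \<bar>f y - f x\<bar> \<le> w y - w x"
    and v: "\<And>x y. x \<in> X \<Longrightarrow> y \<in> X \<Longrightarrow> w y - w x \<le> v"
  shows "(\<Sum>J\<in>\<J>. w (hi J) - w (lo J)) \<le> v"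
proof -
  have cX: "closedin T X" by simp
  obtain m where m: "m \<in> X" "\<And>x. x \<in> X \<Longrightarrow> m \<le> x" using closed_attains_min[OF cX ne] by blast
  obtain b where b: "b \<in> X" "\<And>x. x \<in> X \<Longrightarrow> x \<le> b" using closed_attains_max[OF cX ne] by blast
  have "(\<Sum>J\<in>\<J>. w (hi J) - w (lo J)) \<le> w b - w m"
  proof (rule sum_osc_le[OF pmonoD(2,3)[OF g]])
    show "w x \<le> w y" if "x \<in> X" "y \<in> X" "x \<le> y" for x y using w[OF that] by linarith
    show "m \<le> lo J \<and> hi J \<le> b" if "J \<in> \<J>" for J
      using lohi[OF that] pmonoD(13)[OF g that] m b by blast
    show "m \<le> b" using m b by blast
  qed (use pmonoD(10)[OF g] lohi m b in auto)
  then show ?thesis using v[OF m(1) b(1)] by linarith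
qed

end

section \<open>Scaled measures and the Lasota--Yorke inequality\<close>

locale scaled_system = expanding_system +
  fixes \<mu> :: "'a measure" and s :: real
  assumes prob: "prob_space \<mu>" and space: "space \<mu> = X"
    and sets: "sets \<mu> = sigma_sets X {U. openin T U}"
    and scaled: "scaled_by \<mu> \<sigma> s"
begin

sublocale prob_space \<mu> by (rule prob)

lemma measure_space_1 [simp]: "measure \<mu> (space \<mu>) = 1" by (rule prob_space)

lemma s_pos: "s > 0" using scaled by (simp add: scaled_by_def)

lemma open_in_sets: "openin T U \<Longrightarrow> U \<in> sets \<mu>"
  unfolding sets by (rule sigma_sets.Basic) simp

lemma cont_measurable: assumes "cont f" shows "f \<in> borel_measurable \<mu>"
proof (rule borel_measurableI)
  fix U :: "real set" assume "open U"
  then have "openin T {x \<in> X. f x \<in> U}" using assms by (simp add: continuous_map_def)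
  moreover have "f -` U \<inter> space \<mu> = {x \<in> X. f x \<in> U}" using space by auto
  ultimately show "f -` U \<inter> space \<mu> \<in> sets \<mu>" using open_in_sets by simp
qed

lemma cont_integrable: assumes "cont f" shows "integrable \<mu> f"
proof -
  obtain B where "\<forall>x\<in>X. \<bar>f x\<bar> \<le> B" using cont_bounded[OF assms] by auto
  then show ?thesis
    using cont_measurable[OF assms] space by (intro integrable_const_bound[of _ B]) auto
qed

lemma sigma_measurable: "\<sigma> \<in> measurable \<mu> \<mu>"
proof (rule measurable_sigma_sets[OF sets])
  show "{U. openin T U} \<subseteq> Pow X" using openin_subset by blast
  show "\<sigma> \<in> space \<mu> \<rightarrow> X" using space pmonoD(14)[OF pmono] by auto
  fix U assume "U \<in> {U. openin T U}"
  then have "openin T {x \<in> X. \<sigma> x \<in> U}" using pmonoD(1)[OF pmono] by (simp add: continuous_map_def)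
  moreover have "\<sigma> -` U \<inter> space \<mu> = {x \<in> X. \<sigma> x \<in> U}" using space by auto
  ultimately show "\<sigma> -` U \<inter> space \<mu> \<in> sets \<mu>" using open_in_sets by simp
qed

text \<open>Change of variables on one piece: scaling is applied to the part of \<open>C\<close>
  that is mapped into \<open>B\<close>, on which \<open>\<sigma>\<close> is injective.\<close>

lemma distr_piece:
  assumes C: "C \<in> \<C>"
  shows "distr (density \<mu> (\<lambda>x. ennreal (indicat_real C x))) \<mu> \<sigma>
    = density \<mu> (\<lambda>x. ennreal (indicat_real (\<sigma> ` C) x / s))"
proof (rule measure_eqI)
  show "sets (distr (density \<mu> (\<lambda>x. ennreal (indicat_real C x))) \<mu> \<sigma>)
    = sets (density \<mu> (\<lambda>x. ennreal (indicat_real (\<sigma> ` C) x / s)))" by simp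
  fix B assume "B \<in> sets (distr (density \<mu> (\<lambda>x. ennreal (indicat_real C x))) \<mu> \<sigma>)"
  then have B: "B \<in> sets \<mu>" by simp
  have Cm: "C \<in> sets \<mu>" "\<sigma> ` C \<in> sets \<mu>"
    using open_in_sets pmonoD(8,11)[OF pmono C] by blast+
  have pre: "\<sigma> -` B \<inter> space \<mu> \<in> sets \<mu>" using measurable_sets[OF sigma_measurable B] .
  have 1: "emeasure (density \<mu> (\<lambda>x. ennreal (indicat_real C x))) A = emeasure \<mu> (C \<inter> A)"
    if A: "A \<in> sets \<mu>" for A
  proof -
    have "emeasure (density \<mu> (\<lambda>x. ennreal (indicat_real C x))) A
      = (\<integral>\<^sup>+x. ennreal (indicat_real C x) * indicator A x \<partial>\<mu>)"
      using A Cm by (intro emeasure_density) auto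
    also have "\<dots> = (\<integral>\<^sup>+x. indicator (C \<inter> A) x \<partial>\<mu>)"
      by (intro nn_integral_cong) (auto simp: indicator_def)
    finally show ?thesis using A Cm by simp
  qed
  have "emeasure (distr (density \<mu> (\<lambda>x. ennreal (indicat_real C x))) \<mu> \<sigma>) B
    = emeasure (density \<mu> (\<lambda>x. ennreal (indicat_real C x))) (\<sigma> -` B \<inter> space \<mu>)"
    using sigma_measurable B by (subst emeasure_distr) auto
  also have "\<dots> = emeasure \<mu> (C \<inter> (\<sigma> -` B \<inter> space \<mu>))" using 1 pre by simp
  also have "\<dots> = ennreal (measure \<mu> (\<sigma> ` C \<inter> B) / s)"
  proof -
    let ?E = "C \<inter> (\<sigma> -` B \<inter> space \<mu>)"
    have E: "?E \<in> sets \<mu>" using Cm pre by blast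
    have "inj_on \<sigma> ?E" using pmonoD(7)[OF pmono C] by (rule inj_on_subset) auto
    then have "measure \<mu> (\<sigma> ` ?E) = s * measure \<mu> ?E" using scaled E by (auto simp: scaled_by_def)
    moreover have "\<sigma> ` ?E = \<sigma> ` C \<inter> B" using pmonoD(13)[OF pmono C] space by auto
    ultimately have "measure \<mu> ?E = measure \<mu> (\<sigma> ` C \<inter> B) / s" using s_pos by (simp add: field_simps)
    then show ?thesis by (simp add: emeasure_eq_measure)
  qed
  also have "\<dots> = emeasure (density \<mu> (\<lambda>x. ennreal (indicat_real (\<sigma> ` C) x / s))) B"
  proof -
    have "emeasure (density \<mu> (\<lambda>x. ennreal (indicat_real (\<sigma> ` C) x / s))) B
      = (\<integral>\<^sup>+x. ennreal (indicat_real (\<sigma> ` C) x / s) * indicator B x \<partial>\<mu>)"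
      using B Cm by (intro emeasure_density) auto
    also have "\<dots> = (\<integral>\<^sup>+x. ennreal (1 / s) * indicator (\<sigma> ` C \<inter> B) x \<partial>\<mu>)"
      by (intro nn_integral_cong) (auto simp: indicator_def)
    also have "\<dots> = ennreal (1 / s) * emeasure \<mu> (\<sigma> ` C \<inter> B)"
      using B Cm by (simp add: nn_integral_cmult_indicator)
    also have "\<dots> = ennreal (measure \<mu> (\<sigma> ` C \<inter> B) / s)"
      using s_pos by (simp add: emeasure_eq_measure ennreal_mult[symmetric])
    finally show ?thesis by simp
  qed
  finally show "emeasure (distr (density \<mu> (\<lambda>x. ennreal (indicat_real C x))) \<mu> \<sigma>) B
    = emeasure (density \<mu> (\<lambda>x. ennreal (indicat_real (\<sigma> ` C) x / s))) B" .
qed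

lemma integral_lift_piece:
  assumes C: "C \<in> \<C>" and f: "cont f"
  shows "(\<integral>x. lift_piece \<sigma> C f x \<partial>\<mu>) = s * (\<integral>x. indicat_real C x * f x \<partial>\<mu>)"
proof -
  have Cm: "C \<in> sets \<mu>" "\<sigma> ` C \<in> sets \<mu>"
    using open_in_sets pmonoD(8,11)[OF pmono C] by blast+
  have Fm: "lift_piece \<sigma> C f \<in> borel_measurable \<mu>"
    using cont_measurable cont_lift_piece[OF pmono C f] by blast
  let ?D = "density \<mu> (\<lambda>x. ennreal (indicat_real C x))"
  have "(\<integral>x. lift_piece \<sigma> C f x \<partial>\<mu>) = s * (\<integral>x. (indicat_real (\<sigma> ` C) x / s) *\<^sub>R lift_piece \<sigma> C f x \<partial>\<mu>)"
  proof -
    have "(\<integral>x. (indicat_real (\<sigma> ` C) x / s) *\<^sub>R lift_piece \<sigma> C f x \<partial>\<mu>) = (\<integral>x. lift_piece \<sigma> C f x / s \<partial>\<mu>)"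
      by (intro Bochner_Integration.integral_cong) (auto simp: lift_piece_def)
    then show ?thesis using s_pos by simp
  qed
  also have "(\<integral>x. (indicat_real (\<sigma> ` C) x / s) *\<^sub>R lift_piece \<sigma> C f x \<partial>\<mu>)
    = (\<integral>x. lift_piece \<sigma> C f x \<partial>density \<mu> (\<lambda>x. ennreal (indicat_real (\<sigma> ` C) x / s)))"
    using Fm Cm s_pos by (intro integral_density[symmetric]) auto
  also have "\<dots> = (\<integral>x. lift_piece \<sigma> C f x \<partial>distr ?D \<mu> \<sigma>)" using distr_piece[OF C] by simp
  also have "\<dots> = (\<integral>x. lift_piece \<sigma> C f (\<sigma> x) \<partial>?D)"
    using sigma_measurable Fm by (intro integral_distr) auto
  also have "\<dots> = (\<integral>x. indicat_real C x *\<^sub>R lift_piece \<sigma> C f (\<sigma> x) \<partial>\<mu>)"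
    using Fm Cm sigma_measurable by (intro integral_density) auto
  also have "\<dots> = (\<integral>x. indicat_real C x * f x \<partial>\<mu>)"
    using lift_piece_image[OF pmonoD(7)[OF pmono C]]
    by (intro Bochner_Integration.integral_cong) (auto simp: indicator_def)
  finally show ?thesis .
qed

lemma cont_mult_indicator: "openin T A \<Longrightarrow> closedin T A \<Longrightarrow> cont f \<Longrightarrow> cont (\<lambda>x. indicat_real A x * f x)"
  by (intro continuous_map_real_mult cont_indicator)

text \<open>Summing the change of variables over the pieces: the scaled measure is an eigenmeasure
  of the dual of the transfer operator, with eigenvalue \<open>s\<close>.\<close>

lemma integral_transfer:
  assumes f: "cont f"
  shows "(\<integral>x. transfer T \<sigma> f x \<partial>\<mu>) = s * (\<integral>x. f x \<partial>\<mu>)"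
proof -
  have "(\<integral>x. transfer T \<sigma> f x \<partial>\<mu>) = (\<integral>x. (\<Sum>C\<in>\<C>. lift_piece \<sigma> C f x) \<partial>\<mu>)"
    using transfer_eq_sum_pieces[OF pmono] by simp
  also have "\<dots> = (\<Sum>C\<in>\<C>. \<integral>x. lift_piece \<sigma> C f x \<partial>\<mu>)"
    using cont_integrable cont_lift_piece[OF pmono _ f] by (intro Bochner_Integration.integral_sum) auto
  also have "\<dots> = s * (\<Sum>C\<in>\<C>. \<integral>x. indicat_real C x * f x \<partial>\<mu>)"
    using integral_lift_piece[OF _ f] by (simp add: sum_distrib_left)
  also have "(\<Sum>C\<in>\<C>. \<integral>x. indicat_real C x * f x \<partial>\<mu>) = (\<integral>x. (\<Sum>C\<in>\<C>. indicat_real C x * f x) \<partial>\<mu>)"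
    using cont_integrable cont_mult_indicator[OF _ _ f] pmonoD(8,9)[OF pmono]
    by (intro Bochner_Integration.integral_sum[symmetric]) auto
  also have "\<dots> = (\<integral>x. f x \<partial>\<mu>)"
  proof (rule Bochner_Integration.integral_cong[OF refl])
    fix x assume "x \<in> space \<mu>"
    then have "x \<in> X" using space by simp
    then obtain C where C: "C \<in> \<C>" "x \<in> C" using piece_containing by blast
    have "indicat_real D x = (if D = C then 1 else 0)" if D: "D \<in> \<C>" for D
    proof (cases "D = C")
      case True
      then show ?thesis using C by simp
    next
      case False
      then have "D \<inter> C = {}" using pmonoD(3)[OF pmono] D C by (auto simp: disjoint_def)
      then have "x \<notin> D" using C(2) by blast
      then show ?thesis using False by simp
    qed
    then have "(\<Sum>D\<in>\<C>. indicat_real D x * f x) = (\<Sum>D\<in>\<C>. if D = C then f x else 0)"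
      by (intro sum.cong) auto
    also have "\<dots> = f x" using C pmonoD(2)[OF pmono] by simp
    finally show "(\<Sum>C\<in>\<C>. indicat_real C x * f x) = f x" .
  qed
  finally show ?thesis .
qed

section \<open>The normalized transfer operator\<close>

definition P :: "nat \<Rightarrow> ('a \<Rightarrow> real) \<Rightarrow> 'a \<Rightarrow> real" where
  "P k f x = transfer T (\<sigma> ^^ k) f x / s ^ k"

lemma P_cong: "(\<And>y. y \<in> X \<Longrightarrow> f y = f' y) \<Longrightarrow> P k f x = P k f' x"
  unfolding P_def using transfer_cong[of f f'] by simp

lemma cont_P: assumes "cont f" shows "cont (P k f)"
proof -
  have "cont (\<lambda>x. transfer T (\<sigma> ^^ k) f x / s ^ k)"
    using cont_transfer[OF pmono_funpow assms, of k] s_pos by (intro continuous_map_real_divide) auto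
  then show ?thesis by (simp add: P_def[abs_def])
qed

lemma P_add_exponent: assumes "x \<in> X" shows "P (j + k) f x = P j (P k f) x"
proof -
  have "transfer T (\<sigma> ^^ (j + k)) f x = transfer T (\<sigma> ^^ j) (transfer T (\<sigma> ^^ k) f) x"
    using transfer_comp[OF pmono_funpow pmono_funpow] by (simp add: funpow_add)
  then show ?thesis
    by (simp add: P_def transfer_def sum_divide_distrib[symmetric] power_add mult.commute)
qed

lemma P_0: assumes "x \<in> X" shows "P 0 f x = f x"
proof -
  have "{y \<in> X. y = x} = {x}" using assms by auto
  then show ?thesis by (simp add: P_def transfer_def)
qed

lemma P_lincomb: "P k (\<lambda>x. a * f x + b * g x) x = a * P k f x + b * P k g x"
  by (simp add: P_def transfer_def sum.distrib sum_distrib_left add_divide_distrib)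

lemma P_cmult: "P k (\<lambda>x. a * f x) x = a * P k f x"
  using P_lincomb[of k a f 0 f x] by simp

lemma P_diff: "P k (\<lambda>x. f x - g x) x = P k f x - P k g x"
  using P_lincomb[of k 1 f "-1" g x] by simp

lemma P_mono: assumes "\<And>y. y \<in> X \<Longrightarrow> f y \<le> g y" shows "P k f x \<le> P k g x"
  unfolding P_def transfer_def using assms s_pos by (intro divide_right_mono sum_mono) auto

lemma P_nonneg: assumes "\<And>y. y \<in> X \<Longrightarrow> 0 \<le> f y" shows "0 \<le> P k f x"
  unfolding P_def transfer_def using assms s_pos by (intro divide_nonneg_nonneg sum_nonneg) auto

lemma P_abs: "\<bar>P k f x\<bar> \<le> P k (\<lambda>y. \<bar>f y\<bar>) x"
  unfolding P_def transfer_def using s_pos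
  by (simp add: abs_divide divide_right_mono sum_abs)

lemma integral_P: assumes f: "cont f" shows "(\<integral>x. P k f x \<partial>\<mu>) = (\<integral>x. f x \<partial>\<mu>)"
proof (induction k)
  case 0
  show ?case using P_0 space by (intro Bochner_Integration.integral_cong) auto
next
  case (Suc k)
  have "(\<integral>x. P (Suc k) f x \<partial>\<mu>) = (\<integral>x. P 1 (P k f) x \<partial>\<mu>)"
    using P_add_exponent[of _ 1 k f] space by (intro Bochner_Integration.integral_cong) auto
  also have "\<dots> = (\<integral>x. transfer T \<sigma> (P k f) x \<partial>\<mu>) / s" by (simp add: P_def)
  also have "\<dots> = (\<integral>x. P k f x \<partial>\<mu>)" using integral_transfer[OF cont_P[OF f]] s_pos by simp
  finally show ?case using Suc by simp
qed

lemma cont_abs: "cont f \<Longrightarrow> cont (\<lambda>x. \<bar>f x\<bar>)"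
  by (rule continuous_map_real_abs)

definition L1 :: "('a \<Rightarrow> real) \<Rightarrow> real" where "L1 f = (\<integral>x. \<bar>f x\<bar> \<partial>\<mu>)"

lemma L1_nonneg: "L1 f \<ge> 0" by (simp add: L1_def)

lemma integral_mono_cont:
  assumes "cont f" "cont g" "\<And>x. x \<in> X \<Longrightarrow> f x \<le> g x"
  shows "(\<integral>x. f x \<partial>\<mu>) \<le> (\<integral>x. g x \<partial>\<mu>)"
  using assms cont_integrable space by (intro integral_mono) auto

lemma L1_P_le: assumes "cont f" shows "L1 (P k f) \<le> L1 f"
proof -
  have "L1 (P k f) \<le> (\<integral>x. P k (\<lambda>y. \<bar>f y\<bar>) x \<partial>\<mu>)" unfolding L1_def
    by (intro integral_mono_cont cont_abs cont_P assms P_abs)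
  then show ?thesis using integral_P[OF cont_abs[OF assms]] by (simp add: L1_def)
qed

lemma integral_indicator: "openin T A \<Longrightarrow> (\<integral>x. indicat_real A x \<partial>\<mu>) = measure \<mu> A"
  using open_in_sets by simp

lemma integral_const: "(\<integral>x. c \<partial>\<mu>) = (c::real)" using prob_space by simp

lemma transfer_indicator_ge:
  assumes "x \<in> (\<sigma> ^^ k) ` A" "A \<subseteq> X" shows "transfer T (\<sigma> ^^ k) (indicat_real A) x \<ge> 1"
proof -
  obtain y where y: "y \<in> A" "x = (\<sigma> ^^ k) y" using assms by auto
  have "indicat_real A y \<le> (\<Sum>y\<in>{y \<in> X. (\<sigma> ^^ k) y = x}. indicat_real A y)"
    using y assms(2) pmono_fibre_finite[OF pmono_funpow] by (intro member_le_sum) auto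
  then show ?thesis using y by (simp add: transfer_def)
qed

lemma P_indicator_ge:
  assumes "x \<in> (\<sigma> ^^ k) ` A" "A \<subseteq> X" shows "P k (indicat_real A) x \<ge> 1 / s ^ k"
  unfolding P_def using transfer_indicator_ge[OF assms] s_pos by (intro divide_right_mono) auto

text \<open>If \<open>A\<close> covers \<open>X\<close> within \<open>m\<close> steps, the transfers
  of its indicator at times up to \<open>m\<close> add up to at least 1 everywhere; the integral of
  their sum is a multiple of the measure of \<open>A\<close>.\<close>

lemma measure_clopen_pos:
  assumes A: "openin T A" "closedin T A" "A \<noteq> {}" shows "measure \<mu> A > 0"
proof -
  obtain m where m: "(\<Union>k\<le>m. (\<sigma> ^^ k) ` A) = X" using strongly_transitive[OF A(1,3)] by auto
  let ?f = "indicat_real A"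
  have f: "cont ?f" using cont_indicator A by blast
  have AX: "A \<subseteq> X" using openin_subset A by blast
  have "1 = (\<integral>x. (1::real) \<partial>\<mu>)" using integral_const by simp
  also have "\<dots> \<le> (\<integral>x. (\<Sum>k\<le>m. s ^ k * P k ?f x) \<partial>\<mu>)"
  proof (rule integral_mono_cont)
    show "cont (\<lambda>x. \<Sum>k\<le>m. s ^ k * P k ?f x)"
      by (intro continuous_map_sum continuous_map_real_mult cont_P f) auto
    fix x assume "x \<in> X"
    then have "x \<in> (\<Union>k\<le>m. (\<sigma> ^^ k) ` A)" using m by simp
    then obtain k where k: "k \<le> m" "x \<in> (\<sigma> ^^ k) ` A" by blast
    have "1 \<le> s ^ k * P k ?f x" using P_indicator_ge[OF k(2) AX] s_pos by (simp add: field_simps)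
    also have "\<dots> \<le> (\<Sum>k\<le>m. s ^ k * P k ?f x)"
      using k(1) s_pos P_nonneg[of ?f] by (intro member_le_sum[of k "{..m}" "\<lambda>k. s ^ k * P k ?f x"]) auto
    finally show "1 \<le> (\<Sum>k\<le>m. s ^ k * P k ?f x)" .
  qed simp
  also have "\<dots> = (\<Sum>k\<le>m. \<integral>x. s ^ k * P k ?f x \<partial>\<mu>)"
    by (intro Bochner_Integration.integral_sum integrable_mult_right cont_integrable cont_P f)
  also have "\<dots> = (\<Sum>k\<le>m. s ^ k * measure \<mu> A)"
    using integral_P[OF f] integral_indicator[OF A(1)] by simp
  also have "\<dots> = (\<Sum>k\<le>m. s ^ k) * measure \<mu> A" by (simp add: sum_distrib_right)
  finally have "1 \<le> (\<Sum>k\<le>m. s ^ k) * measure \<mu> A" .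
  then have "measure \<mu> A \<noteq> 0" by auto
  then show ?thesis using measure_nonneg[of \<mu> A] by linarith
qed

text \<open>The integral of the number of preimages is \<open>s\<close>. Every point has a preimage
  by surjectivity, and the points of the non-empty clopen set \<open>A\<close>, where the images of
  two pieces overlap, have at least two; \<open>A\<close> has positive measure.\<close>

lemma s_gt_1: "s > 1"
proof -
  obtain x y where xy: "x \<in> X" "y \<in> X" "x \<noteq> y" "\<sigma> x = \<sigma> y" using noninjective by auto
  obtain C where C: "C \<in> \<C>" "x \<in> C" using piece_containing xy by blast
  obtain D where D: "D \<in> \<C>" "y \<in> D" using piece_containing xy by blast
  have "C \<noteq> D" using pmonoD(7)[OF pmono C(1)] C D xy by (auto simp: inj_on_def)
  then have disj: "C \<inter> D = {}" using pmonoD(3)[OF pmono] C D by (auto simp: disjoint_def)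
  define A where "A = \<sigma> ` C \<inter> \<sigma> ` D"
  have oA: "openin T A" unfolding A_def using pmonoD(11)[OF pmono] C D by blast
  have cA: "closedin T A" unfolding A_def
    using closed_image[OF pmonoD(1)[OF pmono]] pmonoD(9)[OF pmono] C D by blast
  have "\<sigma> x \<in> A" unfolding A_def using C D xy(4) by (metis IntI imageI)
  then have "measure \<mu> A > 0" using measure_clopen_pos oA cA by blast
  have one: "cont (\<lambda>x. 1)" by simp
  have ge: "1 + indicat_real A z \<le> transfer T \<sigma> (\<lambda>x. 1) z" if z: "z \<in> X" for z
  proof -
    let ?F = "{y \<in> X. \<sigma> y = z}"
    have fin: "finite ?F" using pmono_fibre_finite[OF pmono] .
    have tr: "transfer T \<sigma> (\<lambda>x. 1) z = real (card ?F)" by (simp add: transfer_def)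
    show ?thesis
    proof (cases "z \<in> A")
      case True
      then obtain u v where uv: "u \<in> C" "v \<in> D" "z = \<sigma> u" "z = \<sigma> v" unfolding A_def by auto
      then have "{u, v} \<subseteq> ?F" using pmonoD(13)[OF pmono C(1)] pmonoD(13)[OF pmono D(1)] by auto
      moreover have "u \<noteq> v" using uv disj by auto
      ultimately have "2 \<le> card ?F" using card_mono[OF fin, of "{u, v}"] by simp
      then show ?thesis using True tr by simp
    next
      case False
      have "z \<in> \<sigma> ` X" using z surj by simp
      then have "?F \<noteq> {}" by auto
      then have "1 \<le> card ?F" using fin by (simp add: Suc_le_eq card_gt_0_iff)
      then show ?thesis using False tr by simp
    qed
  qed
  have "(\<integral>x. 1 + indicat_real A x \<partial>\<mu>) \<le> (\<integral>x. transfer T \<sigma> (\<lambda>x. 1) x \<partial>\<mu>)"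
    by (intro integral_mono_cont continuous_map_add cont_indicator oA cA cont_transfer[OF pmono] one ge)
  also have "\<dots> = s" using integral_transfer[OF one] integral_const by simp
  also have "(\<integral>x. 1 + indicat_real A x \<partial>\<mu>) = 1 + measure \<mu> A"
    using Bochner_Integration.integral_add[OF cont_integrable[OF one] cont_integrable[OF cont_indicator[OF oA cA]]]
      integral_const integral_indicator[OF oA] by simp
  finally show ?thesis using \<open>measure \<mu> A > 0\<close> by linarith
qed

text \<open>Injectivity on the piece bounds the transfer of its indicator by 1, and \<open>P\<close>
  preserves integrals.\<close>

lemma measure_piece_le: assumes J: "J \<in> pieces k" shows "measure \<mu> J \<le> 1 / s ^ k"
proof -
  note pm = pmono_funpow[of k]
  have f: "cont (indicat_real J)" using cont_indicator pmonoD(8,9)[OF pm J] by blast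
  have "measure \<mu> J = (\<integral>x. P k (indicat_real J) x \<partial>\<mu>)"
    using integral_P[OF f] integral_indicator[OF pmonoD(8)[OF pm J]] by simp
  also have "\<dots> \<le> (\<integral>x. 1 / s ^ k \<partial>\<mu>)"
  proof (rule integral_mono_cont[OF cont_P[OF f]])
    fix x
    have "transfer T (\<sigma> ^^ k) (indicat_real J) x = real (card {y \<in> J. (\<sigma> ^^ k) y = x})"
    proof -
      have "transfer T (\<sigma> ^^ k) (indicat_real J) x = (\<Sum>y\<in>{y \<in> J. (\<sigma> ^^ k) y = x}. 1)"
        unfolding transfer_def using pmonoD(13)[OF pm J] pmono_fibre_finite[OF pm]
        by (intro sum.mono_neutral_cong_right) (auto simp: indicator_def)
      then show ?thesis by simp
    qed
    moreover have "card {y \<in> J. (\<sigma> ^^ k) y = x} \<le> 1"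
    proof -
      have "\<exists>z. {y \<in> J. (\<sigma> ^^ k) y = x} \<subseteq> {z}" using pmonoD(7)[OF pm J] by (auto simp: inj_on_def)
      then obtain z where "{y \<in> J. (\<sigma> ^^ k) y = x} \<subseteq> {z}" by auto
      from card_mono[OF _ this] show ?thesis by simp
    qed
    ultimately show "P k (indicat_real J) x \<le> 1 / s ^ k"
      unfolding P_def using s_pos by (intro divide_right_mono) auto
  qed simp
  also have "\<dots> = 1 / s ^ k" using integral_const by simp
  finally show ?thesis .
qed

text \<open>On a piece, the supremum of \<open>f\<close> is at most its oscillation plus its mean.
  The two boundary jumps and the inner variation therefore cost three oscillations and two means;
  the oscillations of disjoint pieces add up to at most \<open>v\<close>, and the means are
  controlled by the \<open>L1\<close> norm because the pieces have positive measure.\<close>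

lemma Lasota_Yorke:
  "\<exists>c\<ge>0. \<forall>f v. cont f \<and> vdom f v \<longrightarrow> vdom (P k f) (3 / s ^ k * v + c * L1 f)"
proof -
  note pm = pmono_funpow[of k]
  define c where "c = (\<Sum>J\<in>pieces k. 2 / measure \<mu> J) / s ^ k"
  have c0: "c \<ge> 0" unfolding c_def using s_pos by (intro divide_nonneg_nonneg sum_nonneg) auto
  obtain lo hi where lohi: "\<forall>J\<in>pieces k. lo J \<in> J \<and> hi J \<in> J \<and> (\<forall>x\<in>J. lo J \<le> x \<and> x \<le> hi J)"
    using pmono_endpoints[OF pm] by auto
  have "vdom (P k f) (3 / s ^ k * v + c * L1 f)" if f: "cont f" and v: "vdom f v" for f v
  proof -
    obtain w where "dominated f w v" using v by (auto simp: vdom_def)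
    note w = dominatedD[OF this]
    define osc where "osc J = w (hi J) - w (lo J)" for J
    define M where "M J = osc J + L1 f / measure \<mu> J" for J
    have M: "\<bar>f x\<bar> \<le> M J" if J: "J \<in> pieces k" and x: "x \<in> J" for J x
    proof -
      have JX: "J \<subseteq> X" using pmonoD(13)[OF pm J] .
      have wb: "w (lo J) \<le> w z" "w z \<le> w (hi J)" if "z \<in> J" for z
        using w(1)[of "lo J" z] w(1)[of z "hi J"] lohi J JX that by fastforce+
      have le: "\<bar>f x\<bar> - osc J \<le> \<bar>f y\<bar>" if y: "y \<in> J" for y
      proof -
        have "\<bar>f y - f x\<bar> \<le> \<bar>w y - w x\<bar>"
        proof (cases "x \<le> y")
          case True
          have "\<bar>f y - f x\<bar> \<le> w y - w x" by (rule w(1)) (use x y JX True in auto)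
          then show ?thesis by linarith
        next
          case False
          have "\<bar>f x - f y\<bar> \<le> w x - w y" by (rule w(1)) (use x y JX False in auto)
          then show ?thesis by linarith
        qed
        then show ?thesis using wb[OF x] wb[OF y] unfolding osc_def by linarith
      qed
      have cJ: "cont (indicat_real J)" using cont_indicator pmonoD(8,9)[OF pm J] by blast
      have "(\<integral>y. (\<bar>f x\<bar> - osc J) * indicat_real J y \<partial>\<mu>) \<le> L1 f" unfolding L1_def
      proof (rule integral_mono_cont[OF _ cont_abs[OF f]])
        show "cont (\<lambda>y. (\<bar>f x\<bar> - osc J) * indicat_real J y)"
          using cJ by (intro continuous_map_real_mult) auto
        show "(\<bar>f x\<bar> - osc J) * indicat_real J y \<le> \<bar>f y\<bar>" if "y \<in> X" for y
          using le[of y] by (cases "y \<in> J") auto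
      qed
      then have "(\<bar>f x\<bar> - osc J) * measure \<mu> J \<le> L1 f"
        using integral_indicator[OF pmonoD(8)[OF pm J]] by simp
      moreover have "measure \<mu> J > 0" using measure_clopen_pos pmonoD(5,8,9)[OF pm J] by blast
      ultimately show ?thesis unfolding M_def by (simp add: field_simps)
    qed
    have "vdom (transfer T (\<sigma> ^^ k) f) (\<Sum>J\<in>pieces k. 2 * M J + (w (hi J) - w (lo J)))"
      by (rule vdom_transfer[OF pm]) (use lohi w(1) M in auto)
    moreover have "(\<Sum>J\<in>pieces k. 2 * M J + (w (hi J) - w (lo J)))
      = 3 * (\<Sum>J\<in>pieces k. osc J) + (\<Sum>J\<in>pieces k. 2 / measure \<mu> J) * L1 f"
      by (simp add: M_def osc_def sum.distrib sum_distrib_left sum_distrib_right algebra_simps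
          sum_subtractf)
    moreover have "(\<Sum>J\<in>pieces k. osc J) \<le> v" unfolding osc_def
      by (rule pmono_sum_osc_le[OF pm nonempty, where f = f]) (use lohi w in auto)
    ultimately have "vdom (transfer T (\<sigma> ^^ k) f) (3 * v + (\<Sum>J\<in>pieces k. 2 / measure \<mu> J) * L1 f)"
      using vdom_le by fastforce
    from vdom_cmult[OF this, of "1 / s ^ k"]
    have "vdom (\<lambda>x. 1 / s ^ k * transfer T (\<sigma> ^^ k) f x)
      (1 / s ^ k * (3 * v + (\<Sum>J\<in>pieces k. 2 / measure \<mu> J) * L1 f))" using s_pos by simp
    moreover have "1 / s ^ k * (3 * v + (\<Sum>J\<in>pieces k. 2 / measure \<mu> J) * L1 f) = 3 / s ^ k * v + c * L1 f"
      by (simp add: c_def algebra_simps add_divide_distrib)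
    ultimately show ?thesis by (auto simp: P_def intro: vdom_cong)
  qed
  then show ?thesis using c0 by blast
qed

lemma sup_le: assumes f: "cont f" "vdom f v" and x: "x \<in> X" shows "\<bar>f x\<bar> \<le> v + L1 f"
proof -
  have "(\<integral>y. \<bar>f x\<bar> - v \<partial>\<mu>) \<le> L1 f" unfolding L1_def
  proof (rule integral_mono_cont[OF _ cont_abs[OF f(1)]])
    show "\<bar>f x\<bar> - v \<le> \<bar>f y\<bar>" if "y \<in> X" for y using vdom_dist[OF f(2) x that] by linarith
  qed simp
  then show ?thesis using integral_const[of "\<bar>f x\<bar> - v"] by simp
qed

end

section \<open>Convergence on an exact piece\<close>

context ordered_compact
begin

text \<open>A variation bound in terms of finite sums passes to pointwise limits, which is not
  evident for \<open>vdom\<close> with its hidden majorant.\<close>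

definition chain_bounded :: "('a \<Rightarrow> real) \<Rightarrow> real \<Rightarrow> bool" where
  "chain_bounded f v \<longleftrightarrow> (\<forall>(m::nat) x. (\<forall>i\<le>m. x i \<in> X) \<and> (\<forall>i\<in>{1..m}. x (i - 1) < x i) \<longrightarrow>
     (\<Sum>i=1..m. \<bar>f (x i) - f (x (i - 1))\<bar>) \<le> v)"

lemma vdom_imp_chain_bounded: assumes "vdom f v" shows "chain_bounded f v"
  unfolding chain_bounded_def
proof (intro allI impI)
  fix m :: nat and x assume x: "(\<forall>i\<le>m. x i \<in> X) \<and> (\<forall>i\<in>{1..m}. x (i - 1) < x i)"
  obtain w where "dominated f w v" using assms by (auto simp: vdom_def)
  note w = dominatedD[OF this]
  have "(\<Sum>i=1..m. \<bar>f (x i) - f (x (i - 1))\<bar>) \<le> (\<Sum>i=1..m. w (x i) - w (x (i - 1)))"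
  proof (rule sum_mono)
    fix i assume i: "i \<in> {1..m}"
    show "\<bar>f (x i) - f (x (i - 1))\<bar> \<le> w (x i) - w (x (i - 1))"
    proof (rule w(1))
      show "x (i - 1) \<in> X" "x i \<in> X" using x i by auto
      have "x (i - 1) < x i" using x i by blast
      then show "x (i - 1) \<le> x i" by simp
    qed
  qed
  also have "\<dots> = w (x m) - w (x 0)"
    by (induction m) auto
  also have "\<dots> \<le> v" using w(2) x by auto
  finally show "(\<Sum>i=1..m. \<bar>f (x i) - f (x (i - 1))\<bar>) \<le> v" .
qed

text \<open>The majorant is Jordan's variation function: the supremum of the variations along chains
  that end at or before the given point. A chain for \<open>y\<close> is first extended to end at
  \<open>y\<close>, then by the step from \<open>y\<close> to \<open>z\<close>.\<close>

lemma chain_bounded_imp_vdom: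
  assumes f: "chain_bounded f v" shows "vdom f v"
proof -
  define chain where "chain m x \<longleftrightarrow> (\<forall>i\<le>m. x i \<in> X) \<and> (\<forall>i\<in>{1..m}. x (i - 1) < x i)" for m :: nat and x :: "nat \<Rightarrow> 'a"
  define var where "var m x = (\<Sum>i=1..m. \<bar>f (x i) - f (x (i - 1))\<bar>)" for m :: nat and x
  have var_le: "var m x \<le> v" if "chain m x" for m x
    using f that unfolding chain_bounded_def chain_def var_def by blast
  define V where "V z = {var m x | m x. chain m x \<and> x m \<le> z}" for z
  define w where "w z = Sup (V z)" for z
  have bdd: "bdd_above (V z)" for z unfolding V_def bdd_above_def using var_le by blast
  have zero: "0 \<in> V z" if "z \<in> X" for z
  proof -
    have "chain 0 (\<lambda>_. z)" "var 0 (\<lambda>_. z) = 0" using that by (auto simp: chain_def var_def)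
    then show ?thesis unfolding V_def by force
  qed
  have snoc: "chain (Suc m) (x(Suc m := z)) \<and> var (Suc m) (x(Suc m := z)) = var m x + \<bar>f z - f (x m)\<bar>"
    if "chain m x" "x m < z" "z \<in> X" for m x z
  proof
    show "chain (Suc m) (x(Suc m := z))" unfolding chain_def
    proof (intro conjI allI impI ballI)
      fix i assume "i \<le> Suc m"
      then show "(x(Suc m := z)) i \<in> X" using that by (auto simp: chain_def)
    next
      fix i assume i: "i \<in> {1..Suc m}"
      show "(x(Suc m := z)) (i - 1) < (x(Suc m := z)) i"
      proof (cases "i = Suc m")
        case True
        then show ?thesis using that by simp
      next
        case False
        then have "i \<in> {1..m}" "i - 1 \<noteq> Suc m" using i by auto
        then show ?thesis using that(1) False unfolding chain_def by simp
      qed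
    qed
    have "var (Suc m) (x(Suc m := z)) = (\<Sum>i=1..m. \<bar>f ((x(Suc m := z)) i) - f ((x(Suc m := z)) (i - 1))\<bar>) + \<bar>f z - f (x m)\<bar>"
      by (simp add: var_def)
    also have "(\<Sum>i=1..m. \<bar>f ((x(Suc m := z)) i) - f ((x(Suc m := z)) (i - 1))\<bar>) = var m x"
      unfolding var_def by (intro sum.cong) auto
    finally show "var (Suc m) (x(Suc m := z)) = var m x + \<bar>f z - f (x m)\<bar>" .
  qed
  show ?thesis
  proof (rule vdomI[of _ w])
    fix y z assume yz: "y \<in> X" "z \<in> X" "y \<le> z"
    have "var m x + \<bar>f z - f y\<bar> \<le> w z" if c: "chain m x" "x m \<le> y" for m x
    proof -
      obtain m' x' where c': "chain m' x'" "x' m' = y" "var m x \<le> var m' x'"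
      proof (cases "x m = y")
        case True
        then show ?thesis using that c by blast
      next
        case False
        then have "x m < y" using c by simp
        from snoc[OF c(1) this yz(1)] have s: "chain (Suc m) (x(Suc m := y))"
          "var (Suc m) (x(Suc m := y)) = var m x + \<bar>f y - f (x m)\<bar>" by auto
        show ?thesis by (rule that[OF s(1)]) (use s(2) in auto)
      qed
      have "var m' x' + \<bar>f z - f y\<bar> \<in> V z"
      proof (cases "y = z")
        case True
        then show ?thesis using c'(1,2) unfolding V_def by force
      next
        case False
        then have "x' m' < z" using c' yz by simp
        from snoc[OF c'(1) this yz(2)] have s: "chain (Suc m') (x'(Suc m' := z))"
          "var (Suc m') (x'(Suc m' := z)) = var m' x' + \<bar>f z - f y\<bar>" using c'(2) by auto
        have "(x'(Suc m' := z)) (Suc m') \<le> z" by simp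
        then show ?thesis unfolding V_def using s by (smt (verit, best) mem_Collect_eq)
      qed
      then have "var m' x' + \<bar>f z - f y\<bar> \<le> w z" unfolding w_def using bdd by (rule cSup_upper)
      then show ?thesis using c'(3) by simp
    qed
    then have "u \<le> w z - \<bar>f z - f y\<bar>" if "u \<in> V y" for u using that unfolding V_def by force
    then have "w y \<le> w z - \<bar>f z - f y\<bar>" unfolding w_def[of y] using zero[OF yz(1)]
      by (intro cSup_least) auto
    then show "\<bar>f z - f y\<bar> \<le> w z - w y" by simp
  next
    fix y z assume yz: "y \<in> X" "z \<in> X"
    have "w z \<le> v" unfolding w_def
      using zero[OF yz(2)] var_le by (intro cSup_least) (auto simp: V_def)
    moreover have "0 \<le> w y" unfolding w_def using zero[OF yz(1)] bdd by (rule cSup_upper)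
    ultimately show "w z - w y \<le> v" by simp
  qed
qed

end

section \<open>Contraction on one member of the partition\<close>

locale exact_piece = scaled_system +
  fixes N :: nat and A :: "'a set"
  assumes N: "N \<ge> 1" and A_open: "openin T A" and A_closed: "closedin T A" and A_ne: "A \<noteq> {}"
    and A_inv: "(\<sigma> ^^ (N * k)) ` A = A"
    and A_exact: "openin T V \<Longrightarrow> V \<noteq> {} \<Longrightarrow> V \<subseteq> A \<Longrightarrow> \<exists>K. \<forall>k\<ge>K. (\<sigma> ^^ (N * k)) ` V = A"
begin

text \<open>As \<open>A\<close> is closed, this amounts to the support of \<open>f\<close> being
  contained in \<open>A\<close>.\<close>

definition off :: "('a \<Rightarrow> real) \<Rightarrow> bool" where
  "off f \<longleftrightarrow> (\<forall>x\<in>X - A. f x = 0)"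

lemma offD: "off f \<Longrightarrow> x \<in> X \<Longrightarrow> x \<notin> A \<Longrightarrow> f x = 0"
  by (simp add: off_def)

lemma A_X: "A \<subseteq> X" using openin_subset[OF A_open] .

lemma off_P: assumes "off f" shows "off (P (N * k) f)"
  unfolding off_def
proof
  fix x assume x: "x \<in> X - A"
  have "f y = 0" if "y \<in> X" "(\<sigma> ^^ (N * k)) y = x" for y
  proof (rule offD[OF assms that(1)])
    show "y \<notin> A" using that(2) A_inv[of k] x by blast
  qed
  then have "transfer T (\<sigma> ^^ (N * k)) f x = 0" by (simp add: transfer_def)
  then show "P (N * k) f x = 0" by (simp add: P_def)
qed

text \<open>Let \<open>a\<close> be the integral of \<open>f\<close>. If each piece of a high
  iterate contained a point where \<open>f < a / 2\<close>, then \<open>f\<close> would be at most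
  \<open>a / 2\<close> plus the local oscillation; integrating,
  \<open>a \<le> a / 2 + v / s ^ p\<close>, which is impossible for large \<open>p\<close> since
  \<open>v \<le> B * a\<close>. So \<open>f\<close> is at least \<open>a / 2\<close> on some piece,
  which lies in \<open>A\<close> because \<open>f\<close> vanishes elsewhere. Exactness spreads this
  piece over \<open>A\<close>, at one time for all of the finitely many pieces.\<close>

lemma lower_bound:
  "\<exists>M c. c > 0 \<and> (\<forall>f v. cont f \<and> (\<forall>x\<in>X. f x \<ge> 0) \<and> off f \<and> vdom f v \<and> v \<le> B * (\<integral>x. f x \<partial>\<mu>) \<longrightarrow>
     (\<forall>x\<in>A. P (N * M) f x \<ge> c * (\<integral>x. f x \<partial>\<mu>)))"
proof -
  obtain p where p: "4 * \<bar>B\<bar> + 1 < s ^ p" using real_arch_pow[OF s_gt_1] by blast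
  note pm = pmono_funpow[of p]
  have "\<forall>J\<in>pieces p. J \<subseteq> A \<longrightarrow> (\<exists>K. \<forall>k\<ge>K. (\<sigma> ^^ (N * k)) ` J = A)"
    using A_exact[OF pmonoD(8)[OF pm] pmonoD(5)[OF pm]] by simp
  then obtain K where K: "\<And>J k. J \<in> pieces p \<Longrightarrow> J \<subseteq> A \<Longrightarrow> k \<ge> K J \<Longrightarrow> (\<sigma> ^^ (N * k)) ` J = A"
    by metis
  define M where "M = Max (K ` pieces p)"
  have M: "K J \<le> M" if "J \<in> pieces p" for J
    unfolding M_def using that pmonoD(2)[OF pm] by (intro Max_ge) auto
  define c where "c = 1 / (2 * s ^ (N * M))"
  have c: "c > 0" using s_pos by (simp add: c_def)
  have "P (N * M) f x \<ge> c * (\<integral>x. f x \<partial>\<mu>)"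
    if f: "cont f" "\<forall>x\<in>X. f x \<ge> 0" "off f" "vdom f v" "v \<le> B * (\<integral>x. f x \<partial>\<mu>)" and x: "x \<in> A" for f v x
  proof -
    define a where "a = (\<integral>x. f x \<partial>\<mu>)"
    have a0: "a \<ge> 0" unfolding a_def using f(2) space by (intro Bochner_Integration.integral_nonneg) auto
    have nn: "P (N * M) f x \<ge> 0" using f(2) by (intro P_nonneg) auto
    show ?thesis
    proof (cases "a = 0")
      case True
      then show ?thesis using nn by (simp add: a_def)
    next
      case False
      then have a: "a > 0" using a0 by simp
      have "\<exists>J\<in>pieces p. \<forall>y\<in>J. f y \<ge> a / 2"
      proof (rule ccontr)
        assume "\<not> ?thesis"
        then have "\<forall>J\<in>pieces p. \<exists>y\<in>J. f y < a / 2" by (meson not_le)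
        then obtain y where y: "\<And>J. J \<in> pieces p \<Longrightarrow> y J \<in> J" "\<And>J. J \<in> pieces p \<Longrightarrow> f (y J) < a / 2"
          by metis
        obtain w where "dominated f w v" using f(4) by (auto simp: vdom_def)
        note w = dominatedD[OF this]
        obtain lo hi where lohi: "\<forall>J\<in>pieces p. lo J \<in> J \<and> hi J \<in> J \<and> (\<forall>x\<in>J. lo J \<le> x \<and> x \<le> hi J)"
          using pmono_endpoints[OF pm] by auto
        define osc where "osc J = w (hi J) - w (lo J)" for J
        have osc: "\<bar>f z - f (y J)\<bar> \<le> osc J" if J: "J \<in> pieces p" and z: "z \<in> J" for J z
        proof -
          have JX: "J \<subseteq> X" using pmonoD(13)[OF pm J] .
          have wb: "w (lo J) \<le> w u" "w u \<le> w (hi J)" if u: "u \<in> J" for u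
          proof -
            have "\<bar>f u - f (lo J)\<bar> \<le> w u - w (lo J)" by (rule w(1)) (use lohi J JX u in auto)
            then show "w (lo J) \<le> w u" by linarith
            have "\<bar>f (hi J) - f u\<bar> \<le> w (hi J) - w u" by (rule w(1)) (use lohi J JX u in auto)
            then show "w u \<le> w (hi J)" by linarith
          qed
          have yJ: "y J \<in> J" using y(1)[OF J] .
          show ?thesis
          proof (cases "y J \<le> z")
            case True
            have "\<bar>f z - f (y J)\<bar> \<le> w z - w (y J)" by (rule w(1)) (use JX yJ z True in auto)
            then show ?thesis using wb[OF z] wb[OF yJ] unfolding osc_def by linarith
          next
            case False
            have "\<bar>f (y J) - f z\<bar> \<le> w (y J) - w z" by (rule w(1)) (use JX yJ z False in auto)
            then show ?thesis using wb[OF z] wb[OF yJ] unfolding osc_def by linarith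
          qed
        qed
        have osc0: "osc J \<ge> 0" if J: "J \<in> pieces p" for J using osc[OF J y(1)[OF J]] by simp
        have cJ: "cont (indicat_real J)" if J: "J \<in> pieces p" for J
          using cont_indicator pmonoD(8,9)[OF pm J] by blast
        have csum: "cont (\<lambda>z. \<Sum>J\<in>pieces p. osc J * indicat_real J z)"
          using cJ pmonoD(2)[OF pm] by (intro continuous_map_sum continuous_map_real_mult) auto
        have "a \<le> (\<integral>z. a / 2 + (\<Sum>J\<in>pieces p. osc J * indicat_real J z) \<partial>\<mu>)" unfolding a_def
        proof (rule integral_mono_cont[OF f(1)])
          show "cont (\<lambda>z. (\<integral>x. f x \<partial>\<mu>) / 2 + (\<Sum>J\<in>pieces p. osc J * indicat_real J z))"
            using csum by (intro continuous_map_add) auto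
          fix z assume z: "z \<in> X"
          then obtain J where J: "J \<in> pieces p" "z \<in> J" using pmonoD(4)[OF pm] by auto
          have "f z \<le> a / 2 + osc J * indicat_real J z" using osc[OF J] y(2)[OF J(1)] J(2) by simp
          also have "osc J * indicat_real J z \<le> (\<Sum>J\<in>pieces p. osc J * indicat_real J z)"
            using J(1) pmonoD(2)[OF pm] osc0 by (intro member_le_sum) auto
          finally show "f z \<le> (\<integral>x. f x \<partial>\<mu>) / 2 + (\<Sum>J\<in>pieces p. osc J * indicat_real J z)"
            by (simp add: a_def)
        qed
        also have "\<dots> = a / 2 + (\<Sum>J\<in>pieces p. osc J * measure \<mu> J)"
        proof -
          have "(\<integral>z. a / 2 + (\<Sum>J\<in>pieces p. osc J * indicat_real J z) \<partial>\<mu>)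
            = (\<integral>z. a / 2 \<partial>\<mu>) + (\<integral>z. (\<Sum>J\<in>pieces p. osc J * indicat_real J z) \<partial>\<mu>)"
            by (intro Bochner_Integration.integral_add cont_integrable csum) auto
          also have "(\<integral>z. (\<Sum>J\<in>pieces p. osc J * indicat_real J z) \<partial>\<mu>)
            = (\<Sum>J\<in>pieces p. \<integral>z. osc J * indicat_real J z \<partial>\<mu>)"
            using cont_integrable[OF cJ] by (intro Bochner_Integration.integral_sum integrable_mult_right) auto
          also have "\<dots> = (\<Sum>J\<in>pieces p. osc J * measure \<mu> J)"
            using integral_indicator pmonoD(8)[OF pm] by (intro sum.cong) auto
          finally show ?thesis using integral_const by simp
        qed
        also have "\<dots> \<le> a / 2 + (\<Sum>J\<in>pieces p. osc J * (1 / s ^ p))"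
          using osc0 measure_piece_le by (intro add_left_mono sum_mono mult_left_mono) auto
        also have "(\<Sum>J\<in>pieces p. osc J * (1 / s ^ p)) = (\<Sum>J\<in>pieces p. osc J) / s ^ p"
          by (simp add: sum_divide_distrib)
        also have "\<dots> \<le> v / s ^ p"
        proof (rule divide_right_mono)
          show "(\<Sum>J\<in>pieces p. osc J) \<le> v" unfolding osc_def
            by (rule pmono_sum_osc_le[OF pm nonempty, where f = f]) (use lohi w in auto)
        qed (use s_pos in simp)
        finally have "a / 2 \<le> v / s ^ p" by linarith
        then have "a * s ^ p \<le> 2 * v" using s_pos by (simp add: field_simps)
        also have "\<dots> \<le> 2 * (\<bar>B\<bar> * a)" using f(5) a unfolding a_def[symmetric]
          by (smt (verit) mult_right_mono abs_ge_self)
        also have "\<dots> < (4 * \<bar>B\<bar> + 1) * a" using a by (simp add: algebra_simps add_pos_nonneg add_nonneg_pos)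
        also have "\<dots> < s ^ p * a" using p a by (intro mult_strict_right_mono) auto
        finally show False by (simp add: mult.commute)
      qed
      then obtain J where J: "J \<in> pieces p" "\<And>y. y \<in> J \<Longrightarrow> f y \<ge> a / 2" by auto
      have JX: "J \<subseteq> X" using pmonoD(13)[OF pm J(1)] .
      have JA: "J \<subseteq> A"
      proof
        fix y assume "y \<in> J"
        then show "y \<in> A" using J(2)[of y] a offD[OF f(3), of y] JX by fastforce
      qed
      have "(\<sigma> ^^ (N * M)) ` J = A" using K[OF J(1) JA M[OF J(1)]] .
      then have "P (N * M) (indicat_real J) x \<ge> 1 / s ^ (N * M)" using P_indicator_ge[OF _ JX] x by simp
      then have "a / 2 * (1 / s ^ (N * M)) \<le> a / 2 * P (N * M) (indicat_real J) x"
        using a by (intro mult_left_mono) auto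
      moreover have "c * a = a / 2 * (1 / s ^ (N * M))" by (simp add: c_def)
      ultimately have "c * a \<le> a / 2 * P (N * M) (indicat_real J) x" by simp
      also have "\<dots> = P (N * M) (\<lambda>y. a / 2 * indicat_real J y) x" by (rule P_cmult[symmetric])
      also have "\<dots> \<le> P (N * M) f x"
      proof (rule P_mono)
        show "a / 2 * indicat_real J y \<le> f y" if "y \<in> X" for y
          using J(2)[of y] f(2) that by (cases "y \<in> J") auto
      qed
      finally show ?thesis by (simp add: a_def)
    qed
  qed
  then show ?thesis using c by blast
qed

text \<open>The positive and negative parts of \<open>f\<close> have the same integral
  \<open>a\<close>. Their images both exceed a fixed multiple of \<open>a\<close> on
  \<open>A\<close>, and this common part cancels in the image of \<open>f\<close>.\<close>

lemma L1_contraction: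
  "\<exists>M c. 0 < c \<and> (\<forall>f v. cont f \<and> off f \<and> (\<integral>x. f x \<partial>\<mu>) = 0 \<and> vdom f v \<and> v \<le> B * L1 f \<longrightarrow>
     (\<forall>k\<ge>M. L1 (P (N * k) f) \<le> (1 - c) * L1 f))"
proof -
  \<comment> \<open>The bound is doubled because each of the two parts carries only half of the
    \<open>L1\<close> norm.\<close>
  obtain M c where c: "c > 0" and lb0: "\<forall>f v. cont f \<and> (\<forall>x\<in>X. f x \<ge> 0) \<and> off f \<and> vdom f v \<and>
      v \<le> (2 * B) * (\<integral>x. f x \<partial>\<mu>) \<longrightarrow> (\<forall>x\<in>A. P (N * M) f x \<ge> c * (\<integral>x. f x \<partial>\<mu>))"
    using lower_bound[of "2 * B"] by (elim exE conjE)
  have lb: "P (N * M) f x \<ge> c * (\<integral>x. f x \<partial>\<mu>)"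
    if "cont f" "\<forall>x\<in>X. f x \<ge> 0" "off f" "vdom f v" "v \<le> (2 * B) * (\<integral>x. f x \<partial>\<mu>)" "x \<in> A" for f v x
    using spec[OF spec[OF lb0, of f], of v] that by simp
  define m where "m = measure \<mu> A"
  have m: "m > 0" using measure_clopen_pos A_open A_closed A_ne by (simp add: m_def)
  have "L1 (P (N * k) f) \<le> (1 - c * m) * L1 f"
    if f: "cont f" "off f" "(\<integral>x. f x \<partial>\<mu>) = 0" "vdom f v" "v \<le> B * L1 f" and k: "k \<ge> M" for f v k
  proof -
    define fp where "fp x = max 0 (f x)" for x
    define fm where "fm x = max 0 (- f x)" for x
    have cfp: "cont fp" unfolding fp_def by (intro continuous_map_real_max f(1)) auto
    have cfm: "cont fm" unfolding fm_def by (intro continuous_map_real_max continuous_map_minus f(1)) auto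
    have "(\<integral>x. fp x - fm x \<partial>\<mu>) = 0"
    proof -
      have "fp x - fm x = f x" for x by (auto simp: fp_def fm_def)
      then show ?thesis using f(3) by simp
    qed
    then have eq: "(\<integral>x. fp x \<partial>\<mu>) = (\<integral>x. fm x \<partial>\<mu>)"
      using Bochner_Integration.integral_diff[OF cont_integrable[OF cfp] cont_integrable[OF cfm]] by simp
    define a where "a = (\<integral>x. fp x \<partial>\<mu>)"
    have "(\<integral>x. fp x + fm x \<partial>\<mu>) = L1 f"
    proof -
      have "fp x + fm x = \<bar>f x\<bar>" for x by (auto simp: fp_def fm_def)
      then show ?thesis by (simp add: L1_def)
    qed
    then have a2: "L1 f = 2 * a"
      using Bochner_Integration.integral_add[OF cont_integrable[OF cfp] cont_integrable[OF cfm]] eq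
      by (simp add: a_def)
    have vm: "vdom (\<lambda>x. - f x) v" using vdom_cmult[OF f(4), of "-1"] by simp
    have p: "P (N * M) fp x \<ge> c * a" if "x \<in> A" for x unfolding a_def
    proof (rule lb[OF cfp _ _ _ _ that])
      show "vdom fp v" unfolding fp_def using vdom_pos_part[OF f(4)] .
      show "v \<le> 2 * B * (\<integral>x. fp x \<partial>\<mu>)" using f(5) a2 by (simp add: a_def)
    qed (use f(2) in \<open>auto simp: off_def fp_def\<close>)
    have q: "P (N * M) fm x \<ge> c * a" if "x \<in> A" for x unfolding a_def eq
    proof (rule lb[OF cfm _ _ _ _ that])
      show "vdom fm v" unfolding fm_def using vdom_pos_part[OF vm] .
      show "v \<le> 2 * B * (\<integral>x. fm x \<partial>\<mu>)" using f(5) a2 eq by (simp add: a_def)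
    qed (use f(2) in \<open>auto simp: off_def fm_def\<close>)
    let ?g = "\<lambda>x. (P (N * M) fp x + P (N * M) fm x) - 2 * (c * a) * indicat_real A x"
    have cA: "cont (indicat_real A)" using cont_indicator A_open A_closed by blast
    have cs: "cont (\<lambda>x. P (N * M) fp x + P (N * M) fm x)" by (intro continuous_map_add cont_P cfp cfm)
    have cd: "cont (\<lambda>x. 2 * (c * a) * indicat_real A x)" using cA by (intro continuous_map_real_mult) auto
    have "L1 (P (N * M) f) \<le> (\<integral>x. ?g x \<partial>\<mu>)" unfolding L1_def
    proof (rule integral_mono_cont[OF cont_abs[OF cont_P[OF f(1)]]])
      show "cont ?g" by (intro continuous_map_diff cs cd)
      fix x assume "x \<in> X"
      have "f = (\<lambda>x. fp x - fm x)" by (auto simp: fp_def fm_def)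
      then have d: "P (N * M) f x = P (N * M) fp x - P (N * M) fm x" using P_diff by metis
      have nn: "P (N * M) fp x \<ge> 0" "P (N * M) fm x \<ge> 0" by (auto intro!: P_nonneg simp: fp_def fm_def)
      show "\<bar>P (N * M) f x\<bar> \<le> ?g x"
      proof (cases "x \<in> A")
        case True
        then show ?thesis using p[OF True] q[OF True] d by simp
      next
        case False
        then show ?thesis using nn d by simp
      qed
    qed
    also have "\<dots> = (\<integral>x. P (N * M) fp x \<partial>\<mu>) + (\<integral>x. P (N * M) fm x \<partial>\<mu>) - 2 * (c * a) * m"
      using Bochner_Integration.integral_diff[OF cont_integrable[OF cs] cont_integrable[OF cd]]
        Bochner_Integration.integral_add[OF cont_integrable[OF cont_P[OF cfp]] cont_integrable[OF cont_P[OF cfm]]]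
        integral_indicator[OF A_open] by (simp add: m_def)
    also have "\<dots> = (1 - c * m) * L1 f"
      using integral_P[OF cfp] integral_P[OF cfm] eq a2 by (simp add: a_def[symmetric] algebra_simps)
    finally have 1: "L1 (P (N * M) f) \<le> (1 - c * m) * L1 f" .
    have "L1 (P (N * k) f) = L1 (P (N * (k - M)) (P (N * M) f))"
    proof -
      have "N * k = N * (k - M) + N * M" using k by (simp add: diff_mult_distrib2)
      then have "\<bar>P (N * k) f x\<bar> = \<bar>P (N * (k - M)) (P (N * M) f) x\<bar>" if "x \<in> X" for x
        using P_add_exponent[OF that, of "N * (k - M)" "N * M" f] by simp
      then show ?thesis unfolding L1_def using space by (intro Bochner_Integration.integral_cong) auto
    qed
    also have "\<dots> \<le> L1 (P (N * M) f)" by (rule L1_P_le[OF cont_P[OF f(1)]])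
    finally show ?thesis using 1 by linarith
  qed
  moreover have "c * m > 0" using c m by simp
  ultimately show ?thesis by blast
qed

text \<open>The factor \<open>3 / s ^ (N * \<kappa>)\<close> is at most \<open>1 / 4\<close> as soon
  as \<open>s ^ \<kappa> > 12\<close>. The \<open>L1\<close> coefficient is then
  \<open>4 / 3 * c\<close>, the fixed point of the recursion that sends \<open>D\<close> to
  \<open>D / 4 + c\<close>; it does not grow with \<open>j\<close>.\<close>

lemma iterated_Lasota_Yorke:
  "\<exists>\<kappa> D. \<kappa> \<ge> 1 \<and> D \<ge> 0 \<and> (\<forall>j f v. cont f \<and> vdom f v \<and> v \<ge> 0 \<longrightarrow> vdom (P (N * (\<kappa> * j)) f) (v / 4 ^ j + D * L1 f))"
proof -
  obtain \<kappa> where \<kappa>: "12 < s ^ \<kappa>" using real_arch_pow[OF s_gt_1] by blast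
  have k1: "\<kappa> \<ge> 1" using \<kappa> by (cases \<kappa>) auto
  have "s ^ \<kappa> \<le> s ^ (N * \<kappa>)" using s_gt_1 N by (intro power_increasing) auto
  then have s12: "3 / s ^ (N * \<kappa>) \<le> 1 / 4" using \<kappa> s_pos by (simp add: field_simps)
  obtain c where c: "c \<ge> 0" "\<And>f v. cont f \<Longrightarrow> vdom f v \<Longrightarrow> vdom (P (N * \<kappa>) f) (3 / s ^ (N * \<kappa>) * v + c * L1 f)"
    using Lasota_Yorke[of "N * \<kappa>"] by auto
  have "vdom (P (N * (\<kappa> * j)) f) (v / 4 ^ j + (4 / 3 * c) * L1 f)"
    if f: "cont f" "vdom f v" "v \<ge> 0" for j f v
  proof (induction j)
    case 0
    have "vdom (P (N * (\<kappa> * 0)) f) v" using P_0 by (intro vdom_cong[OF f(2)]) auto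
    moreover have "0 \<le> c * L1 f" using c(1) L1_nonneg by simp
    ultimately show ?case by (auto intro: vdom_le)
  next
    case (Suc j)
    let ?g = "P (N * (\<kappa> * j)) f"
    let ?v = "v / 4 ^ j + (4 / 3 * c) * L1 f"
    have v0: "?v \<ge> 0" using f(3) c(1) L1_nonneg by simp
    have "vdom (P (N * \<kappa>) ?g) (3 / s ^ (N * \<kappa>) * ?v + c * L1 ?g)"
      by (rule c(2)[OF cont_P[OF f(1)] Suc])
    moreover have "3 / s ^ (N * \<kappa>) * ?v + c * L1 ?g \<le> 1 / 4 * ?v + c * L1 f"
      using s12 v0 c(1) L1_P_le[OF f(1)] by (intro add_mono mult_right_mono mult_left_mono) auto
    ultimately have "vdom (P (N * \<kappa>) ?g) (1 / 4 * ?v + c * L1 f)" by (rule vdom_le)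
    moreover have "1 / 4 * ?v + c * L1 f = v / 4 ^ Suc j + (4 / 3 * c) * L1 f"
      by (simp add: field_simps)
    moreover have "P (N * \<kappa>) ?g x = P (N * (\<kappa> * Suc j)) f x" if "x \<in> X" for x
      using P_add_exponent[OF that, of "N * \<kappa>" "N * (\<kappa> * j)" f] by (simp add: algebra_simps)
    ultimately show ?case by (metis (no_types, lifting) vdom_cong)
  qed
  then show ?thesis using k1 c(1) by (intro exI[of _ \<kappa>] exI[of _ "4 / 3 * c"]) auto
qed

text \<open>The bound \<open>K\<close> on variation and weighted \<open>L1\<close> norm is carried
  as an argument, so that no infimum over variation bounds has to be formed.\<close>

definition null :: "real \<Rightarrow> ('a \<Rightarrow> real) \<Rightarrow> real \<Rightarrow> bool" where
  "null B f K \<longleftrightarrow> cont f \<and> off f \<and> (\<integral>x. f x \<partial>\<mu>) = 0 \<and> vdom f K \<and> B * L1 f \<le> K"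

text \<open>The seminorm max(var f, B |f|) is contracted only by the second iterate: if the first
  iterate leaves the L1 part large, it has already shrunk the variation.\<close>

lemma null_contraction:
  "\<exists>B\<ge>1. \<exists>\<rho>. 0 \<le> \<rho> \<and> \<rho> < 1 \<and> (\<exists>l\<ge>1. \<forall>f K. null B f K \<longrightarrow> null B (P (N * l) f) (\<rho> * K))"
proof -
  obtain \<kappa> D where \<kappa>: "\<kappa> \<ge> 1" and D: "D \<ge> 0" and LY0: "\<forall>j f v. cont f \<and> vdom f v \<and> v \<ge> 0 \<longrightarrow>
      vdom (P (N * (\<kappa> * j)) f) (v / 4 ^ j + D * L1 f)"
    using iterated_Lasota_Yorke by (elim exE conjE)
  have LY: "vdom (P (N * (\<kappa> * j)) f) (v / 4 ^ j + D * L1 f)" if "cont f" "vdom f v" "v \<ge> 0" for j f v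
    using LY0 that by simp
  \<comment> \<open>With \<open>B > 2 * D\<close> the \<open>L1\<close> term of the inequality is at
    most \<open>K / 2\<close>; together with a quarter of the variation this gives the factor
    \<open>3 / 4\<close>.\<close>
  define B where "B = 2 * D + 1"
  have B: "B \<ge> 1" using D by (simp add: B_def)
  obtain M c where c: "c > 0" and contr0: "\<forall>f v. cont f \<and> off f \<and> (\<integral>x. f x \<partial>\<mu>) = 0 \<and> vdom f v \<and>
      v \<le> B * L1 f \<longrightarrow> (\<forall>k\<ge>M. L1 (P (N * k) f) \<le> (1 - c) * L1 f)"
    using L1_contraction[of B] by (elim exE conjE)
  have contr: "L1 (P (N * k) f) \<le> (1 - c) * L1 f"
    if "cont f" "off f" "(\<integral>x. f x \<partial>\<mu>) = 0" "vdom f v" "v \<le> B * L1 f" "k \<ge> M" for f v k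
    using spec[OF spec[OF contr0, of f], of v] that by simp
  \<comment> \<open>\<open>q = \<kappa> * m\<close> has to be at least \<open>M\<close>, for the
    \<open>L1\<close> contraction, and \<open>m\<close> at least 1, for the factor
    \<open>1 / 4\<close>.\<close>
  define m where "m = Suc M"
  define q where "q = \<kappa> * m"
  have "1 * m \<le> \<kappa> * m" using \<kappa> by (intro mult_le_mono1) simp
  then have qM: "q \<ge> M" "q \<ge> 1" unfolding q_def m_def by simp_all
  define \<rho> where "\<rho> = max (3 / 4) (1 - c)"
  have \<rho>: "0 \<le> \<rho>" "\<rho> < 1" "3 / 4 \<le> \<rho>" "1 - c \<le> \<rho>" using c by (auto simp: \<rho>_def)
  have four: "(4::real) ^ m \<ge> 4" unfolding m_def by (simp add: one_le_power)
  have step: "vdom (P (N * q) f) (3 / 4 * K)" if f: "cont f" "vdom f K" "B * L1 f \<le> K" "K \<ge> 0" for f K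
  proof -
    have "vdom (P (N * q) f) (K / 4 ^ m + D * L1 f)" unfolding q_def by (rule LY[OF f(1,2,4)])
    moreover have "K / 4 ^ m \<le> K / 4" using four f(4) by (intro divide_left_mono) auto
    moreover have "D * L1 f \<le> K / 2" using f(3) L1_nonneg[of f] by (simp add: B_def algebra_simps)
    ultimately show ?thesis by (auto intro: vdom_le)
  qed
  have "null B (P (N * (q + q)) f) (\<rho> * K)" if n: "null B f K" for f K
  proof -
    have f: "cont f" "off f" "(\<integral>x. f x \<partial>\<mu>) = 0" "vdom f K" "B * L1 f \<le> K" using n by (auto simp: null_def)
    have K: "K \<ge> 0" using f(5) B L1_nonneg[of f] by (smt (verit) mult_nonneg_nonneg)
    define g where "g = P (N * q) f"
    have g: "cont g" "off g" "(\<integral>x. g x \<partial>\<mu>) = 0" "L1 g \<le> L1 f" "vdom g (3 / 4 * K)"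
      unfolding g_def using cont_P f off_P integral_P L1_P_le step K by auto
    have gB: "B * L1 g \<le> K" using mult_left_mono[OF g(4), of B] B f(5) by linarith
    define h where "h = P (N * q) g"
    have h: "cont h" "off h" "(\<integral>x. h x \<partial>\<mu>) = 0" "L1 h \<le> L1 g"
      unfolding h_def using cont_P g off_P integral_P L1_P_le by auto
    have eq: "P (N * (q + q)) f x = h x" if "x \<in> X" for x
      using P_add_exponent[OF that, of "N * q" "N * q" f] by (simp add: h_def g_def algebra_simps)
    have vh: "vdom h (\<rho> * K)"
    proof -
      have v1: "vdom g K" using g(5) K by (auto intro: vdom_le)
      have "vdom h (3 / 4 * K)" unfolding h_def by (rule step[OF g(1) v1 gB K])
      moreover have "3 / 4 * K \<le> \<rho> * K" using \<rho> K by (intro mult_right_mono) auto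
      ultimately show ?thesis by (rule vdom_le)
    qed
    have "B * L1 h \<le> \<rho> * K"
    proof (cases "3 / 4 * K \<le> B * L1 g")
      case True
      \<comment> \<open>In this case the variation bound \<open>3 / 4 * K\<close> of
        \<open>g\<close> is at most \<open>B * L1 g\<close>, which is just the hypothesis of the
        \<open>L1\<close> contraction.\<close>
      have "L1 h \<le> (1 - c) * L1 g" unfolding h_def using contr[OF g(1,2,3,5) True qM(1)] .
      also have "\<dots> \<le> \<rho> * L1 g" using \<rho> L1_nonneg by (intro mult_right_mono) auto
      finally have "B * L1 h \<le> B * (\<rho> * L1 g)" using B by (intro mult_left_mono) auto
      also have "\<dots> = \<rho> * (B * L1 g)" by simp
      also have "\<dots> \<le> \<rho> * K" using gB \<rho> by (intro mult_left_mono) auto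
      finally show ?thesis .
    next
      case False
      have "B * L1 h \<le> B * L1 g" using h(4) B by (intro mult_left_mono) auto
      also have "\<dots> \<le> 3 / 4 * K" using False by simp
      also have "\<dots> \<le> \<rho> * K" using \<rho> K by (intro mult_right_mono) auto
      finally show ?thesis .
    qed
    then have nh: "null B h (\<rho> * K)" using h vh by (simp add: null_def)
    have 1: "cont (P (N * (q + q)) f)" "off (P (N * (q + q)) f)" "(\<integral>x. P (N * (q + q)) f x \<partial>\<mu>) = 0"
      using cont_P f off_P integral_P by auto
    have 2: "vdom (P (N * (q + q)) f) (\<rho> * K)" using vdom_cong[OF vh] eq by simp
    have 3: "L1 (P (N * (q + q)) f) = L1 h"
      unfolding L1_def using eq space by (intro Bochner_Integration.integral_cong) auto
    show ?thesis unfolding null_def using 1 2 3 \<open>B * L1 h \<le> \<rho> * K\<close> by simp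
  qed
  moreover have "q + q \<ge> 1" using qM by simp
  ultimately show ?thesis using B \<rho> by blast
qed

lemma null_sup: assumes "null B f K" "B \<ge> 1" "x \<in> X" shows "\<bar>f x\<bar> \<le> 2 * K"
proof -
  have n: "cont f" "vdom f K" "B * L1 f \<le> K" using assms by (auto simp: null_def)
  have "L1 f \<le> B * L1 f" using assms(2) L1_nonneg[of f] by (simp add: mult_le_cancel_right1)
  then show ?thesis using sup_le[OF n(1,2) assms(3)] n(3) by linarith
qed

lemma null_exI: assumes "cont f" "off f" "(\<integral>x. f x \<partial>\<mu>) = 0" "vdom f v" shows "\<exists>K\<ge>0. null B f K"
proof (intro exI[of _ "\<bar>v\<bar> + \<bar>B * L1 f\<bar>"] conjI)
  show "null B f (\<bar>v\<bar> + \<bar>B * L1 f\<bar>)"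
    unfolding null_def using assms by (auto intro: vdom_le)
qed simp

lemma P_add_fun: "P j (P k f) x = P (j + k) f x" if "x \<in> X"
  using P_add_exponent[OF that] by simp

lemma P_sup: assumes "\<And>y. y \<in> X \<Longrightarrow> \<bar>f y\<bar> \<le> b" shows "\<bar>P k f x\<bar> \<le> b * P k (\<lambda>_. 1) x"
proof -
  have "\<bar>P k f x\<bar> \<le> P k (\<lambda>y. \<bar>f y\<bar>) x" by (rule P_abs)
  also have "\<dots> \<le> P k (\<lambda>y. b * 1) x" using assms by (intro P_mono) auto
  also have "\<dots> = b * P k (\<lambda>_. 1) x" by (rule P_cmult)
  finally show ?thesis .
qed

lemma P_one_bounded: "\<exists>b\<ge>0. \<forall>x\<in>X. P k (\<lambda>_. 1) x \<le> b"
proof -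
  have "cont (P k (\<lambda>_. 1))" by (rule cont_P) simp
  then obtain b where "\<forall>x\<in>X. \<bar>P k (\<lambda>_. 1) x\<bar> \<le> b" using cont_bounded by blast
  then show ?thesis by (intro exI[of _ "\<bar>b\<bar>"]) force
qed

lemma vdom_limit:
  assumes f: "\<And>j. vdom (f j) v" and lim: "\<And>x. x \<in> X \<Longrightarrow> (\<lambda>j. f j x) \<longlonglongrightarrow> g x"
  shows "\<exists>v. vdom g v"
proof -
  have "chain_bounded g v" unfolding chain_bounded_def
  proof (intro allI impI)
    fix m :: nat and x assume x: "(\<forall>i\<le>m. x i \<in> X) \<and> (\<forall>i\<in>{1..m}. x (i - 1) < x i)"
    have "(\<lambda>j. \<Sum>i=1..m. \<bar>f j (x i) - f j (x (i - 1))\<bar>) \<longlonglongrightarrow> (\<Sum>i=1..m. \<bar>g (x i) - g (x (i - 1))\<bar>)"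
    proof (intro tendsto_sum tendsto_rabs tendsto_diff lim)
      fix i assume i: "i \<in> {1..m}"
      then have "i - 1 \<le> m" by auto
      then show "x (i - 1) \<in> X" "x i \<in> X" using x i by auto
    qed
    moreover have "(\<Sum>i=1..m. \<bar>f j (x i) - f j (x (i - 1))\<bar>) \<le> v" for j
      using vdom_imp_chain_bounded[OF f[of j]] x unfolding chain_bounded_def by blast
    ultimately show "(\<Sum>i=1..m. \<bar>g (x i) - g (x (i - 1))\<bar>) \<le> v"
      using LIMSEQ_le_const2 by blast
  qed
  then show ?thesis using chain_bounded_imp_vdom by blast
qed

lemma uniform_limit_cont:
  assumes f: "\<And>j. cont (f j)" and b: "\<And>j x. x \<in> X \<Longrightarrow> \<bar>f j x - g x\<bar> \<le> e j" and e: "e \<longlonglongrightarrow> 0"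
  shows "cont g"
proof -
  have "continuous_map T Met_TC.mtopology g"
  proof (rule Met_TC.continuous_map_uniform_limit)
    show "\<forall>\<^sub>F j in sequentially. continuous_map T Met_TC.mtopology (f j)" using f by simp
    show "\<forall>\<^sub>F j in sequentially. \<forall>x\<in>X. g x \<in> UNIV \<and> dist (f j x) (g x) < \<epsilon>" if "0 < \<epsilon>" for \<epsilon>
    proof -
      have "\<forall>\<^sub>F j in sequentially. e j < \<epsilon>" using e that by (rule order_tendstoD)
      then show ?thesis
      proof eventually_elim
        case (elim j)
        show ?case
        proof
          fix x assume "x \<in> X"
          then show "g x \<in> UNIV \<and> dist (f j x) (g x) < \<epsilon>" using b[of x j] elim by (simp add: dist_real_def)
        qed
      qed
    qed
  qed simp
  then show ?thesis by simp
qed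

text \<open>Successive iterates of the indicator of \<open>A\<close> differ by images of one
  mean-zero function, so they converge geometrically; the normalized limit is the density.
  Subtracting from \<open>f\<close> its integral times the density leaves a mean-zero function,
  which is contracted to 0.\<close>

theorem invariant_density:
  "\<exists>\<phi>. cont \<phi> \<and> (\<exists>v. vdom \<phi> v) \<and> off \<phi> \<and> (\<forall>x\<in>A. \<phi> x > 0) \<and> (\<integral>x. \<phi> x \<partial>\<mu>) = 1 \<and>
     (\<forall>k. \<forall>x\<in>X. P (N * k) \<phi> x = \<phi> x) \<and>
     (\<forall>f. cont f \<and> (\<exists>v. vdom f v) \<and> off f \<longrightarrow>
        uniform_limit X (\<lambda>k. P (N * k) f) (\<lambda>x. (\<integral>y. f y \<partial>\<mu>) * \<phi> x) sequentially)"
proof -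
  obtain B \<rho> l where B: "B \<ge> 1" and \<rho>: "0 \<le> \<rho>" "\<rho> < 1" and l: "l \<ge> 1"
    and contr0: "\<forall>f K. null B f K \<longrightarrow> null B (P (N * l) f) (\<rho> * K)"
    using null_contraction by (elim exE conjE)
  define R where "R j = P (N * (l * j))" for j
  have R_add: "R i (R j f) x = R (i + j) f x" if "x \<in> X" for i j f x
    unfolding R_def P_add_fun[OF that] by (simp add: algebra_simps)
  have R_P: "R i (P (N * j) f) x = P (N * (l * i + j)) f x" if "x \<in> X" for i j f x
    unfolding R_def P_add_fun[OF that] by (simp add: algebra_simps)
  have null_cong: "null B g K" if "null B f K" "\<And>x. x \<in> X \<Longrightarrow> f x = g x" for f g K
  proof -
    have n: "cont f" "off f" "(\<integral>x. f x \<partial>\<mu>) = 0" "vdom f K" "B * L1 f \<le> K" using that(1) by (auto simp: null_def)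
    have "cont g" using n(1) that(2) continuous_map_eq by blast
    moreover have "off g" using n(2) that(2) by (simp add: off_def)
    moreover have "(\<integral>x. g x \<partial>\<mu>) = (\<integral>x. f x \<partial>\<mu>)"
      using that(2) space by (intro Bochner_Integration.integral_cong) auto
    moreover have "L1 g = L1 f" unfolding L1_def
      using that(2) space by (intro Bochner_Integration.integral_cong) auto
    ultimately show ?thesis using n vdom_cong[OF n(4) that(2)] by (simp add: null_def)
  qed
  have nullR: "null B (R j f) (\<rho> ^ j * K)" if "null B f K" for j f K
  proof (induction j)
    case 0
    have "null B (R 0 f) K" by (rule null_cong[OF that]) (simp add: R_def P_0)
    then show ?case by simp
  next
    case (Suc j)
    have "null B (P (N * l) (R j f)) (\<rho> * (\<rho> ^ j * K))" using contr0 Suc by blast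
    then have "null B (R (Suc j) f) (\<rho> * (\<rho> ^ j * K))"
    proof (rule null_cong)
      show "P (N * l) (R j f) x = R (Suc j) f x" if "x \<in> X" for x
        using R_add[OF that, of 1 j f] by (simp add: R_def)
    qed
    then show ?case by (simp add: mult.assoc)
  qed
  have supR: "\<bar>R j f x\<bar> \<le> 2 * (\<rho> ^ j * K)" if "null B f K" "x \<in> X" for j f K x
    using null_sup[OF nullR[OF that(1)] B that(2)] .
  have rho_lim: "(\<lambda>j. c * \<rho> ^ j) \<longlonglongrightarrow> 0" for c
    using tendsto_mult_right_zero[OF LIMSEQ_power_zero[of \<rho>]] \<rho> by simp
  define I where "I = indicat_real A"
  have cI: "cont I" unfolding I_def using cont_indicator A_open A_closed by blast
  have offI: "off I" by (simp add: off_def I_def)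
  obtain vI where vI: "vdom I vI" using vdom_indicator[OF A_open A_closed] I_def by auto
  have cR: "cont (R j I)" for j unfolding R_def by (rule cont_P[OF cI])
  obtain \<kappa> D where LY0: "\<forall>j f v. cont f \<and> vdom f v \<and> v \<ge> 0 \<longrightarrow>
      vdom (P (N * (\<kappa> * j)) f) (v / 4 ^ j + D * L1 f)" and D: "D \<ge> 0" and k1: "\<kappa> \<ge> 1"
    using iterated_Lasota_Yorke by (elim exE conjE)
  obtain v1 where v1: "vdom (\<lambda>x. R 1 I x - I x) v1"
  proof -
    obtain c where "\<forall>f v. cont f \<and> vdom f v \<longrightarrow> vdom (P (N * (l * 1)) f) (3 / s ^ (N * (l * 1)) * v + c * L1 f)"
      using Lasota_Yorke by meson
    then have "vdom (R 1 I) (3 / s ^ (N * (l * 1)) * vI + c * L1 I)" using cI vI unfolding R_def by blast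
    from vdom_add[OF this vdom_cmult[OF vI, of "-1"]] show thesis using that by simp
  qed
  have "\<exists>K\<ge>0. null B (\<lambda>x. R 1 I x - I x) K"
  proof (rule null_exI[OF _ _ _ v1])
    show "cont (\<lambda>x. R 1 I x - I x)" by (intro continuous_map_diff cR cI)
    show "off (\<lambda>x. R 1 I x - I x)" using off_P[OF offI, of "l * 1"] offI by (simp add: off_def R_def)
    show "(\<integral>x. R 1 I x - I x \<partial>\<mu>) = 0"
      using Bochner_Integration.integral_diff[OF cont_integrable[OF cR[of 1]] cont_integrable[OF cI]]
        integral_P[OF cI] by (simp add: R_def)
  qed
  then obtain K where K: "K \<ge> 0" "null B (\<lambda>x. R 1 I x - I x) K" by auto
  have diff: "\<bar>R (Suc j) I x - R j I x\<bar> \<le> 2 * K * \<rho> ^ j" if "x \<in> X" for j x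
  proof -
    have "R j (\<lambda>x. R 1 I x - I x) x = R j (R 1 I) x - R j I x" unfolding R_def by (rule P_diff)
    then show ?thesis using supR[OF K(2) that, of j] R_add[OF that, of j 1 I] by (simp add: mult_ac)
  qed
  have summ: "summable (\<lambda>j. 2 * K * \<rho> ^ j)" using \<rho> by (intro summable_mult summable_geometric) auto
  have tel: "R j I x = I x + (\<Sum>i<j. R (Suc i) I x - R i I x)" if "x \<in> X" for j x
    using sum_lessThan_telescope[of "\<lambda>i. R i I x" j] P_0[OF that, of I] by (simp add: R_def)
  \<comment> \<open>The limit of the iterates \<open>R j I\<close>, written as a telescoping series
    so that convergence and its rate come from \<open>diff\<close>.\<close>
  define \<psi> where "\<psi> x = I x + (\<Sum>i. R (Suc i) I x - R i I x)" for x
  define e where "e j = 2 * K / (1 - \<rho>) * \<rho> ^ j" for j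
  have elim: "e \<longlonglongrightarrow> 0" unfolding e_def by (rule rho_lim)
  have close: "\<bar>R j I x - \<psi> x\<bar> \<le> e j" if x: "x \<in> X" for j x
  proof -
    let ?d = "\<lambda>i. R (Suc i) I x - R i I x"
    have sd: "summable ?d" by (rule summable_comparison_test'[OF summ, of 0]) (use diff[OF x] in auto)
    have "\<psi> x - R j I x = (\<Sum>i. ?d (i + j))"
      using suminf_minus_initial_segment[OF sd, of j] tel[OF x, of j] by (simp add: \<psi>_def)
    also have "\<bar>\<dots>\<bar> \<le> (\<Sum>i. 2 * K * \<rho> ^ j * \<rho> ^ i)"
    proof -
      have s2: "summable (\<lambda>i. 2 * K * \<rho> ^ j * \<rho> ^ i)" using \<rho> by (intro summable_mult summable_geometric) auto
      have le: "norm (?d (i + j)) \<le> 2 * K * \<rho> ^ j * \<rho> ^ i" for i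
        using diff[OF x, of "i + j"] by (simp add: power_add mult_ac)
      show ?thesis unfolding real_norm_def[symmetric] by (rule norm_suminf_le[OF le s2])
    qed
    also have "\<dots> = 2 * K * \<rho> ^ j * (1 / (1 - \<rho>))"
      using \<rho> by (subst suminf_mult) (auto simp: suminf_geometric intro: summable_geometric)
    finally show ?thesis by (simp add: e_def abs_minus_commute)
  qed
  have c\<psi>: "cont \<psi>" using uniform_limit_cont[OF cR close elim] .
  have lim\<psi>: "(\<lambda>j. R j I x) \<longlonglongrightarrow> \<psi> x" if "x \<in> X" for x
  proof -
    have "\<forall>\<^sub>F j in sequentially. norm (R j I x - \<psi> x) \<le> e j" using close[OF that] by simp
    from Lim_null_comparison[OF this elim] show ?thesis by (rule LIM_zero_cancel)
  qed
  have off\<psi>: "off \<psi>" unfolding off_def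
  proof
    fix x assume x: "x \<in> X - A"
    have "R j I x = 0" for j using off_P[OF offI, of "l * j"] x by (simp add: R_def off_def)
    then show "\<psi> x = 0" using lim\<psi>[of x] x by (simp add: LIMSEQ_const_iff)
  qed
  have \<psi>0: "\<psi> x \<ge> 0" if "x \<in> X" for x
    by (rule LIMSEQ_le_const[OF lim\<psi>[OF that]]) (auto simp: R_def I_def intro!: P_nonneg)
  have int\<psi>: "(\<integral>x. \<psi> x \<partial>\<mu>) = measure \<mu> A"
  proof -
    have "\<bar>measure \<mu> A - (\<integral>x. \<psi> x \<partial>\<mu>)\<bar> \<le> e j" for j
    proof -
      have "measure \<mu> A - (\<integral>x. \<psi> x \<partial>\<mu>) = (\<integral>x. R j I x - \<psi> x \<partial>\<mu>)"
        using Bochner_Integration.integral_diff[OF cont_integrable[OF cR] cont_integrable[OF c\<psi>]]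
          integral_P[OF cI] integral_indicator[OF A_open] by (simp add: R_def I_def)
      also have "\<bar>\<dots>\<bar> \<le> L1 (\<lambda>x. R j I x - \<psi> x)" unfolding L1_def by (rule integral_abs_bound)
      also have "\<dots> \<le> (\<integral>x. e j \<partial>\<mu>)" unfolding L1_def
        by (intro integral_mono_cont cont_abs continuous_map_diff cR c\<psi> close) auto
      finally show ?thesis using integral_const by simp
    qed
    then have "\<bar>measure \<mu> A - (\<integral>x. \<psi> x \<partial>\<mu>)\<bar> \<le> 0" using LIMSEQ_le_const[OF elim] by blast
    then show ?thesis by simp
  qed
  have "\<exists>v. vdom \<psi> v"
  proof (rule vdom_limit)
    \<comment> \<open>A variation bound uniform in \<open>j\<close> is available along multiples of
      \<open>\<kappa>\<close>; such a subsequence is enough to pass it to the limit.\<close>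
    have "vdom (R (\<kappa> * j) I) (\<bar>vI\<bar> + D * L1 I)" for j
    proof -
      have "vdom I \<bar>vI\<bar>" using vI by (auto intro: vdom_le)
      then have "vdom (P (N * (\<kappa> * (l * j))) I) (\<bar>vI\<bar> / 4 ^ (l * j) + D * L1 I)" using LY0 cI by auto
      moreover have "\<bar>vI\<bar> / 4 ^ (l * j) \<le> \<bar>vI\<bar> / 1" by (intro divide_left_mono) auto
      ultimately have "vdom (P (N * (\<kappa> * (l * j))) I) (\<bar>vI\<bar> + D * L1 I)" by (auto intro: vdom_le)
      then show ?thesis by (simp add: R_def mult_ac)
    qed
    then show "vdom (R (\<kappa> * j) I) (\<bar>vI\<bar> + D * L1 I)" for j .
    have "strict_mono (\<lambda>j. \<kappa> * j)" using k1 by (simp add: strict_mono_def)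
    then show "(\<lambda>j. R (\<kappa> * j) I x) \<longlonglongrightarrow> \<psi> x" if "x \<in> X" for x
      using LIMSEQ_subseq_LIMSEQ[OF lim\<psi>[OF that]] by (simp add: o_def)
  qed
  then obtain v\<psi> where v\<psi>: "vdom \<psi> v\<psi>" by auto
  have R\<psi>: "R 1 \<psi> x = \<psi> x" if x: "x \<in> X" for x
  proof -
    \<comment> \<open>The image of the constant 1 bounds \<open>R 1\<close> in the supremum norm, so
      invariance survives the uniform limit.\<close>
    obtain b where b: "b \<ge> 0" "\<forall>x\<in>X. P (N * (l * 1)) (\<lambda>_. 1) x \<le> b" using P_one_bounded by blast
    have "\<bar>R (Suc j) I x - R 1 \<psi> x\<bar> \<le> b * e j" for j
    proof -
      have "R (Suc j) I x - R 1 \<psi> x = R 1 (\<lambda>x. R j I x - \<psi> x) x"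
        using R_add[OF x, of 1 j I] P_diff[of _ "R j I" \<psi>] by (simp add: R_def)
      also have "\<bar>\<dots>\<bar> \<le> e j * P (N * (l * 1)) (\<lambda>_. 1) x" unfolding R_def
        by (rule P_sup) (use close in \<open>auto simp: R_def\<close>)
      also have "\<dots> \<le> e j * b" using b x K(1) \<rho> by (intro mult_left_mono) (auto simp: e_def)
      finally show ?thesis by (simp add: mult.commute)
    qed
    then have "\<forall>\<^sub>F j in sequentially. norm (R (Suc j) I x - R 1 \<psi> x) \<le> b * e j" by simp
    from Lim_null_comparison[OF this tendsto_mult_right_zero[OF elim]]
    have "(\<lambda>j. R (Suc j) I x) \<longlonglongrightarrow> R 1 \<psi> x" by (rule LIM_zero_cancel)
    moreover have "(\<lambda>j. R (Suc j) I x) \<longlonglongrightarrow> \<psi> x" using lim\<psi>[OF x] by (rule LIMSEQ_Suc)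
    ultimately show ?thesis by (rule LIMSEQ_unique)
  qed
  have Rj\<psi>: "R j \<psi> x = \<psi> x" if "x \<in> X" for j x
    using that
  proof (induction j arbitrary: x)
    case (Suc j)
    have "R (Suc j) \<psi> x = R 1 (R j \<psi>) x" using R_add[OF Suc.prems, of 1 j \<psi>] by simp
    also have "\<dots> = R 1 \<psi> x" unfolding R_def[of 1] by (rule P_cong) (use Suc.IH in auto)
    finally show ?case using R\<psi>[OF Suc.prems] by simp
  qed (simp add: R_def P_0)
  have P\<psi>: "P (N * k) \<psi> x = \<psi> x" if x: "x \<in> X" for k x
  proof -
    \<comment> \<open>So far \<open>\<psi>\<close> is invariant only at multiples of
      \<open>N * l\<close>. For other multiples of \<open>N\<close>, the difference
      \<open>?g\<close> has mean zero and is fixed by every \<open>R j\<close>, because these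
      commute with \<open>P (N * k)\<close>; the contraction forces it to vanish.\<close>
    let ?g = "\<lambda>x. P (N * k) \<psi> x - \<psi> x"
    obtain c where "\<forall>f v. cont f \<and> vdom f v \<longrightarrow> vdom (P (N * k) f) (3 / s ^ (N * k) * v + c * L1 f)"
      using Lasota_Yorke by meson
    then have "vdom (P (N * k) \<psi>) (3 / s ^ (N * k) * v\<psi> + c * L1 \<psi>)" using c\<psi> v\<psi> by blast
    from vdom_add[OF this vdom_cmult[OF v\<psi>, of "-1"]]
    have v: "vdom ?g (3 / s ^ (N * k) * v\<psi> + c * L1 \<psi> + \<bar>-1\<bar> * v\<psi>)" by simp
    have "\<exists>K\<ge>0. null B ?g K"
    proof (rule null_exI[OF _ _ _ v])
      show "cont ?g" by (intro continuous_map_diff cont_P c\<psi>)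
      show "off ?g" using off_P[OF off\<psi>] off\<psi> by (simp add: off_def)
      show "(\<integral>x. ?g x \<partial>\<mu>) = 0"
        using Bochner_Integration.integral_diff[OF cont_integrable[OF cont_P[OF c\<psi>]] cont_integrable[OF c\<psi>]]
          integral_P[OF c\<psi>] by simp
    qed
    then obtain K' where K': "null B ?g K'" by auto
    have "R j ?g x = ?g x" for j
    proof -
      have "R j ?g x = R j (P (N * k) \<psi>) x - R j \<psi> x" unfolding R_def by (rule P_diff)
      also have "R j (P (N * k) \<psi>) x = P (N * k) (R j \<psi>) x"
        unfolding R_def P_add_fun[OF x] by (simp add: add.commute)
      also have "\<dots> = P (N * k) \<psi> x" by (rule P_cong) (rule Rj\<psi>)
      finally show ?thesis using Rj\<psi>[OF x] by simp
    qed
    then have "\<bar>?g x\<bar> \<le> (2 * K') * \<rho> ^ j" for j using supR[OF K' x, of j] by (simp add: mult_ac)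
    then have "\<bar>?g x\<bar> \<le> 0" using LIMSEQ_le_const[OF rho_lim[of "2 * K'"]] by blast
    then show ?thesis by simp
  qed
  have \<psi>pos: "\<psi> x > 0" if x: "x \<in> A" for x
  proof -
    have mA: "measure \<mu> A > 0" using measure_clopen_pos A_open A_closed A_ne by simp
    \<comment> \<open>As \<open>\<psi>\<close> is fixed by \<open>P (N * M)\<close>, a lower bound
      for its image is one for \<open>\<psi>\<close> itself; the constant is chosen to turn the
      hypothesis on the variation into an equality.\<close>
    obtain M c where c: "c > 0" and lb0: "\<forall>f v. cont f \<and> (\<forall>x\<in>X. f x \<ge> 0) \<and> off f \<and> vdom f v \<and>
      v \<le> (v\<psi> / measure \<mu> A) * (\<integral>x. f x \<partial>\<mu>) \<longrightarrow> (\<forall>x\<in>A. P (N * M) f x \<ge> c * (\<integral>x. f x \<partial>\<mu>))"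
      using lower_bound[of "v\<psi> / measure \<mu> A"] by (elim exE conjE)
    have "v\<psi> \<le> (v\<psi> / measure \<mu> A) * (\<integral>x. \<psi> x \<partial>\<mu>)" using mA int\<psi> by simp
    then have "P (N * M) \<psi> x \<ge> c * (\<integral>x. \<psi> x \<partial>\<mu>)"
      using spec[OF spec[OF lb0, of \<psi>], of v\<psi>] c\<psi> \<psi>0 off\<psi> v\<psi> x by simp
    moreover have "P (N * M) \<psi> x = \<psi> x" using P\<psi> x A_X by blast
    moreover have "c * (\<integral>x. \<psi> x \<partial>\<mu>) > 0" using c int\<psi> mA by simp
    ultimately show ?thesis by linarith
  qed
  have mA: "measure \<mu> A > 0" using measure_clopen_pos A_open A_closed A_ne by simp
  define \<phi> where "\<phi> x = (1 / measure \<mu> A) * \<psi> x" for x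
  have c\<phi>: "cont \<phi>" unfolding \<phi>_def using c\<psi> by (intro continuous_map_real_mult) auto
  have v\<phi>: "vdom \<phi> (\<bar>1 / measure \<mu> A\<bar> * v\<psi>)" unfolding \<phi>_def by (rule vdom_cmult[OF v\<psi>])
  have off\<phi>: "off \<phi>" using off\<psi> by (simp add: off_def \<phi>_def)
  have int\<phi>: "(\<integral>x. \<phi> x \<partial>\<mu>) = 1" using int\<psi> mA by (simp add: \<phi>_def)
  have P\<phi>: "P (N * k) \<phi> x = \<phi> x" if "x \<in> X" for k x
    unfolding \<phi>_def P_cmult P\<psi>[OF that] ..
  have "uniform_limit X (\<lambda>k. P (N * k) f) (\<lambda>x. (\<integral>y. f y \<partial>\<mu>) * \<phi> x) sequentially"
    if f: "cont f" "vdom f v" "off f" for f v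
  proof -
    define m where "m = (\<integral>y. f y \<partial>\<mu>)"
    let ?g = "\<lambda>x. f x - m * \<phi> x"
    have cm: "cont (\<lambda>x. m * \<phi> x)" using c\<phi> by (intro continuous_map_real_mult) auto
    have cg: "cont ?g" by (intro continuous_map_diff f(1) cm)
    have offg: "off ?g" using f(3) off\<phi> by (simp add: off_def)
    have intg: "(\<integral>x. ?g x \<partial>\<mu>) = 0"
      using Bochner_Integration.integral_diff[OF cont_integrable[OF f(1)] cont_integrable[OF cm]] int\<phi>
      by (simp add: m_def)
    obtain vg where vg: "vdom ?g vg"
      using vdom_add[OF f(2) vdom_cmult[OF v\<phi>, of "- m"]] by auto
    \<comment> \<open>The contraction acts at multiples of \<open>l\<close>. Writing
      \<open>k\<close> with quotient and remainder modulo \<open>l\<close>, bounds for the finitely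
      many remainders suffice.\<close>
    have "\<exists>K. null B (P (N * i) ?g) K" for i
    proof -
      obtain c where "\<forall>f v. cont f \<and> vdom f v \<longrightarrow> vdom (P (N * i) f) (3 / s ^ (N * i) * v + c * L1 f)"
        using Lasota_Yorke by meson
      then have v: "vdom (P (N * i) ?g) (3 / s ^ (N * i) * vg + c * L1 ?g)" using cg vg by blast
      have "(\<integral>x. P (N * i) ?g x \<partial>\<mu>) = 0" using integral_P[OF cg] intg by simp
      then show ?thesis using null_exI[OF cont_P[OF cg] off_P[OF offg] _ v] by blast
    qed
    then obtain Kf where Kf: "\<And>i. null B (P (N * i) ?g) (Kf i)" by metis
    define K' where "K' = (\<Sum>i<l. \<bar>Kf i\<bar>)"
    have bound: "\<bar>P (N * k) f x - m * \<phi> x\<bar> \<le> 2 * K' * \<rho> ^ (k div l)" if x: "x \<in> X" for k x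
    proof -
      have "P (N * k) ?g x = R (k div l) (P (N * (k mod l)) ?g) x" using R_P[OF x] by simp
      then have "\<bar>P (N * k) ?g x\<bar> \<le> 2 * (\<rho> ^ (k div l) * Kf (k mod l))" using supR[OF Kf x] by simp
      also have "\<dots> \<le> 2 * (\<rho> ^ (k div l) * K')"
      proof -
        have "Kf (k mod l) \<le> \<bar>Kf (k mod l)\<bar>" by simp
        also have "\<dots> \<le> K'" unfolding K'_def using l by (intro member_le_sum) auto
        finally show ?thesis using \<rho> by (intro mult_left_mono) auto
      qed
      finally have "\<bar>P (N * k) ?g x\<bar> \<le> 2 * K' * \<rho> ^ (k div l)" by (simp add: mult_ac)
      moreover have "P (N * k) ?g x = P (N * k) f x - m * \<phi> x"
        unfolding P_diff P_cmult P\<phi>[OF x] ..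
      ultimately show ?thesis by simp
    qed
    have lim0: "(\<lambda>k. 2 * K' * \<rho> ^ (k div l)) \<longlonglongrightarrow> 0"
    proof -
      have "filterlim (\<lambda>k. k div l) at_top sequentially"
        unfolding filterlim_at_top
      proof
        fix Z
        show "\<forall>\<^sub>F k in sequentially. Z \<le> k div l"
          using eventually_ge_at_top[of "Z * l"]
        proof eventually_elim
          case (elim k)
          then have "Z * l div l \<le> k div l" by (rule div_le_mono)
          then show ?case using l by simp
        qed
      qed
      from filterlim_compose[OF rho_lim[of "2 * K'"] this] show ?thesis .
    qed
    show ?thesis
    proof (rule uniform_limitI)
      fix \<epsilon> :: real assume "\<epsilon> > 0"
      then have "\<forall>\<^sub>F k in sequentially. 2 * K' * \<rho> ^ (k div l) < \<epsilon>" using lim0 order_tendstoD by blast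
      then show "\<forall>\<^sub>F k in sequentially. \<forall>x\<in>X. dist (P (N * k) f x) ((\<integral>y. f y \<partial>\<mu>) * \<phi> x) < \<epsilon>"
      proof eventually_elim
        case (elim k)
        then show ?case using bound[of _ k] unfolding m_def dist_real_def by (meson le_less_trans)
      qed
    qed
  qed
  moreover have "\<phi> x > 0" if "x \<in> A" for x using \<psi>pos[OF that] mA by (simp add: \<phi>_def)
  ultimately show ?thesis
    using c\<phi> v\<phi> off\<phi> int\<phi> P\<phi> by (intro exI[of _ \<phi>] conjI allI impI ballI) auto
qed

end

section \<open>Densities on all members of the partition\<close>

context scaled_system
begin

lemma transfer_funpow:
  assumes "x \<in> X" shows "(transfer T \<sigma> ^^ k) f x = transfer T (\<sigma> ^^ k) f x"
  using assms
proof (induction k arbitrary: x)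
  case 0
  have "{y \<in> X. y = x} = {x}" using 0 by auto
  then show ?case by (simp add: transfer_def)
next
  case (Suc k)
  have "(transfer T \<sigma> ^^ Suc k) f x = transfer T \<sigma> ((transfer T \<sigma> ^^ k) f) x" by simp
  also have "\<dots> = transfer T \<sigma> (transfer T (\<sigma> ^^ k) f) x" using Suc.IH by (rule transfer_cong)
  also have "\<dots> = transfer T (\<sigma> ^^ Suc k) f x" using transfer_comp[OF pmono_funpow pmono, of k f x] by simp
  finally show ?case .
qed

lemma normalized_transfer_funpow:
  assumes "x \<in> X"
  shows "((\<lambda>h x. (1 / s ^ N) * (transfer T \<sigma> ^^ N) h x) ^^ k) f x = P (N * k) f x"
  using assms
proof (induction k arbitrary: x)
  case 0
  then show ?case by (simp add: P_0)
next
  case (Suc k)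
  let ?Q = "\<lambda>h x. (1 / s ^ N) * (transfer T \<sigma> ^^ N) h x"
  have "(?Q ^^ Suc k) f x = P N ((?Q ^^ k) f) x"
    using transfer_funpow[OF Suc.prems] by (simp add: P_def)
  also have "\<dots> = P N (P (N * k) f) x" using Suc.IH by (rule P_cong)
  also have "\<dots> = P (N * Suc k) f x" using P_add_exponent[OF Suc.prems, of N "N * k" f] by simp
  finally show ?case .
qed

lemma exact_piece_cyclic:
  assumes ecp: "exact_cyclic_partition T \<sigma> N Y" and i: "i \<in> {1..N}"
  shows "exact_piece T \<sigma> \<C> \<mu> s N (Y i)"
proof unfold_locales
  show "N \<ge> 1" "openin T (Y i)" "closedin T (Y i)" "Y i \<noteq> {}"
    using ecp i by (auto simp: exact_cyclic_partition_def)
  show "(\<sigma> ^^ (N * k)) ` Y i = Y i" for k by (rule cyclic_partition_funpow[OF ecp i])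
  show "\<exists>K. \<forall>k\<ge>K. (\<sigma> ^^ (N * k)) ` V = Y i" if "openin T V" "V \<noteq> {}" "V \<subseteq> Y i" for V
    by (rule exact_cyclic_partition_exactD[OF ecp i that])
qed

theorem cyclic_densities:
  assumes ecp: "exact_cyclic_partition T \<sigma> N Y"
  shows "\<exists>\<phi>. \<forall>i\<in>{1..N}. cont (\<phi> i) \<and> (\<exists>v. vdom (\<phi> i) v) \<and> supp T (\<phi> i) = Y i \<and>
    (\<forall>x\<in>Y i. \<phi> i x > 0) \<and>
    (\<forall>f. cont f \<and> (\<exists>v. vdom f v) \<and> supp T f \<subseteq> Y i \<longrightarrow>
      uniform_limit X (\<lambda>k. ((\<lambda>h x. (1 / s ^ N) * (transfer T \<sigma> ^^ N) h x) ^^ k) f)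
        (\<lambda>x. (\<integral>y. f y \<partial>\<mu>) * \<phi> i x) sequentially) \<and>
    (\<forall>x\<in>X. (1 / s) * transfer T \<sigma> (\<phi> i) x = \<phi> (i mod N + 1) x)"
proof -
  define good where "good i \<phi> \<longleftrightarrow> cont \<phi> \<and> (\<exists>v. vdom \<phi> v) \<and> (\<forall>x\<in>X - Y i. \<phi> x = 0) \<and> (\<forall>x\<in>Y i. \<phi> x > 0) \<and>
     (\<integral>x. \<phi> x \<partial>\<mu>) = 1 \<and> (\<forall>k. \<forall>x\<in>X. P (N * k) \<phi> x = \<phi> x) \<and>
     (\<forall>f. cont f \<and> (\<exists>v. vdom f v) \<and> (\<forall>x\<in>X - Y i. f x = 0) \<longrightarrow>
        uniform_limit X (\<lambda>k. P (N * k) f) (\<lambda>x. (\<integral>y. f y \<partial>\<mu>) * \<phi> x) sequentially)" for i \<phi>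
  have "\<exists>\<phi>. good i \<phi>" if i: "i \<in> {1..N}" for i
  proof -
    interpret E: exact_piece T \<sigma> \<C> \<mu> s N "Y i" by (rule exact_piece_cyclic[OF ecp i])
    show ?thesis using E.invariant_density unfolding good_def E.off_def .
  qed
  then obtain \<phi> where good: "\<And>i. i \<in> {1..N} \<Longrightarrow> good i (\<phi> i)" by metis
  note g = good[unfolded good_def]
  have N: "N \<ge> 1" and Yc: "\<And>i. i \<in> {1..N} \<Longrightarrow> closedin T (Y i)"
    and step: "\<And>i. i \<in> {1..N} \<Longrightarrow> \<sigma> ` Y i = Y (i mod N + 1)"
    using ecp by (auto simp: exact_cyclic_partition_def)
  show ?thesis
  proof (intro exI[of _ \<phi>] ballI conjI allI impI)
    fix i assume i: "i \<in> {1..N}"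
    show "cont (\<phi> i)" "\<exists>v. vdom (\<phi> i) v" using g[OF i] by blast+
    show "\<phi> i x > 0" if "x \<in> Y i" for x using g[OF i] that by blast
    have YX: "Y i \<subseteq> X" using closedin_subset[OF Yc[OF i]] .
    have "{x \<in> X. \<phi> i x \<noteq> 0} = Y i"
    proof
      show "{x \<in> X. \<phi> i x \<noteq> 0} \<subseteq> Y i" using g[OF i] by blast
      show "Y i \<subseteq> {x \<in> X. \<phi> i x \<noteq> 0}" using g[OF i] YX by fastforce
    qed
    then show "supp T (\<phi> i) = Y i" using Yc[OF i] by (simp add: supp_def closure_of_closedin)
    show "uniform_limit X (\<lambda>k. ((\<lambda>h x. (1 / s ^ N) * (transfer T \<sigma> ^^ N) h x) ^^ k) f)
        (\<lambda>x. (\<integral>y. f y \<partial>\<mu>) * \<phi> i x) sequentially"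
      if f: "cont f \<and> (\<exists>v. vdom f v) \<and> supp T f \<subseteq> Y i" for f
    proof -
      have "{x \<in> X. f x \<noteq> 0} \<subseteq> supp T f" unfolding supp_def by (rule closure_of_subset) blast
      then have "\<forall>x\<in>X - Y i. f x = 0" using f by blast
      then have "uniform_limit X (\<lambda>k. P (N * k) f) (\<lambda>x. (\<integral>y. f y \<partial>\<mu>) * \<phi> i x) sequentially"
        using g[OF i] f by blast
      moreover have "((\<lambda>h x. (1 / s ^ N) * (transfer T \<sigma> ^^ N) h x) ^^ k) f x = P (N * k) f x"
        if "x \<in> X" for k x by (rule normalized_transfer_funpow[OF that])
      ultimately show ?thesis by (simp cong: uniform_limit_cong')
    qed
    let ?j = "i mod N + 1"
    have j: "?j \<in> {1..N}" using N by (simp add: Suc_le_eq)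
    \<comment> \<open>\<open>h\<close> vanishes off the next member, has integral 1 and is fixed by
      all \<open>P (N * k)\<close>. The convergence on that member, applied to this constant
      sequence, identifies \<open>h\<close> with the next density.\<close>
    define h where "h = P 1 (\<phi> i)"
    have ch: "cont h" unfolding h_def using g[OF i] cont_P by blast
    obtain v where v: "vdom (\<phi> i) v" using g[OF i] by blast
    obtain c where "\<forall>f v. cont f \<and> vdom f v \<longrightarrow> vdom (P 1 f) (3 / s ^ 1 * v + c * L1 f)"
      using Lasota_Yorke[of 1] by auto
    then have vh: "\<exists>v. vdom h v" unfolding h_def using v g[OF i] by blast
    have offh: "\<forall>x\<in>X - Y ?j. h x = 0"
    proof
      fix x assume x: "x \<in> X - Y ?j"
      have "\<phi> i y = 0" if "y \<in> X" "\<sigma> y = x" for y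
      proof -
        have "y \<notin> Y i" using step[OF i] x that by blast
        then show ?thesis using g[OF i] that by blast
      qed
      then show "h x = 0" by (simp add: h_def P_def transfer_def)
    qed
    have inth: "(\<integral>x. h x \<partial>\<mu>) = 1" unfolding h_def using integral_P g[OF i] by metis
    have "uniform_limit X (\<lambda>k. P (N * k) h) (\<lambda>x. (\<integral>y. h y \<partial>\<mu>) * \<phi> ?j x) sequentially"
      using g[OF j] ch vh offh by blast
    then have ul: "uniform_limit X (\<lambda>k. P (N * k) h) (\<phi> ?j) sequentially" using inth by simp
    fix x assume x: "x \<in> X"
    have "P (N * k) h x = h x" for k
    proof -
      have "P (N * k) h x = P (1 + N * k) (\<phi> i) x"
        unfolding h_def using P_add_exponent[OF x, of "N * k" 1 "\<phi> i"] by (simp add: add.commute)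
      also have "\<dots> = P 1 (P (N * k) (\<phi> i)) x" by (rule P_add_exponent[OF x])
      also have "\<dots> = h x" unfolding h_def by (rule P_cong) (use g[OF i] in blast)
      finally show ?thesis .
    qed
    then have "(\<lambda>k. h x) \<longlonglongrightarrow> \<phi> ?j x" using tendsto_uniform_limitI[OF ul x] by simp
    then have "h x = \<phi> ?j x" by (simp add: LIMSEQ_const_iff)
    then show "(1 / s) * transfer T \<sigma> (\<phi> i) x = \<phi> ?j x" by (simp add: h_def P_def)
  qed
qed

end

section \<open>The disconnected interval\<close>

text \<open>By monotonicity the infimum and the supremum are the one-sided limits at the ends.
  Strictness at the ends comes from inserting one more interior point before comparing.\<close>

lemma strict_mono_extension:
  fixes f :: "real \<Rightarrow> real"
  assumes cd: "c < d" and cont: "continuous_on {c<..<d} f" and mono: "strict_mono_on {c<..<d} f"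
    and bnd: "\<And>x. x \<in> {c<..<d} \<Longrightarrow> lo \<le> f x \<and> f x \<le> hi"
  shows "\<exists>g. continuous_on {c..d} g \<and> (\<forall>x\<in>{c..d}. (f \<longlongrightarrow> g x) (at x within {c<..<d})) \<and>
    (\<forall>x\<in>{c<..<d}. g x = f x) \<and> (\<forall>x\<in>{c..d}. \<forall>y\<in>{c..d}. x < y \<longrightarrow> g x < g y) \<and>
    (\<forall>x\<in>{c..d}. lo \<le> g x \<and> g x \<le> hi)"
proof -
  let ?S = "{c<..<d}"
  define l where "l = Inf (f ` ?S)"
  define u where "u = Sup (f ` ?S)"
  have ne: "f ` ?S \<noteq> {}" using cd by auto
  have bb: "bdd_below (f ` ?S)" "bdd_above (f ` ?S)"
    using bnd by (auto intro!: bdd_belowI2[where m = lo] bdd_aboveI2[where M = hi])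
  have less: "f x < f y" if "x \<in> ?S" "y \<in> ?S" "x < y" for x y
    using mono that by (auto simp: strict_mono_on_def)
  have lx: "l < f x" and ux: "f x < u" if x: "x \<in> ?S" for x
  proof -
    have "(c + x) / 2 \<in> ?S" "(x + d) / 2 \<in> ?S" using x by auto
    moreover from this have "f ((c + x) / 2) < f x" "f x < f ((x + d) / 2)" using x by (auto intro!: less)
    moreover have "l \<le> f ((c + x) / 2)" "f ((x + d) / 2) \<le> u"
      unfolding l_def u_def using calculation bb by (auto intro: cInf_lower cSup_upper)
    ultimately show "l < f x" "f x < u" by linarith+
  qed
  have evr: "eventually (\<lambda>x. x \<in> ?S) (at_right c)" using cd by (rule eventually_at_right_real)
  have evl: "eventually (\<lambda>x. x \<in> ?S) (at_left d)" using cd by (rule eventually_at_left_real)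
  have limc: "(f \<longlongrightarrow> l) (at_right c)"
  proof (rule order_tendstoI)
    fix b assume b: "b < l"
    show "eventually (\<lambda>x. b < f x) (at_right c)"
      using evr by eventually_elim (use lx b in \<open>meson less_trans\<close>)
  next
    fix b assume "l < b"
    then obtain x0 where x0: "x0 \<in> ?S" "f x0 < b"
      unfolding l_def using cInf_less_iff[OF ne bb(1)] by auto
    have "eventually (\<lambda>x. x \<in> {c<..<x0}) (at_right c)" using x0 by (intro eventually_at_right_real) auto
    then show "eventually (\<lambda>x. f x < b) (at_right c)"
    proof eventually_elim
      case (elim x)
      then have "f x < f x0" using x0 by (intro less) auto
      then show ?case using x0 by simp
    qed
  qed
  have limd: "(f \<longlongrightarrow> u) (at_left d)"
  proof (rule order_tendstoI)
    fix b assume b: "u < b"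
    show "eventually (\<lambda>x. f x < b) (at_left d)"
      using evl by eventually_elim (use ux b in \<open>meson less_trans\<close>)
  next
    fix b assume "b < u"
    then obtain x0 where x0: "x0 \<in> ?S" "b < f x0"
      unfolding u_def using less_cSup_iff[OF ne bb(2)] by auto
    have "eventually (\<lambda>x. x \<in> {x0<..<d}) (at_left d)" using x0 by (intro eventually_at_left_real) auto
    then show "eventually (\<lambda>x. b < f x) (at_left d)"
    proof eventually_elim
      case (elim x)
      then have "f x0 < f x" using x0 by (intro less) auto
      then show ?case using x0 by simp
    qed
  qed
  define g where "g x = (if x \<le> c then l else if x \<ge> d then u else f x)" for x
  have gS: "g x = f x" if "x \<in> ?S" for x using that by (simp add: g_def)
  have gc: "g c = l" and gd: "g d = u" using cd by (auto simp: g_def)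
  have inner: "f \<midarrow>x\<rightarrow> f x" if "x \<in> ?S" for x
    using cont that continuous_on_eq_continuous_at[of ?S f] by (auto simp: isCont_def)
  have "continuous_on {c..d} g"
  proof (rule continuous_on_IccI[OF _ _ _ cd])
    have "eventually (\<lambda>x. f x = g x) (at_right c)" using evr by eventually_elim (simp add: gS)
    then show "(g \<longlongrightarrow> g c) (at_right c)" using limc gc tendsto_cong by fastforce
    have "eventually (\<lambda>x. f x = g x) (at_left d)" using evl by eventually_elim (simp add: gS)
    then show "(g \<longlongrightarrow> g d) (at_left d)" using limd gd tendsto_cong by fastforce
    fix x assume x: "c < x" "x < d"
    then have xS: "x \<in> ?S" by simp
    show "g \<midarrow>x\<rightarrow> g x"
      by (rule Lim_transform_within_open[OF inner[OF xS, folded gS[OF xS]] open_greaterThanLessThan xS])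
        (use gS in auto)
  qed
  moreover have "(f \<longlongrightarrow> g x) (at x within ?S)" if x: "x \<in> {c..d}" for x
  proof -
    consider "x = c" | "x = d" | "x \<in> ?S" using x by force
    then show ?thesis
    proof cases
      case 1
      show ?thesis unfolding 1 gc by (rule tendsto_within_subset[OF limc]) auto
    next
      case 2
      show ?thesis unfolding 2 gd by (rule tendsto_within_subset[OF limd]) auto
    next
      case 3
      then show ?thesis using gS[OF 3] tendsto_within_subset[OF inner[OF 3], of ?S] by simp
    qed
  qed
  moreover have "g x < g y" if "x \<in> {c..d}" "y \<in> {c..d}" "x < y" for x y
  proof -
    obtain z where z0: "x < z" "z < y" using dense[OF \<open>x < y\<close>] by auto
    have "z \<in> ?S" using z0 that(1,2) by auto
    note z = z0 this
    have "g x < f z"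
    proof (cases "x = c")
      case True
      then show ?thesis using lx[OF z(3)] gc by simp
    next
      case False
      then have "x \<in> ?S" using that by auto
      then show ?thesis using less[of x z] z gS by simp
    qed
    moreover have "f z < g y"
    proof (cases "y = d")
      case True
      then show ?thesis using ux[OF z(3)] gd by simp
    next
      case False
      then have "y \<in> ?S" using that by auto
      then show ?thesis using less[of z y] z gS by simp
    qed
    ultimately show ?thesis by simp
  qed
  moreover have "lo \<le> g x \<and> g x \<le> hi" if "x \<in> {c..d}" for x
  proof -
    have "lo \<le> l" unfolding l_def using ne bnd by (intro cInf_greatest) auto
    moreover have "u \<le> hi" unfolding u_def using ne bnd by (intro cSup_least) auto
    moreover have "l \<le> u"
    proof -
      obtain z where "z \<in> ?S" using dense[OF cd] by auto
      then show ?thesis using lx ux by fastforce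
    qed
    ultimately show ?thesis using bnd[of x] by (auto simp: g_def not_le)
  qed
  ultimately show ?thesis using gS by (intro exI[of _ g]) auto
qed

locale interval_map =
  fixes \<tau> :: "real \<Rightarrow> real" and n :: nat and a :: "nat \<Rightarrow> real"
  assumes pm: "piecewise_monotonic \<tau> n a"
begin

abbreviation lap :: "nat \<Rightarrow> real set" where "lap i \<equiv> {a i<..<a (Suc i)}"
abbreviation clap :: "nat \<Rightarrow> real set" where "clap i \<equiv> {a i..a (Suc i)}"
abbreviation br :: "nat \<Rightarrow> real \<Rightarrow> real" where "br i \<equiv> branch \<tau> a i"
abbreviation pp :: "real set" where "pp \<equiv> partition_points n a"

lemma a0: "a 0 = 0" and an: "a n = 1" and a_step: "i < n \<Longrightarrow> a i < a (Suc i)"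
  and tau01: "x \<in> {0..1} \<Longrightarrow> \<tau> x \<in> {0..1}"
  and lap_mono: "i < n \<Longrightarrow> cont_strictly_monotonic_on \<tau> (lap i)"
  using pm by (auto simp: piecewise_monotonic_def)

lemma a_less: assumes "i < j" "j \<le> n" shows "a i < a j"
  using assms
proof (induction j)
  case (Suc j)
  then show ?case using a_step[of j] by (cases "i = j") (auto intro: less_trans)
qed simp

lemma a_le: assumes "i \<le> j" "j \<le> n" shows "a i \<le> a j"
  using a_less[of i j] assms by (cases "i = j") auto

lemma a01: "i \<le> n \<Longrightarrow> a i \<in> {0..1}"
  using a_le[of 0 i] a_le[of i n] a0 an by auto

lemma n_pos: "n > 0" using a0 an by (cases n) auto

lemma lap01: "i < n \<Longrightarrow> x \<in> clap i \<Longrightarrow> x \<in> {0..1}"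
  using a01[of i] a01[of "Suc i"] by auto

lemma lap_cover: assumes "x \<in> {0..1}" "x \<notin> pp" shows "\<exists>i<n. x \<in> lap i"
proof -
  have ne: "x \<noteq> a i" if "i \<le> n" for i using assms(2) that by (auto simp: partition_points_def)
  have ex: "x < a n" using assms(1) ne[of n] an by auto
  define k where "k = (LEAST k. x < a k)"
  have k: "x < a k" unfolding k_def using ex by (rule LeastI)
  have least: "\<not> x < a j" if "j < k" for j using that not_less_Least unfolding k_def by blast
  have kn: "k \<le> n" unfolding k_def using ex by (rule Least_le)
  have "k \<noteq> 0" using k a0 assms(1) by (cases "k = 0") auto
  then obtain i where i: "k = Suc i" by (cases k) auto
  have "a i \<le> x" using least[of i] i by simp
  then have "a i < x" using ne[of i] kn i by auto
  then show ?thesis using k i kn by (intro exI[of _ i]) auto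
qed

definition up :: "nat \<Rightarrow> bool" where "up i \<longleftrightarrow> strict_mono_on (lap i) \<tau>"

text \<open>A decreasing lap is reduced to an increasing one by passing to the negative of
  \<open>\<tau>\<close>, which is why the extension lemma allows arbitrary bounds on the
  values.\<close>

lemma branch_props:
  assumes i: "i < n"
  shows "continuous_on (clap i) (br i)" "\<And>x. x \<in> lap i \<Longrightarrow> br i x = \<tau> x"
    "\<And>x y. x \<in> clap i \<Longrightarrow> y \<in> clap i \<Longrightarrow> x < y \<Longrightarrow> (if up i then br i x < br i y else br i y < br i x)"
    "\<And>x. x \<in> clap i \<Longrightarrow> br i x \<in> {0..1}"
proof -
  have csm: "continuous_on (lap i) \<tau>" "strict_mono_on (lap i) \<tau> \<or> strict_antimono_on (lap i) \<tau>"
    using lap_mono[OF i] by (auto simp: cont_strictly_monotonic_on_def)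
  have bnd: "0 \<le> \<tau> x \<and> \<tau> x \<le> 1" if "x \<in> lap i" for x using tau01[of x] lap01[OF i, of x] that by auto
  have nontriv: "at x within lap i \<noteq> bot" if "x \<in> clap i" for x
  proof -
    have "x = a i \<or> x = a (Suc i) \<or> x \<in> lap i" using that by auto
    then consider "x = a i" | "x = a (Suc i)" | "x \<in> lap i" by blast
    then have "x islimpt lap i"
    proof cases
      case 3
      then show ?thesis using interior_limit_point[of x "lap i"] by (simp add: interior_open)
    qed (use a_step[OF i] islimpt_greaterThanLessThan1 islimpt_greaterThanLessThan2 in auto)
    then show ?thesis by (simp add: trivial_limit_within)
  qed
  have "\<exists>g. continuous_on (clap i) g \<and> (\<forall>x\<in>clap i. (\<tau> \<longlongrightarrow> g x) (at x within lap i)) \<and>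
    (\<forall>x\<in>lap i. g x = \<tau> x) \<and> (\<forall>x\<in>clap i. \<forall>y\<in>clap i. x < y \<longrightarrow> (if up i then g x < g y else g y < g x)) \<and>
    (\<forall>x\<in>clap i. 0 \<le> g x \<and> g x \<le> 1)"
  proof (cases "up i")
    case True
    then show ?thesis using strict_mono_extension[OF a_step[OF i] csm(1) _ bnd] by (simp add: up_def)
  next
    case False
    then have "strict_antimono_on (lap i) \<tau>" using csm by (simp add: up_def)
    then have "strict_mono_on (lap i) (\<lambda>x. - \<tau> x)" by (auto simp: monotone_on_def)
    moreover have "continuous_on (lap i) (\<lambda>x. - \<tau> x)" by (intro continuous_on_minus csm(1))
    moreover have "-1 \<le> - \<tau> x \<and> - \<tau> x \<le> 0" if "x \<in> lap i" for x using bnd[OF that] by simp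
    ultimately obtain g where g: "continuous_on (clap i) g"
      "\<forall>x\<in>clap i. ((\<lambda>x. - \<tau> x) \<longlongrightarrow> g x) (at x within lap i)"
      "\<forall>x\<in>lap i. g x = - \<tau> x" "\<forall>x\<in>clap i. \<forall>y\<in>clap i. x < y \<longrightarrow> g x < g y"
      "\<forall>x\<in>clap i. -1 \<le> g x \<and> g x \<le> 0"
      using strict_mono_extension[OF a_step[OF i], of "\<lambda>x. - \<tau> x" "-1" 0] by auto
    have "(\<tau> \<longlongrightarrow> - g x) (at x within lap i)" if "x \<in> clap i" for x
      using tendsto_minus[OF bspec[OF g(2) that]] by simp
    moreover have "continuous_on (clap i) (\<lambda>x. - g x)" by (intro continuous_on_minus g(1))
    ultimately show ?thesis using False g(3-5) by (intro exI[of _ "\<lambda>x. - g x"]) auto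
  qed
  then obtain g where g: "continuous_on (clap i) g" "\<forall>x\<in>clap i. (\<tau> \<longlongrightarrow> g x) (at x within lap i)"
    "\<forall>x\<in>lap i. g x = \<tau> x" "\<forall>x\<in>clap i. \<forall>y\<in>clap i. x < y \<longrightarrow> (if up i then g x < g y else g y < g x)"
    "\<forall>x\<in>clap i. 0 \<le> g x \<and> g x \<le> 1" by blast
  have eq: "br i x = g x" if "x \<in> clap i" for x
    unfolding branch_def using tendsto_Lim[OF nontriv[OF that] bspec[OF g(2) that]] .
  show "continuous_on (clap i) (br i)" using iffD2[OF continuous_on_cong[OF refl eq] g(1)] by simp
  show "br i x = \<tau> x" if "x \<in> lap i" for x using eq[of x] g(3) that by auto
  show "if up i then br i x < br i y else br i y < br i x" if "x \<in> clap i" "y \<in> clap i" "x < y" for x y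
    using eq[OF that(1)] eq[OF that(2)] g(4) that by auto
  show "br i x \<in> {0..1}" if "x \<in> clap i" for x using eq[OF that] g(5) that by auto
qed

lemma branch_inj: assumes "i < n" shows "inj_on (br i) (clap i)"
proof (rule inj_onI)
  fix x y assume xy: "x \<in> clap i" "y \<in> clap i" "br i x = br i y"
  show "x = y"
  proof (rule ccontr)
    assume "x \<noteq> y"
    then consider "x < y" | "y < x" by linarith
    then show False
      using branch_props(3)[OF assms xy(1,2)] branch_props(3)[OF assms xy(2,1)] xy(3)
      by cases (auto split: if_splits)
  qed
qed

abbreviation I1' :: "real set" where "I1' \<equiv> I1 \<tau> n a"
abbreviation I0' :: "real set" where "I0' \<equiv> I0 \<tau> n a"

text \<open>Invariance passes to the intersection. For countability, the countable set obtained from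
  \<open>c\<close> by alternately adding images and preimages is one of the intersected sets;
  preimages stay countable because each branch is injective.\<close>

lemma generalized_orbit_props:
  assumes "c \<in> {0..1}"
  shows "c \<in> generalized_orbit \<tau> n a c" "generalized_orbit \<tau> n a c \<subseteq> {0..1}"
    "hat_image \<tau> n a (generalized_orbit \<tau> n a c) \<subseteq> generalized_orbit \<tau> n a c"
    "hat_vimage \<tau> n a (generalized_orbit \<tau> n a c) \<subseteq> generalized_orbit \<tau> n a c"
    "countable (generalized_orbit \<tau> n a c)"
proof -
  define F where "F = {B. B \<subseteq> {0..1} \<and> c \<in> B \<and> hat_image \<tau> n a B \<subseteq> B \<and> hat_vimage \<tau> n a B \<subseteq> B}"
  have G: "generalized_orbit \<tau> n a c = \<Inter>F" by (simp add: generalized_orbit_def F_def)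
  have top: "{0..1} \<in> F" unfolding F_def
  proof (intro CollectI conjI)
    show "hat_image \<tau> n a {0..1} \<subseteq> {0..1}" using branch_props(4) by (fastforce simp: hat_image_def)
    show "hat_vimage \<tau> n a {0..1} \<subseteq> {0..1}" using lap01 by (fastforce simp: hat_vimage_def)
  qed (use assms in auto)
  show "c \<in> generalized_orbit \<tau> n a c" unfolding G F_def by blast
  show "generalized_orbit \<tau> n a c \<subseteq> {0..1}" unfolding G using top by blast
  have "hat_image \<tau> n a (\<Inter>F) \<subseteq> B" if "B \<in> F" for B
  proof -
    have "hat_image \<tau> n a (\<Inter>F) \<subseteq> hat_image \<tau> n a B" using that unfolding hat_image_def by blast
    then show ?thesis using that unfolding F_def by blast
  qed
  then show "hat_image \<tau> n a (generalized_orbit \<tau> n a c) \<subseteq> generalized_orbit \<tau> n a c" unfolding G by blast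
  have "hat_vimage \<tau> n a (\<Inter>F) \<subseteq> B" if "B \<in> F" for B
  proof -
    have "hat_vimage \<tau> n a (\<Inter>F) \<subseteq> hat_vimage \<tau> n a B" using that unfolding hat_vimage_def by blast
    then show ?thesis using that unfolding F_def by blast
  qed
  then show "hat_vimage \<tau> n a (generalized_orbit \<tau> n a c) \<subseteq> generalized_orbit \<tau> n a c" unfolding G by blast
  define st where "st A = A \<union> hat_image \<tau> n a A \<union> hat_vimage \<tau> n a A" for A
  define B where "B = (\<Union>k. (st ^^ k) {c})"
  have st: "countable (st A) \<and> st A \<subseteq> {0..1}" if A: "countable A" "A \<subseteq> {0..1}" for A
  proof
    have "countable (hat_image \<tau> n a A)" unfolding hat_image_def using A by auto
    moreover have "countable {x \<in> clap i. br i x \<in> A}" if "i < n" for i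
    proof (rule countable_image_inj_on)
      show "countable (br i ` {x \<in> clap i. br i x \<in> A})" using A(1) by (rule countable_subset[rotated]) auto
      show "inj_on (br i) {x \<in> clap i. br i x \<in> A}" using branch_inj[OF that] by (rule inj_on_subset) auto
    qed
    then have "countable (hat_vimage \<tau> n a A)" unfolding hat_vimage_def by auto
    ultimately show "countable (st A)" unfolding st_def using A by auto
    have "hat_image \<tau> n a A \<subseteq> {0..1}" using branch_props(4) by (fastforce simp: hat_image_def)
    moreover have "hat_vimage \<tau> n a A \<subseteq> {0..1}" using lap01 by (fastforce simp: hat_vimage_def)
    ultimately show "st A \<subseteq> {0..1}" unfolding st_def using A by auto
  qed
  have stk: "countable ((st ^^ k) {c}) \<and> (st ^^ k) {c} \<subseteq> {0..1}" for k
    by (induction k) (use st assms in auto)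
  have "B \<in> F" unfolding F_def
  proof (intro CollectI conjI)
    show "B \<subseteq> {0..1}" unfolding B_def using stk by blast
    show "c \<in> B" unfolding B_def by (rule UN_I[of 0]) auto
    have sub: "st ((st ^^ k) {c}) \<subseteq> B" for k
    proof
      fix y assume "y \<in> st ((st ^^ k) {c})"
      then have "y \<in> (st ^^ Suc k) {c}" by simp
      then show "y \<in> B" unfolding B_def by blast
    qed
    show "hat_image \<tau> n a B \<subseteq> B"
    proof
      fix y assume "y \<in> hat_image \<tau> n a B"
      then obtain i x k where x: "i < n" "x \<in> (st ^^ k) {c}" "x \<in> clap i" "y = br i x"
        unfolding hat_image_def B_def by auto
      then have "y \<in> hat_image \<tau> n a ((st ^^ k) {c})" unfolding hat_image_def
        by (intro UN_I[of i] image_eqI[of _ _ x]) auto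
      then show "y \<in> B" using sub[of k] unfolding st_def by blast
    qed
    show "hat_vimage \<tau> n a B \<subseteq> B"
    proof
      fix y assume "y \<in> hat_vimage \<tau> n a B"
      then obtain i k where x: "i < n" "y \<in> clap i" "br i y \<in> (st ^^ k) {c}"
        unfolding hat_vimage_def B_def by auto
      then have "y \<in> hat_vimage \<tau> n a ((st ^^ k) {c})" unfolding hat_vimage_def by auto
      then show "y \<in> B" using sub[of k] unfolding st_def by blast
    qed
  qed
  then have "generalized_orbit \<tau> n a c \<subseteq> B" unfolding G by blast
  moreover have "countable B" unfolding B_def using stk by auto
  ultimately show "countable (generalized_orbit \<tau> n a c)" by (rule countable_subset)
qed

lemma I1_countable: "countable I1'"
  unfolding I1_def partition_points_def using generalized_orbit_props(5)[OF a01] by auto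

lemma I1_01: "I1' \<subseteq> {0..1}"
  unfolding I1_def partition_points_def using generalized_orbit_props(2)[OF a01] by blast

lemma a_I1: "i \<le> n \<Longrightarrow> a i \<in> I1'"
  unfolding I1_def partition_points_def using generalized_orbit_props(1)[OF a01] by blast

lemma zero_one_I1: "0 \<in> I1'" "1 \<in> I1'" using a_I1[of 0] a_I1[of n] a0 an by auto

lemma branch_I1_iff: assumes i: "i < n" and x: "x \<in> clap i" shows "br i x \<in> I1' \<longleftrightarrow> x \<in> I1'"
proof
  assume "x \<in> I1'"
  then obtain j where j: "j \<le> n" "x \<in> generalized_orbit \<tau> n a (a j)"
    unfolding I1_def partition_points_def by blast
  then have "br i x \<in> hat_image \<tau> n a (generalized_orbit \<tau> n a (a j))"
    unfolding hat_image_def using i x by blast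
  then show "br i x \<in> I1'" using generalized_orbit_props(3)[OF a01[OF j(1)]] j(1)
    unfolding I1_def partition_points_def by blast
next
  assume "br i x \<in> I1'"
  then obtain j where j: "j \<le> n" "br i x \<in> generalized_orbit \<tau> n a (a j)"
    unfolding I1_def partition_points_def by blast
  then have "x \<in> hat_vimage \<tau> n a (generalized_orbit \<tau> n a (a j))"
    unfolding hat_vimage_def using i x by blast
  then show "x \<in> I1'" using generalized_orbit_props(4)[OF a01[OF j(1)]] j(1)
    unfolding I1_def partition_points_def by blast
qed

text \<open>\<open>I1\<close> is countable. Properties on \<open>X\<close> are later tested on the
  dense set of unsplit points, where \<open>\<sigma>\<close> is given by
  \<open>\<tau>\<close>.\<close>

lemma I0_dense: assumes "u < v" "0 \<le> u" "v \<le> 1" shows "\<exists>x\<in>I0'. u < x \<and> x < v"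
proof (rule ccontr)
  assume "\<not> ?thesis"
  then have "{u<..<v} \<subseteq> I1'" using assms by (auto simp: I0_def)
  then have "countable {u<..<v}" using I1_countable countable_subset by blast
  then show False using uncountable_open_interval assms by blast
qed

end

text \<open>On \<open>X_set \<tau> n a\<close> this lexicographic order is \<open>point_less\<close>. The order topology of the whole
  type is useless, since \<open>Pt x\<close> is isolated in it between \<open>Minus x\<close> and \<open>Plus x\<close>; this is why
  \<open>ordered_compact\<close> takes the topology as a parameter.\<close>

instantiation point :: linorder
begin

definition side :: "point \<Rightarrow> nat" where
  "side p = (case p of Minus _ \<Rightarrow> 0 | Pt _ \<Rightarrow> 1 | Plus _ \<Rightarrow> 2)"

definition less_point :: "point \<Rightarrow> point \<Rightarrow> bool" where
  "p < q \<longleftrightarrow> collapse p < collapse q \<or> (collapse p = collapse q \<and> side p < side q)"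

definition less_eq_point :: "point \<Rightarrow> point \<Rightarrow> bool" where
  "p \<le> q \<longleftrightarrow> collapse p < collapse q \<or> (collapse p = collapse q \<and> side p \<le> side q)"

instance
proof
  fix p q r :: point
  show "p < q \<longleftrightarrow> p \<le> q \<and> \<not> q \<le> p" by (auto simp: less_point_def less_eq_point_def)
  show "p \<le> p" by (simp add: less_eq_point_def)
  show "p \<le> q \<Longrightarrow> q \<le> r \<Longrightarrow> p \<le> r" by (auto simp: less_eq_point_def)
  show "p \<le> q \<Longrightarrow> q \<le> p \<Longrightarrow> p = q"
    by (cases p; cases q) (auto simp: less_eq_point_def side_def)
  show "p \<le> q \<or> q \<le> p" by (auto simp: less_eq_point_def)
qed

end

lemma collapse_mono: "p \<le> q \<Longrightarrow> collapse p \<le> collapse q"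
  by (auto simp: less_eq_point_def)

lemma collapse_less: "collapse p < collapse q \<Longrightarrow> p < q"
  by (simp add: less_point_def)

lemma side_simps [simp]: "side (Minus x) = 0" "side (Pt x) = 1" "side (Plus x) = 2"
  by (simp_all add: side_def)

context interval_map
begin

abbreviation XX :: "point set" where "XX \<equiv> X_set \<tau> n a"
abbreviation TT :: "point topology" where "TT \<equiv> X_top \<tau> n a"

lemma X_iff [simp]:
  "Pt x \<in> XX \<longleftrightarrow> x \<in> I0' \<or> x = 0 \<or> x = 1"
  "Minus x \<in> XX \<longleftrightarrow> x \<in> I1' \<and> x \<noteq> 0 \<and> x \<noteq> 1"
  "Plus x \<in> XX \<longleftrightarrow> x \<in> I1' \<and> x \<noteq> 0 \<and> x \<noteq> 1"
  by (auto simp: X_set_def)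

lemma X_cases:
  assumes "p \<in> XX"
  obtains (Pt) x where "p = Pt x" "x \<in> I0' \<or> x = 0 \<or> x = 1"
    | (Minus) x where "p = Minus x" "x \<in> I1'" "x \<noteq> 0" "x \<noteq> 1"
    | (Plus) x where "p = Plus x" "x \<in> I1'" "x \<noteq> 0" "x \<noteq> 1"
  using assms by (cases p) auto

lemma I0_iff: "x \<in> I0' \<longleftrightarrow> x \<in> {0..1} \<and> x \<notin> I1'" by (auto simp: I0_def)

lemma collapse_01: assumes "p \<in> XX" shows "collapse p \<in> {0..1}"
  using assms by (cases rule: X_cases) (use I1_01 in \<open>auto simp: I0_iff\<close>)

lemma ex_point: assumes "x \<in> {0..1}" shows "\<exists>p\<in>XX. collapse p = x"
proof (cases "x \<in> I0' \<or> x = 0 \<or> x = 1")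
  case True
  then show ?thesis by (intro bexI[of _ "Pt x"]) auto
next
  case False
  then show ?thesis using assms by (intro bexI[of _ "Minus x"]) (auto simp: I0_iff)
qed

lemma same_collapse:
  assumes "p \<in> XX" "q \<in> XX" "collapse p = collapse q" "p < q"
  shows "\<exists>x. p = Minus x \<and> q = Plus x"
  using assms zero_one_I1 by (cases p; cases q) (auto simp: less_point_def I0_iff)

lemma point_less_iff: assumes "p \<in> XX" "q \<in> XX" shows "point_less p q \<longleftrightarrow> p < q"
proof
  assume "point_less p q"
  then show "p < q" by (auto simp: point_less_def less_point_def)
next
  assume lt: "p < q"
  show "point_less p q"
  proof (cases "collapse p = collapse q")
    case True
    then show ?thesis using same_collapse[OF assms True lt] by (auto simp: point_less_def)
  next
    case False
    then show ?thesis using lt by (auto simp: point_less_def less_point_def)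
  qed
qed

section \<open>The order topology of the split interval\<close>

definition rays :: "point set set" where
  "rays = insert XX ((\<lambda>p. {q \<in> XX. p < q}) ` XX \<union> (\<lambda>p. {q \<in> XX. q < p}) ` XX)"

lemma TT_eq: "TT = topology_generated_by rays"
proof -
  have "(\<lambda>p. {q \<in> XX. point_less p q}) ` XX = (\<lambda>p. {q \<in> XX. p < q}) ` XX"
    using point_less_iff by (intro image_cong refl) auto
  moreover have "(\<lambda>p. {q \<in> XX. point_less q p}) ` XX = (\<lambda>p. {q \<in> XX. q < p}) ` XX"
    using point_less_iff by (intro image_cong refl) auto
  ultimately show ?thesis unfolding X_top_def rays_def by simp
qed

lemma Union_rays: "\<Union>rays = XX" by (auto simp: rays_def)

lemma topspace_TT [simp]: "topspace TT = XX"
  by (simp add: TT_eq Union_rays)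

lemma openin_TT_iff: "openin TT U \<longleftrightarrow> generate_topology_on rays U"
  by (simp add: TT_eq openin_topology_generated_by_iff)

lemma ray_open: "p \<in> XX \<Longrightarrow> openin TT {q \<in> XX. p < q}" "p \<in> XX \<Longrightarrow> openin TT {q \<in> XX. q < p}"
  unfolding openin_TT_iff by (rule generate_topology_on.Basis, auto simp: rays_def)+

lemma rays_induct [consumes 1, case_names Int UN X upper lower]:
  assumes "openin TT U"
    and "\<And>A B. openin TT A \<Longrightarrow> openin TT B \<Longrightarrow> Q A \<Longrightarrow> Q B \<Longrightarrow> Q (A \<inter> B)"
    and "\<And>\<K>. (\<And>A. A \<in> \<K> \<Longrightarrow> openin TT A \<and> Q A) \<Longrightarrow> Q (\<Union>\<K>)"
    and "Q XX" "\<And>p. p \<in> XX \<Longrightarrow> Q {q \<in> XX. p < q}" "\<And>p. p \<in> XX \<Longrightarrow> Q {q \<in> XX. q < p}"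
  shows "Q U"
proof -
  have "generate_topology_on rays U" using assms(1) by (simp add: openin_TT_iff)
  then show ?thesis
  proof (induction rule: generate_topology_on.induct)
    case Empty
    show ?case using assms(3)[of "{}"] by simp
  next
    case (Int A B)
    then show ?case using assms(2) by (simp add: openin_TT_iff)
  next
    case (UN K)
    then show ?case using assms(3)[of K] by (simp add: openin_TT_iff)
  next
    case (Basis s)
    then show ?case using assms(4-6) unfolding rays_def by auto
  qed
qed

text \<open>A cut of \<open>X\<close> is filled by a point over the supremum \<open>u\<close> of the
  collapsed lower set. If \<open>u\<close> is split, that point is \<open>Plus u\<close> when
  \<open>R\<close> contains it and \<open>Minus u\<close> otherwise.\<close>

lemma order_complete:
  assumes R: "R \<subseteq> XX" and L: "L \<subseteq> XX" and le: "\<And>p q. p \<in> R \<Longrightarrow> q \<in> L \<Longrightarrow> p \<le> q"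
  shows "\<exists>c\<in>XX. (\<forall>p\<in>R. p \<le> c) \<and> (\<forall>q\<in>L. c \<le> q)"
proof (cases "R = {}")
  case True
  have "Pt 0 \<le> q" if "q \<in> XX" for q
    using that collapse_01[OF that] zero_one_I1
    by (cases q) (auto simp: less_eq_point_def I0_iff)
  then show ?thesis using True L by (intro bexI[of _ "Pt 0"]) auto
next
  case False
  define u where "u = Sup (collapse ` R)"
  have bdd: "bdd_above (collapse ` R)" using R collapse_01 by (intro bdd_aboveI2[where M = 1]) auto
  have up: "collapse p \<le> u" if "p \<in> R" for p unfolding u_def using bdd that by (intro cSup_upper) auto
  have lo: "u \<le> collapse q" if "q \<in> L" for q
    unfolding u_def using False le[OF _ that] by (intro cSup_least) (auto intro: collapse_mono)
  have u01: "u \<in> {0..1}"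
  proof -
    obtain p where p: "p \<in> R" using False by auto
    have "0 \<le> collapse p" using collapse_01 p R by auto
    then have "0 \<le> u" using up[OF p] by linarith
    moreover have "u \<le> 1" unfolding u_def using False R collapse_01 by (intro cSup_least) auto
    ultimately show ?thesis by simp
  qed
  show ?thesis
  proof (cases "u \<in> I1' \<and> u \<noteq> 0 \<and> u \<noteq> 1")
    case True
    show ?thesis
    proof (cases "Plus u \<in> R")
      case P: True
      have "p \<le> Plus u" if "p \<in> R" for p
        using up[OF that] by (cases p) (auto simp: less_eq_point_def)
      then show ?thesis using P le R by (intro bexI[of _ "Plus u"]) auto
    next
      case nP: False
      have "p \<le> Minus u" if p: "p \<in> R" for p
      proof (cases "collapse p = u")
        case eq: True
        have "p \<in> XX" using p R by auto
        then show ?thesis using eq nP p True by (cases p) (auto simp: less_eq_point_def I0_iff)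
      next
        case False
        then have "collapse p < collapse (Minus u)" using up[OF p] by simp
        then show ?thesis using collapse_less less_imp_le by blast
      qed
      moreover have "Minus u \<le> q" if "q \<in> L" for q
        using lo[OF that] by (auto simp: less_eq_point_def)
      ultimately show ?thesis using True by (intro bexI[of _ "Minus u"]) auto
    qed
  next
    case nI1: False
    then have PtX: "Pt u \<in> XX" using u01 by (auto simp: I0_iff)
    have eq: "p = Pt u" if "p \<in> XX" "collapse p = u" for p
      using that nI1 by (cases p) auto
    have "p \<le> Pt u" if p: "p \<in> R" for p
    proof (cases "collapse p = u")
      case True
      then show ?thesis using eq p R by auto
    next
      case False
      then have "collapse p < collapse (Pt u)" using up[OF p] by simp
      then show ?thesis using collapse_less less_imp_le by blast
    qed
    moreover have "Pt u \<le> q" if q: "q \<in> L" for q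
    proof (cases "collapse q = u")
      case True
      then show ?thesis using eq q L by auto
    next
      case False
      then have "collapse (Pt u) < collapse q" using lo[OF q] by simp
      then show ?thesis using collapse_less less_imp_le by blast
    qed
    ultimately show ?thesis using PtX by blast
  qed
qed

text \<open>In a subbasic cover not containing \<open>X\<close> itself, some lower ray must end to
  the right of where some upper ray starts, for otherwise the point filling the cut would be
  uncovered. These two rays already cover \<open>X\<close>.\<close>

lemma compact_TT: "compact_space TT"
proof -
  \<comment> \<open>The topology in the form to which Alexander's subbase theorem applies. It is
    only shown to be finer than \<open>TT\<close>, and compactness passes to the coarser
    topology.\<close>
  define T' where "T' = topology (arbitrary union_of (finite intersection_of (\<lambda>x. x \<in> rays) relative_to \<Union>rays))"
  have top': "topspace T' = XX" unfolding T'_def using topspace_subbase Union_rays by metis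
  have "compact_space T'"
  proof (rule Alexander_subbase)
    show "topology (arbitrary union_of (finite intersection_of (\<lambda>x. x \<in> rays) relative_to \<Union>rays)) = T'"
      by (simp add: T'_def)
    fix C assume C: "C \<subseteq> rays" "\<Union>C = topspace T'"
    define R where "R = {p \<in> XX. {q \<in> XX. q < p} \<in> C}"
    define L where "L = {p \<in> XX. {q \<in> XX. p < q} \<in> C}"
    show "\<exists>C'. finite C' \<and> C' \<subseteq> C \<and> \<Union>C' = topspace T'"
    proof (cases "XX \<in> C")
      case True
      then show ?thesis using top' by (intro exI[of _ "{XX}"]) auto
    next
      case False
      have "\<exists>p\<in>R. \<exists>q\<in>L. q < p"
      proof (rule ccontr)
        assume "\<not> ?thesis"
        then have "p \<le> q" if "p \<in> R" "q \<in> L" for p q using that by (meson not_le)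
        then obtain c where c: "c \<in> XX" "\<forall>p\<in>R. p \<le> c" "\<forall>q\<in>L. c \<le> q"
          using order_complete[of R L] by (auto simp: R_def L_def)
        then have "c \<in> \<Union>C" using C(2) top' by simp
        then obtain A where A: "A \<in> C" "c \<in> A" by blast
        then have "A \<in> rays" using C by auto
        then consider p where "p \<in> XX" "A = {q \<in> XX. p < q}" | p where "p \<in> XX" "A = {q \<in> XX. q < p}"
          using False A(1) unfolding rays_def by auto
        then show False
        proof cases
          case 1
          then have "p \<in> L" using A(1) by (simp add: L_def)
          then have "c \<le> p" using c(3) by auto
          then show False using A(2) 1 by (auto dest: leD)
        next
          case 2
          then have "p \<in> R" using A(1) by (simp add: R_def)
          then have "p \<le> c" using c(2) by auto
          then show False using A(2) 2 by (auto dest: leD)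
        qed
      qed
      then obtain p q where pq: "p \<in> R" "q \<in> L" "q < p" by blast
      have "{z \<in> XX. z < p} \<union> {z \<in> XX. q < z} = XX"
      proof -
        have "z < p \<or> q < z" for z using pq(3) by (meson less_le_trans not_le)
        then show ?thesis by blast
      qed
      then show ?thesis using pq top' by (intro exI[of _ "{{z \<in> XX. z < p}, {z \<in> XX. q < z}}"]) (auto simp: R_def L_def)
    qed
  qed
  moreover have "openin T' U" if "openin TT U" for U
    using that unfolding openin_TT_iff
  proof (induction rule: generate_topology_on.induct)
    case (Basis s)
    have "s = \<Union>rays \<inter> s" using Basis by auto
    then show ?case unfolding T'_def openin_subbase
      by (metis (mono_tags, lifting) Basis arbitrary_union_of_inc finite_intersection_of_inc relative_to_inc)
  qed auto
  ultimately have c: "compactin T' XX" and finer: "\<And>U. openin TT U \<Longrightarrow> openin T' U"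
    using top' by (simp_all add: compact_space_def)
  show ?thesis unfolding compact_space_def compactin_def
  proof (intro conjI allI impI)
    fix \<U> assume U: "Ball \<U> (openin TT) \<and> topspace TT \<subseteq> \<Union>\<U>"
    then have "Ball \<U> (openin T') \<and> XX \<subseteq> \<Union>\<U>" using finer by simp
    then show "\<exists>\<F>. finite \<F> \<and> \<F> \<subseteq> \<U> \<and> topspace TT \<subseteq> \<Union>\<F>"
      using c unfolding compactin_def topspace_TT by simp
  qed simp
qed

lemma convex_nbhd_TT:
  assumes "openin TT U" "p \<in> U"
  shows "\<exists>N. openin TT N \<and> order_convex XX N \<and> p \<in> N \<and> N \<subseteq> U"
proof -
  have "\<forall>p\<in>U. \<exists>N. openin TT N \<and> order_convex XX N \<and> p \<in> N \<and> N \<subseteq> U"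
    using assms(1)
  proof (induction rule: rays_induct)
    case (Int A B)
    show ?case
    proof
      fix p assume p: "p \<in> A \<inter> B"
      obtain N where N: "openin TT N" "order_convex XX N" "p \<in> N" "N \<subseteq> A" using Int p by blast
      obtain M where M: "openin TT M" "order_convex XX M" "p \<in> M" "M \<subseteq> B" using Int p by blast
      show "\<exists>N. openin TT N \<and> order_convex XX N \<and> p \<in> N \<and> N \<subseteq> A \<inter> B"
        using N M order_convex_Int[OF N(2) M(2)] by (intro exI[of _ "N \<inter> M"]) auto
    qed
  next
    case (UN \<K>)
    show ?case
    proof
      fix p assume "p \<in> \<Union>\<K>"
      then obtain A where A: "A \<in> \<K>" "p \<in> A" by auto
      obtain N where "openin TT N" "order_convex XX N" "p \<in> N" "N \<subseteq> A"
        using bspec[OF conjunct2[OF UN[OF A(1)]] A(2)] by auto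
      then show "\<exists>N. openin TT N \<and> order_convex XX N \<and> p \<in> N \<and> N \<subseteq> \<Union>\<K>"
        using A(1) by (intro exI[of _ N]) auto
    qed
  next
    case X
    have "openin TT XX" using openin_topspace[of TT] by simp
    moreover have "order_convex XX XX" by (simp add: order_convex_def)
    ultimately show ?case by blast
  next
    case (upper p)
    have "order_convex XX {q \<in> XX. p < q}" unfolding order_convex_def by (auto intro: less_le_trans)
    then show ?case using ray_open(1)[OF upper] by blast
  next
    case (lower p)
    have "order_convex XX {q \<in> XX. q < p}" unfolding order_convex_def by (auto intro: le_less_trans)
    then show ?case using ray_open(2)[OF lower] by blast
  qed
  then show ?thesis using assms(2) by blast
qed

sublocale ordered_compact TT
proof
  show "compact_space TT" by (rule compact_TT)
qed (use ray_open convex_nbhd_TT in auto)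

text \<open>An upper ray that contains \<open>p\<close> starts at some \<open>r\<close> with
  \<open>collapse r < x\<close>: equality would mean that \<open>r\<close> and \<open>p\<close> are
  the two halves of a split point, with \<open>p\<close> the right half. A lower ray containing
  \<open>p\<close> contains everything that collapses to the left of \<open>x\<close>.\<close>

lemma left_germ:
  assumes "openin TT U" "p \<in> U" "p = Minus x \<or> (p = Pt x \<and> x \<noteq> 0)"
  shows "\<exists>e>0. \<forall>q\<in>XX. x - e < collapse q \<and> collapse q < x \<longrightarrow> q \<in> U"
proof -
  have "\<forall>p x. p \<in> U \<and> (p = Minus x \<or> (p = Pt x \<and> x \<noteq> 0)) \<longrightarrow>
    (\<exists>e>0. \<forall>q\<in>XX. x - e < collapse q \<and> collapse q < x \<longrightarrow> q \<in> U)"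
    using assms(1)
  proof (induction rule: rays_induct)
    case (Int A B)
    show ?case
    proof (intro allI impI)
      fix p x assume p: "p \<in> A \<inter> B \<and> (p = Minus x \<or> (p = Pt x \<and> x \<noteq> 0))"
      obtain e where e: "e > 0" "\<forall>q\<in>XX. x - e < collapse q \<and> collapse q < x \<longrightarrow> q \<in> A" using Int p by blast
      obtain e' where e': "e' > 0" "\<forall>q\<in>XX. x - e' < collapse q \<and> collapse q < x \<longrightarrow> q \<in> B" using Int p by blast
      show "\<exists>e>0. \<forall>q\<in>XX. x - e < collapse q \<and> collapse q < x \<longrightarrow> q \<in> A \<inter> B"
        using e e' by (intro exI[of _ "min e e'"]) auto
    qed
  next
    case (UN \<K>)
    show ?case
    proof (intro allI impI)
      fix p x assume p: "p \<in> \<Union>\<K> \<and> (p = Minus x \<or> (p = Pt x \<and> x \<noteq> 0))"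
      then obtain A where A: "A \<in> \<K>" "p \<in> A" by auto
      have "\<exists>e>0. \<forall>q\<in>XX. x - e < collapse q \<and> collapse q < x \<longrightarrow> q \<in> A"
        using conjunct2[OF UN[OF A(1)], rule_format, of p x] A(2) p by simp
      then show "\<exists>e>0. \<forall>q\<in>XX. x - e < collapse q \<and> collapse q < x \<longrightarrow> q \<in> \<Union>\<K>" using A(1) by (meson UnionI)
    qed
  next
    case X
    then show ?case by (auto intro: exI[of _ 1])
  next
    case (upper r)
    show ?case
    proof (intro allI impI)
      fix p x assume p: "p \<in> {q \<in> XX. r < q} \<and> (p = Minus x \<or> (p = Pt x \<and> x \<noteq> 0))"
      have "collapse r < x"
      proof (rule ccontr)
        assume "\<not> collapse r < x"
        then have "collapse r = collapse p" using p collapse_mono[of r p] by auto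
        then have "\<exists>z. r = Minus z \<and> p = Plus z" using same_collapse[of r p] upper p by blast
        then show False using p by auto
      qed
      then show "\<exists>e>0. \<forall>q\<in>XX. x - e < collapse q \<and> collapse q < x \<longrightarrow> q \<in> {q \<in> XX. r < q}"
        by (intro exI[of _ "x - collapse r"]) (auto intro: collapse_less)
    qed
  next
    case (lower r)
    show ?case
    proof (intro allI impI)
      fix p x assume p: "p \<in> {q \<in> XX. q < r} \<and> (p = Minus x \<or> (p = Pt x \<and> x \<noteq> 0))"
      then have "x \<le> collapse r" using collapse_mono[of p r] by auto
      then show "\<exists>e>0. \<forall>q\<in>XX. x - e < collapse q \<and> collapse q < x \<longrightarrow> q \<in> {q \<in> XX. q < r}"
        by (intro exI[of _ 1]) (auto intro: collapse_less)
    qed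
  qed
  then show ?thesis using assms by blast
qed

lemma right_germ:
  assumes "openin TT U" "p \<in> U" "p = Plus x \<or> (p = Pt x \<and> x \<noteq> 1)"
  shows "\<exists>e>0. \<forall>q\<in>XX. x < collapse q \<and> collapse q < x + e \<longrightarrow> q \<in> U"
proof -
  have "\<forall>p x. p \<in> U \<and> (p = Plus x \<or> (p = Pt x \<and> x \<noteq> 1)) \<longrightarrow>
    (\<exists>e>0. \<forall>q\<in>XX. x < collapse q \<and> collapse q < x + e \<longrightarrow> q \<in> U)"
    using assms(1)
  proof (induction rule: rays_induct)
    case (Int A B)
    show ?case
    proof (intro allI impI)
      fix p x assume p: "p \<in> A \<inter> B \<and> (p = Plus x \<or> (p = Pt x \<and> x \<noteq> 1))"
      obtain e where e: "e > 0" "\<forall>q\<in>XX. x < collapse q \<and> collapse q < x + e \<longrightarrow> q \<in> A" using Int p by blast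
      obtain e' where e': "e' > 0" "\<forall>q\<in>XX. x < collapse q \<and> collapse q < x + e' \<longrightarrow> q \<in> B" using Int p by blast
      show "\<exists>e>0. \<forall>q\<in>XX. x < collapse q \<and> collapse q < x + e \<longrightarrow> q \<in> A \<inter> B"
        using e e' by (intro exI[of _ "min e e'"]) auto
    qed
  next
    case (UN \<K>)
    show ?case
    proof (intro allI impI)
      fix p x assume p: "p \<in> \<Union>\<K> \<and> (p = Plus x \<or> (p = Pt x \<and> x \<noteq> 1))"
      then obtain A where A: "A \<in> \<K>" "p \<in> A" by auto
      have "\<exists>e>0. \<forall>q\<in>XX. x < collapse q \<and> collapse q < x + e \<longrightarrow> q \<in> A"
        using conjunct2[OF UN[OF A(1)], rule_format, of p x] A(2) p by simp
      then show "\<exists>e>0. \<forall>q\<in>XX. x < collapse q \<and> collapse q < x + e \<longrightarrow> q \<in> \<Union>\<K>" using A(1) by (meson UnionI)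
    qed
  next
    case X
    then show ?case by (auto intro: exI[of _ 1])
  next
    case (upper r)
    show ?case
    proof (intro allI impI)
      fix p x assume p: "p \<in> {q \<in> XX. r < q} \<and> (p = Plus x \<or> (p = Pt x \<and> x \<noteq> 1))"
      then have "collapse r \<le> x" using collapse_mono[of r p] by auto
      then show "\<exists>e>0. \<forall>q\<in>XX. x < collapse q \<and> collapse q < x + e \<longrightarrow> q \<in> {q \<in> XX. r < q}"
        by (intro exI[of _ 1]) (auto intro: collapse_less)
    qed
  next
    case (lower r)
    show ?case
    proof (intro allI impI)
      fix p x assume p: "p \<in> {q \<in> XX. q < r} \<and> (p = Plus x \<or> (p = Pt x \<and> x \<noteq> 1))"
      have "x < collapse r"
      proof (rule ccontr)
        assume "\<not> x < collapse r"
        then have "collapse p = collapse r" using p collapse_mono[of p r] by auto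
        then have "\<exists>z. p = Minus z \<and> r = Plus z" using same_collapse[of p r] lower p by blast
        then show False using p by auto
      qed
      then show "\<exists>e>0. \<forall>q\<in>XX. x < collapse q \<and> collapse q < x + e \<longrightarrow> q \<in> {q \<in> XX. q < r}"
        by (intro exI[of _ "collapse r - x"]) (auto intro: collapse_less)
    qed
  qed
  then show ?thesis using assms by blast
qed

text \<open>Each point has a germ on at least one side, so every non-empty open set contains all
  points over some open interval. This carries density and transitivity from the interval to
  \<open>X\<close>.\<close>

lemma open_contains_lift:
  assumes U: "openin TT U" "U \<noteq> {}"
  shows "\<exists>u v. u < v \<and> 0 \<le> u \<and> v \<le> 1 \<and> (\<forall>q\<in>XX. u < collapse q \<and> collapse q < v \<longrightarrow> q \<in> U)"
proof -
  obtain p where p: "p \<in> U" using U by auto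
  then have pX: "p \<in> XX" using openin_subset[OF U(1)] by auto
  have c01: "collapse p \<in> {0..1}" using collapse_01[OF pX] .
  have "(\<exists>x. p = Minus x \<or> (p = Pt x \<and> x \<noteq> 0)) \<or> (\<exists>x. p = Plus x \<or> (p = Pt x \<and> x \<noteq> 1))"
    by (cases p) auto
  then show ?thesis
  proof (elim disjE exE)
    fix x assume x: "p = Minus x" then have x': "p = Minus x \<or> (p = Pt x \<and> x \<noteq> 0)" by simp
    obtain e where e: "e > 0" "\<forall>q\<in>XX. x - e < collapse q \<and> collapse q < x \<longrightarrow> q \<in> U"
      using left_germ[OF U(1) p x'] by auto
    have "x > 0" using x pX c01 by auto
    then show ?thesis using e c01 x by (intro exI[of _ "max 0 (x - e)"] exI[of _ x]) auto
  next
    fix x assume x: "p = Pt x \<and> x \<noteq> 0" then have x': "p = Minus x \<or> (p = Pt x \<and> x \<noteq> 0)" by simp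
    obtain e where e: "e > 0" "\<forall>q\<in>XX. x - e < collapse q \<and> collapse q < x \<longrightarrow> q \<in> U"
      using left_germ[OF U(1) p x'] by auto
    have "x > 0" using x c01 by auto
    then show ?thesis using e c01 x by (intro exI[of _ "max 0 (x - e)"] exI[of _ x]) auto
  next
    fix x assume x: "p = Plus x" then have x': "p = Plus x \<or> (p = Pt x \<and> x \<noteq> 1)" by simp
    obtain e where e: "e > 0" "\<forall>q\<in>XX. x < collapse q \<and> collapse q < x + e \<longrightarrow> q \<in> U"
      using right_germ[OF U(1) p x'] by auto
    have "x < 1" using x pX c01 by auto
    then show ?thesis using e c01 x by (intro exI[of _ x] exI[of _ "min 1 (x + e)"]) auto
  next
    fix x assume x: "p = Pt x \<and> x \<noteq> 1" then have x': "p = Plus x \<or> (p = Pt x \<and> x \<noteq> 1)" by simp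
    obtain e where e: "e > 0" "\<forall>q\<in>XX. x < collapse q \<and> collapse q < x + e \<longrightarrow> q \<in> U"
      using right_germ[OF U(1) p x'] by auto
    have "x < 1" using x c01 by auto
    then show ?thesis using e c01 x by (intro exI[of _ x] exI[of _ "min 1 (x + e)"]) auto
  qed
qed

lemma open_contains_Pt:
  assumes U: "openin TT U" "U \<noteq> {}" shows "\<exists>x\<in>I0'. Pt x \<in> U"
proof -
  obtain u v where uv: "u < v" "0 \<le> u" "v \<le> 1" "\<forall>q\<in>XX. u < collapse q \<and> collapse q < v \<longrightarrow> q \<in> U"
    using open_contains_lift[OF U] by auto
  obtain x where x: "x \<in> I0'" "u < x" "x < v" using I0_dense[OF uv(1-3)] by auto
  then have "Pt x \<in> U" using uv(4) by (auto dest: bspec[of _ _ "Pt x"])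
  then show ?thesis using x by auto
qed

lemma no_isolated_TT: "\<not> openin TT {p}"
proof
  assume U: "openin TT {p}"
  obtain u v where uv: "u < v" "0 \<le> u" "v \<le> 1" "\<forall>q\<in>XX. u < collapse q \<and> collapse q < v \<longrightarrow> q \<in> {p}"
    using open_contains_lift[OF U] by auto
  obtain x where x: "x \<in> I0'" "u < x" "x < v" using I0_dense[OF uv(1-3)] by auto
  obtain y where y: "y \<in> I0'" "u < y" "y < x" using I0_dense[of u x] uv x by auto
  have "Pt x = p" "Pt y = p" using uv(4) x y by (auto dest: bspec[of _ _ "Pt x"] bspec[of _ _ "Pt y"])
  then show False using y by auto
qed

text \<open>The preimage of a half-line is a union of rays that start or end at unsplit points, by
  density of \<open>I0\<close>.\<close>

lemma cont_collapse: "cont collapse"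
  unfolding continuous_map_upper_lower_semicontinuous_lt
proof (intro conjI allI)
  fix c :: real
  show "openin TT {p \<in> topspace TT. c < collapse p}"
  proof (cases "c < 0")
    case True
    then have "{p \<in> topspace TT. c < collapse p} = topspace TT" using collapse_01 by fastforce
    then show ?thesis by (metis openin_topspace)
  next
    case False
    have "{p \<in> topspace TT. c < collapse p} = (\<Union>x\<in>{x \<in> I0'. c < x}. {q \<in> XX. Pt x < q})"
    proof
      show "(\<Union>x\<in>{x \<in> I0'. c < x}. {q \<in> XX. Pt x < q}) \<subseteq> {p \<in> topspace TT. c < collapse p}"
        using collapse_mono[of "Pt _"] by (force dest: less_imp_le)
      show "{p \<in> topspace TT. c < collapse p} \<subseteq> (\<Union>x\<in>{x \<in> I0'. c < x}. {q \<in> XX. Pt x < q})"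
      proof
        fix p assume p: "p \<in> {p \<in> topspace TT. c < collapse p}"
        then obtain x where "x \<in> I0'" "c < x" "x < collapse p"
          using I0_dense[of c "collapse p"] False collapse_01[of p] by auto
        then show "p \<in> (\<Union>x\<in>{x \<in> I0'. c < x}. {q \<in> XX. Pt x < q})" using p by (auto intro!: exI[of _ x] collapse_less)
      qed
    qed
    moreover have "openin TT (\<Union>x\<in>{x \<in> I0'. c < x}. {q \<in> XX. Pt x < q})"
      using ray_open(1) by (intro openin_Union) auto
    ultimately show ?thesis by simp
  qed
  show "openin TT {p \<in> topspace TT. collapse p < c}"
  proof (cases "c > 1")
    case True
    then have "{p \<in> topspace TT. collapse p < c} = topspace TT" using collapse_01 by fastforce
    then show ?thesis by (metis openin_topspace)
  next
    case False
    have "{p \<in> topspace TT. collapse p < c} = (\<Union>x\<in>{x \<in> I0'. x < c}. {q \<in> XX. q < Pt x})"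
    proof
      show "(\<Union>x\<in>{x \<in> I0'. x < c}. {q \<in> XX. q < Pt x}) \<subseteq> {p \<in> topspace TT. collapse p < c}"
        using collapse_mono[of _ "Pt _"] by (force dest: less_imp_le)
      show "{p \<in> topspace TT. collapse p < c} \<subseteq> (\<Union>x\<in>{x \<in> I0'. x < c}. {q \<in> XX. q < Pt x})"
      proof
        fix p assume p: "p \<in> {p \<in> topspace TT. collapse p < c}"
        then obtain x where "x \<in> I0'" "collapse p < x" "x < c"
          using I0_dense[of "collapse p" c] False collapse_01[of p] by auto
        then show "p \<in> (\<Union>x\<in>{x \<in> I0'. x < c}. {q \<in> XX. q < Pt x})" using p by (auto intro!: exI[of _ x] collapse_less)
      qed
    qed
    moreover have "openin TT (\<Union>x\<in>{x \<in> I0'. x < c}. {q \<in> XX. q < Pt x})"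
      using ray_open(2) by (intro openin_Union) auto
    ultimately show ?thesis by simp
  qed
qed

end

text \<open>0 and 1 belong to \<open>I1\<close> but are not split, so blocks that reach the ends of
  the interval need a different endpoint there.\<close>

definition right_point :: "real \<Rightarrow> point" where "right_point u = (if u = 0 then Pt 0 else Plus u)"
definition left_point :: "real \<Rightarrow> point" where "left_point v = (if v = 1 then Pt 1 else Minus v)"

context interval_map
begin

definition block :: "real \<Rightarrow> real \<Rightarrow> point set" where
  "block u v = {p \<in> XX. right_point u \<le> p \<and> p \<le> left_point v}"

lemma block_iff:
  assumes "u < v" "u \<in> I1'" "v \<in> I1'"
  shows "p \<in> block u v \<longleftrightarrow> p \<in> XX \<and> (u < collapse p \<and> collapse p < v \<or> p = right_point u \<or> p = left_point v)"
proof -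
  have uv: "0 \<le> u" "v \<le> 1" using assms I1_01 by auto
  have 1: "right_point u \<le> p \<longleftrightarrow> u < collapse p \<or> p = right_point u" if "p \<in> XX"
    using that assms(2) zero_one_I1 by (cases p) (auto simp: right_point_def less_eq_point_def I0_iff)
  have 2: "p \<le> left_point v \<longleftrightarrow> collapse p < v \<or> p = left_point v" if "p \<in> XX"
    using that assms(3) zero_one_I1 by (cases p) (auto simp: left_point_def less_eq_point_def I0_iff)
  have 3: "collapse (right_point u) = u" "collapse (left_point v) = v" by (auto simp: right_point_def left_point_def)
  show ?thesis unfolding block_def using 1 2 3 assms(1) by auto
qed

lemma block_collapse:
  assumes "u < v" "u \<in> I1'" "v \<in> I1'" "p \<in> block u v"
  shows "collapse p \<in> {u..v}"
  using assms by (auto simp: block_iff right_point_def left_point_def)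

lemma block_X: "block u v \<subseteq> XX" by (auto simp: block_def)

lemma endpoint_X: "u \<in> I1' \<Longrightarrow> u \<noteq> 1 \<Longrightarrow> right_point u \<in> XX" "v \<in> I1' \<Longrightarrow> v \<noteq> 0 \<Longrightarrow> left_point v \<in> XX"
  by (auto simp: right_point_def left_point_def)

lemma block_convex: "order_convex XX (block u v)"
  unfolding order_convex_def block_def by auto

text \<open>Nothing lies between \<open>Minus u\<close> and \<open>Plus u\<close>, so the closed ray
  from \<open>Plus u\<close> is also the open ray above \<open>Minus u\<close>; likewise at
  \<open>v\<close>.\<close>

lemma block_clopen:
  assumes "u < v" "u \<in> I1'" "v \<in> I1'"
  shows "openin TT (block u v)" "closedin TT (block u v)"
proof -
  have uv: "0 \<le> u" "v \<le> 1" "u \<noteq> 1" "v \<noteq> 0" using assms I1_01 by auto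
  have X: "right_point u \<in> XX" "left_point v \<in> XX" using endpoint_X assms uv by auto
  have eq: "block u v = {p \<in> XX. right_point u \<le> p} \<inter> {p \<in> XX. p \<le> left_point v}" by (auto simp: block_def)
  show "closedin TT (block u v)" unfolding eq
    using closedin_atLeast[of "right_point u"] closedin_atMost[of "left_point v"] X by auto
  have XXo: "openin TT XX" using openin_topspace[of TT] by simp
  have "openin TT {p \<in> XX. right_point u \<le> p}"
  proof (cases "u = 0")
    case True
    have "{p \<in> XX. right_point u \<le> p} = XX"
    proof -
      have "Pt 0 \<le> p" if "p \<in> XX" for p
        using that collapse_01[OF that] zero_one_I1 by (cases p) (auto simp: less_eq_point_def I0_iff)
      then show ?thesis using True by (auto simp: right_point_def)
    qed
    then show ?thesis using XXo by simp
  next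
    case False
    then have M: "Minus u \<in> XX" using assms uv by auto
    have "{p \<in> XX. right_point u \<le> p} = {p \<in> XX. Minus u < p}"
    proof -
      have "Plus u \<le> p \<longleftrightarrow> Minus u < p" if "p \<in> XX" for p
        using that assms(2) False uv(3) by (cases p) (auto simp: less_eq_point_def less_point_def I0_iff)
      then show ?thesis using False by (auto simp: right_point_def)
    qed
    then show ?thesis using ray_open(1)[OF M] by simp
  qed
  moreover have "openin TT {p \<in> XX. p \<le> left_point v}"
  proof (cases "v = 1")
    case True
    have "{p \<in> XX. p \<le> left_point v} = XX"
    proof -
      have "p \<le> Pt 1" if "p \<in> XX" for p
        using that collapse_01[OF that] zero_one_I1 by (cases p) (auto simp: less_eq_point_def I0_iff)
      then show ?thesis using True by (auto simp: left_point_def)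
    qed
    then show ?thesis using XXo by simp
  next
    case False
    then have M: "Plus v \<in> XX" using assms uv by auto
    have "{p \<in> XX. p \<le> left_point v} = {p \<in> XX. p < Plus v}"
    proof -
      have "p \<le> Minus v \<longleftrightarrow> p < Plus v" if "p \<in> XX" for p
        using that assms(3) False uv(4) by (cases p) (auto simp: less_eq_point_def less_point_def I0_iff)
      then show ?thesis using False by (auto simp: left_point_def)
    qed
    then show ?thesis using ray_open(2)[OF M] by simp
  qed
  ultimately show "openin TT (block u v)" unfolding eq by (rule openin_Int)
qed

lemma block_Pt: "u < v \<Longrightarrow> u \<in> I1' \<Longrightarrow> v \<in> I1' \<Longrightarrow> x \<in> I0' \<Longrightarrow> Pt x \<in> block u v \<longleftrightarrow> u < x \<and> x < v"
  by (auto simp: block_iff right_point_def left_point_def I0_iff)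

end

section \<open>The local homeomorphism is piecewise monotone\<close>

locale associated_map = interval_map +
  fixes \<sigma> :: "point \<Rightarrow> point"
  assumes assoc: "associated_local_homeo \<tau> n a \<sigma>"
begin

lemma sigma_cont: "continuous_map TT TT \<sigma>"
  using assoc by (simp add: associated_local_homeo_def)

lemma sigma_X: "p \<in> XX \<Longrightarrow> \<sigma> p \<in> XX"
  using continuous_map_funspace[OF sigma_cont] by auto

lemma tau_I1_iff: "i < n \<Longrightarrow> x \<in> lap i \<Longrightarrow> \<tau> x \<in> I1' \<longleftrightarrow> x \<in> I1'"
  using branch_I1_iff[of i x] branch_props(2)[of i x] by auto

lemma I0_lap: assumes "x \<in> I0'" shows "\<exists>i<n. x \<in> lap i"
proof (rule lap_cover)
  show "x \<in> {0..1}" using assms by (simp add: I0_iff)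
  show "x \<notin> pp" using assms a_I1 by (auto simp: partition_points_def I0_iff)
qed

lemma tau_I0: assumes "x \<in> I0'" shows "\<tau> x \<in> I0'"
proof -
  obtain i where "i < n" "x \<in> lap i" using I0_lap[OF assms] by auto
  then show ?thesis using tau_I1_iff[of i x] tau01[of x] assms by (auto simp: I0_iff)
qed

lemma sigma_Pt: assumes "x \<in> I0'" shows "\<sigma> (Pt x) = Pt (\<tau> x)"
proof -
  have "Pt x \<in> X0_set \<tau> n a" using assms by (simp add: X0_set_def)
  then have c: "collapse (\<sigma> (Pt x)) = \<tau> x" using assoc by (auto simp: associated_local_homeo_def)
  have "\<sigma> (Pt x) \<in> XX" using sigma_X assms by simp
  then show ?thesis using c tau_I0[OF assms] by (cases "\<sigma> (Pt x)") (auto simp: I0_iff)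
qed

definition cell :: "nat \<Rightarrow> point set" where "cell i = block (a i) (a (Suc i))"

lemma cell_props:
  assumes i: "i < n"
  shows "openin TT (cell i)" "closedin TT (cell i)" "order_convex XX (cell i)"
    "p \<in> cell i \<Longrightarrow> collapse p \<in> clap i" "p \<in> cell i \<Longrightarrow> p \<in> XX"
    "x \<in> I0' \<Longrightarrow> Pt x \<in> cell i \<longleftrightarrow> x \<in> lap i"
    "p \<in> cell i \<longleftrightarrow> p \<in> XX \<and> (collapse p \<in> lap i \<or> p = right_point (a i) \<or> p = left_point (a (Suc i)))"
  unfolding cell_def
  using block_clopen[OF a_step[OF i] a_I1 a_I1] block_convex block_collapse[OF a_step[OF i] a_I1 a_I1, of p]
    block_X block_Pt[OF a_step[OF i] a_I1 a_I1, of x] block_iff[OF a_step[OF i] a_I1 a_I1, of p] i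
  by auto

text \<open>Both sides are continuous on the clopen cell. The set where they differ is open, and if
  non-empty it would contain an unsplit point, where they agree.\<close>

lemma collapse_sigma:
  assumes i: "i < n" and p: "p \<in> cell i" shows "collapse (\<sigma> p) = br i (collapse p)"
proof (rule ccontr)
  assume ne: "collapse (\<sigma> p) \<noteq> br i (collapse p)"
  let ?T = "subtopology TT (cell i)"
  have c1: "continuous_map ?T euclideanreal (collapse \<circ> \<sigma>)"
    using continuous_map_compose[OF sigma_cont cont_collapse] by (rule continuous_map_from_subtopology)
  have "continuous_map ?T (top_of_set (clap i)) collapse"
    using continuous_map_from_subtopology[OF cont_collapse] cell_props(4)[OF i]
    by (auto simp: continuous_map_in_subtopology)
  then have "continuous_map ?T euclideanreal (br i \<circ> collapse)"
    using branch_props(1)[OF i] by (rule continuous_map_compose[of _ "top_of_set (clap i)", OF _ iffD2[OF continuous_map_iff_continuous]])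
  then have "continuous_map ?T euclideanreal (\<lambda>q. (collapse \<circ> \<sigma>) q - (br i \<circ> collapse) q)"
    using c1 by (intro continuous_map_diff)
  moreover have "openin euclideanreal (- {0})" using open_Compl[OF closed_singleton, of "0::real"] by simp
  ultimately have "openin ?T {q \<in> topspace ?T. (collapse \<circ> \<sigma>) q - (br i \<circ> collapse) q \<in> - {0}}"
    by (rule openin_continuous_map_preimage)
  then have o: "openin TT {q \<in> topspace ?T. (collapse \<circ> \<sigma>) q - (br i \<circ> collapse) q \<in> - {0}}"
    using cell_props(1)[OF i] openin_open_subtopology by blast
  have "p \<in> {q \<in> topspace ?T. (collapse \<circ> \<sigma>) q - (br i \<circ> collapse) q \<in> - {0}}"
    using ne p cell_props(5)[OF i p] by simp
  then obtain x where x: "x \<in> I0'" "Pt x \<in> {q \<in> topspace ?T. (collapse \<circ> \<sigma>) q - (br i \<circ> collapse) q \<in> - {0}}"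
    using open_contains_Pt[OF o] by blast
  then have "x \<in> lap i" "collapse (\<sigma> (Pt x)) \<noteq> br i x" using cell_props(6)[OF i x(1)] by auto
  then show False using sigma_Pt[OF x(1)] branch_props(2)[OF i] by simp
qed

lemma tau_less:
  assumes "i < n" "x \<in> lap i" "y \<in> lap i" "x < y"
  shows "if up i then \<tau> x < \<tau> y else \<tau> y < \<tau> x"
  using branch_props(3)[OF assms(1), of x y] branch_props(2)[OF assms(1)] assms(2-4) by auto

lemma tau_interior:
  assumes i: "i < n" and x: "x \<in> lap i" shows "0 < \<tau> x" "\<tau> x < 1"
proof -
  have m: "a i \<in> clap i" "a (Suc i) \<in> clap i" "x \<in> clap i" "a i < x" "x < a (Suc i)" using x by auto
  show "0 < \<tau> x" "\<tau> x < 1"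
    using branch_props(3)[OF i m(1,3,4)] branch_props(3)[OF i m(3,2,5)] branch_props(4)[OF i m(1)]
      branch_props(4)[OF i m(2)] branch_props(2)[OF i x] by (auto split: if_splits)
qed

text \<open>Both halves of \<open>x\<close> go to points over \<open>y = \<tau> x\<close>; which
  half goes where is decided by continuity. \<open>Minus x\<close> is approached by unsplit points
  from the left and \<open>Plus x\<close> from the right, and \<open>\<tau>\<close> is monotone on
  the lap.\<close>

lemma sigma_split:
  assumes i: "i < n" and x: "x \<in> lap i" "x \<in> I1'"
  shows "\<sigma> (Minus x) < \<sigma> (Plus x) \<longleftrightarrow> up i" "\<sigma> (Minus x) \<noteq> \<sigma> (Plus x)"
proof -
  define y where "y = \<tau> x"
  have yI1: "y \<in> I1'" using tau_I1_iff[OF i x(1)] x(2) y_def by simp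
  have y01: "0 < y" "y < 1" using tau_interior[OF i x(1)] y_def by auto
  have x01: "x \<noteq> 0" "x \<noteq> 1" using x a01[of i] a01[of "Suc i"] i by auto
  have MP: "Minus x \<in> XX" "Plus x \<in> XX" using x x01 by auto
  have MPc: "Minus x \<in> cell i" "Plus x \<in> cell i" using cell_props(7)[OF i] x MP by auto
  have yX: "Minus y \<in> XX" "Plus y \<in> XX" using yI1 y01 by auto
  have split: "\<sigma> p = Minus y \<or> \<sigma> p = Plus y" if "p \<in> cell i" "collapse p = x" for p
  proof -
    have "collapse (\<sigma> p) = y" using collapse_sigma[OF i that(1)] that(2) branch_props(2)[OF i x(1)] y_def by simp
    moreover have "\<sigma> p \<in> XX" using sigma_X cell_props(5)[OF i that(1)] by simp
    ultimately show ?thesis using yI1 y01 by (cases "\<sigma> p") (auto simp: I0_iff)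
  qed
  have pre: "openin TT {p \<in> XX. \<sigma> p \<in> U}" if "openin TT U" for U
    using openin_continuous_map_preimage[OF sigma_cont that] by simp
  have left: "\<exists>x'\<in>I0'. x' \<in> lap i \<and> x' < x \<and> Pt (\<tau> x') \<in> U" if U: "openin TT U" "\<sigma> (Minus x) \<in> U" for U
  proof -
    have "Minus x \<in> {p \<in> XX. \<sigma> p \<in> U}" using U(2) MP by simp
    from left_germ[OF pre[OF U(1)] this, of x] obtain e where e: "e > 0"
      "\<forall>q\<in>XX. x - e < collapse q \<and> collapse q < x \<longrightarrow> q \<in> {p \<in> XX. \<sigma> p \<in> U}" by auto
    have "max (x - e) (a i) < x" "0 \<le> max (x - e) (a i)" "x \<le> 1" using e x a01[of i] a01[of "Suc i"] i by auto
    then obtain x' where x': "x' \<in> I0'" "max (x - e) (a i) < x'" "x' < x" using I0_dense by blast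
    have "Pt x' \<in> {p \<in> XX. \<sigma> p \<in> U}" using bspec[OF e(2), of "Pt x'"] x' by simp
    then show ?thesis using x' x sigma_Pt[OF x'(1)] by (intro bexI[of _ x']) auto
  qed
  have right: "\<exists>x'\<in>I0'. x' \<in> lap i \<and> x < x' \<and> Pt (\<tau> x') \<in> U" if U: "openin TT U" "\<sigma> (Plus x) \<in> U" for U
  proof -
    have "Plus x \<in> {p \<in> XX. \<sigma> p \<in> U}" using U(2) MP by simp
    from right_germ[OF pre[OF U(1)] this, of x] obtain e where e: "e > 0"
      "\<forall>q\<in>XX. x < collapse q \<and> collapse q < x + e \<longrightarrow> q \<in> {p \<in> XX. \<sigma> p \<in> U}" by auto
    have "x < min (x + e) (a (Suc i))" "0 \<le> x" "min (x + e) (a (Suc i)) \<le> 1" using e x a01[of i] a01[of "Suc i"] i by auto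
    then obtain x' where x': "x' \<in> I0'" "x < x'" "x' < min (x + e) (a (Suc i))" using I0_dense by blast
    have "Pt x' \<in> {p \<in> XX. \<sigma> p \<in> U}" using bspec[OF e(2), of "Pt x'"] x' by simp
    then show ?thesis using x' x sigma_Pt[OF x'(1)] by (intro bexI[of _ x']) auto
  qed
  let ?A = "{q \<in> XX. Minus y < q}" and ?B = "{q \<in> XX. q < Plus y}"
  have A: "\<tau> x' \<ge> y" if "Pt (\<tau> x') \<in> ?A" for x' using that collapse_mono[of "Minus y" "Pt (\<tau> x')"] by (simp add: less_imp_le)
  have B: "\<tau> x' \<le> y" if "Pt (\<tau> x') \<in> ?B" for x' using that collapse_mono[of "Pt (\<tau> x')" "Plus y"] by (simp add: less_imp_le)
  have PA: "Plus y \<in> ?A" and MB: "Minus y \<in> ?B" using yX by (auto simp: less_point_def)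
  have main: "\<sigma> (Minus x) = (if up i then Minus y else Plus y) \<and> \<sigma> (Plus x) = (if up i then Plus y else Minus y)"
  proof (cases "up i")
    case True
    have "\<sigma> (Minus x) \<noteq> Plus y"
    proof
      assume "\<sigma> (Minus x) = Plus y"
      then obtain x' where "x' \<in> lap i" "x' < x" "Pt (\<tau> x') \<in> ?A" using left[OF ray_open(1)[OF yX(1)]] PA by auto
      then show False using A[of x'] tau_less[OF i _ x(1), of x'] True y_def by simp
    qed
    moreover have "\<sigma> (Plus x) \<noteq> Minus y"
    proof
      assume "\<sigma> (Plus x) = Minus y"
      then obtain x' where "x' \<in> lap i" "x < x'" "Pt (\<tau> x') \<in> ?B" using right[OF ray_open(2)[OF yX(2)]] MB by auto
      then show False using B[of x'] tau_less[OF i x(1), of x'] True y_def by simp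
    qed
    ultimately show ?thesis using split[OF MPc(1)] split[OF MPc(2)] True by simp
  next
    case False
    have "\<sigma> (Minus x) \<noteq> Minus y"
    proof
      assume "\<sigma> (Minus x) = Minus y"
      then obtain x' where "x' \<in> lap i" "x' < x" "Pt (\<tau> x') \<in> ?B" using left[OF ray_open(2)[OF yX(2)]] MB by auto
      then show False using B[of x'] tau_less[OF i _ x(1), of x'] False y_def by simp
    qed
    moreover have "\<sigma> (Plus x) \<noteq> Plus y"
    proof
      assume "\<sigma> (Plus x) = Plus y"
      then obtain x' where "x' \<in> lap i" "x < x'" "Pt (\<tau> x') \<in> ?A" using right[OF ray_open(1)[OF yX(1)]] PA by auto
      then show False using A[of x'] tau_less[OF i x(1), of x'] False y_def by simp
    qed
    ultimately show ?thesis using split[OF MPc(1)] split[OF MPc(2)] False by simp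
  qed
  show "\<sigma> (Minus x) < \<sigma> (Plus x) \<longleftrightarrow> up i" "\<sigma> (Minus x) \<noteq> \<sigma> (Plus x)"
    using main by (auto simp: less_point_def)
qed

lemma sigma_strict_mono:
  assumes i: "i < n" and pq: "p \<in> cell i" "q \<in> cell i" "p < q"
  shows "if up i then \<sigma> p < \<sigma> q else \<sigma> q < \<sigma> p"
proof (cases "collapse p = collapse q")
  case False
  then have "collapse p < collapse q" using pq(3) by (auto simp: less_point_def)
  then have "if up i then br i (collapse p) < br i (collapse q) else br i (collapse q) < br i (collapse p)"
    using branch_props(3)[OF i cell_props(4)[OF i pq(1)] cell_props(4)[OF i pq(2)]] by simp
  then show ?thesis using collapse_sigma[OF i pq(1)] collapse_sigma[OF i pq(2)]
    by (auto simp: less_point_def)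
next
  case True
  obtain x where x: "p = Minus x" "q = Plus x"
    using same_collapse[OF cell_props(5)[OF i pq(1)] cell_props(5)[OF i pq(2)] True pq(3)] by auto
  have "x \<in> I1'" using cell_props(5)[OF i pq(1)] x by simp
  have "x \<in> lap i \<or> x = a (Suc i)" using pq(1) x cell_props(7)[OF i, of p]
    by (auto simp: right_point_def left_point_def split: if_splits)
  moreover have "x \<in> lap i \<or> x = a i" using pq(2) x cell_props(7)[OF i, of q]
    by (auto simp: right_point_def left_point_def split: if_splits)
  ultimately have "x \<in> lap i" using a_step[OF i] by auto
  then show ?thesis using sigma_split[OF i _ \<open>x \<in> I1'\<close>] x by (auto simp: not_less order_less_le)
qed

text \<open>\<open>u\<close> and \<open>v\<close> are the values of the branch at the ends of the
  lap. Since the block and the image are closed and the block and the cell are open, both inclusions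
  can be tested on unsplit points; there the intermediate value theorem provides the
  preimages.\<close>

lemma sigma_image_cell:
  assumes i: "i < n"
  shows "\<exists>u v. u < v \<and> u \<in> I1' \<and> v \<in> I1' \<and> (\<forall>x\<in>lap i. u < \<tau> x \<and> \<tau> x < v) \<and> \<sigma> ` cell i = block u v"
proof -
  define u where "u = min (br i (a i)) (br i (a (Suc i)))"
  define v where "v = max (br i (a i)) (br i (a (Suc i)))"
  have m: "a i \<in> clap i" "a (Suc i) \<in> clap i" using a_step[OF i] by auto
  have uv: "u < v" using branch_props(3)[OF i m a_step[OF i]] unfolding u_def v_def
    by (auto simp: min_def max_def split: if_splits)
  have "br i (a i) \<in> I1'" "br i (a (Suc i)) \<in> I1'" using branch_I1_iff[OF i] m a_I1 i by auto
  then have I: "u \<in> I1'" "v \<in> I1'" by (auto simp: u_def v_def min_def max_def)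
  have inside: "u < \<tau> x \<and> \<tau> x < v" if x: "x \<in> lap i" for x
  proof -
    have x': "x \<in> clap i" "a i < x" "x < a (Suc i)" using x by auto
    show ?thesis
      using branch_props(3)[OF i m(1) x'(1,2)] branch_props(3)[OF i x'(1) m(2) x'(3)] branch_props(2)[OF i x]
      unfolding u_def v_def by (auto split: if_splits)
  qed
  have "\<sigma> ` cell i = block u v"
  proof
    show "\<sigma> ` cell i \<subseteq> block u v"
    proof (rule ccontr)
      assume "\<not> ?thesis"
      then obtain p where p: "p \<in> cell i" "\<sigma> p \<notin> block u v" by auto
      let ?U = "cell i \<inter> {q \<in> topspace TT. \<sigma> q \<in> XX - block u v}"
      have "openin TT (XX - block u v)" using block_clopen(2)[OF uv I] by (metis closedin_def topspace_TT)
      then have o: "openin TT ?U" using cell_props(1)[OF i] openin_continuous_map_preimage[OF sigma_cont] by blast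
      have "p \<in> ?U" using p sigma_X cell_props(5)[OF i p(1)] by simp
      then obtain x where x: "x \<in> I0'" "Pt x \<in> ?U" using open_contains_Pt[OF o] by blast
      then have "x \<in> lap i" "Pt (\<tau> x) \<notin> block u v" using cell_props(6)[OF i x(1)] sigma_Pt[OF x(1)] by auto
      then show False using inside block_Pt[OF uv I tau_I0[OF x(1)]] by simp
    qed
    show "block u v \<subseteq> \<sigma> ` cell i"
    proof (rule ccontr)
      assume "\<not> ?thesis"
      then obtain q where q: "q \<in> block u v - \<sigma> ` cell i" by auto
      have cl: "closedin TT (\<sigma> ` cell i)" by (rule closed_image[OF sigma_cont cell_props(2)[OF i]])
      have "openin TT (block u v - \<sigma> ` cell i)" using block_clopen(1)[OF uv I] cl by auto
      then obtain y where y: "y \<in> I0'" "Pt y \<in> block u v - \<sigma> ` cell i" using open_contains_Pt q by blast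
      then have yuv: "u < y" "y < v" using block_Pt[OF uv I y(1)] by auto
      have "\<exists>x. a i \<le> x \<and> x \<le> a (Suc i) \<and> br i x = y"
      proof (cases "br i (a i) \<le> br i (a (Suc i))")
        case True
        then show ?thesis using yuv a_step[OF i] branch_props(1)[OF i]
          by (intro IVT') (auto simp: u_def v_def)
      next
        case False
        then show ?thesis using yuv a_step[OF i] branch_props(1)[OF i]
          by (intro IVT2') (auto simp: u_def v_def)
      qed
      then obtain x where x: "x \<in> clap i" "br i x = y" by auto
      have "x \<noteq> a i" "x \<noteq> a (Suc i)" using x yuv by (auto simp: u_def v_def)
      then have xl: "x \<in> lap i" using x by auto
      have "x \<in> I0'" using branch_I1_iff[OF i x(1)] x y(1) lap01[OF i x(1)] by (auto simp: I0_iff)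
      then have "Pt x \<in> cell i" "\<sigma> (Pt x) = Pt y"
        using cell_props(6)[OF i] xl sigma_Pt branch_props(2)[OF i xl] x(2) by auto
      then show False using y(2) by (metis DiffD2 imageI)
    qed
  qed
  then show ?thesis using uv I inside by blast
qed

lemma mono_piece_cell: assumes i: "i < n" shows "mono_piece \<sigma> (up i) (cell i)"
proof -
  obtain u v where uv: "u < v" "u \<in> I1'" "v \<in> I1'" "\<sigma> ` cell i = block u v" using sigma_image_cell[OF i] by auto
  show ?thesis unfolding mono_piece_def topspace_TT
    using cell_props(1-3)[OF i] sigma_strict_mono[OF i] block_clopen(1)[OF uv(1-3)] block_convex uv(4) by auto
qed

lemma cell_cover: assumes p: "p \<in> XX" shows "\<exists>i<n. p \<in> cell i"
proof (cases "collapse p \<in> pp")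
  case False
  then obtain i where i: "i < n" "collapse p \<in> lap i" using lap_cover[OF collapse_01[OF p]] by auto
  then show ?thesis using cell_props(7)[OF i(1)] p by auto
next
  case True
  then obtain j where j: "j \<le> n" "collapse p = a j" by (auto simp: partition_points_def)
  show ?thesis using p
  proof (cases rule: X_cases)
    case (Pt x)
    have "x \<notin> I0'" using j Pt a_I1 by (auto simp: I0_iff)
    then consider "x = 0" | "x = 1" using Pt by auto
    then show ?thesis
    proof cases
      case 1
      then have "p = right_point (a 0)" using Pt a0 by (simp add: right_point_def)
      then show ?thesis using cell_props(7)[OF n_pos] p n_pos by auto
    next
      case 2
      have n1: "n - 1 < n" "Suc (n - 1) = n" using n_pos by auto
      then have "p = left_point (a (Suc (n - 1)))" using Pt 2 an by (simp add: left_point_def)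
      then have "p \<in> cell (n - 1)" using cell_props(7)[OF n1(1), of p] p by blast
      then show ?thesis using n1(1) by blast
    qed
  next
    case (Minus x)
    then have "j \<noteq> 0" using j a0 by (metis collapse.simps(2))
    then obtain i where i: "j = Suc i" by (cases j) auto
    then have "p = left_point (a (Suc i))" using Minus j by (simp add: left_point_def)
    moreover have "i < n" using j i by simp
    ultimately show ?thesis using cell_props(7)[of i p] p by blast
  next
    case (Plus x)
    then have "j \<noteq> n" using j an by (metis collapse.simps(3))
    then have jn: "j < n" using j by simp
    have "p = right_point (a j)" using Plus j by (simp add: right_point_def)
    then show ?thesis using cell_props(7)[OF jn] p jn by auto
  qed
qed

lemma cell_disjoint: assumes "i < j" "j < n" shows "cell i \<inter> cell j = {}"
proof (rule ccontr)
  assume "cell i \<inter> cell j \<noteq> {}"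
  then obtain p where p: "p \<le> left_point (a (Suc i))" "right_point (a j) \<le> p"
    unfolding cell_def block_def by auto
  have le: "a (Suc i) \<le> a j" using a_le[of "Suc i" j] assms by simp
  have "0 < a (Suc i)" "a j < 1" using a_less[of 0 "Suc i"] a_less[of j n] assms a0 an by auto
  then have "left_point (a (Suc i)) < right_point (a j)"
    using le by (auto simp: left_point_def right_point_def less_point_def)
  then show False using p by auto
qed

lemma pmono_sigma: "pmono \<sigma> (cell ` {..<n})"
  unfolding pmono_def
proof (intro conjI ballI)
  show "continuous_map TT TT \<sigma>" by (rule sigma_cont)
  show "finite (cell ` {..<n})" by simp
  show "disjoint (cell ` {..<n})" unfolding disjoint_def
  proof (intro ballI impI)
    fix A B assume "A \<in> cell ` {..<n}" "B \<in> cell ` {..<n}" "A \<noteq> B"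
    then obtain i j where ij: "i < n" "j < n" "A = cell i" "B = cell j" "i \<noteq> j" by auto
    then consider "i < j" | "j < i" by linarith
    then show "A \<inter> B = {}" using cell_disjoint[of i j] cell_disjoint[of j i] ij by cases auto
  qed
  show "\<Union>(cell ` {..<n}) = topspace TT"
  proof
    show "\<Union>(cell ` {..<n}) \<subseteq> topspace TT" using cell_props(5) by auto
    show "topspace TT \<subseteq> \<Union>(cell ` {..<n})"
    proof
      fix p assume "p \<in> topspace TT"
      then obtain i where "i < n" "p \<in> cell i" using cell_cover[of p] by auto
      then show "p \<in> \<Union>(cell ` {..<n})" by blast
    qed
  qed
  fix C assume "C \<in> cell ` {..<n}"
  then obtain i where i: "i < n" "C = cell i" by auto
  show "\<exists>up. mono_piece \<sigma> up C" using mono_piece_cell[OF i(1)] i(2) by auto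
  have "right_point (a i) \<in> XX" using endpoint_X(1)[OF a_I1, of i] a_less[of i n] i an by auto
  then show "C \<noteq> {}" using cell_props(7)[OF i(1)] i(2) by auto
qed

sublocale pmono_system TT \<sigma> "cell ` {..<n}"
proof
  show "pmono \<sigma> (cell ` {..<n})" by (rule pmono_sigma)
  have "Pt 0 \<in> topspace TT" by simp
  then show "topspace TT \<noteq> {}" by (metis empty_iff)
qed

section \<open>Transitivity and non-injectivity on the split interval\<close>

definition lift :: "real set \<Rightarrow> point set" where "lift A = {p \<in> XX. collapse p \<in> A}"

text \<open>For \<open>x\<close> inside a lap, \<open>\<tau> x\<close> lies strictly between the
  ends of the image block, so the block contains all points over \<open>\<tau> x\<close>, both
  halves if it is split. Injectivity of the branch then locates the preimage over
  \<open>x\<close>.\<close>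

lemma lift_partial_image:
  assumes "A \<subseteq> {0..1}" shows "lift (partial_image \<tau> n a A) \<subseteq> \<sigma> ` lift A"
proof
  fix q assume "q \<in> lift (partial_image \<tau> n a A)"
  then obtain x where x: "q \<in> XX" "x \<in> A" "x \<notin> pp" "collapse q = \<tau> x"
    by (auto simp: lift_def partial_image_def)
  have "x \<in> {0..1}" using x(2) assms by auto
  then obtain i where i: "i < n" "x \<in> lap i" using lap_cover[OF _ x(3)] by blast
  obtain u v where uv: "u < v" "u \<in> I1'" "v \<in> I1'" "\<forall>x\<in>lap i. u < \<tau> x \<and> \<tau> x < v" "\<sigma> ` cell i = block u v"
    using sigma_image_cell[OF i(1)] by auto
  have "q \<in> block u v" using block_iff[OF uv(1-3), of q] x uv(4) i(2) by auto
  then obtain p where p: "p \<in> cell i" "q = \<sigma> p" using uv(5) by blast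
  have "br i (collapse p) = br i x"
    using collapse_sigma[OF i(1) p(1)] p(2) x(4) branch_props(2)[OF i] by simp
  then have "collapse p = x"
    using branch_inj[OF i(1)] cell_props(4)[OF i(1) p(1)] i(2) by (auto simp: inj_on_def)
  then have "p \<in> lift A" using x(2) cell_props(5)[OF i(1) p(1)] by (simp add: lift_def)
  then show "q \<in> \<sigma> ` lift A" using p(2) by blast
qed

lemma partial_image_funpow_01: "A \<subseteq> {0..1} \<Longrightarrow> (partial_image \<tau> n a ^^ k) A \<subseteq> {0..1}"
  by (induction k) (use tau01 in \<open>auto simp: partial_image_def\<close>)

lemma lift_funpow:
  assumes "A \<subseteq> {0..1}" shows "lift ((partial_image \<tau> n a ^^ k) A) \<subseteq> (\<sigma> ^^ k) ` lift A"
proof (induction k)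
  case (Suc k)
  have "lift ((partial_image \<tau> n a ^^ Suc k) A) \<subseteq> \<sigma> ` lift ((partial_image \<tau> n a ^^ k) A)"
    using lift_partial_image[OF partial_image_funpow_01[OF assms]] by simp
  also have "\<dots> \<subseteq> \<sigma> ` ((\<sigma> ^^ k) ` lift A)" using Suc by (rule image_mono)
  finally show ?case by (simp add: image_comp)
qed simp

lemma sigma_transitive:
  assumes tr: "transitive_map \<tau> n a" and U: "openin TT U" "U \<noteq> {}" and V: "openin TT V" "V \<noteq> {}"
  shows "\<exists>k. (\<sigma> ^^ k) ` U \<inter> V \<noteq> {}"
proof -
  obtain u v where uv: "u < v" "0 \<le> u" "v \<le> 1" "\<forall>q\<in>XX. u < collapse q \<and> collapse q < v \<longrightarrow> q \<in> U"
    using open_contains_lift[OF U] by auto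
  obtain w z where wz: "w < z" "0 \<le> w" "z \<le> 1" "\<forall>q\<in>XX. w < collapse q \<and> collapse q < z \<longrightarrow> q \<in> V"
    using open_contains_lift[OF V] by auto
  have o: "openin (top_of_set {0..1}) {b<..<c}" if "0 \<le> b" "c \<le> 1" for b c :: real
  proof -
    have "{b<..<c} = {0..1} \<inter> {b<..<c}" using that by auto
    then show ?thesis by (metis open_greaterThanLessThan openin_open)
  qed
  have ne: "{u<..<v} \<noteq> {}" "{w<..<z} \<noteq> {}" using uv wz by auto
  have "\<exists>k. (partial_image \<tau> n a ^^ k) {u<..<v} \<inter> {w<..<z} \<noteq> {}"
    using tr o[OF uv(2,3)] o[OF wz(2,3)] ne unfolding transitive_map_def by blast
  then obtain k y where y: "y \<in> (partial_image \<tau> n a ^^ k) {u<..<v}" "y \<in> {w<..<z}" by blast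
  have "y \<in> {0..1}" using y(2) wz by auto
  then obtain q where q: "q \<in> XX" "collapse q = y" using ex_point by auto
  have "q \<in> lift ((partial_image \<tau> n a ^^ k) {u<..<v})" using q y by (simp add: lift_def)
  moreover have "{u<..<v} \<subseteq> {0..1}" using uv by auto
  ultimately have "q \<in> (\<sigma> ^^ k) ` lift {u<..<v}" using lift_funpow by blast
  moreover have "lift {u<..<v} \<subseteq> U" using uv(4) by (auto simp: lift_def)
  moreover have "q \<in> V" using wz(4) q y(2) by auto
  ultimately show ?thesis by blast
qed

text \<open>An unsplit point \<open>x\<close> of \<open>J\<close> has its value attained again at
  some \<open>y\<close> in \<open>J'\<close>. Since \<open>I1\<close> is invariant under the
  branches in both directions, \<open>y\<close> is unsplit too, and \<open>\<sigma>\<close>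
  identifies the two unsplit points.\<close>

lemma sigma_noninjective:
  assumes "\<not> essentially_injective \<tau> n a"
  shows "\<exists>p\<in>XX. \<exists>q\<in>XX. p \<noteq> q \<and> \<sigma> p = \<sigma> q"
proof -
  obtain J J' where J: "nondegenerate_interval J" "nondegenerate_interval J'" "J \<inter> J' = {}"
    "partial_image \<tau> n a J = partial_image \<tau> n a J'"
    using assms by (auto simp: essentially_injective_def)
  obtain c d where cd: "c \<in> J" "d \<in> J" "c < d" and int: "is_interval J" and J01: "J \<subseteq> {0..1}"
    using J(1) by (auto simp: nondegenerate_interval_def)
  have J'01: "J' \<subseteq> {0..1}" using J(2) by (simp add: nondegenerate_interval_def)
  have "0 \<le> c" "d \<le> 1" using cd J01 by auto
  then obtain x where x: "x \<in> I0'" "c < x" "x < d" using I0_dense[OF cd(3)] by blast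
  have xJ: "x \<in> J" using int cd x unfolding is_interval_1 by (meson less_imp_le)
  have pp_I1: "pp \<subseteq> I1'" using a_I1 by (auto simp: partition_points_def)
  then have "x \<notin> pp" using x(1) by (auto simp: I0_iff)
  then have "\<tau> x \<in> partial_image \<tau> n a J'" using xJ J(4) unfolding partial_image_def by blast
  then obtain y where y: "y \<in> J'" "y \<notin> pp" "\<tau> y = \<tau> x" unfolding partial_image_def by auto
  have "y \<in> {0..1}" using y(1) J'01 by auto
  then obtain i where i: "i < n" "y \<in> lap i" using lap_cover[OF _ y(2)] by blast
  have "\<tau> y \<notin> I1'" using tau_I0[OF x(1)] y(3) by (simp add: I0_iff)
  then have "y \<in> I0'" using tau_I1_iff[OF i] y(1) J'01 by (auto simp: I0_iff)
  moreover have "x \<noteq> y" using xJ y(1) J(3) by auto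
  ultimately show ?thesis using x(1) sigma_Pt y(3) by (intro bexI[of _ "Pt x"] bexI[of _ "Pt y"]) auto
qed

end

lemma (in interval_map) bounded_variation_iff: "bounded_variation XX f \<longleftrightarrow> (\<exists>v. vdom f v)"
proof
  assume "bounded_variation XX f"
  then obtain v where v: "\<And>s. s \<in> {\<Sum>i=1..m. \<bar>f (x i) - f (x (i - 1))\<bar> | (m::nat) x.
       (\<forall>i\<le>m. x i \<in> XX) \<and> (\<forall>i\<in>{1..m}. point_less (x (i - 1)) (x i))} \<Longrightarrow> s \<le> v"
    unfolding bounded_variation_def bdd_above_def by blast
  have "chain_bounded f v" unfolding chain_bounded_def topspace_TT
  proof (intro allI impI)
    fix m :: nat and x assume x: "(\<forall>i\<le>m. x i \<in> XX) \<and> (\<forall>i\<in>{1..m}. x (i - 1) < x i)"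
    have "point_less (x (i - 1)) (x i)" if "i \<in> {1..m}" for i
    proof -
      have "i - 1 \<le> m" "i \<le> m" using that by auto
      then show ?thesis using x that point_less_iff by blast
    qed
    then show "(\<Sum>i=1..m. \<bar>f (x i) - f (x (i - 1))\<bar>) \<le> v" using x by (intro v) blast
  qed
  then show "\<exists>v. vdom f v" using chain_bounded_imp_vdom by blast
next
  assume "\<exists>v. vdom f v"
  then obtain v where v: "chain_bounded f v" using vdom_imp_chain_bounded by blast
  show "bounded_variation XX f" unfolding bounded_variation_def
  proof (rule bdd_aboveI[of _ v])
    fix s assume "s \<in> {\<Sum>i=1..m. \<bar>f (x i) - f (x (i - 1))\<bar> | (m::nat) x.
       (\<forall>i\<le>m. x i \<in> XX) \<and> (\<forall>i\<in>{1..m}. point_less (x (i - 1)) (x i))}"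
    then obtain m :: nat and x where x: "s = (\<Sum>i=1..m. \<bar>f (x i) - f (x (i - 1))\<bar>)"
      "\<forall>i\<le>m. x i \<in> XX" "\<forall>i\<in>{1..m}. point_less (x (i - 1)) (x i)" by blast
    have "x (i - 1) < x i" if "i \<in> {1..m}" for i
    proof -
      have "i - 1 \<le> m" "i \<le> m" using that by auto
      then show ?thesis using x(2,3) that point_less_iff by blast
    qed
    then show "s \<le> v" using v x unfolding chain_bounded_def topspace_TT by blast
  qed
qed

theorem theorem4p5:
  fixes \<tau> :: "real \<Rightarrow> real" and n :: nat and a :: "nat \<Rightarrow> real" and \<sigma> :: "point \<Rightarrow> point"
  assumes "piecewise_monotonic \<tau> n a"
    and "transitive_map \<tau> n a"
    and "\<not> essentially_injective \<tau> n a"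
    and "associated_local_homeo \<tau> n a \<sigma>"
  shows
    "(\<exists>!P. \<exists>N Y. exact_cyclic_partition (X_top \<tau> n a) \<sigma> N Y \<and> P = Y ` {1..N}) \<and>
     (\<forall>N Y. exact_cyclic_partition (X_top \<tau> n a) \<sigma> N Y \<longrightarrow>
       (\<forall>\<mu> s. regular_borel_prob (X_top \<tau> n a) \<mu> \<and> scaled_by \<mu> \<sigma> s \<longrightarrow>
         (\<exists>\<phi> :: nat \<Rightarrow> point \<Rightarrow> real.
           (\<forall>i\<in>{1..N}.
             continuous_map (X_top \<tau> n a) euclideanreal (\<phi> i) \<and>
             bounded_variation (X_set \<tau> n a) (\<phi> i) \<and>
             supp (X_top \<tau> n a) (\<phi> i) = Y i \<and>
             (\<forall>x\<in>Y i. \<phi> i x > 0) \<and>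
             (\<forall>f. continuous_map (X_top \<tau> n a) euclideanreal f \<and>
                   bounded_variation (X_set \<tau> n a) f \<and>
                   supp (X_top \<tau> n a) f \<subseteq> Y i \<longrightarrow>
                uniform_limit (X_set \<tau> n a)
                  (\<lambda>k. ((\<lambda>h x. (1 / s ^ N) * (transfer (X_top \<tau> n a) \<sigma> ^^ N) h x) ^^ k) f)
                  (\<lambda>x. (\<integral>y. f y \<partial>\<mu>) * \<phi> i x) sequentially) \<and>
             (\<forall>x\<in>X_set \<tau> n a.
                (1 / s) * transfer (X_top \<tau> n a) \<sigma> (\<phi> i) x = \<phi> (i mod N + 1) x)))))"
proof -
  interpret associated_map \<tau> n a \<sigma> by unfold_locales (use assms in auto)
  interpret expanding_system TT \<sigma> "cell ` {..<n}"
  proof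
    show "\<exists>k. (\<sigma> ^^ k) ` U \<inter> V \<noteq> {}" if "openin TT U" "U \<noteq> {}" "openin TT V" "V \<noteq> {}" for U V
      by (rule sigma_transitive[OF assms(2) that])
    show "\<not> openin TT {p}" for p by (rule no_isolated_TT)
    show "\<exists>x\<in>topspace TT. \<exists>y\<in>topspace TT. x \<noteq> y \<and> \<sigma> x = \<sigma> y"
      using sigma_noninjective[OF assms(3)] by simp
  qed
  show ?thesis
  proof (intro conjI allI impI)
    show "\<exists>!P. \<exists>N Y. exact_cyclic_partition TT \<sigma> N Y \<and> P = Y ` {1..N}"
      by (rule ex1_exact_cyclic_partition)
    fix N Y \<mu> s
    assume ecp: "exact_cyclic_partition TT \<sigma> N Y"
      and \<mu>: "regular_borel_prob TT \<mu> \<and> scaled_by \<mu> \<sigma> s"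
    interpret scaled_system TT \<sigma> "cell ` {..<n}" \<mu> s
    proof (rule scaled_system.intro[OF expanding_system_axioms scaled_system_axioms.intro])
      show "prob_space \<mu>" "space \<mu> = topspace TT" "sets \<mu> = sigma_sets (topspace TT) {U. openin TT U}"
        "scaled_by \<mu> \<sigma> s" using \<mu> unfolding regular_borel_prob_def by blast+
    qed
    show "\<exists>\<phi> :: nat \<Rightarrow> point \<Rightarrow> real. \<forall>i\<in>{1..N}. cont (\<phi> i) \<and> bounded_variation XX (\<phi> i) \<and>
        supp TT (\<phi> i) = Y i \<and> (\<forall>x\<in>Y i. \<phi> i x > 0) \<and>
        (\<forall>f. cont f \<and> bounded_variation XX f \<and> supp TT f \<subseteq> Y i \<longrightarrow>
           uniform_limit XX (\<lambda>k. ((\<lambda>h x. (1 / s ^ N) * (transfer TT \<sigma> ^^ N) h x) ^^ k) f)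
             (\<lambda>x. (\<integral>y. f y \<partial>\<mu>) * \<phi> i x) sequentially) \<and>
        (\<forall>x\<in>XX. (1 / s) * transfer TT \<sigma> (\<phi> i) x = \<phi> (i mod N + 1) x)"
      using cyclic_densities[OF ecp] unfolding bounded_variation_iff topspace_TT .
  qed
qed

end
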